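(* Let $n\ge 2$ and let $G=\mathrm{Isom}(\mathbf{H}^n)$. There is a family $\{C_t\}_{0<t\le 1}$ of proper CAT($-1$) spaces, each equipped with a continuous isometric $G$-action which is cocompact and minimal, such that $C_1=\mathbf{H}^n$ with its standard action, and such that, for suitable base points $*_t\in C_t$, the map $t\mapsto (C_t,*_t)$ from $(0,1]$ to the class of pointed metric $G$-spaces is continuous for the strong topology. The spaces $C_t$ are mutually non-isometric, even after rescaling the metrics (that is, for $t\neq t'$ and any $\mu>0$ there is no bijection $h\colon C_t\to C_{t'}$ with $d(h(x),h(y))=\mu\, d(x,y)$ for all $x,y$), and they satisfy $\mathrm{Isom}(C_t)=\mathrm{Isom}(\mathbf{H}^n)$ (the homomorphism $G\to\mathrm{Isom}(C_t)$ given by the action is an isomorphism).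
   Context: $\mathbf{H}^n$ is the real hyperbolic space of dimension $n$ and $\mathrm{Isom}(\mathbf{H}^n)\cong\mathbf{PO}(1,n)$ its full isometry group. A metric space is proper if its closed balls are compact. An isometric action on a CAT($-1$) space is minimal if there is no non-empty proper closed convex invariant subset; it is cocompact if the translates of some compact set cover the space. Strong topology. Let $G$ be a topological group. A pointed metric $G$-space is a triple $(X,*,\pi)$ where $X$ is a geodesic metric space, $*\in X$, and $\pi$ is a continuous $G$-action by isometries on $X$ (one writes $gx$ for $\pi(g)(x)$). Let $B_X(x,r)$ denote the closed ball. Given $R>0$, $\epsilon>0$ and a compact $M\subseteq G$ with $1\in M$, let $U_{R,\epsilon,M}(X,*,\pi)$ be the class of all pointed metric $G$-spaces $(X',*',\pi')$ for which there is a map $f\colon X'\to X$ such that: (1) $f( *')=*$; (2) the Hausdorff distance between $f(B_{X'}( *',R))$ and $B_X( *,R)$ is $<\epsilon$; (3) $|d(f(x),f(y))-d(x,y)|<\epsilon$ for all $x,y\in\pi'(M)(B_{X'}( *',R))$; (4) $d(gf(x),f(gx))<\epsilon$ for all $x\in B_{X'}( *',R)$ and all $g\in M$. The strong topology on the class of pointed metric $G$-spaces is the one for which these classes $U_{R,\epsilon,M}(X,*,\pi)$ form a neighbourhood base. *)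

theory Defs
  imports "HOL-Analysis.Analysis" "HOL-Algebra.Group_Action"
begin

section \<open>Isometry groups\<close>

text \<open>
  As in \<^const>\<open>BijGroup\<close>, group elements are extensional functions.  The topology is that of
  pointwise convergence, which on an isometry group agrees with the compact-open topology.
\<close>

definition isometry_group :: "'a metric \<Rightarrow> ('a \<Rightarrow> 'a) monoid" where
  "isometry_group X = (BijGroup (mspace X))
     \<lparr>carrier := {f \<in> Bij (mspace X).
        \<forall>x\<in>mspace X. \<forall>y\<in>mspace X. mdist X (f x) (f y) = mdist X x y}\<rparr>"

definition isometry_topology :: "'a metric \<Rightarrow> ('a \<Rightarrow> 'a) topology" where
  "isometry_topology X =
     subtopology (product_topology (\<lambda>_. mtopology_of X) (mspace X)) (carrier (isometry_group X))"

lemma group_isometry_group: "group (isometry_group X)"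
proof -
  interpret B: group "BijGroup (mspace X)"
    by (rule group_BijGroup)
  let ?I = "carrier (isometry_group X)"
  have "subgroup ?I (BijGroup (mspace X))"
  proof (rule B.subgroupI)
    show "?I \<subseteq> carrier (BijGroup (mspace X))"
      by (auto simp: isometry_group_def BijGroup_def)
    have "(\<lambda>x\<in>mspace X. x) \<in> ?I"
      by (auto simp: isometry_group_def id_Bij)
    then show "?I \<noteq> {}"
      by blast
  next
    fix f assume f: "f \<in> ?I"
    then have fB: "f \<in> Bij (mspace X)"
      by (simp add: isometry_group_def)
    have bij: "bij_betw f (mspace X) (mspace X)"
      using fB by (simp add: Bij_def)
    have inv: "inv\<^bsub>BijGroup (mspace X)\<^esub> f = (\<lambda>x\<in>mspace X. inv_into (mspace X) f x)"
      using fB by (rule inv_BijGroup)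
    have "mdist X (inv_into (mspace X) f x) (inv_into (mspace X) f y) = mdist X x y"
      if "x \<in> mspace X" "y \<in> mspace X" for x y
    proof -
      have "inv_into (mspace X) f x \<in> mspace X" "inv_into (mspace X) f y \<in> mspace X"
        using that fB by (auto intro: Bij_inv_into_mem)
      then have "mdist X (f (inv_into (mspace X) f x)) (f (inv_into (mspace X) f y))
               = mdist X (inv_into (mspace X) f x) (inv_into (mspace X) f y)"
        using f by (simp add: isometry_group_def)
      then show ?thesis
        using bij that by (simp add: bij_betw_inv_into_right)
    qed
    then show "inv\<^bsub>BijGroup (mspace X)\<^esub> f \<in> ?I"
      unfolding inv using fB by (simp add: isometry_group_def restrict_inv_into_Bij)
  next
    fix f g assume fg: "f \<in> ?I" "g \<in> ?I"
    then have "f \<in> Bij (mspace X)" "g \<in> Bij (mspace X)"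
      by (simp_all add: isometry_group_def)
    moreover from this have "g x \<in> mspace X" if "x \<in> mspace X" for x
      using Bij_imp_funcset that by blast
    ultimately show "f \<otimes>\<^bsub>BijGroup (mspace X)\<^esub> g \<in> ?I"
      using fg by (simp add: isometry_group_def BijGroup_def compose_Bij compose_eq)
  qed
  then have "group (BijGroup (mspace X)\<lparr>carrier := ?I\<rparr>)"
    by (rule B.subgroup_imp_group)
  then show ?thesis
    by (simp add: isometry_group_def)
qed

lemma topspace_isometry_topology: "topspace (isometry_topology X) = carrier (isometry_group X)"
  by (auto simp: isometry_topology_def isometry_group_def Bij_def bij_betw_def extensional_def)


section \<open>Hyperbolic space\<close>

text \<open>The hyperboloid model, with points \<open>(x 0, \<dots>, x n)\<close> encoded as sequences vanishing
  beyond index \<open>n\<close>.\<close>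

definition lorentz :: "nat \<Rightarrow> (nat \<Rightarrow> real) \<Rightarrow> (nat \<Rightarrow> real) \<Rightarrow> real" where
  "lorentz n x y = x 0 * y 0 - (\<Sum>i=1..n. x i * y i)"

definition hyperboloid :: "nat \<Rightarrow> (nat \<Rightarrow> real) set" where
  "hyperboloid n = {x. lorentz n x x = 1 \<and> x 0 > 0 \<and> (\<forall>i>n. x i = 0)}"

text \<open>\<^locale>\<open>Metric_space\<close> wants the distance nonnegative and symmetric off the carrier as well,
  hence the case distinction.\<close>

definition hyperbolic_dist :: "nat \<Rightarrow> (nat \<Rightarrow> real) \<Rightarrow> (nat \<Rightarrow> real) \<Rightarrow> real" where
  "hyperbolic_dist n x y =
     (if x \<in> hyperboloid n \<and> y \<in> hyperboloid n then arcosh (lorentz n x y) else 0)"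

definition hyperbolic_space :: "nat \<Rightarrow> (nat \<Rightarrow> real) metric" where
  "hyperbolic_space n = metric (hyperboloid n, hyperbolic_dist n)"

lemma lorentz_commute: "lorentz n x y = lorentz n y x"
  by (simp add: lorentz_def mult.commute)

lemma lorentz_comb_left:
  "lorentz n (\<lambda>i. x i + c * y i) z = lorentz n x z + c * lorentz n y z"
  by (simp add: lorentz_def algebra_simps sum.distrib sum_distrib_left)

lemma lorentz_comb_right:
  "lorentz n z (\<lambda>i. x i + c * y i) = lorentz n z x + c * lorentz n z y"
  by (metis lorentz_commute lorentz_comb_left)

lemma lorentz_orth_bound:
  assumes y: "lorentz n y y = 1" and u: "lorentz n u y = 0"
  shows "(u 0)\<^sup>2 * (y 0)\<^sup>2 \<le> (\<Sum>i=1..n. (u i)\<^sup>2) * ((y 0)\<^sup>2 - 1)"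
proof -
  have "(\<Sum>i=1..n. u i * y i)\<^sup>2 \<le> (\<Sum>i=1..n. (u i)\<^sup>2) * (\<Sum>i=1..n. (y i)\<^sup>2)"
    by (rule Cauchy_Schwarz_ineq_sum)
  moreover have "(\<Sum>i=1..n. (y i)\<^sup>2) = (y 0)\<^sup>2 - 1"
    using y by (simp add: lorentz_def power2_eq_square)
  moreover have "(\<Sum>i=1..n. u i * y i) = u 0 * y 0"
    using u by (simp add: lorentz_def)
  ultimately show ?thesis
    by (simp add: power_mult_distrib)
qed

lemma lorentz_orth_nonpos:
  assumes y: "lorentz n y y = 1" and u: "lorentz n u y = 0"
  shows "lorentz n u u \<le> 0"
proof (rule ccontr)
  define S where "S = (\<Sum>i=1..n. (u i)\<^sup>2)"
  assume "\<not> lorentz n u u \<le> 0"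
  then have lt: "S < (u 0)\<^sup>2"
    by (simp add: lorentz_def S_def power2_eq_square)
  have "S \<ge> 0"
    by (simp add: S_def sum_nonneg)
  have "(\<Sum>i=1..n. (y i)\<^sup>2) = (y 0)\<^sup>2 - 1"
    using y by (simp add: lorentz_def power2_eq_square)
  then have "(y 0)\<^sup>2 - 1 \<ge> 0"
    by (metis sum_nonneg zero_le_power2)
  then have "S * ((y 0)\<^sup>2 - 1) \<le> (u 0)\<^sup>2 * ((y 0)\<^sup>2 - 1)"
    using lt by (simp add: mult_right_mono)
  then show False
    using lorentz_orth_bound[OF y u] lt \<open>S \<ge> 0\<close> unfolding S_def[symmetric]
    by (simp add: algebra_simps)
qed

lemma lorentz_orth_zero:
  assumes y: "lorentz n y y = 1" and u: "lorentz n u y = 0" and z: "lorentz n u u = 0"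
    and "i \<le> n"
  shows "u i = 0"
proof -
  define S where "S = (\<Sum>i=1..n. (u i)\<^sup>2)"
  have S: "S = (u 0)\<^sup>2"
    using z by (simp add: lorentz_def S_def power2_eq_square)
  then have "(u 0)\<^sup>2 \<le> 0"
    using lorentz_orth_bound[OF y u] unfolding S_def[symmetric] by (simp add: algebra_simps)
  then have u0: "u 0 = 0"
    by simp
  then have "(\<Sum>i=1..n. (u i)\<^sup>2) = 0"
    using S by (simp add: S_def)
  then have "\<forall>i\<in>{1..n}. (u i)\<^sup>2 = 0"
    by (subst (asm) sum_nonneg_eq_0_iff) auto
  then show ?thesis
    using u0 \<open>i \<le> n\<close> by (cases "i = 0") auto
qed

lemma lorentz_orth_Cauchy_Schwarz:
  assumes y: "lorentz n y y = 1" and u: "lorentz n u y = 0" and v: "lorentz n v y = 0"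
  shows "(lorentz n u v)\<^sup>2 \<le> lorentz n u u * lorentz n v v"
proof -
  have quad: "lorentz n u u + 2 * t * lorentz n u v + t\<^sup>2 * lorentz n v v \<le> 0" for t
  proof -
    have "lorentz n (\<lambda>i. u i + t * v i) y = 0"
      by (simp add: lorentz_comb_left u v)
    from lorentz_orth_nonpos[OF y this] show ?thesis
      by (simp add: lorentz_comb_left lorentz_comb_right lorentz_commute[of n v u]
          algebra_simps power2_eq_square)
  qed
  show ?thesis
  proof (cases "lorentz n v v = 0")
    case True
    have "lorentz n u v = 0"
    proof (rule ccontr)
      assume "lorentz n u v \<noteq> 0"
      then show False
        using quad[of "(1 - lorentz n u u) / (2 * lorentz n u v)"] True by (simp add: field_simps)
    qed
    then show ?thesis
      using True by simp
  next
    case False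
    then have neg: "lorentz n v v < 0"
      using lorentz_orth_nonpos[OF y v] by simp
    have "lorentz n u u - (lorentz n u v)\<^sup>2 / lorentz n v v \<le> 0"
      using quad[of "- lorentz n u v / lorentz n v v"] neg
      by (simp add: power2_eq_square field_simps)
    then show ?thesis
      using neg by (simp add: field_simps)
  qed
qed

lemma lorentz_ge_1:
  assumes "x \<in> hyperboloid n" "y \<in> hyperboloid n"
  shows "lorentz n x y \<ge> 1"
proof -
  define A where "A = lorentz n x y"
  have x: "lorentz n x x = 1" "x 0 > 0" and y: "lorentz n y y = 1" "y 0 > 0"
    using assms by (auto simp: hyperboloid_def)
  have "lorentz n (\<lambda>i. x i + (- A) * y i) y = 0"
    unfolding lorentz_comb_left by (simp add: A_def y)
  from lorentz_orth_nonpos[OF y(1) this] have "1 \<le> A\<^sup>2"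
    unfolding lorentz_comb_left lorentz_comb_right
    by (simp add: A_def x y lorentz_commute[of n y x] algebra_simps power2_eq_square)
  moreover have "A > 0"
  proof -
    have Sx: "(\<Sum>i=1..n. (x i)\<^sup>2) = (x 0)\<^sup>2 - 1" and Sy: "(\<Sum>i=1..n. (y i)\<^sup>2) = (y 0)\<^sup>2 - 1"
      using x y by (simp_all add: lorentz_def power2_eq_square)
    have "(x 0)\<^sup>2 - 1 \<ge> 0" "(y 0)\<^sup>2 - 1 \<ge> 0"
      by (metis Sx sum_nonneg zero_le_power2, metis Sy sum_nonneg zero_le_power2)
    then have "((x 0)\<^sup>2 - 1) * ((y 0)\<^sup>2 - 1) < (x 0)\<^sup>2 * (y 0)\<^sup>2"
      by (simp add: algebra_simps)
    moreover have "(\<Sum>i=1..n. x i * y i)\<^sup>2 \<le> ((x 0)\<^sup>2 - 1) * ((y 0)\<^sup>2 - 1)"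
      using Cauchy_Schwarz_ineq_sum[of x y "{1..n}"] unfolding Sx Sy .
    ultimately have "(\<Sum>i=1..n. x i * y i)\<^sup>2 < (x 0 * y 0)\<^sup>2"
      by (simp add: power_mult_distrib)
    then have "(\<Sum>i=1..n. x i * y i) < x 0 * y 0"
      using x y by (meson less_eq_real_def mult_pos_pos power_less_imp_less_base)
    then show ?thesis
      by (simp add: A_def lorentz_def)
  qed
  ultimately show ?thesis
    unfolding A_def[symmetric] using power2_le_imp_le[of 1 A] by simp
qed

lemma Metric_space_hyperbolic: "Metric_space (hyperboloid n) (hyperbolic_dist n)"
proof
  fix x y :: "nat \<Rightarrow> real"
  show "0 \<le> hyperbolic_dist n x y"
    by (simp add: hyperbolic_dist_def lorentz_ge_1)
  show "hyperbolic_dist n x y = hyperbolic_dist n y x"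
    by (simp add: hyperbolic_dist_def lorentz_commute)
next
  fix x y :: "nat \<Rightarrow> real"
  assume x: "x \<in> hyperboloid n" and y: "y \<in> hyperboloid n"
  have "hyperbolic_dist n x y = 0 \<longleftrightarrow> lorentz n x y = 1"
    using x y by (simp add: hyperbolic_dist_def lorentz_ge_1)
  also have "\<dots> \<longleftrightarrow> x = y"
  proof
    assume *: "lorentz n x y = 1"
    have q: "lorentz n x x = 1" "lorentz n y y = 1" "\<forall>i>n. x i = 0" "\<forall>i>n. y i = 0"
      using x y by (auto simp: hyperboloid_def)
    let ?u = "\<lambda>i. x i + (-1) * y i"
    have u: "lorentz n ?u y = 0" "lorentz n ?u ?u = 0"
      unfolding lorentz_comb_left lorentz_comb_right
      using * by (simp_all add: q lorentz_commute[of n y x])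
    have "x i = y i" for i
    proof (cases "i \<le> n")
      case True
      then show ?thesis
        using lorentz_orth_zero[OF q(2) u True] by simp
    qed (use q in simp)
    then show "x = y"
      by (rule ext)
  qed (use y in \<open>auto simp: hyperboloid_def\<close>)
  finally show "hyperbolic_dist n x y = 0 \<longleftrightarrow> x = y" .
next
  fix x y z :: "nat \<Rightarrow> real"
  assume x: "x \<in> hyperboloid n" and y: "y \<in> hyperboloid n" and z: "z \<in> hyperboloid n"
  define A where "A = lorentz n x y"
  define B where "B = lorentz n y z"
  define D where "D = lorentz n x z"
  have A: "A \<ge> 1" and B: "B \<ge> 1" and D: "D \<ge> 1"
    unfolding A_def B_def D_def using x y z by (auto intro: lorentz_ge_1)
  have q: "lorentz n x x = 1" "lorentz n y y = 1" "lorentz n z z = 1"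
    using x y z by (auto simp: hyperboloid_def)
  let ?u = "\<lambda>i. x i + (- A) * y i" and ?v = "\<lambda>i. z i + (- B) * y i"
  have "lorentz n ?u y = 0" "lorentz n ?v y = 0"
    unfolding lorentz_comb_left by (simp_all add: A_def B_def q lorentz_commute[of n z y])
  from lorentz_orth_Cauchy_Schwarz[OF q(2) this]
  have "(D - A * B)\<^sup>2 \<le> (A\<^sup>2 - 1) * (B\<^sup>2 - 1)"
    unfolding lorentz_comb_left lorentz_comb_right lorentz_commute[of n y x] lorentz_commute[of n z y]
    unfolding A_def[symmetric] B_def[symmetric] D_def[symmetric] q
    by (simp add: algebra_simps power2_eq_square)
  also have "\<dots> = (sinh (arcosh A) * sinh (arcosh B))\<^sup>2"
    using A B by (simp add: sinh_arcosh_real power_mult_distrib)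
  finally have "D - A * B \<le> sinh (arcosh A) * sinh (arcosh B)"
    by (rule power2_le_imp_le) (use A B in simp)
  then have "cosh (arcosh D) \<le> cosh (arcosh A + arcosh B)"
    using A B D by (simp add: cosh_add)
  then have "arcosh D \<le> arcosh A + arcosh B"
    using A B D by (subst (asm) cosh_real_nonneg_le_iff) auto
  then show "hyperbolic_dist n x z \<le> hyperbolic_dist n x y + hyperbolic_dist n y z"
    using x y z by (simp add: hyperbolic_dist_def A_def B_def D_def)
qed

lemma mspace_hyperbolic_space [simp]: "mspace (hyperbolic_space n) = hyperboloid n"
  by (simp add: hyperbolic_space_def Metric_space.mspace_metric Metric_space_hyperbolic)

lemma mdist_hyperbolic_space [simp]: "mdist (hyperbolic_space n) = hyperbolic_dist n"
  by (simp add: hyperbolic_space_def Metric_space.mdist_metric Metric_space_hyperbolic)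


section \<open>Geodesics, properness and the CAT($-1$) condition\<close>

definition geodesic_path :: "'a metric \<Rightarrow> 'a \<Rightarrow> 'a \<Rightarrow> (real \<Rightarrow> 'a) \<Rightarrow> bool" where
  "geodesic_path X x y c \<longleftrightarrow>
     c \<in> {0..mdist X x y} \<rightarrow> mspace X \<and> c 0 = x \<and> c (mdist X x y) = y \<and>
     (\<forall>s\<in>{0..mdist X x y}. \<forall>t\<in>{0..mdist X x y}. mdist X (c s) (c t) = \<bar>s - t\<bar>)"

definition geodesic_space :: "'a metric \<Rightarrow> bool" where
  "geodesic_space X \<longleftrightarrow> (\<forall>x\<in>mspace X. \<forall>y\<in>mspace X. \<exists>c. geodesic_path X x y c)"

definition proper_space :: "'a metric \<Rightarrow> bool" where
  "proper_space X \<longleftrightarrow> (\<forall>x\<in>mspace X. \<forall>r. compactin (mtopology_of X) (mcball_of X x r))"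

text \<open>A geodesic triangle has vertices \<open>v 0, v 1, v 2\<close> and sides \<open>c i\<close> joining \<open>v i\<close> to
  \<open>v (i + 1 mod 3)\<close>; \<open>w\<close> and \<open>e\<close> are the vertices and sides of a comparison triangle in the
  hyperbolic plane, so that \<open>e i s\<close> is the comparison point of \<open>c i s\<close>.\<close>

definition CAT_minus_one :: "'a metric \<Rightarrow> bool" where
  "CAT_minus_one X \<longleftrightarrow> geodesic_space X \<and>
     (\<forall>v c w e.
        (\<forall>i<3. v i \<in> mspace X \<and> w i \<in> mspace (hyperbolic_space 2) \<and>
           geodesic_path X (v i) (v ((i + 1) mod 3)) (c i) \<and>
           geodesic_path (hyperbolic_space 2) (w i) (w ((i + 1) mod 3)) (e i) \<and>
           mdist (hyperbolic_space 2) (w i) (w ((i + 1) mod 3)) = mdist X (v i) (v ((i + 1) mod 3)))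
        \<longrightarrow> (\<forall>i<3::nat. \<forall>j<3.
               \<forall>s\<in>{0..mdist X (v i) (v ((i + 1) mod 3))}.
               \<forall>t\<in>{0..mdist X (v j) (v ((j + 1) mod 3))}.
               mdist X (c i s) (c j t) \<le> mdist (hyperbolic_space 2) (e i s) (e j t)))"

definition geodesically_convex :: "'a metric \<Rightarrow> 'a set \<Rightarrow> bool" where
  "geodesically_convex X A \<longleftrightarrow>
     (\<forall>x\<in>A. \<forall>y\<in>A. \<forall>c. geodesic_path X x y c \<longrightarrow> c ` {0..mdist X x y} \<subseteq> A)"


section \<open>Isometric actions\<close>

definition continuous_isometric_action ::
    "('g, 'm) monoid_scheme \<Rightarrow> 'g topology \<Rightarrow> 'a metric \<Rightarrow> ('g \<Rightarrow> 'a \<Rightarrow> 'a) \<Rightarrow> bool" where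
  "continuous_isometric_action G T X \<pi> \<longleftrightarrow>
     group_action G (mspace X) \<pi> \<and>
     (\<forall>g\<in>carrier G. \<forall>x\<in>mspace X. \<forall>y\<in>mspace X. mdist X (\<pi> g x) (\<pi> g y) = mdist X x y) \<and>
     continuous_map (prod_topology T (mtopology_of X)) (mtopology_of X) (\<lambda>(g, x). \<pi> g x)"

definition cocompact_action ::
    "('g, 'm) monoid_scheme \<Rightarrow> 'a metric \<Rightarrow> ('g \<Rightarrow> 'a \<Rightarrow> 'a) \<Rightarrow> bool" where
  "cocompact_action G X \<pi> \<longleftrightarrow>
     (\<exists>K. compactin (mtopology_of X) K \<and> (\<Union>g\<in>carrier G. \<pi> g ` K) = mspace X)"

definition minimal_action ::
    "('g, 'm) monoid_scheme \<Rightarrow> 'a metric \<Rightarrow> ('g \<Rightarrow> 'a \<Rightarrow> 'a) \<Rightarrow> bool" where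
  "minimal_action G X \<pi> \<longleftrightarrow>
     \<not> (\<exists>A. A \<noteq> {} \<and> A \<subset> mspace X \<and> closedin (mtopology_of X) A \<and> geodesically_convex X A \<and>
            (\<forall>g\<in>carrier G. \<pi> g ` A \<subseteq> A))"


section \<open>The strong topology on pointed metric $G$-spaces\<close>

text \<open>Extended-real valued, so that the infimum over the empty set is \<open>\<infinity>\<close>.\<close>

definition hausdorff_distance :: "'a metric \<Rightarrow> 'a set \<Rightarrow> 'a set \<Rightarrow> ereal" where
  "hausdorff_distance X A B =
     (INF r \<in> {r. 0 \<le> r \<and> (\<forall>a\<in>A. \<exists>b\<in>B. mdist X a b \<le> r) \<and> (\<forall>b\<in>B. \<exists>a\<in>A. mdist X a b \<le> r)}.
        ereal r)"

type_synonym ('a, 'g) pointed_space = "'a metric \<times> 'a \<times> ('g \<Rightarrow> 'a \<Rightarrow> 'a)"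

definition pointed_metric_G_spaces ::
    "('g, 'm) monoid_scheme \<Rightarrow> 'g topology \<Rightarrow> ('a, 'g) pointed_space set" where
  "pointed_metric_G_spaces G T =
     {(X, p, \<pi>). geodesic_space X \<and> p \<in> mspace X \<and> continuous_isometric_action G T X \<pi>}"

definition strong_nbhd ::
    "('g, 'm) monoid_scheme \<Rightarrow> 'g topology \<Rightarrow> real \<Rightarrow> real \<Rightarrow> 'g set \<Rightarrow>
     ('a, 'g) pointed_space \<Rightarrow> ('a, 'g) pointed_space set" where
  "strong_nbhd G T R \<epsilon> M = (\<lambda>(X, p, \<pi>).
     {(X', p', \<pi>'). (X', p', \<pi>') \<in> pointed_metric_G_spaces G T \<and>
        (\<exists>f \<in> mspace X' \<rightarrow> mspace X.
           f p' = p \<and>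
           hausdorff_distance X (f ` mcball_of X' p' R) (mcball_of X p R) < ereal \<epsilon> \<and>
           (\<forall>x \<in> (\<Union>g\<in>M. \<pi>' g ` mcball_of X' p' R). \<forall>y \<in> (\<Union>g\<in>M. \<pi>' g ` mcball_of X' p' R).
              \<bar>mdist X (f x) (f y) - mdist X' x y\<bar> < \<epsilon>) \<and>
           (\<forall>x \<in> mcball_of X' p' R. \<forall>g\<in>M. mdist X (\<pi> g (f x)) (f (\<pi>' g x)) < \<epsilon>))})"

definition strong_nbhd_params ::
    "('g, 'm) monoid_scheme \<Rightarrow> 'g topology \<Rightarrow> (real \<times> real \<times> 'g set) set" where
  "strong_nbhd_params G T = {(R, \<epsilon>, M). R > 0 \<and> \<epsilon> > 0 \<and> compactin T M \<and> \<one>\<^bsub>G\<^esub> \<in> M}"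

definition strong_topology ::
    "('g, 'm) monoid_scheme \<Rightarrow> 'g topology \<Rightarrow> ('a, 'g) pointed_space topology" where
  "strong_topology G T = topology (\<lambda>U. U \<subseteq> pointed_metric_G_spaces G T \<and>
     (\<forall>P\<in>U. \<exists>(R, \<epsilon>, M) \<in> strong_nbhd_params G T. strong_nbhd G T R \<epsilon> M P \<subseteq> U))"

text \<open>Lemmas \<open>openin_strong_topology\<close> and \<open>strong_nbhd_base\<close> below show that this is a topology for
  which the sets \<^const>\<open>strong_nbhd\<close> form a neighbourhood base.\<close>

lemma hausdorff_distance_less_iff:
  "hausdorff_distance X A B < ereal \<epsilon> \<longleftrightarrow>
     (\<exists>r\<ge>0. r < \<epsilon> \<and> (\<forall>a\<in>A. \<exists>b\<in>B. mdist X a b \<le> r) \<and> (\<forall>b\<in>B. \<exists>a\<in>A. mdist X a b \<le> r))"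
  unfolding hausdorff_distance_def INF_less_iff by auto

lemma mdist_refl [simp]: "x \<in> mspace X \<Longrightarrow> mdist X x x = 0"
  by simp

lemma geodesic_space_shrink:
  assumes "geodesic_space X" "p \<in> mspace X" "z \<in> mspace X" "mdist X p z \<le> R + \<delta>" "0 \<le> R" "0 \<le> \<delta>"
  shows "\<exists>w \<in> mcball_of X p R. mdist X w z \<le> \<delta>"
proof -
  obtain c where c: "geodesic_path X p z c"
    using assms unfolding geodesic_space_def by blast
  define s where "s = min R (mdist X p z)"
  have s: "s \<in> {0..mdist X p z}" "0 \<in> {0..mdist X p z}" "mdist X p z \<in> {0..mdist X p z}"
    using assms by (auto simp: s_def)
  have ends: "c 0 = p" "c (mdist X p z) = z"
    and cm: "c \<in> {0..mdist X p z} \<rightarrow> mspace X"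
    and iso: "\<forall>s\<in>{0..mdist X p z}. \<forall>t\<in>{0..mdist X p z}. mdist X (c s) (c t) = \<bar>s - t\<bar>"
    using c unfolding geodesic_path_def by simp_all
  have "mdist X (c 0) (c s) = \<bar>0 - s\<bar>" "mdist X (c s) (c (mdist X p z)) = \<bar>s - mdist X p z\<bar>"
    using iso s by simp_all
  then have "mdist X p (c s) = \<bar>0 - s\<bar>" "mdist X (c s) z = \<bar>s - mdist X p z\<bar>" "c s \<in> mspace X"
    using funcset_mem[OF cm s(1)] by (simp_all only: ends)
  then have "c s \<in> mcball_of X p R" "mdist X (c s) z \<le> \<delta>"
    using assms by (auto simp: s_def min_def)
  then show ?thesis
    by blast
qed

lemma continuous_isometric_actionD:
  assumes "continuous_isometric_action G T X \<pi>"
  shows "x \<in> mspace X \<Longrightarrow> \<pi> \<one>\<^bsub>G\<^esub> x = x"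
    and "g \<in> carrier G \<Longrightarrow> x \<in> mspace X \<Longrightarrow> \<pi> g x \<in> mspace X"
    and "g \<in> carrier G \<Longrightarrow> x \<in> mspace X \<Longrightarrow> y \<in> mspace X \<Longrightarrow>
           mdist X (\<pi> g x) (\<pi> g y) = mdist X x y"
proof -
  interpret group_action G "mspace X" \<pi>
    using assms by (simp add: continuous_isometric_action_def)
  show "x \<in> mspace X \<Longrightarrow> \<pi> \<one>\<^bsub>G\<^esub> x = x"
    using fun_cong[OF id_eq_one, of x] by simp
  show "g \<in> carrier G \<Longrightarrow> x \<in> mspace X \<Longrightarrow> \<pi> g x \<in> mspace X"
    by (rule element_image[OF _ _ refl])
  show "g \<in> carrier G \<Longrightarrow> x \<in> mspace X \<Longrightarrow> y \<in> mspace X \<Longrightarrow>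
           mdist X (\<pi> g x) (\<pi> g y) = mdist X x y"
    using assms by (simp add: continuous_isometric_action_def)
qed

lemma bounded_displacement:
  assumes act: "continuous_isometric_action G T X \<pi>" and p: "p \<in> mspace X" and M: "compactin T M"
  shows "\<exists>K\<ge>0. \<forall>g\<in>M. mdist X (\<pi> g p) p \<le> K"
proof -
  have "continuous_map T (prod_topology T (mtopology_of X)) (\<lambda>g. (g, p))"
    using p by (simp add: continuous_map_paired)
  moreover have "continuous_map (prod_topology T (mtopology_of X)) (mtopology_of X) (\<lambda>(g, x). \<pi> g x)"
    using act by (simp add: continuous_isometric_action_def)
  ultimately have "continuous_map T (mtopology_of X) ((\<lambda>(g, x). \<pi> g x) \<circ> (\<lambda>g. (g, p)))"
    by (rule continuous_map_compose)
  then have 1: "continuous_map T (mtopology_of X) (\<lambda>g. \<pi> g p)"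
    by (simp add: comp_def)
  have 2: "continuous_map T (mtopology_of X) (\<lambda>g. p)"
    using p by simp
  have "compact ((\<lambda>g. mdist X (\<pi> g p) p) ` M)"
    using image_compactin[OF M continuous_map_mdist[OF 1 2]] by simp
  then obtain B where B: "\<forall>r\<in>(\<lambda>g. mdist X (\<pi> g p) p) ` M. norm r \<le> B"
    using compact_imp_bounded bounded_iff[THEN iffD1] by metis
  have "mdist X (\<pi> g p) p \<le> max B 0" if "g \<in> M" for g
    using bspec[OF B imageI[OF that]] by simp
  then show ?thesis
    by (intro exI[of _ "max B 0"]) simp
qed

lemma mem_strong_nbhd:
  "(X', p', \<pi>') \<in> strong_nbhd G T R \<epsilon> M (X, p, \<pi>) \<longleftrightarrow>
     (X', p', \<pi>') \<in> pointed_metric_G_spaces G T \<and>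
     (\<exists>f \<in> mspace X' \<rightarrow> mspace X.
        f p' = p \<and>
        hausdorff_distance X (f ` mcball_of X' p' R) (mcball_of X p R) < ereal \<epsilon> \<and>
        (\<forall>x \<in> (\<Union>g\<in>M. \<pi>' g ` mcball_of X' p' R). \<forall>y \<in> (\<Union>g\<in>M. \<pi>' g ` mcball_of X' p' R).
           \<bar>mdist X (f x) (f y) - mdist X' x y\<bar> < \<epsilon>) \<and>
        (\<forall>x \<in> mcball_of X' p' R. \<forall>g\<in>M. mdist X (\<pi> g (f x)) (f (\<pi>' g x)) < \<epsilon>))"
  by (simp add: strong_nbhd_def del: in_mcball_of)

lemma strong_nbhd_refl:
  assumes "P \<in> pointed_metric_G_spaces G T" "R > 0" "\<epsilon> > 0" "compactin T M" "topspace T = carrier G"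
  shows "P \<in> strong_nbhd G T R \<epsilon> M P"
proof -
  obtain X p \<pi> where P: "P = (X, p, \<pi>)"
    by (cases P)
  have act: "continuous_isometric_action G T X \<pi>" and p: "p \<in> mspace X"
    using assms(1) by (auto simp: P pointed_metric_G_spaces_def)
  have "M \<subseteq> carrier G"
    using assms compactin_subset_topspace by blast
  then have "\<pi> g x \<in> mspace X" if "x \<in> mspace X" "g \<in> M" for g x
    using continuous_isometric_actionD(2)[OF act] that by blast
  then have "\<forall>x \<in> mcball_of X p R. \<forall>g\<in>M. mdist X (\<pi> g x) (\<pi> g x) < \<epsilon>"
    using assms(3) by auto
  moreover have "hausdorff_distance X ((\<lambda>x. x) ` mcball_of X p R) (mcball_of X p R) < ereal \<epsilon>"
    unfolding hausdorff_distance_less_iff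
    by (rule exI[of _ 0]) (use assms(3) in force)
  ultimately show ?thesis
    using assms p unfolding P strong_nbhd_def by (auto intro!: bexI[of _ "\<lambda>x. x"])
qed


lemma strong_nbhd_compose:
  assumes top: "topspace T = carrier G"
    and P: "P \<in> pointed_metric_G_spaces G T"
    and par: "(R, \<epsilon>, M) \<in> strong_nbhd_params G T"
  obtains \<epsilon>\<^sub>0 R\<^sub>0 where "\<epsilon>\<^sub>0 > 0"
    and "\<And>R' \<epsilon>' M' P'. (R', \<epsilon>', M') \<in> strong_nbhd_params G T \<Longrightarrow> R\<^sub>0 \<le> R' \<Longrightarrow> \<epsilon>' \<le> \<epsilon>\<^sub>0 \<Longrightarrow> M \<subseteq> M' \<Longrightarrow>
      P' \<in> strong_nbhd G T R' \<epsilon>' M' P \<Longrightarrow> strong_nbhd G T R' \<epsilon>' M' P' \<subseteq> strong_nbhd G T R \<epsilon> M P"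
proof -
  obtain X p \<pi> where Pe: "P = (X, p, \<pi>)"
    by (cases P)
  have act: "continuous_isometric_action G T X \<pi>" and p: "p \<in> mspace X" and geo: "geodesic_space X"
    using P by (auto simp: Pe pointed_metric_G_spaces_def)
  have R: "R > 0" and \<epsilon>: "\<epsilon> > 0" and M: "compactin T M" "\<one>\<^bsub>G\<^esub> \<in> M"
    using par by (auto simp: strong_nbhd_params_def)
  obtain K where K: "K \<ge> 0" "\<And>g. g \<in> M \<Longrightarrow> mdist X (\<pi> g p) p \<le> K"
    using bounded_displacement[OF act p M(1)] by blast
  define \<epsilon>\<^sub>0 where "\<epsilon>\<^sub>0 = min (\<epsilon> / 8) (R / 4)"
  define R\<^sub>0 where "R\<^sub>0 = R + K + 5 * \<epsilon>\<^sub>0"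
  have \<epsilon>0: "\<epsilon>\<^sub>0 > 0" "8 * \<epsilon>\<^sub>0 \<le> \<epsilon>" "4 * \<epsilon>\<^sub>0 \<le> R"
    using R \<epsilon> by (auto simp: \<epsilon>\<^sub>0_def)
  have main: "P'' \<in> strong_nbhd G T R \<epsilon> M P"
    if par': "(R', \<epsilon>', M') \<in> strong_nbhd_params G T" and "R\<^sub>0 \<le> R'" "\<epsilon>' \<le> \<epsilon>\<^sub>0" "M \<subseteq> M'"
      and P': "P' \<in> strong_nbhd G T R' \<epsilon>' M' P" and P'': "P'' \<in> strong_nbhd G T R' \<epsilon>' M' P'"
    for R' \<epsilon>' M' P' P''
  proof -
    define e where "e = \<epsilon>'"
    obtain X' p' \<pi>' where P'e: "P' = (X', p', \<pi>')"
      by (cases P')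
    obtain X'' p'' \<pi>'' where P''e: "P'' = (X'', p'', \<pi>'')"
      by (cases P'')
    have e: "e > 0" "8 * e \<le> \<epsilon>" "4 * e \<le> R"
      using par' \<open>\<epsilon>' \<le> \<epsilon>\<^sub>0\<close> \<epsilon>0 by (auto simp: strong_nbhd_params_def e_def)
    have R': "R + K + 5 * e \<le> R'"
      using \<open>R\<^sub>0 \<le> R'\<close> \<open>\<epsilon>' \<le> \<epsilon>\<^sub>0\<close> by (simp add: R\<^sub>0_def e_def)
    have M'G: "M' \<subseteq> carrier G" and oneM': "\<one>\<^bsub>G\<^esub> \<in> M'"
      using par' compactin_subset_topspace top by (auto simp: strong_nbhd_params_def)
    have act': "continuous_isometric_action G T X' \<pi>'" and p': "p' \<in> mspace X'"
      using P' by (auto simp: Pe P'e strong_nbhd_def pointed_metric_G_spaces_def)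
    have act'': "continuous_isometric_action G T X'' \<pi>''" and p'': "p'' \<in> mspace X''"
      and pt'': "P'' \<in> pointed_metric_G_spaces G T"
      using P'' by (auto simp: P'e P''e strong_nbhd_def pointed_metric_G_spaces_def)
    note A = continuous_isometric_actionD[OF act] and A' = continuous_isometric_actionD[OF act']
      and A'' = continuous_isometric_actionD[OF act'']
    define S' where "S' = (\<Union>g\<in>M'. \<pi>' g ` mcball_of X' p' R')"
    define S'' where "S'' = (\<Union>g\<in>M'. \<pi>'' g ` mcball_of X'' p'' R')"
    obtain f where fF: "f \<in> mspace X' \<rightarrow> mspace X" and fp: "f p' = p"
      and fH: "hausdorff_distance X (f ` mcball_of X' p' R') (mcball_of X p R') < ereal e"
      and fd0: "\<forall>x\<in>S'. \<forall>y\<in>S'. \<bar>mdist X (f x) (f y) - mdist X' x y\<bar> < e"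
      and fe0: "\<forall>x\<in>mcball_of X' p' R'. \<forall>g\<in>M'. mdist X (\<pi> g (f x)) (f (\<pi>' g x)) < e"
      using P' unfolding Pe P'e mem_strong_nbhd S'_def[symmetric] e_def[symmetric] by blast
    have f: "\<And>x. x \<in> mspace X' \<Longrightarrow> f x \<in> mspace X" "f p' = p"
      using fF fp by auto
    have fd: "\<bar>mdist X (f x) (f y) - mdist X' x y\<bar> < e" if "x \<in> S'" "y \<in> S'" for x y
      using fd0 that by blast
    have fe: "mdist X (\<pi> g (f x)) (f (\<pi>' g x)) < e"
      if "x \<in> mcball_of X' p' R'" "g \<in> M'" for x g
      using fe0 that by blast
    obtain h where hF: "h \<in> mspace X'' \<rightarrow> mspace X'" and hp: "h p'' = p'"
      and hH: "hausdorff_distance X' (h ` mcball_of X'' p'' R') (mcball_of X' p' R') < ereal e"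
      and hd0: "\<forall>x\<in>S''. \<forall>y\<in>S''. \<bar>mdist X' (h x) (h y) - mdist X'' x y\<bar> < e"
      and he0: "\<forall>x\<in>mcball_of X'' p'' R'. \<forall>g\<in>M'. mdist X' (\<pi>' g (h x)) (h (\<pi>'' g x)) < e"
      using P'' unfolding P'e P''e mem_strong_nbhd S''_def[symmetric] e_def[symmetric] by blast
    have h: "\<And>x. x \<in> mspace X'' \<Longrightarrow> h x \<in> mspace X'" "h p'' = p'"
      using hF hp by auto
    have hd: "\<bar>mdist X' (h x) (h y) - mdist X'' x y\<bar> < e" if "x \<in> S''" "y \<in> S''" for x y
      using hd0 that by blast
    have he: "mdist X' (\<pi>' g (h x)) (h (\<pi>'' g x)) < e"
      if "x \<in> mcball_of X'' p'' R'" "g \<in> M'" for x g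
      using he0 that by blast
    obtain r where r: "0 \<le> r" "r < e"
      "\<And>y. y \<in> mcball_of X p R' \<Longrightarrow> \<exists>x\<in>mcball_of X' p' R'. mdist X (f x) y \<le> r"
      using fH unfolding hausdorff_distance_less_iff by auto
    obtain q where q: "0 \<le> q" "q < e"
      "\<And>y. y \<in> mcball_of X' p' R' \<Longrightarrow> \<exists>x\<in>mcball_of X'' p'' R'. mdist X' (h x) y \<le> q"
      using hH unfolding hausdorff_distance_less_iff by auto
    have S'I: "\<pi>' g x \<in> S'" if "x \<in> mcball_of X' p' R'" "g \<in> M'" for g x
      using that unfolding S'_def by blast
    have S''I: "\<pi>'' g x \<in> S''" if "x \<in> mcball_of X'' p'' R'" "g \<in> M'" for g x
      using that unfolding S''_def by blast
    have BS': "x \<in> S'" if "x \<in> mcball_of X' p' R'" for x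
      using S'I[OF that oneM'] A'(1) that by simp
    have BS'': "x \<in> S''" if "x \<in> mcball_of X'' p'' R'" for x
      using S''I[OF that oneM'] A''(1) that by simp
    have R'pos: "0 \<le> R'" "R \<le> R'"
      using R' e R K(1) by auto
    have pB: "p' \<in> mcball_of X' p' R'" "p'' \<in> mcball_of X'' p'' R'"
      using p' p'' R'pos by auto
    have hM: "h (\<pi>'' g x) \<in> mcball_of X' p' R'"
      if g: "g \<in> M" and x: "x \<in> mcball_of X'' p'' R" for g x
    proof -
      have gM': "g \<in> M'" and gG: "g \<in> carrier G"
        using g \<open>M \<subseteq> M'\<close> M'G by auto
      have xm: "x \<in> mspace X''" "mdist X'' p'' x \<le> R" and xB: "x \<in> mcball_of X'' p'' R'"
        using x R'pos by auto
      note mem = A(2)[OF gG p] A'(2)[OF gG p'] A''(2)[OF gG p''] A''(2)[OF gG xm(1)]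
      have "mdist X' (\<pi>' g p') p' < mdist X (f (\<pi>' g p')) p + e"
        using fd[OF S'I[OF pB(1) gM'] BS'[OF pB(1)]] f(2) by auto
      moreover have "mdist X (f (\<pi>' g p')) p \<le> mdist X (\<pi> g p) (f (\<pi>' g p')) + mdist X (\<pi> g p) p"
        using mdist_triangle[of "f (\<pi>' g p')" X "\<pi> g p" p] mem f(1) p by (simp add: mdist_commute)
      moreover have "mdist X (\<pi> g p) (f (\<pi>' g p')) < e"
        using fe[OF pB(1) gM'] f(2) by simp
      ultimately have 1: "mdist X' (\<pi>' g p') p' < K + 2 * e"
        using K(2)[OF g] by linarith
      have "mdist X'' (\<pi>'' g p'') p'' < mdist X' (h (\<pi>'' g p'')) p' + e"
        using hd[OF S''I[OF pB(2) gM'] BS''[OF pB(2)]] h(2) by auto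
      moreover have "mdist X' (h (\<pi>'' g p'')) p' \<le>
          mdist X' (\<pi>' g p') (h (\<pi>'' g p'')) + mdist X' (\<pi>' g p') p'"
        using mdist_triangle[of "h (\<pi>'' g p'')" X' "\<pi>' g p'" p'] mem h(1) p' by (simp add: mdist_commute)
      moreover have "mdist X' (\<pi>' g p') (h (\<pi>'' g p'')) < e"
        using he[OF pB(2) gM'] h(2) by simp
      ultimately have 2: "mdist X'' (\<pi>'' g p'') p'' < K + 4 * e"
        using 1 by linarith
      have "mdist X'' (\<pi>'' g x) p'' \<le> mdist X'' (\<pi>'' g x) (\<pi>'' g p'') + mdist X'' (\<pi>'' g p'') p''"
        by (rule mdist_triangle[OF mem(4) mem(3) p''])
      moreover have "mdist X'' (\<pi>'' g x) (\<pi>'' g p'') \<le> R"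
        using A''(3)[OF gG xm(1) p''] xm(2) by (simp add: mdist_commute)
      moreover have "mdist X' (h (\<pi>'' g x)) p' < mdist X'' (\<pi>'' g x) p'' + e"
        using hd[OF S''I[OF xB gM'] BS''[OF pB(2)]] h(2) by auto
      ultimately have "mdist X' (h (\<pi>'' g x)) p' \<le> R'"
        using 2 R' by linarith
      then show ?thesis
        using mem h(1) p' by (simp add: mdist_commute)
    qed
    have h1: "h x \<in> mcball_of X' p' R'" if "x \<in> mcball_of X'' p'' R" for x
      using hM[OF M(2) that] A''(1) that by simp
    have S''_mono: "\<pi>'' g x \<in> S''" if "g \<in> M" "x \<in> mcball_of X'' p'' R" for g x
      using that \<open>M \<subseteq> M'\<close> R'pos by (intro S''I) auto

    have c1: "hausdorff_distance X ((\<lambda>x. f (h x)) ` mcball_of X'' p'' R) (mcball_of X p R) < ereal \<epsilon>"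
      unfolding hausdorff_distance_less_iff
    proof (intro exI[of _ "7 * e"] conjI ballI)
      show "0 \<le> 7 * e" "7 * e < \<epsilon>"
        using e by auto
    next
      fix a assume "a \<in> (\<lambda>x. f (h x)) ` mcball_of X'' p'' R"
      then obtain x where a: "a = f (h x)" and x: "x \<in> mcball_of X'' p'' R"
        by blast
      have xB: "x \<in> mcball_of X'' p'' R'"
        using x R'pos by auto
      have "mdist X (f p') (f (h x)) < mdist X' p' (h x) + e"
        using fd[OF BS'[OF pB(1)] BS'[OF h1[OF x]]] by auto
      moreover have "mdist X' (h p'') (h x) < mdist X'' p'' x + e"
        using hd[OF BS''[OF pB(2)] BS''[OF xB]] by auto
      ultimately have "mdist X p a \<le> R + 2 * e"
        using x f(2) h(2) a by auto
      moreover have "a \<in> mspace X"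
        using a x f h by auto
      ultimately obtain w where w: "w \<in> mcball_of X p R" "mdist X w a \<le> 2 * e"
        using geodesic_space_shrink[OF geo p, of a R "2 * e"] R e by auto
      then show "\<exists>b\<in>mcball_of X p R. mdist X a b \<le> 7 * e"
        using e by (intro bexI[OF _ w(1)]) (simp add: mdist_commute)
    next
      fix b assume b: "b \<in> mcball_of X p R"
      obtain w where w: "w \<in> mcball_of X p (R - 4 * e)" "mdist X w b \<le> 4 * e"
        using geodesic_space_shrink[OF geo p, of b "R - 4 * e" "4 * e"] b e by auto
      have "w \<in> mcball_of X p R'"
        using w R'pos e by auto
      then obtain x' where x': "x' \<in> mcball_of X' p' R'" "mdist X (f x') w \<le> r"
        using r by blast
      obtain x where x: "x \<in> mcball_of X'' p'' R'" "mdist X' (h x) x' \<le> q"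
        using q x'(1) by blast
      have m: "x \<in> mspace X''" "x' \<in> mspace X'" "h x \<in> mspace X'" "f x' \<in> mspace X"
          "f (h x) \<in> mspace X" "w \<in> mspace X" "b \<in> mspace X"
        using x x' w b f h by auto
      have "mdist X' p' x' < mdist X p (f x') + e"
        using fd[OF BS'[OF pB(1)] BS'[OF x'(1)]] f(2) by auto
      moreover have "mdist X p (f x') \<le> mdist X p w + mdist X (f x') w"
        using mdist_triangle[of p X w "f x'"] m p by (simp add: mdist_commute)
      ultimately have x'R: "mdist X' p' x' < R - 2 * e"
        using x'(2) w(1) r by auto
      have "mdist X' p' (h x) \<le> mdist X' p' x' + mdist X' (h x) x'"
        using mdist_triangle[of p' X' x' "h x"] m p' by (simp add: mdist_commute)
      then have hxR: "mdist X' p' (h x) < R - e"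
        using x(2) q x'R by linarith
      have "mdist X'' p'' x < mdist X' p' (h x) + e"
        using hd[OF BS''[OF pB(2)] BS''[OF x(1)]] h(2) by auto
      then have xR: "x \<in> mcball_of X'' p'' R"
        using hxR m p'' by auto
      have "h x \<in> mcball_of X' p' R'"
        using hxR m p' R'pos e by auto
      then have "mdist X (f (h x)) (f x') < mdist X' (h x) x' + e"
        using fd[OF BS' BS'[OF x'(1)]] by fastforce
      moreover have "mdist X (f (h x)) b \<le> mdist X (f (h x)) (f x') + mdist X (f x') b"
        "mdist X (f x') b \<le> mdist X (f x') w + mdist X w b"
        by (rule mdist_triangle[OF m(5,4,7)], rule mdist_triangle[OF m(4,6,7)])
      ultimately have "mdist X (f (h x)) b \<le> 7 * e"
        using x(2) x'(2) w(2) q r by linarith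
      then show "\<exists>a\<in>(\<lambda>x. f (h x)) ` mcball_of X'' p'' R. mdist X a b \<le> 7 * e"
        using xR by blast
    qed
    have c2: "\<bar>mdist X (f (h x)) (f (h y)) - mdist X'' x y\<bar> < \<epsilon>"
      if xy: "x \<in> (\<Union>g\<in>M. \<pi>'' g ` mcball_of X'' p'' R)" "y \<in> (\<Union>g\<in>M. \<pi>'' g ` mcball_of X'' p'' R)"
      for x y
    proof -
      have "h x \<in> S'" "h y \<in> S'" "x \<in> S''" "y \<in> S''"
        using xy hM S''_mono by (auto simp del: in_mcball_of intro: BS')
      then have "\<bar>mdist X (f (h x)) (f (h y)) - mdist X' (h x) (h y)\<bar> < e"
        "\<bar>mdist X' (h x) (h y) - mdist X'' x y\<bar> < e"
        using fd hd by auto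
      then show ?thesis
        using e by linarith
    qed
    have c3: "mdist X (\<pi> g (f (h x))) (f (h (\<pi>'' g x))) < \<epsilon>"
      if x: "x \<in> mcball_of X'' p'' R" and g: "g \<in> M" for x g
    proof -
      have gM': "g \<in> M'" and gG: "g \<in> carrier G"
        using g \<open>M \<subseteq> M'\<close> M'G by auto
      have xB: "x \<in> mcball_of X'' p'' R'"
        using x R'pos by auto
      have m: "x \<in> mspace X''" "h x \<in> mspace X'" "f (h x) \<in> mspace X"
        using x f h by auto
      then have m2: "\<pi>'' g x \<in> mspace X''" "\<pi>' g (h x) \<in> mspace X'" "\<pi> g (f (h x)) \<in> mspace X"
        using gG by (auto intro: A(2) A'(2) A''(2))
      have "mdist X (\<pi> g (f (h x))) (f (\<pi>' g (h x))) < e"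
        by (rule fe[OF h1[OF x] gM'])
      moreover have "mdist X (f (\<pi>' g (h x))) (f (h (\<pi>'' g x))) < mdist X' (\<pi>' g (h x)) (h (\<pi>'' g x)) + e"
        using fd[OF S'I[OF h1[OF x] gM'] BS'[OF hM[OF g x]]] by auto
      moreover have "mdist X' (\<pi>' g (h x)) (h (\<pi>'' g x)) < e"
        by (rule he[OF xB gM'])
      moreover have "mdist X (\<pi> g (f (h x))) (f (h (\<pi>'' g x))) \<le>
          mdist X (\<pi> g (f (h x))) (f (\<pi>' g (h x))) + mdist X (f (\<pi>' g (h x))) (f (h (\<pi>'' g x)))"
        using m2 f h by (intro mdist_triangle) auto
      ultimately show ?thesis
        using e by linarith
    qed
    have c4: "(\<lambda>x. f (h x)) \<in> mspace X'' \<rightarrow> mspace X"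
      using f h by auto
    have c5: "f (h p'') = p"
      using f h by simp
    show ?thesis
      unfolding Pe P''e mem_strong_nbhd
    proof (intro conjI bexI[of _ "\<lambda>x. f (h x)", OF _ c4] ballI)
      show "(X'', p'', \<pi>'') \<in> pointed_metric_G_spaces G T"
        using pt'' unfolding P''e .
    qed (fact c1 c5 | rule c2 c3, assumption+)+
  qed
  show ?thesis
    by (rule that[OF \<epsilon>0(1)], rule subsetI, rule main)
qed

lemma strong_nbhd_subset: "strong_nbhd G T R \<epsilon> M P \<subseteq> pointed_metric_G_spaces G T"
  by (auto simp: strong_nbhd_def split: prod.splits)

lemma strong_nbhd_directed:
  assumes top: "topspace T = carrier G" and P: "P \<in> pointed_metric_G_spaces G T"
    and 1: "(R\<^sub>1, \<epsilon>\<^sub>1, M\<^sub>1) \<in> strong_nbhd_params G T" and 2: "(R\<^sub>2, \<epsilon>\<^sub>2, M\<^sub>2) \<in> strong_nbhd_params G T"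
  shows "\<exists>(R, \<epsilon>, M) \<in> strong_nbhd_params G T.
    strong_nbhd G T R \<epsilon> M P \<subseteq> strong_nbhd G T R\<^sub>1 \<epsilon>\<^sub>1 M\<^sub>1 P \<inter> strong_nbhd G T R\<^sub>2 \<epsilon>\<^sub>2 M\<^sub>2 P"
proof -
  obtain S\<^sub>1 d\<^sub>1 where d1: "d\<^sub>1 > 0"
    and S1: "\<And>R \<epsilon> M P'. (R, \<epsilon>, M) \<in> strong_nbhd_params G T \<Longrightarrow> S\<^sub>1 \<le> R \<Longrightarrow> \<epsilon> \<le> d\<^sub>1 \<Longrightarrow> M\<^sub>1 \<subseteq> M \<Longrightarrow>
      P' \<in> strong_nbhd G T R \<epsilon> M P \<Longrightarrow> strong_nbhd G T R \<epsilon> M P' \<subseteq> strong_nbhd G T R\<^sub>1 \<epsilon>\<^sub>1 M\<^sub>1 P"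
    by (rule strong_nbhd_compose[OF top P 1]) (rule that, assumption, blast)
  obtain S\<^sub>2 d\<^sub>2 where d2: "d\<^sub>2 > 0"
    and S2: "\<And>R \<epsilon> M P'. (R, \<epsilon>, M) \<in> strong_nbhd_params G T \<Longrightarrow> S\<^sub>2 \<le> R \<Longrightarrow> \<epsilon> \<le> d\<^sub>2 \<Longrightarrow> M\<^sub>2 \<subseteq> M \<Longrightarrow>
      P' \<in> strong_nbhd G T R \<epsilon> M P \<Longrightarrow> strong_nbhd G T R \<epsilon> M P' \<subseteq> strong_nbhd G T R\<^sub>2 \<epsilon>\<^sub>2 M\<^sub>2 P"
    by (rule strong_nbhd_compose[OF top P 2]) (rule that, assumption, blast)
  define R where "R = max 1 (max S\<^sub>1 S\<^sub>2)"
  define d where "d = min d\<^sub>1 d\<^sub>2"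
  have par: "(R, d, M\<^sub>1 \<union> M\<^sub>2) \<in> strong_nbhd_params G T"
    using 1 2 d1 d2 by (auto simp: strong_nbhd_params_def R_def d_def compactin_Un)
  have "strong_nbhd G T R d (M\<^sub>1 \<union> M\<^sub>2) P \<subseteq> strong_nbhd G T R\<^sub>1 \<epsilon>\<^sub>1 M\<^sub>1 P \<inter> strong_nbhd G T R\<^sub>2 \<epsilon>\<^sub>2 M\<^sub>2 P"
  proof
    fix Q assume Q: "Q \<in> strong_nbhd G T R d (M\<^sub>1 \<union> M\<^sub>2) P"
    have QQ: "Q \<in> strong_nbhd G T R d (M\<^sub>1 \<union> M\<^sub>2) Q"
    proof (rule strong_nbhd_refl[OF _ _ _ _ top])
      show "Q \<in> pointed_metric_G_spaces G T"
        using Q by (rule subsetD[OF strong_nbhd_subset])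
    qed (use par in \<open>auto simp: strong_nbhd_params_def\<close>)
    have le: "S\<^sub>1 \<le> R" "S\<^sub>2 \<le> R" "d \<le> d\<^sub>1" "d \<le> d\<^sub>2"
      by (auto simp: R_def d_def)
    show "Q \<in> strong_nbhd G T R\<^sub>1 \<epsilon>\<^sub>1 M\<^sub>1 P \<inter> strong_nbhd G T R\<^sub>2 \<epsilon>\<^sub>2 M\<^sub>2 P"
      using subsetD[OF S1[OF par le(1,3) Un_upper1 Q] QQ]
        subsetD[OF S2[OF par le(2,4) Un_upper2 Q] QQ] by (rule IntI)
  qed
  with par show ?thesis
    by (intro bexI[of _ "(R, d, M\<^sub>1 \<union> M\<^sub>2)"]) simp_all
qed

lemma openin_strong_topology:
  fixes U :: "('a, 'g) pointed_space set"
  assumes top: "topspace T = carrier G"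
  shows "openin (strong_topology G T) U \<longleftrightarrow> U \<subseteq> pointed_metric_G_spaces G T \<and>
    (\<forall>P\<in>U. \<exists>(R, \<epsilon>, M) \<in> strong_nbhd_params G T. strong_nbhd G T R \<epsilon> M P \<subseteq> U)"
proof -
  let ?O = "\<lambda>U :: ('a, 'g) pointed_space set. U \<subseteq> pointed_metric_G_spaces G T \<and>
     (\<forall>P\<in>U. \<exists>(R, \<epsilon>, M) \<in> strong_nbhd_params G T. strong_nbhd G T R \<epsilon> M P \<subseteq> U)"
  have "istopology ?O"
    unfolding istopology_def
  proof (intro conjI allI impI)
    fix U V assume U: "?O U" and V: "?O V"
    show "U \<inter> V \<subseteq> pointed_metric_G_spaces G T"
      using U by blast
    show "\<forall>P\<in>U \<inter> V. \<exists>(R, \<epsilon>, M) \<in> strong_nbhd_params G T. strong_nbhd G T R \<epsilon> M P \<subseteq> U \<inter> V"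
    proof
      fix P assume P: "P \<in> U \<inter> V"
      obtain R\<^sub>1 \<epsilon>\<^sub>1 M\<^sub>1 where 1: "(R\<^sub>1, \<epsilon>\<^sub>1, M\<^sub>1) \<in> strong_nbhd_params G T" "strong_nbhd G T R\<^sub>1 \<epsilon>\<^sub>1 M\<^sub>1 P \<subseteq> U"
        using U P by blast
      obtain R\<^sub>2 \<epsilon>\<^sub>2 M\<^sub>2 where 2: "(R\<^sub>2, \<epsilon>\<^sub>2, M\<^sub>2) \<in> strong_nbhd_params G T" "strong_nbhd G T R\<^sub>2 \<epsilon>\<^sub>2 M\<^sub>2 P \<subseteq> V"
        using V P by blast
      have "P \<in> pointed_metric_G_spaces G T"
        using U P by blast
      from strong_nbhd_directed[OF top this 1(1) 2(1)] 1(2) 2(2)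
      show "\<exists>(R, \<epsilon>, M) \<in> strong_nbhd_params G T. strong_nbhd G T R \<epsilon> M P \<subseteq> U \<inter> V"
        by blast
    qed
  next
    fix \<K> assume "\<forall>K\<in>\<K>. ?O K"
    then show "\<Union>\<K> \<subseteq> pointed_metric_G_spaces G T"
      and "\<forall>P\<in>\<Union>\<K>. \<exists>(R, \<epsilon>, M) \<in> strong_nbhd_params G T. strong_nbhd G T R \<epsilon> M P \<subseteq> \<Union>\<K>"
      by (blast, fast)
  qed
  then show ?thesis
    unfolding strong_topology_def by (simp add: topology_inverse')
qed

lemma strong_nbhd_base:
  assumes top: "topspace T = carrier G" and P: "P \<in> pointed_metric_G_spaces G T"
  shows "(\<exists>U. openin (strong_topology G T) U \<and> P \<in> U \<and> U \<subseteq> N) \<longleftrightarrow>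
    (\<exists>(R, \<epsilon>, M) \<in> strong_nbhd_params G T. strong_nbhd G T R \<epsilon> M P \<subseteq> N)"
proof
  assume "\<exists>U. openin (strong_topology G T) U \<and> P \<in> U \<and> U \<subseteq> N"
  then obtain U where U: "openin (strong_topology G T) U" "P \<in> U" "U \<subseteq> N"
    by blast
  then obtain R \<epsilon> M where "(R, \<epsilon>, M) \<in> strong_nbhd_params G T" "strong_nbhd G T R \<epsilon> M P \<subseteq> U"
    unfolding openin_strong_topology[OF top] by blast
  with U(3) show "\<exists>(R, \<epsilon>, M) \<in> strong_nbhd_params G T. strong_nbhd G T R \<epsilon> M P \<subseteq> N"
    by (intro bexI[of _ "(R, \<epsilon>, M)"]) auto
next
  assume ex: "\<exists>(R, \<epsilon>, M) \<in> strong_nbhd_params G T. strong_nbhd G T R \<epsilon> M P \<subseteq> N"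
  define U where "U = {Q \<in> pointed_metric_G_spaces G T.
    \<exists>(R, \<epsilon>, M) \<in> strong_nbhd_params G T. strong_nbhd G T R \<epsilon> M Q \<subseteq> N}"
  have "\<exists>(R, \<epsilon>, M) \<in> strong_nbhd_params G T. strong_nbhd G T R \<epsilon> M Q \<subseteq> U" if Q: "Q \<in> U" for Q
  proof -
    obtain R \<epsilon> M where 1: "(R, \<epsilon>, M) \<in> strong_nbhd_params G T" "strong_nbhd G T R \<epsilon> M Q \<subseteq> N"
      using Q unfolding U_def by blast
    have Qp: "Q \<in> pointed_metric_G_spaces G T"
      using Q unfolding U_def by blast
    obtain S d where d: "d > 0"
      and S: "\<And>R' \<epsilon>' M' P'. (R', \<epsilon>', M') \<in> strong_nbhd_params G T \<Longrightarrow> S \<le> R' \<Longrightarrow> \<epsilon>' \<le> d \<Longrightarrow> M \<subseteq> M' \<Longrightarrow>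
        P' \<in> strong_nbhd G T R' \<epsilon>' M' Q \<Longrightarrow> strong_nbhd G T R' \<epsilon>' M' P' \<subseteq> strong_nbhd G T R \<epsilon> M Q"
      by (rule strong_nbhd_compose[OF top Qp 1(1)]) (rule that, assumption, blast)
    have par: "(max 1 S, d, M) \<in> strong_nbhd_params G T"
      using 1(1) d by (auto simp: strong_nbhd_params_def)
    have "strong_nbhd G T (max 1 S) d M Q \<subseteq> U"
    proof
      fix P' assume P': "P' \<in> strong_nbhd G T (max 1 S) d M Q"
      have "strong_nbhd G T (max 1 S) d M P' \<subseteq> N"
        using S[OF par max.cobounded2 order.refl subset_refl P'] 1(2) by (rule subset_trans)
      then show "P' \<in> U"
        using subsetD[OF strong_nbhd_subset P'] par unfolding U_def by blast
    qed
    with par show ?thesis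
      by blast
  qed
  then have "openin (strong_topology G T) U"
    unfolding openin_strong_topology[OF top] by (auto simp: U_def)
  moreover have "P \<in> U"
    using P ex unfolding U_def by blast
  moreover have "U \<subseteq> N"
  proof
    fix Q assume Q: "Q \<in> U"
    then obtain R \<epsilon> M where 1: "(R, \<epsilon>, M) \<in> strong_nbhd_params G T" "strong_nbhd G T R \<epsilon> M Q \<subseteq> N"
      unfolding U_def by blast
    have "Q \<in> strong_nbhd G T R \<epsilon> M Q"
      using Q 1(1) by (intro strong_nbhd_refl[OF _ _ _ _ top]) (auto simp: U_def strong_nbhd_params_def)
    then show "Q \<in> N"
      using 1(2) by blast
  qed
  ultimately show "\<exists>U. openin (strong_topology G T) U \<and> P \<in> U \<and> U \<subseteq> N"
    by blast
qed

lemma topspace_strong_topology: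
  assumes top: "topspace T = carrier G" and one: "\<one>\<^bsub>G\<^esub> \<in> carrier G"
  shows "topspace (strong_topology G T) = pointed_metric_G_spaces G T"
proof -
  have "compactin T {\<one>\<^bsub>G\<^esub>}"
    using top one by simp
  then have "(1, 1, {\<one>\<^bsub>G\<^esub>}) \<in> strong_nbhd_params G T"
    by (simp add: strong_nbhd_params_def)
  then have "openin (strong_topology G T) (pointed_metric_G_spaces G T)"
    unfolding openin_strong_topology[OF top] using strong_nbhd_subset by blast
  then have "pointed_metric_G_spaces G T \<subseteq> topspace (strong_topology G T)"
    by (rule openin_subset)
  moreover have "topspace (strong_topology G T) \<subseteq> pointed_metric_G_spaces G T"
    using openin_strong_topology[OF top, THEN iffD1, OF openin_topspace] by (rule conjunct1)
  ultimately show ?thesis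
    by (rule subset_antisym[rotated])
qed

end

theory Submission
  imports Defs
begin

text \<open>Let \<open>S\<close> be the sphere of light vectors with time coordinate \<open>1\<close>, so that the Lorentz product of
  \<open>x, y \<in> S\<close> is \<open>1 - x\<cdot>y\<close>. For \<open>0 < t \<le> 1\<close> the binomial series \<open>(1 - s)\<^sup>t = 1 - \<Sum>\<^sub>k c\<^sub>k s\<^sup>k\<close> has \<open>c\<^sub>k \<ge> 0\<close>.
  Hence the \<open>t\<close>-th power of the Lorentz product, integrated against positive functionals \<open>\<mu>, \<nu>\<close> on the
  bounded functions on \<open>S\<close>, is the product of their masses minus a positive semidefinite form: a Lorentzian
  form for which the points of \<open>S\<close> (Dirac functionals) are null. The functionals of norm one,
  modulo the radical of the form, make up a convex subset \<open>C\<^sub>t\<close> of an infinite-dimensional hyperbolic space,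
  which is the hull of \<open>S\<close> placed at infinity; in particular \<open>C\<^sub>t\<close> is CAT(-1), and \<open>C\<^sub>1\<close> is the hyperboloid.
  It is proper because means on \<open>S\<close> are weak-* compact. A hyperbolic isometry acts on functionals by
  pushing forward along its action on \<open>S\<close> and multiplying by the \<open>t\<close>-th power of the conformal factor.

  A point whose orbit mass is nearly minimal has bounded mass, which gives cocompactness. An invariant
  closed convex set accumulates at every Dirac functional, and a nearest-point argument then shows that
  it is everything. A similarity \<open>C\<^sub>t \<rightarrow> C\<^sub>t\<^sub>'\<close> of factor \<open>\<mu>\<close> extends to \<open>S\<close> and turns cross-ratios into their powers
  of exponent \<open>\<mu>t/t'\<close>, which is at most \<open>1\<close> by Ptolemy's inequality, while the midpoint of a line between
  antipodal points of \<open>S\<close> gives \<open>\<mu> = 1\<close>; for \<open>t = t'\<close> the boundary map is conformal, hence comes from a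
  hyperbolic isometry. Sending the point of \<open>C\<^sub>u\<close> given by a mean to the point of \<open>C\<^sub>t\<close> given by the same mean
  is almost isometric and almost equivariant on balls when \<open>u\<close> is close to \<open>t\<close>.\<close>

section \<open>Spaces with a Lorentzian kernel\<close>

text \<open>Functionals on all bounded functions stand in for measures, so that pushing forward
  along a boundary map needs no measurability and compactness of means is Tychonoff's theorem. The
  price is that neither dominated convergence nor Fubini holds. One fact replaces both: the binomial
  series converges uniformly on [-1, 1], so the kernel is a uniform limit of finite-rank kernels,
  for which iterated functionals commute and the sign of the form can be read off. A cluster point
  of a sequence of means need not be the limit of a subsequence. But the form is nonpositive on
  differences of means, and the resulting squared seminorm \<open>gap\<close> does admit convergent
  subsequences; compactness and minimality are argued with \<open>gap\<close>. All the spaces live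
  in one type, and \<open>X 1\<close> has to be the hyperboloid itself and not a copy of it. Points
  are therefore encoded by their moments, as sequences of reals. Conformal boundary maps do not
  refer to the exponent. This lets an isometry of one space be turned into an isometry of the
  hyperboloid.\<close>

lemma quadratic_form_discriminant:
  fixes P R M :: real
  assumes "\<And>a c. a\<^sup>2 * P + c\<^sup>2 * R + 2 * a * c * M \<ge> 0"
  shows "M\<^sup>2 \<le> P * R"
proof (cases "R = 0")
  case True
  have "M = 0"
  proof (rule ccontr)
    assume "M \<noteq> 0"
    then show False
      using assms[of 1 "- (P + 1) / (2 * M)"] True by (simp add: field_simps)
  qed
  then show ?thesis
    using True by simp
next
  case False
  have "R \<ge> 0"
    using assms[of 0 1] by simp
  then have R: "R > 0"
    using False by simp
  have "R * (P * R - M\<^sup>2) \<ge> 0"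
    using assms[of R "- M"] by (simp add: power2_eq_square algebra_simps)
  then show ?thesis
    using R by (simp add: zero_le_mult_iff)
qed

text \<open>The hypothesis bounds a Gram matrix by the square of a linear form, so the matrix has at most
  one positive direction; shifting along the second vector until the linear form vanishes shows that
  it is nonpositive on the orthogonal complement of that vector.\<close>

lemma lorentzian_gram_bound:
  fixes A C D lx ly lz :: real
  assumes psd: "\<And>a b c. a\<^sup>2 + b\<^sup>2 + c\<^sup>2 + 2 * a * b * A + 2 * b * c * C + 2 * a * c * D
                 \<le> (a * lx + b * ly + c * lz)\<^sup>2"
  shows "(D - A * C)\<^sup>2 \<le> (A\<^sup>2 - 1) * (C\<^sup>2 - 1)"
proof -
  have ly: "ly \<noteq> 0"
    using psd[of 0 1 0] by auto
  have "0 \<le> a\<^sup>2 * (A\<^sup>2 - 1) + c\<^sup>2 * (C\<^sup>2 - 1) + 2 * a * c * (A * C - D)" for a c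
  proof -
    \<comment> \<open>This \<open>b\<close> makes the combination orthogonal to the second vector,
      so that a further multiple \<open>s\<close> of that vector only adds the square of
      \<open>s\<close>.\<close>
    define b where "b = - (a * A + c * C)"
    define s where "s = - (a * lx + b * ly + c * lz) / ly"
    have "a * lx + (b + s) * ly + c * lz = 0"
      using ly by (simp add: s_def field_simps)
    then have "a\<^sup>2 + (b + s)\<^sup>2 + c\<^sup>2 + 2 * a * (b + s) * A + 2 * (b + s) * c * C + 2 * a * c * D \<le> 0"
      using psd[of a "b + s" c] by simp
    moreover have "a\<^sup>2 + (b + s)\<^sup>2 + c\<^sup>2 + 2 * a * (b + s) * A + 2 * (b + s) * c * C + 2 * a * c * D
        = a\<^sup>2 * (1 - A\<^sup>2) + c\<^sup>2 * (1 - C\<^sup>2) + 2 * a * c * (D - A * C) + s\<^sup>2"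
      by (simp add: b_def power2_eq_square algebra_simps)
    ultimately have "a\<^sup>2 * (1 - A\<^sup>2) + c\<^sup>2 * (1 - C\<^sup>2) + 2 * a * c * (D - A * C) \<le> 0"
      using zero_le_power2[of s] by linarith
    then show ?thesis
      by (simp add: algebra_simps)
  qed
  from quadratic_form_discriminant[OF this] show ?thesis
    by (simp add: power2_commute)
qed

section \<open>Kernel spaces: metric, geodesics and comparison triangles\<close>

definition kernel_space :: "'a set \<Rightarrow> ('a \<Rightarrow> 'a \<Rightarrow> real) \<Rightarrow> 'a metric" where
  "kernel_space X B = metric (X, \<lambda>x y. if x \<in> X \<and> y \<in> X then arcosh (B x y) else 0)"

text \<open>Axioms for a convex subset of a hyperbolic space of any dimension, with \<open>B\<close>
  the Lorentz product. \<open>gram\<close> is Cauchy-Schwarz for the components of \<open>x\<close>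
  and \<open>z\<close> orthogonal to \<open>y\<close>. \<open>convex\<close> describes a point of a
  segment only by its products, so that no ambient vector space has to be built.\<close>

locale hyp_kernel =
  fixes X :: "'a set" and B :: "'a \<Rightarrow> 'a \<Rightarrow> real"
  assumes sym: "x \<in> X \<Longrightarrow> y \<in> X \<Longrightarrow> B x y = B y x"
    and self: "x \<in> X \<Longrightarrow> B x x = 1"
    and ge1: "x \<in> X \<Longrightarrow> y \<in> X \<Longrightarrow> 1 \<le> B x y"
    and eq: "x \<in> X \<Longrightarrow> y \<in> X \<Longrightarrow> B x y = 1 \<Longrightarrow> x = y"
    and gram: "x \<in> X \<Longrightarrow> y \<in> X \<Longrightarrow> z \<in> X \<Longrightarrow>
      (B x z - B x y * B y z)\<^sup>2 \<le> ((B x y)\<^sup>2 - 1) * ((B y z)\<^sup>2 - 1)"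
    and convex: "x \<in> X \<Longrightarrow> y \<in> X \<Longrightarrow> 0 \<le> a \<Longrightarrow> 0 \<le> b \<Longrightarrow> a\<^sup>2 + b\<^sup>2 + 2 * a * b * B x y = 1 \<Longrightarrow>
      \<exists>z\<in>X. \<forall>w\<in>X. B z w = a * B x w + b * B y w"
begin

sublocale Metric_space X "\<lambda>x y. if x \<in> X \<and> y \<in> X then arcosh (B x y) else 0"
proof
  fix x y
  show "0 \<le> (if x \<in> X \<and> y \<in> X then arcosh (B x y) else 0)"
    by (simp add: ge1)
  show "(if x \<in> X \<and> y \<in> X then arcosh (B x y) else 0) = (if y \<in> X \<and> x \<in> X then arcosh (B y x) else 0)"
    by (auto simp: sym)
next
  fix x y assume "x \<in> X" "y \<in> X"
  then show "((if x \<in> X \<and> y \<in> X then arcosh (B x y) else 0) = 0) = (x = y)"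
    using ge1[of x y] eq[of x y] self by auto
next
  fix x y z assume x: "x \<in> X" and y: "y \<in> X" and z: "z \<in> X"
  have A: "B x y \<ge> 1" and C: "B y z \<ge> 1" and D: "B x z \<ge> 1"
    using x y z by (auto intro: ge1)
  have "(B x z - B x y * B y z)\<^sup>2 \<le> ((B x y)\<^sup>2 - 1) * ((B y z)\<^sup>2 - 1)"
    by (rule gram[OF x y z])
  also have "\<dots> = (sinh (arcosh (B x y)) * sinh (arcosh (B y z)))\<^sup>2"
    using A C by (simp add: sinh_arcosh_real power_mult_distrib)
  finally have "B x z - B x y * B y z \<le> sinh (arcosh (B x y)) * sinh (arcosh (B y z))"
    by (rule power2_le_imp_le) (use A C in simp)
  then have "cosh (arcosh (B x z)) \<le> cosh (arcosh (B x y) + arcosh (B y z))"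
    using A C D by (simp add: cosh_add)
  then have "arcosh (B x z) \<le> arcosh (B x y) + arcosh (B y z)"
    using A C D by (subst (asm) cosh_real_nonneg_le_iff) auto
  then show "(if x \<in> X \<and> z \<in> X then arcosh (B x z) else 0) \<le>
     (if x \<in> X \<and> y \<in> X then arcosh (B x y) else 0) + (if y \<in> X \<and> z \<in> X then arcosh (B y z) else 0)"
    using x y z by simp
qed

abbreviation "K \<equiv> kernel_space X B"

lemma mspace_kernel_space [simp]: "mspace K = X"
  by (simp add: kernel_space_def mspace_metric)

lemma mdist_kernel_space: "x \<in> X \<Longrightarrow> y \<in> X \<Longrightarrow> mdist K x y = arcosh (B x y)"
  by (simp add: kernel_space_def mdist_metric)

lemma cosh_mdist: "x \<in> X \<Longrightarrow> y \<in> X \<Longrightarrow> cosh (mdist K x y) = B x y"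
  by (simp add: mdist_kernel_space ge1)

lemma mdist_eqI: "x \<in> X \<Longrightarrow> y \<in> X \<Longrightarrow> 0 \<le> d \<Longrightarrow> B x y = cosh d \<Longrightarrow> mdist K x y = d"
  by (simp add: mdist_kernel_space arcosh_cosh_real)

lemma mtopology_kernel_space: "mtopology_of K = mtopology"
  by (simp add: kernel_space_def mtopology_of)

lemma mdist_le_iff: "x \<in> X \<Longrightarrow> y \<in> X \<Longrightarrow> 0 \<le> r \<Longrightarrow> mdist K x y \<le> r \<longleftrightarrow> B x y \<le> cosh r"
  by (metis cosh_mdist cosh_real_nonneg_le_iff mdist_nonneg)

lemma kernel_eqI:
  assumes "x \<in> X" "y \<in> X" "\<And>w. w \<in> X \<Longrightarrow> B x w = B y w"
  shows "x = y"
  using assms by (intro eq) (auto simp: self)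

text \<open>Hyperbolic interpolation: the point at distance \<open>s\<close> from the start of a
  segment of length \<open>L\<close> is the combination of the endpoints with weights
  \<open>geo_coeff L s\<close> and \<open>geo_coeff L (L - s)\<close>. The value 1 at
  \<open>L = 0\<close> lets a degenerate segment stay at its start.\<close>

definition geo_coeff :: "real \<Rightarrow> real \<Rightarrow> real" where
  "geo_coeff L s = (if L = 0 then 1 else sinh (L - s) / sinh L)"

text \<open>Both sides are the Lorentz product of the points with parameters \<open>s\<close> and
  \<open>s'\<close> on one geodesic, the second having products \<open>cosh s'\<close> and
  \<open>cosh (L - s')\<close> with the endpoints. Expressed through \<open>L - s\<close>,
  \<open>s\<close> and \<open>s - s'\<close>, the identity reduces to addition formulas.\<close>

lemma geo_coeff_combination:
  assumes "0 < L"
  shows "geo_coeff L s * cosh s' + geo_coeff L (L - s) * cosh (L - s') = cosh (s - s')"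
proof -
  have "sinh L > 0"
    using assms by simp
  moreover have "sinh (L - s) * cosh s' + sinh s * cosh (L - s') = sinh L * cosh (s - s')"
  proof -
    have "sinh L = sinh ((L - s) + s)"
      by simp
    also have "\<dots> = sinh (L - s) * cosh s + cosh (L - s) * sinh s"
      by (rule sinh_add)
    finally have 1: "sinh L = sinh (L - s) * cosh s + cosh (L - s) * sinh s" .
    have "cosh (L - s') = cosh ((L - s) + (s - s'))"
      by simp
    also have "\<dots> = cosh (L - s) * cosh (s - s') + sinh (L - s) * sinh (s - s')"
      by (rule cosh_add)
    finally have 2: "cosh (L - s') = cosh (L - s) * cosh (s - s') + sinh (L - s) * sinh (s - s')" .
    have "cosh s' = cosh (s - (s - s'))"
      by simp
    also have "\<dots> = cosh s * cosh (s - s') - sinh s * sinh (s - s')"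
      by (rule cosh_diff)
    finally have 3: "cosh s' = cosh s * cosh (s - s') - sinh s * sinh (s - s')" .
    show ?thesis
      unfolding 1 2 3 by (simp add: algebra_simps)
  qed
  ultimately show ?thesis
    using assms by (simp add: geo_coeff_def field_simps)
qed

lemma geo_coeff_nonneg: "0 \<le> s \<Longrightarrow> s \<le> L \<Longrightarrow> 0 \<le> geo_coeff L s"
  by (auto simp: geo_coeff_def)

lemma geodesic_point_exists:
  assumes x: "x \<in> X" and y: "y \<in> X" and L: "L = mdist K x y" "0 < L" and s: "0 \<le> s" "s \<le> L"
  shows "\<exists>z\<in>X. \<forall>w\<in>X. B z w = geo_coeff L s * B x w + geo_coeff L (L - s) * B y w"
proof (rule convex[OF x y])
  show "0 \<le> geo_coeff L s" "0 \<le> geo_coeff L (L - s)"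
    using s by (auto intro: geo_coeff_nonneg)
  have Bxy: "B x y = cosh L"
    using x y L cosh_mdist by simp
  have "(geo_coeff L s)\<^sup>2 + (geo_coeff L (L - s))\<^sup>2 + 2 * geo_coeff L s * geo_coeff L (L - s) * B x y
    = geo_coeff L s * (geo_coeff L s * cosh 0 + geo_coeff L (L - s) * cosh (L - 0))
      + geo_coeff L (L - s) * (geo_coeff L s * cosh L + geo_coeff L (L - s) * cosh (L - L))"
    by (simp add: Bxy power2_eq_square algebra_simps)
  also have "\<dots> = geo_coeff L s * cosh s + geo_coeff L (L - s) * cosh (L - s)"
    using geo_coeff_combination[OF L(2), of s 0] geo_coeff_combination[OF L(2), of s L]
      cosh_minus[of "s - L"] by (simp only: minus_diff_eq diff_0_right)
  also have "\<dots> = 1"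
    using geo_coeff_combination[OF L(2), of s s] unfolding diff_self cosh_0 .
  finally show "(geo_coeff L s)\<^sup>2 + (geo_coeff L (L - s))\<^sup>2
    + 2 * geo_coeff L s * geo_coeff L (L - s) * B x y = 1" .
qed

text \<open>Geodesics are unique: \<open>c s\<close> has the prescribed distances to both endpoints,
  so its product with the interpolated point is 1. The \<open>if\<close> keeps the default value of
  \<open>geo_coeff\<close> from counting a degenerate segment twice.\<close>

lemma geodesic_path_kernel:
  assumes c: "geodesic_path K x y c" and x: "x \<in> X" and y: "y \<in> X"
    and s: "s \<in> {0..mdist K x y}" and w: "w \<in> X"
  shows "B (c s) w = geo_coeff (mdist K x y) s * B x w
     + (if mdist K x y = 0 then 0 else geo_coeff (mdist K x y) (mdist K x y - s)) * B y w"
proof -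
  define L where "L = mdist K x y"
  have c0: "c 0 = x" "c L = y" and cX: "c s \<in> X"
    and iso: "\<And>a b. a \<in> {0..L} \<Longrightarrow> b \<in> {0..L} \<Longrightarrow> mdist K (c a) (c b) = \<bar>a - b\<bar>"
    using c s unfolding geodesic_path_def L_def[symmetric] by auto
  show ?thesis
  proof (cases "L = 0")
    case True
    then show ?thesis
      using s c0 by (simp add: L_def[symmetric] geo_coeff_def)
  next
    case False
    then have L: "L > 0"
      by (simp add: L_def less_le)
    have s': "0 \<le> s" "s \<le> L"
      using s by (auto simp: L_def)
    obtain z where z: "z \<in> X" "\<And>w. w \<in> X \<Longrightarrow> B z w = geo_coeff L s * B x w + geo_coeff L (L - s) * B y w"
      using geodesic_point_exists[OF x y L_def L s'] by blast
    have "mdist K x (c s) = s" "mdist K y (c s) = L - s"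
      using iso[of 0 s] iso[of L s] s' L by (auto simp: c0)
    then have "B x (c s) = cosh s" "B y (c s) = cosh (L - s)"
      using cosh_mdist[OF x cX] cosh_mdist[OF y cX] by auto
    then have "B z (c s) = 1"
      using z(2)[OF cX] geo_coeff_combination[OF L, of s s] by simp
    then have "z = c s"
      by (rule eq[OF z(1) cX])
    then show ?thesis
      using z(2)[OF w] False by (simp add: L_def[symmetric])
  qed
qed

lemma geodesic_path_exists:
  assumes x: "x \<in> X" and y: "y \<in> X"
  shows "\<exists>c. geodesic_path K x y c"
proof (cases "x = y")
  case True
  then show ?thesis
    using x by (intro exI[of _ "\<lambda>_. x"]) (auto simp: geodesic_path_def)
next
  case False
  define L where "L = mdist K x y"
  have L: "L > 0"
    using False eq[OF x y] cosh_mdist[OF x y] mdist_nonneg[of K x y] by (auto simp: L_def less_le)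
  have "\<forall>s\<in>{0..L}. \<exists>z. z \<in> X \<and> (\<forall>w\<in>X. B z w = geo_coeff L s * B x w + geo_coeff L (L - s) * B y w)"
    using geodesic_point_exists[OF x y L_def L] unfolding Bex_def by simp
  then obtain c where c: "\<And>s. s \<in> {0..L} \<Longrightarrow> c s \<in> X"
    "\<And>s w. s \<in> {0..L} \<Longrightarrow> w \<in> X \<Longrightarrow> B (c s) w = geo_coeff L s * B x w + geo_coeff L (L - s) * B y w"
    by metis
  have Bxy: "B x y = cosh L" "B y x = cosh L"
    using x y L_def cosh_mdist sym by auto
  have cx: "B x (c s) = cosh s" if "s \<in> {0..L}" for s
    using c[OF that] x geo_coeff_combination[OF L, of s 0] Bxy sym[OF x c(1)[OF that]] by (simp add: self)
  have cy: "B y (c s) = cosh (L - s)" if "s \<in> {0..L}" for s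
    using c[OF that] y geo_coeff_combination[OF L, of s L] Bxy sym[OF y c(1)[OF that]]
    by (simp add: self cosh_diff)
  have cc: "B (c s) (c s') = cosh (s - s')" if "s \<in> {0..L}" "s' \<in> {0..L}" for s s'
    using c(2)[OF that(1) c(1)[OF that(2)]] cx[OF that(2)] cy[OF that(2)] geo_coeff_combination[OF L]
    by simp
  have "geodesic_path K x y c"
    unfolding geodesic_path_def L_def[symmetric]
  proof (intro conjI ballI)
    show "c \<in> {0..L} \<rightarrow> mspace K"
      using c by auto
    show "c 0 = x"
      using eq[OF x c(1), of 0] cx[of 0] L by simp
    show "c L = y"
      using eq[OF y c(1), of L] cy[of L] L by simp
    show "mdist K (c s) (c t) = \<bar>s - t\<bar>" if "s \<in> {0..L}" "t \<in> {0..L}" for s t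
      using that c(1) cc by (intro mdist_eqI) auto
  qed
  then show ?thesis
    by blast
qed

lemma geodesic_space_kernel: "geodesic_space K"
  by (auto simp: geodesic_space_def geodesic_path_exists)

end

lemma kernel_space_hyperboloid: "hyperbolic_space n = kernel_space (hyperboloid n) (lorentz n)"
  by (simp add: hyperbolic_space_def kernel_space_def hyperbolic_dist_def[abs_def])

lemma lorentz_sum_psd:
  assumes "\<And>i. u i = a * x i + b * y i + c * z i"
  shows "a\<^sup>2 * lorentz n x x + b\<^sup>2 * lorentz n y y + c\<^sup>2 * lorentz n z z + 2 * a * b * lorentz n x y
     + 2 * b * c * lorentz n y z + 2 * a * c * lorentz n x z = lorentz n u u"
  unfolding lorentz_def assms
  by (simp add: power2_eq_square algebra_simps sum.distrib sum_distrib_left)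

lemma hyp_kernel_hyperboloid: "hyp_kernel (hyperboloid n) (lorentz n)"
proof
  fix x y assume x: "x \<in> hyperboloid n" and y: "y \<in> hyperboloid n"
  show "lorentz n x y = lorentz n y x"
    by (rule lorentz_commute)
  show "lorentz n x x = 1"
    using x by (simp add: hyperboloid_def)
  show "1 \<le> lorentz n x y"
    using x y by (rule lorentz_ge_1)
  interpret Metric_space "hyperboloid n" "hyperbolic_dist n"
    by (rule Metric_space_hyperbolic)
  show "x = y" if "lorentz n x y = 1"
    using zero[OF x y] that x y by (simp add: hyperbolic_dist_def)
  show "(lorentz n x z - lorentz n x y * lorentz n y z)\<^sup>2 \<le>
       ((lorentz n x y)\<^sup>2 - 1) * ((lorentz n y z)\<^sup>2 - 1)" if z: "z \<in> hyperboloid n" for z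
  \<comment> \<open>The linear form is the time coordinate: the Lorentz form is its square minus a
    sum of squares.\<close>
  proof (rule lorentzian_gram_bound[where lx = "x 0" and ly = "y 0" and lz = "z 0"])
    fix a b c
    have q: "lorentz n x x = 1" "lorentz n y y = 1" "lorentz n z z = 1"
      using x y z by (auto simp: hyperboloid_def)
    define u where "u i = a * x i + b * y i + c * z i" for i
    have "lorentz n u u \<le> (u 0)\<^sup>2"
      by (simp add: lorentz_def power2_eq_square sum_nonneg)
    then show "a\<^sup>2 + b\<^sup>2 + c\<^sup>2 + 2 * a * b * lorentz n x y + 2 * b * c * lorentz n y z
      + 2 * a * c * lorentz n x z \<le> (a * x 0 + b * y 0 + c * z 0)\<^sup>2"
      using lorentz_sum_psd[where u = u, OF u_def, of n] by (simp add: q u_def)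
  qed
  fix a b :: real
  assume ab: "0 \<le> a" "0 \<le> b" "a\<^sup>2 + b\<^sup>2 + 2 * a * b * lorentz n x y = 1"
  define u where "u i = a * x i + b * y i" for i
  have lin: "lorentz n u w = a * lorentz n x w + b * lorentz n y w" for w
    unfolding lorentz_def u_def by (simp add: algebra_simps sum.distrib sum_distrib_left)
  have "lorentz n u u = 1"
    using ab(3) x y unfolding lin lorentz_commute[of n x u] lorentz_commute[of n y u]
      lorentz_commute[of n y x] hyperboloid_def by (simp add: power2_eq_square algebra_simps)
  moreover have "u 0 > 0"
  proof -
    have "a \<noteq> 0 \<or> b \<noteq> 0"
      using ab by auto
    then show ?thesis
      using ab x y unfolding u_def hyperboloid_def
      by (metis (no_types, lifting) add_nonneg_pos add_pos_nonneg less_eq_real_def mem_Collect_eq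
          mult_nonneg_nonneg mult_pos_pos)
  qed
  ultimately have "u \<in> hyperboloid n"
    using x y by (auto simp: hyperboloid_def u_def)
  then show "\<exists>z\<in>hyperboloid n. \<forall>w\<in>hyperboloid n. lorentz n z w = a * lorentz n x w + b * lorentz n y w"
    using lin by blast
qed

interpretation hyperboloid: hyp_kernel "hyperboloid n" "lorentz n" for n
  by (rule hyp_kernel_hyperboloid)

text \<open>Points on the sides of a triangle are combinations of the vertices with coefficients
  that depend only on the side lengths. A comparison triangle has the same Gram matrix, so
  corresponding distances are equal and not just ordered.\<close>

lemma (in hyp_kernel) CAT_minus_one_kernel: "CAT_minus_one K"
  unfolding CAT_minus_one_def
proof (intro conjI allI impI ballI)
  show "geodesic_space K"
    by (rule geodesic_space_kernel)
  fix v :: "nat \<Rightarrow> 'a" and c w e and i j :: nat and s t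
  assume *: "\<forall>i<3. v i \<in> mspace K \<and> w i \<in> mspace (hyperbolic_space 2) \<and>
       geodesic_path K (v i) (v ((i + 1) mod 3)) (c i) \<and>
       geodesic_path (hyperbolic_space 2) (w i) (w ((i + 1) mod 3)) (e i) \<and>
       mdist (hyperbolic_space 2) (w i) (w ((i + 1) mod 3)) = mdist K (v i) (v ((i + 1) mod 3))"
    and i: "i < 3" and j: "j < 3"
    and s: "s \<in> {0..mdist K (v i) (v ((i + 1) mod 3))}"
    and t: "t \<in> {0..mdist K (v j) (v ((j + 1) mod 3))}"
  have v: "v l \<in> X" and w: "w l \<in> hyperboloid 2"
    and cl: "geodesic_path K (v l) (v ((l + 1) mod 3)) (c l)"
    and el: "geodesic_path (kernel_space (hyperboloid 2) (lorentz 2)) (w l) (w ((l + 1) mod 3)) (e l)"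
    and d: "mdist (kernel_space (hyperboloid 2) (lorentz 2)) (w l) (w ((l + 1) mod 3))
       = mdist K (v l) (v ((l + 1) mod 3))"
    if "l < 3" for l
    using * that by (auto simp: kernel_space_hyperboloid[symmetric])
  have m3: "(l + 1) mod 3 < 3" for l :: nat
    by simp
  have side: "lorentz 2 (w l) (w ((l + 1) mod 3)) = B (v l) (v ((l + 1) mod 3))" if "l < 3" for l
    using d[OF that] cosh_mdist[OF v[OF that] v[OF m3]] hyperboloid.cosh_mdist[OF w[OF that] w[OF m3]]
    by metis
  have gram_eq: "lorentz 2 (w a) (w b) = B (v a) (v b)" if a: "a < 3" and b: "b < 3" for a b
  proof -
    have "a = 0 \<or> a = 1 \<or> a = 2" "b = 0 \<or> b = 1 \<or> b = 2"
      using a b by linarith+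
    then have "a = b \<or> b = (a + 1) mod 3 \<or> a = (b + 1) mod 3"
      by (elim disjE) simp_all
    then consider "a = b" | "b = (a + 1) mod 3" | "a = (b + 1) mod 3"
      by blast
    then show ?thesis
    proof cases
      case 1
      then show ?thesis
        using self[OF v[OF a]] hyperboloid.self[OF w[OF a]] by simp
    next
      case 2
      then show ?thesis
        using side[OF a] by simp
    next
      case 3
      then show ?thesis
        using side[OF b] sym[OF v[OF a] v[OF b]] lorentz_commute[of 2 "w a" "w b"] by simp
    qed
  qed
  have cX: "c i s \<in> X" "c j t \<in> X"
    using cl[OF i] cl[OF j] s t by (auto simp: geodesic_path_def)
  have "e l r \<in> hyperboloid 2" if "l < 3" "r \<in> {0..mdist K (v l) (v ((l + 1) mod 3))}" for l r
    using el[OF that(1)] that(2) unfolding geodesic_path_def d[OF that(1)] by (auto dest: funcset_mem)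
  then have eX: "e i s \<in> hyperboloid 2" "e j t \<in> hyperboloid 2"
    using i j s t by blast+
  note 1 = geodesic_path_kernel[OF cl[OF i] v[OF i] v[OF m3] s]
  note 2 = geodesic_path_kernel[OF cl[OF j] v[OF j] v[OF m3] t]
  note 3 = hyperboloid.geodesic_path_kernel[OF el[OF i] w[OF i] w[OF m3] s[folded d[OF i]], unfolded d[OF i]]
  note 4 = hyperboloid.geodesic_path_kernel[OF el[OF j] w[OF j] w[OF m3] t[folded d[OF j]], unfolded d[OF j]]
  have "B (c i s) (v l) = lorentz 2 (e i s) (w l)" if "l < 3" for l
    unfolding 1[OF v[OF that]] 3[OF w[OF that]] gram_eq[OF i that] gram_eq[OF m3 that] ..
  then have "B (v l) (c i s) = lorentz 2 (w l) (e i s)" if "l < 3" for l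
    using that sym[OF v[OF that] cX(1)] lorentz_commute[of 2 "w l" "e i s"] by simp
  then have "B (c j t) (c i s) = lorentz 2 (e j t) (e i s)"
    unfolding 2[OF cX(1)] 4[OF eX(1)] using j m3 by simp
  then have "B (c i s) (c j t) = lorentz 2 (e i s) (e j t)"
    using sym[OF cX] lorentz_commute[of 2 "e j t"] by simp
  then show "mdist K (c i s) (c j t) \<le> mdist (hyperbolic_space 2) (e i s) (e j t)"
    unfolding kernel_space_hyperboloid hyperboloid.mdist_kernel_space[OF eX] mdist_kernel_space[OF cX]
    by simp
qed

section \<open>Powers of the Lorentz product on the light cone\<close>

text \<open>The sign makes the coefficients of index at least 1 nonnegative for exponents in (0, 1].
  Index 0, with value -1, is kept out of all sums.\<close>

definition binom_coeff :: "real \<Rightarrow> nat \<Rightarrow> real" where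
  "binom_coeff t k = - ((-1) ^ k * (t gchoose k))"

lemma binom_coeff_1: "binom_coeff t (Suc 0) = t"
  by (simp add: binom_coeff_def)

lemma binom_coeff_Suc: "binom_coeff t (Suc k) = binom_coeff t k * (real k - t) / (real k + 1)"
proof -
  have "real (Suc k) * (t gchoose Suc k) = (t - real k) * (t gchoose k)"
    using gbinomial_mult_1[of t k] by (simp add: algebra_simps)
  then have *: "t gchoose Suc k = (t - real k) * (t gchoose k) / (real k + 1)"
    by (simp add: field_simps)
  show ?thesis
    unfolding binom_coeff_def * by (simp add: algebra_simps add_divide_distrib diff_divide_distrib)
qed

text \<open>The recursion multiplies by \<open>k - t\<close>. At \<open>t = 1\<close> the second
  coefficient already vanishes, hence the restriction to \<open>t < 1\<close> and the separate
  treatment of \<open>t = 1\<close> in \<open>iota\<close>.\<close>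

lemma binom_coeff_pos:
  assumes "0 < t" "t < 1" "1 \<le> k"
  shows "0 < binom_coeff t k"
  using assms(3)
proof (induction k rule: nat_induct_at_least)
  case base
  then show ?case
    using assms by (simp add: binom_coeff_1)
next
  case (Suc k)
  then show ?case
    using assms unfolding binom_coeff_Suc by (intro divide_pos_pos mult_pos_pos) auto
qed

lemma binom_coeff_nonneg:
  assumes "0 < t" "t \<le> 1" "1 \<le> k"
  shows "0 \<le> binom_coeff t k"
  using assms(3)
proof (induction k rule: nat_induct_at_least)
  case base
  then show ?case
    using assms by (simp add: binom_coeff_1)
next
  case (Suc k)
  then show ?case
    using assms unfolding binom_coeff_Suc by (intro divide_nonneg_pos mult_nonneg_nonneg) auto
qed

lemma binom_series:
  assumes "\<bar>s\<bar> < 1"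
  shows "(\<lambda>k. binom_coeff t (Suc k) * s ^ Suc k) sums (1 - (1 - s) powr t)"
proof -
  have "(\<lambda>k. (t gchoose k) * (- s) ^ k) sums (1 + (- s)) powr t"
    by (rule gen_binomial_real) (use assms in simp)
  then have "(\<lambda>k. (t gchoose Suc k) * (- s) ^ Suc k) sums ((1 - s) powr t - 1)"
    by (subst sums_Suc_iff) simp
  then have "(\<lambda>k. - ((t gchoose Suc k) * (- s) ^ Suc k)) sums - ((1 - s) powr t - 1)"
    by (rule sums_minus)
  moreover have "- ((t gchoose Suc k) * (- s) ^ Suc k) = binom_coeff t (Suc k) * s ^ Suc k" for k
    unfolding binom_coeff_def power_minus[of s] by simp
  ultimately show ?thesis
    by (simp del: power_Suc)
qed

definition binom_poly :: "real \<Rightarrow> nat \<Rightarrow> real \<Rightarrow> real" where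
  "binom_poly t N s = 1 - (\<Sum>k=1..N. binom_coeff t k * s ^ k)"

text \<open>For \<open>s < 1\<close> a partial sum lies below the full sum
  \<open>1 - (1 - s) powr t\<close>, hence below 1; then \<open>s\<close> tends to 1.\<close>

lemma binom_coeff_sum_le:
  assumes t: "0 < t" "t \<le> 1"
  shows "(\<Sum>k<N. binom_coeff t (Suc k)) \<le> 1"
proof -
  have nn: "0 \<le> binom_coeff t (Suc k)" for k
    by (rule binom_coeff_nonneg[OF t]) simp
  have 1: "(\<Sum>k<N. binom_coeff t (Suc k) * s ^ Suc k) \<le> 1" if s: "0 < s" "s < 1" for s
  proof -
    have S: "(\<lambda>k. binom_coeff t (Suc k) * s ^ Suc k) sums (1 - (1 - s) powr t)"
      by (rule binom_series) (use s in simp)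
    have "(\<Sum>k<N. binom_coeff t (Suc k) * s ^ Suc k) \<le> (\<Sum>k. binom_coeff t (Suc k) * s ^ Suc k)"
      by (rule sum_le_suminf) (use S s nn in \<open>auto simp: sums_iff\<close>)
    also have "\<dots> = 1 - (1 - s) powr t"
      using S by (simp add: sums_iff)
    finally show ?thesis
      using powr_ge_zero[of "1 - s" t] by linarith
  qed
  have "((\<lambda>s. \<Sum>k<N. binom_coeff t (Suc k) * s ^ Suc k) \<longlongrightarrow> (\<Sum>k<N. binom_coeff t (Suc k) * 1 ^ Suc k)) (at_left 1)"
    by (intro tendsto_intros)
  moreover have "\<forall>\<^sub>F s in at_left (1::real). (\<Sum>k<N. binom_coeff t (Suc k) * s ^ Suc k) \<le> 1"
    by (rule eventually_mono[OF eventually_at_left_real[of 0 1]]) (auto intro: 1 simp del: power_Suc)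
  ultimately show ?thesis
    by (intro tendsto_upperbound[of _ _ "at_left (1::real)"]) auto
qed

text \<open>Inside the interval the error is a tail of the series, dominated by the tail of the
  summable coefficients; continuity carries the bound to the endpoints. Uniformity up to
  \<open>s = 1\<close>, where the power may fail to be smooth, is what functionals without countable
  additivity require.\<close>

lemma binom_poly_uniform:
  assumes t: "0 < t" "t \<le> 1"
  shows "\<exists>e. e \<longlonglongrightarrow> 0 \<and> (\<forall>N s. \<bar>s\<bar> \<le> 1 \<longrightarrow> \<bar>(1 - s) powr t - binom_poly t N s\<bar> \<le> e N)"
proof -
  define c where "c k = binom_coeff t (Suc k)" for k
  have nn: "0 \<le> c k" for k
    unfolding c_def by (rule binom_coeff_nonneg[OF t]) simp
  have sm: "summable c"
    by (rule summableI_nonneg_bounded[of _ 1]) (use nn binom_coeff_sum_le[OF t] in \<open>auto simp: c_def\<close>)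
  define e where "e N = suminf c - (\<Sum>k<N. c k)" for N
  have "e \<longlonglongrightarrow> suminf c - suminf c"
    unfolding e_def by (intro tendsto_intros summable_LIMSEQ sm)
  then have e0: "e \<longlonglongrightarrow> 0"
    by simp
  have poly: "binom_poly t N s = 1 - (\<Sum>k<N. c k * s ^ Suc k)" for N s
    unfolding binom_poly_def c_def One_nat_def sum.atLeast1_atMost_eq ..
  have 1: "\<bar>(1 - s) powr t - binom_poly t N s\<bar> \<le> e N" if s: "\<bar>s\<bar> < 1" for N s
  proof -
    have S: "(\<lambda>k. c k * s ^ Suc k) sums (1 - (1 - s) powr t)"
      unfolding c_def by (rule binom_series[OF s])
    have le: "norm (c k * s ^ Suc k) \<le> c k" for k
    proof -
      have "\<bar>s\<bar> ^ Suc k \<le> 1"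
        by (rule power_le_one) (use s in auto)
      then show ?thesis
        using nn mult_left_le[of "\<bar>s\<bar> ^ Suc k" "c k"] by (simp add: abs_mult power_abs)
    qed
    have "(1 - s) powr t - binom_poly t N s = - (\<Sum>k. c (k + N) * s ^ Suc (k + N))"
      using suminf_minus_initial_segment[OF sums_summable[OF S], of N] S by (simp add: poly sums_iff)
    also have "\<bar>\<dots>\<bar> \<le> (\<Sum>k. c (k + N))"
      unfolding real_norm_def[symmetric] norm_minus_cancel
      by (rule norm_suminf_le) (use le sm in auto)
    also have "\<dots> = e N"
      unfolding e_def by (rule suminf_minus_initial_segment[OF sm])
    finally show ?thesis .
  qed
  have "\<bar>(1 - s) powr t - binom_poly t N s\<bar> \<le> e N" if s: "\<bar>s\<bar> \<le> 1" for N s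
  proof (rule continuous_le_on_closure[where S = "{-1<..<1}" and f = "\<lambda>s. \<bar>(1 - s) powr t - binom_poly t N s\<bar>"])
    show "s \<in> closure {-1<..<1}"
      using s by auto
    show "continuous_on (closure {- 1<..<1::real}) (\<lambda>s. \<bar>(1 - s) powr t - binom_poly t N s\<bar>)"
      unfolding binom_poly_def using t by (auto intro!: continuous_intros continuous_on_powr')
    show "\<And>s. s \<in> {- 1<..<1} \<Longrightarrow> \<bar>(1 - s) powr t - binom_poly t N s\<bar> \<le> e N"
      by (rule 1) auto
  qed
  with e0 show ?thesis
    by blast
qed

section \<open>The sphere of light directions and the bounded functions on it\<close>

locale light_sphere =
  fixes n :: nat
  assumes n2: "2 \<le> n"
begin

definition S :: "(nat \<Rightarrow> real) set" where
  "S = {x. x 0 = 1 \<and> lorentz n x x = 0 \<and> (\<forall>i>n. x i = 0)}"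

definition dot :: "(nat \<Rightarrow> real) \<Rightarrow> (nat \<Rightarrow> real) \<Rightarrow> real" where
  "dot x y = (\<Sum>i=1..n. x i * y i)"

lemma dot_self: "x \<in> S \<Longrightarrow> dot x x = 1"
  by (auto simp: S_def lorentz_def dot_def)

lemma lorentz_S: "x \<in> S \<Longrightarrow> y \<in> S \<Longrightarrow> lorentz n x y = 1 - dot x y"
  by (simp add: S_def lorentz_def dot_def)

lemma dot_expand: "(\<Sum>i=1..n. (x i + c * y i)\<^sup>2) = dot x x + 2 * c * dot x y + c\<^sup>2 * dot y y"
  unfolding dot_def sum_distrib_left sum.distrib[symmetric]
  by (intro sum.cong refl) (simp add: power2_eq_square algebra_simps)

lemma dot_bound: "x \<in> S \<Longrightarrow> y \<in> S \<Longrightarrow> \<bar>dot x y\<bar> \<le> 1"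
  using dot_expand[of x 1 y] dot_expand[of x "-1" y]
    sum_nonneg[of "{1..n}" "\<lambda>i. (x i + 1 * y i)\<^sup>2"] sum_nonneg[of "{1..n}" "\<lambda>i. (x i + (-1) * y i)\<^sup>2"]
  by (simp add: dot_self)

lemma lorentz_S_nonneg: "x \<in> S \<Longrightarrow> y \<in> S \<Longrightarrow> 0 \<le> lorentz n x y"
  and lorentz_S_le_2: "x \<in> S \<Longrightarrow> y \<in> S \<Longrightarrow> lorentz n x y \<le> 2"
  using dot_bound[of x y] by (auto simp: lorentz_S)

lemma lorentz_S_self: "x \<in> S \<Longrightarrow> lorentz n x x = 0"
  by (simp add: S_def)

lemma lorentz_S_eq_0:
  assumes x: "x \<in> S" and y: "y \<in> S" and 0: "lorentz n x y = 0"
  shows "x = y"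
proof
  fix i
  have "(\<Sum>i=1..n. (x i + (-1) * y i)\<^sup>2) = 0"
    unfolding dot_expand using 0 x y by (simp add: dot_self lorentz_S)
  then have "\<forall>i\<in>{1..n}. (x i + (-1) * y i)\<^sup>2 = 0"
    by (subst (asm) sum_nonneg_eq_0_iff) auto
  then have "x i = y i" if "i \<in> {1..n}"
    using that by auto
  then show "x i = y i"
    using x y by (cases "i = 0"; cases "i > n") (auto simp: S_def)
qed

lemma coord_bound:
  assumes x: "x \<in> S"
  shows "\<bar>x i\<bar> \<le> 1"
proof (cases "i \<in> {1..n}")
  case True
  then have "(x i)\<^sup>2 \<le> dot x x"
    unfolding dot_def power2_eq_square by (intro member_le_sum) auto
  then show ?thesis
    using x by (simp add: dot_self abs_square_le_1)
next
  case False
  then show ?thesis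
    using x by (cases "i = 0") (auto simp: S_def)
qed

text \<open>Neither measurability nor continuity is asked for, because functions get pulled back
  along arbitrary boundary maps.\<close>

definition Bd :: "((nat \<Rightarrow> real) \<Rightarrow> real) set" where
  "Bd = {\<phi>. \<exists>C. \<forall>x\<in>S. \<bar>\<phi> x\<bar> \<le> C}"

lemma BdI: "(\<And>x. x \<in> S \<Longrightarrow> \<bar>\<phi> x\<bar> \<le> C) \<Longrightarrow> \<phi> \<in> Bd"
  by (auto simp: Bd_def)

lemma Bd_const [simp]: "(\<lambda>x. c) \<in> Bd"
  by (auto simp: Bd_def)

lemma Bd_add:
  assumes "\<phi> \<in> Bd" "\<psi> \<in> Bd"
  shows "(\<lambda>x. \<phi> x + \<psi> x) \<in> Bd"
proof -
  obtain C D where "\<forall>x\<in>S. \<bar>\<phi> x\<bar> \<le> C" "\<forall>x\<in>S. \<bar>\<psi> x\<bar> \<le> D"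
    using assms by (auto simp: Bd_def)
  then have "\<bar>\<phi> x + \<psi> x\<bar> \<le> C + D" if "x \<in> S" for x
    using that by (intro order_trans[OF abs_triangle_ineq]) (auto intro: add_mono)
  then show ?thesis
    by (rule BdI)
qed

lemma Bd_mult:
  assumes "\<phi> \<in> Bd" "\<psi> \<in> Bd"
  shows "(\<lambda>x. \<phi> x * \<psi> x) \<in> Bd"
proof -
  obtain C D where CD: "\<forall>x\<in>S. \<bar>\<phi> x\<bar> \<le> C" "\<forall>x\<in>S. \<bar>\<psi> x\<bar> \<le> D"
    using assms by (auto simp: Bd_def)
  have "\<bar>\<phi> x * \<psi> x\<bar> \<le> C * D" if "x \<in> S" for x
    unfolding abs_mult using that CD abs_ge_zero[of "\<phi> x"] by (intro mult_mono) (auto intro: order_trans)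
  then show ?thesis
    by (rule BdI)
qed

lemma Bd_cmult: "\<phi> \<in> Bd \<Longrightarrow> (\<lambda>x. c * \<phi> x) \<in> Bd"
  by (rule Bd_mult) auto

lemma Bd_minus: "\<phi> \<in> Bd \<Longrightarrow> (\<lambda>x. - \<phi> x) \<in> Bd"
  using Bd_cmult[of \<phi> "-1"] by simp

lemma Bd_diff: "\<phi> \<in> Bd \<Longrightarrow> \<psi> \<in> Bd \<Longrightarrow> (\<lambda>x. \<phi> x - \<psi> x) \<in> Bd"
  using Bd_add[OF _ Bd_minus, of \<phi> \<psi>] by simp

lemma Bd_sum: "(\<And>i. i \<in> I \<Longrightarrow> f i \<in> Bd) \<Longrightarrow> (\<lambda>x. \<Sum>i\<in>I. f i x) \<in> Bd"
  by (induction I rule: infinite_finite_induct) (auto intro: Bd_add)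

lemma Bd_coord: "(\<lambda>x. x i) \<in> Bd"
  by (rule BdI) (rule coord_bound)

lemma Bd_lorentz: "(\<lambda>x. lorentz n x y) \<in> Bd"
  unfolding lorentz_def by (intro Bd_diff Bd_sum Bd_mult Bd_coord Bd_const)

lemma Bd_powr:
  assumes "\<phi> \<in> Bd" "\<And>x. x \<in> S \<Longrightarrow> 0 \<le> \<phi> x" "0 \<le> t"
  shows "(\<lambda>x. \<phi> x powr t) \<in> Bd"
proof -
  obtain C where "\<forall>x\<in>S. \<bar>\<phi> x\<bar> \<le> C"
    using assms by (auto simp: Bd_def)
  then have "\<bar>\<phi> x powr t\<bar> \<le> C powr t" if "x \<in> S" for x
    using assms that by (auto intro!: powr_mono2)
  then show ?thesis
    by (rule BdI)
qed

text \<open>Monomials are indexed by words and not by exponent vectors, so that a power of the dot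
  product expands with all coefficients equal to 1.\<close>

definition mon :: "nat list \<Rightarrow> (nat \<Rightarrow> real) \<Rightarrow> real" where
  "mon w x = (\<Prod>i\<leftarrow>w. x i)"

lemma mon_simps [simp]: "mon [] x = 1" "mon (i # w) x = x i * mon w x"
  by (simp_all add: mon_def)

lemma Bd_mon: "mon w \<in> Bd"
proof (induction w)
  case Nil
  have "mon [] = (\<lambda>x. 1)" by (rule ext) simp
  then show ?case by simp
next
  case (Cons i w)
  have "mon (i # w) = (\<lambda>x. x i * mon w x)" by (rule ext) simp
  then show ?case using Bd_mult[OF Bd_coord Cons] by simp
qed

text \<open>The empty word is left out: the constant term of the binomial polynomial contributes the
  product of the masses instead.\<close>

definition words :: "nat \<Rightarrow> nat list set" where
  "words N = {w. set w \<subseteq> {1..n} \<and> 1 \<le> length w \<and> length w \<le> N}"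

lemma finite_words: "finite (words N)"
  by (rule finite_subset[OF _ finite_lists_length_le[of "{1..n}" N]]) (auto simp: words_def)

lemma dot_power: "dot x y ^ k = (\<Sum>w | set w \<subseteq> {1..n} \<and> length w = k. mon w x * mon w y)"
proof (induction k)
  case 0
  have "{w. set w \<subseteq> {1..n} \<and> length w = 0} = {[]}"
    by auto
  then show ?case
    by simp
next
  case (Suc k)
  have W: "{w. set w \<subseteq> {1..n} \<and> length w = Suc k} = (\<lambda>(i, w). i # w) ` ({1..n} \<times> {w. set w \<subseteq> {1..n} \<and> length w = k})"
    by (rule Set.set_eqI) (auto simp: length_Suc_conv image_iff)
  have inj: "inj_on (\<lambda>(i, w). i # w) ({1..n} \<times> {w. set w \<subseteq> {1..n} \<and> length w = k})"
    by (auto simp: inj_on_def)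
  have "(\<Sum>w | set w \<subseteq> {1..n} \<and> length w = Suc k. mon w x * mon w y)
      = (\<Sum>(i, w) \<in> {1..n} \<times> {w. set w \<subseteq> {1..n} \<and> length w = k}. (x i * y i) * (mon w x * mon w y))"
    unfolding W sum.reindex[OF inj] by (rule sum.cong) auto
  also have "\<dots> = (\<Sum>i\<in>{1..n}. \<Sum>w\<in>{w. set w \<subseteq> {1..n} \<and> length w = k}. (x i * y i) * (mon w x * mon w y))"
    by (rule sum.cartesian_product[symmetric])
  also have "\<dots> = dot x y * (\<Sum>w | set w \<subseteq> {1..n} \<and> length w = k. mon w x * mon w y)"
    unfolding dot_def by (rule sum_product[symmetric])
  finally show ?case
    by (simp add: Suc)
qed

lemma binom_poly_dot:
  "binom_poly t N (dot x y) = 1 - (\<Sum>w\<in>words N. binom_coeff t (length w) * (mon w x * mon w y))"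
proof -
  have "(\<Sum>w\<in>words N. binom_coeff t (length w) * (mon w x * mon w y))
      = (\<Sum>k=1..N. \<Sum>w | w \<in> words N \<and> length w = k. binom_coeff t (length w) * (mon w x * mon w y))"
    by (rule sum.group[symmetric]) (auto simp: finite_words, auto simp: words_def)
  also have "\<dots> = (\<Sum>k=1..N. binom_coeff t k * dot x y ^ k)"
    unfolding dot_power sum_distrib_left by (intro sum.cong refl) (auto simp: words_def)
  finally show ?thesis
    by (simp add: binom_poly_def)
qed

section \<open>Positive functionals and the form of exponent t\<close>

definition posf :: "(((nat \<Rightarrow> real) \<Rightarrow> real) \<Rightarrow> real) \<Rightarrow> bool" where
  "posf \<mu> \<longleftrightarrow> (\<forall>\<phi>\<in>Bd. \<forall>\<psi>\<in>Bd. \<mu> (\<lambda>x. \<phi> x + \<psi> x) = \<mu> \<phi> + \<mu> \<psi>) \<and>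
     (\<forall>c. \<forall>\<phi>\<in>Bd. \<mu> (\<lambda>x. c * \<phi> x) = c * \<mu> \<phi>) \<and>
     (\<forall>\<phi>\<in>Bd. (\<forall>x\<in>S. 0 \<le> \<phi> x) \<longrightarrow> 0 \<le> \<mu> \<phi>)"

definition mass :: "(((nat \<Rightarrow> real) \<Rightarrow> real) \<Rightarrow> real) \<Rightarrow> real" where
  "mass \<mu> = \<mu> (\<lambda>_. 1)"

lemma posf_add: "posf \<mu> \<Longrightarrow> \<phi> \<in> Bd \<Longrightarrow> \<psi> \<in> Bd \<Longrightarrow> \<mu> (\<lambda>x. \<phi> x + \<psi> x) = \<mu> \<phi> + \<mu> \<psi>"
  and posf_cmult: "posf \<mu> \<Longrightarrow> \<phi> \<in> Bd \<Longrightarrow> \<mu> (\<lambda>x. c * \<phi> x) = c * \<mu> \<phi>"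
  and posf_nonneg: "posf \<mu> \<Longrightarrow> \<phi> \<in> Bd \<Longrightarrow> (\<And>x. x \<in> S \<Longrightarrow> 0 \<le> \<phi> x) \<Longrightarrow> 0 \<le> \<mu> \<phi>"
  unfolding posf_def by blast+

lemma posf_const: "posf \<mu> \<Longrightarrow> \<mu> (\<lambda>x. c) = c * mass \<mu>"
  using posf_cmult[of \<mu> "\<lambda>x. 1" c] by (simp add: mass_def)

lemma posf_diff:
  assumes "posf \<mu>" "\<phi> \<in> Bd" "\<psi> \<in> Bd"
  shows "\<mu> (\<lambda>x. \<phi> x - \<psi> x) = \<mu> \<phi> - \<mu> \<psi>"
  using posf_add[OF assms(1,2) Bd_cmult[OF assms(3), of "-1"]] posf_cmult[OF assms(1,3), of "-1"] by simp

lemma posf_mono: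
  assumes "posf \<mu>" "\<phi> \<in> Bd" "\<psi> \<in> Bd" "\<And>x. x \<in> S \<Longrightarrow> \<phi> x \<le> \<psi> x"
  shows "\<mu> \<phi> \<le> \<mu> \<psi>"
  using posf_nonneg[OF assms(1) Bd_diff[OF assms(3,2)]] posf_diff[OF assms(1,3,2)] assms(4) by simp

text \<open>Positivity only tests values on \<open>S\<close>, so a positive functional cannot see
  what a function does elsewhere.\<close>

lemma posf_cong:
  assumes "posf \<mu>" "\<phi> \<in> Bd" "\<And>x. x \<in> S \<Longrightarrow> \<phi> x = \<psi> x"
  shows "\<mu> \<phi> = \<mu> \<psi>"
proof -
  have "\<psi> \<in> Bd"
    using assms(2,3) by (auto simp: Bd_def)
  then show ?thesis
    using posf_mono[OF assms(1), of \<phi> \<psi>] posf_mono[OF assms(1), of \<psi> \<phi>] assms by fastforce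
qed

lemma posf_bound:
  assumes "posf \<mu>" "\<And>x. x \<in> S \<Longrightarrow> \<bar>\<phi> x\<bar> \<le> C"
  shows "\<bar>\<mu> \<phi>\<bar> \<le> C * mass \<mu>"
proof -
  have B: "\<phi> \<in> Bd"
    using assms(2) by (rule BdI)
  have "\<phi> x \<le> C" "- C \<le> \<phi> x" if "x \<in> S" for x
    using assms(2)[OF that] by auto
  then have "\<mu> \<phi> \<le> \<mu> (\<lambda>x. C)" "\<mu> (\<lambda>x. - C) \<le> \<mu> \<phi>"
    using B by (auto intro!: posf_mono[OF assms(1)])
  then show ?thesis
    by (simp add: posf_const[OF assms(1)] abs_le_iff)
qed

lemma posf_sum:
  assumes "posf \<mu>" "\<And>i. i \<in> I \<Longrightarrow> f i \<in> Bd"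
  shows "\<mu> (\<lambda>x. \<Sum>i\<in>I. f i x) = (\<Sum>i\<in>I. \<mu> (f i))"
  using assms(2)
proof (induction I rule: infinite_finite_induct)
  case (insert i I)
  have "\<mu> (\<lambda>x. \<Sum>i\<in>insert i I. f i x) = \<mu> (\<lambda>x. f i x + (\<Sum>i\<in>I. f i x))"
    using insert.hyps by simp
  also have "\<dots> = \<mu> (f i) + \<mu> (\<lambda>x. \<Sum>i\<in>I. f i x)"
    by (rule posf_add[OF assms(1) _ Bd_sum]) (use insert.prems in auto)
  finally show ?case
    using insert by simp
qed (simp_all add: posf_const[OF assms(1), of 0])

lemma mass_nonneg: "posf \<mu> \<Longrightarrow> 0 \<le> mass \<mu>"
  unfolding mass_def by (rule posf_nonneg[of \<mu>]) auto

lemma mass_coord: "posf \<mu> \<Longrightarrow> \<mu> (\<lambda>x. x 0) = mass \<mu>"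
  unfolding mass_def by (rule posf_cong[of \<mu>]) (auto simp: Bd_coord S_def)

lemma Bd_section:
  assumes "posf \<nu>" "\<And>x y. x \<in> S \<Longrightarrow> y \<in> S \<Longrightarrow> \<bar>f x y\<bar> \<le> C"
  shows "(\<lambda>x. \<nu> (f x)) \<in> Bd"
  using posf_bound[OF assms(1), of "f _" C] assms(2) by (intro BdI[of _ "C * mass \<nu>"]) auto

lemma double_bound:
  assumes "posf \<mu>" "posf \<nu>" "\<And>x y. x \<in> S \<Longrightarrow> y \<in> S \<Longrightarrow> \<bar>f x y\<bar> \<le> C"
  shows "\<bar>\<mu> (\<lambda>x. \<nu> (f x))\<bar> \<le> C * mass \<mu> * mass \<nu>"
  using posf_bound[OF assms(1), of "\<lambda>x. \<nu> (f x)" "C * mass \<nu>"] posf_bound[OF assms(2), of "f _" C] assms(3)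
  by (simp add: mult_ac)

lemma double_diff:
  assumes "posf \<mu>" "posf \<nu>" and f: "\<And>x y. x \<in> S \<Longrightarrow> y \<in> S \<Longrightarrow> \<bar>f x y\<bar> \<le> C"
    and g: "\<And>x y. x \<in> S \<Longrightarrow> y \<in> S \<Longrightarrow> \<bar>g x y\<bar> \<le> D"
  shows "\<mu> (\<lambda>x. \<nu> (f x)) - \<mu> (\<lambda>x. \<nu> (g x)) = \<mu> (\<lambda>x. \<nu> (\<lambda>y. f x y - g x y))"
proof -
  have fg: "f x \<in> Bd" "g x \<in> Bd" if "x \<in> S" for x
    using f[OF that] g[OF that] by (auto simp: Bd_def)
  have "\<mu> (\<lambda>x. \<nu> (f x) - \<nu> (g x)) = \<mu> (\<lambda>x. \<nu> (\<lambda>y. f x y - g x y))"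
    by (intro posf_cong[OF assms(1)] Bd_diff Bd_section[OF assms(2) f] Bd_section[OF assms(2) g])
      (use fg in \<open>auto simp: posf_diff assms(2)\<close>)
  then show ?thesis
    using posf_diff[OF assms(1) Bd_section[OF assms(2) f] Bd_section[OF assms(2) g]] by simp
qed

lemma double_bound_diff:
  assumes "posf \<mu>" "posf \<nu>" and f: "\<And>x y. x \<in> S \<Longrightarrow> y \<in> S \<Longrightarrow> \<bar>f x y\<bar> \<le> C"
    and g: "\<And>x y. x \<in> S \<Longrightarrow> y \<in> S \<Longrightarrow> \<bar>g x y\<bar> \<le> D"
    and fg: "\<And>x y. x \<in> S \<Longrightarrow> y \<in> S \<Longrightarrow> \<bar>f x y - g x y\<bar> \<le> e"
  shows "\<bar>\<mu> (\<lambda>x. \<nu> (f x)) - \<mu> (\<lambda>x. \<nu> (g x))\<bar> \<le> e * mass \<mu> * mass \<nu>"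
  using double_diff[OF assms(1,2) f g] double_bound[OF assms(1,2) fg] by simp

lemma double_cong:
  assumes "posf \<mu>" "posf \<nu>" "\<And>x y. x \<in> S \<Longrightarrow> y \<in> S \<Longrightarrow> \<bar>f x y\<bar> \<le> C"
    and "\<And>x y. x \<in> S \<Longrightarrow> y \<in> S \<Longrightarrow> f x y = g x y"
  shows "\<mu> (\<lambda>x. \<nu> (f x)) = \<mu> (\<lambda>x. \<nu> (g x))"
proof (rule posf_cong[OF assms(1)])
  show "(\<lambda>x. \<nu> (f x)) \<in> Bd"
    by (rule Bd_section[OF assms(2,3)])
  show "\<nu> (f x) = \<nu> (g x)" if "x \<in> S" for x
    using assms(3,4) that by (intro posf_cong[OF assms(2)] BdI[of "f x" C]) auto
qed

definition form :: "real \<Rightarrow> (((nat \<Rightarrow> real) \<Rightarrow> real) \<Rightarrow> real) \<Rightarrow> (((nat \<Rightarrow> real) \<Rightarrow> real) \<Rightarrow> real) \<Rightarrow> real" where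
  "form t \<mu> \<nu> = \<mu> (\<lambda>x. \<nu> (\<lambda>y. lorentz n x y powr t))"

definition comb where
  "comb a \<mu> b \<nu> = (\<lambda>\<phi> :: (nat \<Rightarrow> real) \<Rightarrow> real. a * \<mu> \<phi> + b * \<nu> \<phi> :: real)"

definition scale where
  "scale a \<mu> = (\<lambda>\<phi> :: (nat \<Rightarrow> real) \<Rightarrow> real. a * \<mu> \<phi> :: real)"

definition dir :: "(nat \<Rightarrow> real) \<Rightarrow> ((nat \<Rightarrow> real) \<Rightarrow> real) \<Rightarrow> real" where
  "dir \<xi> = (\<lambda>\<phi>. \<phi> \<xi>)"

lemma posf_comb: "posf \<mu> \<Longrightarrow> posf \<nu> \<Longrightarrow> 0 \<le> a \<Longrightarrow> 0 \<le> b \<Longrightarrow> posf (comb a \<mu> b \<nu>)"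
  unfolding posf_def comb_def by (auto simp: algebra_simps)

lemma posf_scale: "posf \<mu> \<Longrightarrow> 0 \<le> a \<Longrightarrow> posf (scale a \<mu>)"
  unfolding posf_def scale_def by (auto simp: algebra_simps)

lemma posf_dir: "\<xi> \<in> S \<Longrightarrow> posf (dir \<xi>)"
  unfolding posf_def dir_def by auto

lemma mass_comb: "mass (comb a \<mu> b \<nu>) = a * mass \<mu> + b * mass \<nu>"
  and mass_scale: "mass (scale a \<mu>) = a * mass \<mu>"
  and mass_dir: "mass (dir \<xi>) = 1"
  by (simp_all add: mass_def comb_def scale_def dir_def)

lemma kernel_bound:
  assumes "x \<in> S" "y \<in> S" "0 < t" "t \<le> 1"
  shows "\<bar>lorentz n x y powr t\<bar> \<le> 2"
proof -
  have "lorentz n x y powr t \<le> 2 powr t"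
    using assms lorentz_S_nonneg lorentz_S_le_2 by (intro powr_mono2) auto
  also have "\<dots> \<le> 2 powr 1"
    using assms by (intro powr_mono) auto
  finally show ?thesis
    by simp
qed

lemma Bd_kernel: "y \<in> S \<Longrightarrow> 0 \<le> t \<Longrightarrow> (\<lambda>x. lorentz n x y powr t) \<in> Bd"
  by (intro Bd_powr Bd_lorentz) (auto simp: lorentz_S_nonneg)

lemma Bd_kernel': "x \<in> S \<Longrightarrow> 0 \<le> t \<Longrightarrow> (\<lambda>y. lorentz n x y powr t) \<in> Bd"
  using Bd_kernel[of x t] by (simp add: lorentz_commute[of n x])

text \<open>The iterated functional of the truncated kernel, which has finite rank. The two
  functionals enter symmetrically, which is not apparent for \<open>form\<close>.\<close>

definition formN where
  "formN t N \<mu> \<nu> = mass \<mu> * mass \<nu> - (\<Sum>w\<in>words N. binom_coeff t (length w) * (\<mu> (mon w) * \<nu> (mon w)))"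

lemma double_binom_poly:
  assumes \<mu>: "posf \<mu>" and \<nu>: "posf \<nu>"
  shows "\<mu> (\<lambda>x. \<nu> (\<lambda>y. binom_poly t N (dot x y))) = formN t N \<mu> \<nu>"
proof -
  have 1: "\<nu> (\<lambda>y. binom_poly t N (dot x y)) = mass \<nu> - (\<Sum>w\<in>words N. (binom_coeff t (length w) * \<nu> (mon w)) * mon w x)"
    (is "?L = ?R") for x
  proof -
    have "?L = \<nu> (\<lambda>y. 1) - \<nu> (\<lambda>y. \<Sum>w\<in>words N. (binom_coeff t (length w) * mon w x) * mon w y)"
      unfolding binom_poly_dot mult.assoc[symmetric]
      by (intro posf_diff[OF \<nu>] Bd_sum Bd_cmult) (auto simp: Bd_mon)
    also have "\<nu> (\<lambda>y. \<Sum>w\<in>words N. (binom_coeff t (length w) * mon w x) * mon w y)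
      = (\<Sum>w\<in>words N. (binom_coeff t (length w) * mon w x) * \<nu> (mon w))"
      by (subst posf_sum[OF \<nu>]) (auto intro!: sum.cong simp: posf_cmult[OF \<nu>] Bd_cmult Bd_mon)
    finally show ?thesis
      by (simp add: mass_def mult_ac)
  qed
  have "\<mu> (\<lambda>x. mass \<nu> - (\<Sum>w\<in>words N. (binom_coeff t (length w) * \<nu> (mon w)) * mon w x))
     = \<mu> (\<lambda>x. mass \<nu>) - \<mu> (\<lambda>x. \<Sum>w\<in>words N. (binom_coeff t (length w) * \<nu> (mon w)) * mon w x)"
    by (intro posf_diff[OF \<mu>] Bd_sum Bd_cmult) (auto simp: Bd_mon)
  also have "\<mu> (\<lambda>x. \<Sum>w\<in>words N. (binom_coeff t (length w) * \<nu> (mon w)) * mon w x)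
    = (\<Sum>w\<in>words N. (binom_coeff t (length w) * \<nu> (mon w)) * \<mu> (mon w))"
    by (subst posf_sum[OF \<mu>]) (auto intro!: sum.cong simp: posf_cmult[OF \<mu>] Bd_cmult Bd_mon)
  finally show ?thesis
    unfolding 1 formN_def posf_const[OF \<mu>] by (simp add: mult_ac)
qed

lemma binom_poly_bound:
  "\<bar>s\<bar> \<le> 1 \<Longrightarrow> \<bar>binom_poly t N s\<bar> \<le> 1 + (\<Sum>k=1..N. \<bar>binom_coeff t k\<bar>)"
proof -
  assume s: "\<bar>s\<bar> \<le> 1"
  have "\<bar>\<Sum>k=1..N. binom_coeff t k * s ^ k\<bar> \<le> (\<Sum>k=1..N. \<bar>binom_coeff t k\<bar>)"
  proof (rule order_trans[OF sum_abs sum_mono])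
    fix k
    have "\<bar>s\<bar> ^ k \<le> 1"
      using s by (intro power_le_one) auto
    then show "\<bar>binom_coeff t k * s ^ k\<bar> \<le> \<bar>binom_coeff t k\<bar>"
      by (simp add: abs_mult power_abs mult_left_le)
  qed
  then show ?thesis
    unfolding binom_poly_def by linarith
qed

text \<open>The error depends on the functionals only through their masses. This lets finitely many
  moments control \<open>gap\<close> along a whole sequence of means.\<close>

lemma form_approx:
  assumes t: "0 < t" "t \<le> 1"
  shows "\<exists>e. e \<longlonglongrightarrow> 0 \<and> (\<forall>N \<mu> \<nu>. posf \<mu> \<longrightarrow> posf \<nu> \<longrightarrow> \<bar>form t \<mu> \<nu> - formN t N \<mu> \<nu>\<bar> \<le> e N * mass \<mu> * mass \<nu>)"
proof -
  obtain e where e: "e \<longlonglongrightarrow> 0" "\<And>N s. \<bar>s\<bar> \<le> 1 \<Longrightarrow> \<bar>(1 - s) powr t - binom_poly t N s\<bar> \<le> e N"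
    using binom_poly_uniform[OF t] by blast
  have "\<bar>form t \<mu> \<nu> - formN t N \<mu> \<nu>\<bar> \<le> e N * mass \<mu> * mass \<nu>" if "posf \<mu>" "posf \<nu>" for N \<mu> \<nu>
    unfolding form_def double_binom_poly[OF that, symmetric]
    by (rule double_bound_diff[OF that kernel_bound binom_poly_bound])
      (auto simp: t dot_bound lorentz_S intro: e(2))
  with e(1) show ?thesis
    by blast
qed

lemma formN_tendsto:
  assumes t: "0 < t" "t \<le> 1" and "posf \<mu>" "posf \<nu>"
  shows "(\<lambda>N. formN t N \<mu> \<nu>) \<longlonglongrightarrow> form t \<mu> \<nu>"
proof -
  obtain e where e: "e \<longlonglongrightarrow> 0" "\<And>N. \<bar>form t \<mu> \<nu> - formN t N \<mu> \<nu>\<bar> \<le> e N * mass \<mu> * mass \<nu>"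
    using form_approx[OF t] assms(3,4) by blast
  have "(\<lambda>N. e N * mass \<mu> * mass \<nu>) \<longlonglongrightarrow> 0 * mass \<mu> * mass \<nu>"
    by (intro tendsto_intros e(1))
  then have *: "(\<lambda>N. e N * mass \<mu> * mass \<nu>) \<longlonglongrightarrow> 0"
    by simp
  have "(\<lambda>N. form t \<mu> \<nu> - formN t N \<mu> \<nu>) \<longlonglongrightarrow> 0"
    by (rule Lim_null_comparison[OF always_eventually *]) (use e(2) in \<open>unfold real_norm_def, blast\<close>)
  from tendsto_diff[OF tendsto_const[of "form t \<mu> \<nu>"] this] show ?thesis
    by simp
qed

lemma formN_commute: "formN t N \<mu> \<nu> = formN t N \<nu> \<mu>"
  by (simp add: formN_def mult.commute)

text \<open>Finitely additive functionals need not commute on a general bounded kernel; here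
  symmetry is inherited from the finite-rank truncations.\<close>

lemma form_commute:
  assumes "0 < t" "t \<le> 1" "posf \<mu>" "posf \<nu>"
  shows "form t \<mu> \<nu> = form t \<nu> \<mu>"
  using formN_tendsto[OF assms(1,2,3,4)] formN_tendsto[OF assms(1,2,4,3)]
  unfolding formN_commute[of t _ \<nu> \<mu>] by (rule LIMSEQ_unique)

lemma formN_expand:
  "a\<^sup>2 * formN t N \<mu> \<mu> + b\<^sup>2 * formN t N \<nu> \<nu> + c\<^sup>2 * formN t N \<rho> \<rho> + 2 * a * b * formN t N \<mu> \<nu>
     + 2 * b * c * formN t N \<nu> \<rho> + 2 * a * c * formN t N \<mu> \<rho>
   = (a * mass \<mu> + b * mass \<nu> + c * mass \<rho>)\<^sup>2
     - (\<Sum>w\<in>words N. binom_coeff t (length w) * (a * \<mu> (mon w) + b * \<nu> (mon w) + c * \<rho> (mon w))\<^sup>2)"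
proof -
  have "(\<Sum>w\<in>words N. binom_coeff t (length w) * (a * \<mu> (mon w) + b * \<nu> (mon w) + c * \<rho> (mon w))\<^sup>2)
    = a\<^sup>2 * (\<Sum>w\<in>words N. binom_coeff t (length w) * (\<mu> (mon w) * \<mu> (mon w)))
    + b\<^sup>2 * (\<Sum>w\<in>words N. binom_coeff t (length w) * (\<nu> (mon w) * \<nu> (mon w)))
    + c\<^sup>2 * (\<Sum>w\<in>words N. binom_coeff t (length w) * (\<rho> (mon w) * \<rho> (mon w)))
    + 2 * a * b * (\<Sum>w\<in>words N. binom_coeff t (length w) * (\<mu> (mon w) * \<nu> (mon w)))
    + 2 * b * c * (\<Sum>w\<in>words N. binom_coeff t (length w) * (\<nu> (mon w) * \<rho> (mon w)))
    + 2 * a * c * (\<Sum>w\<in>words N. binom_coeff t (length w) * (\<mu> (mon w) * \<rho> (mon w)))"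
    unfolding sum_distrib_left sum.distrib[symmetric]
    by (intro sum.cong refl) (simp add: power2_eq_square algebra_simps)
  then show ?thesis
    unfolding formN_def by (simp add: power2_eq_square algebra_simps)
qed

text \<open>By \<open>formN_expand\<close> each truncation is the square of the combined mass minus
  squares with nonnegative coefficients. Since \<open>a\<close>, \<open>b\<close>, \<open>c\<close>
  may have any sign, signed combinations are covered, and those of mass zero have nonpositive
  form.\<close>

lemma form_psd:
  assumes t: "0 < t" "t \<le> 1" and "posf \<mu>" "posf \<nu>" "posf \<rho>"
  shows "a\<^sup>2 * form t \<mu> \<mu> + b\<^sup>2 * form t \<nu> \<nu> + c\<^sup>2 * form t \<rho> \<rho> + 2 * a * b * form t \<mu> \<nu>
     + 2 * b * c * form t \<nu> \<rho> + 2 * a * c * form t \<mu> \<rho> \<le> (a * mass \<mu> + b * mass \<nu> + c * mass \<rho>)\<^sup>2"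
proof (rule LIMSEQ_le_const2)
  show "(\<lambda>N. a\<^sup>2 * formN t N \<mu> \<mu> + b\<^sup>2 * formN t N \<nu> \<nu> + c\<^sup>2 * formN t N \<rho> \<rho> + 2 * a * b * formN t N \<mu> \<nu>
     + 2 * b * c * formN t N \<nu> \<rho> + 2 * a * c * formN t N \<mu> \<rho>) \<longlonglongrightarrow>
     a\<^sup>2 * form t \<mu> \<mu> + b\<^sup>2 * form t \<nu> \<nu> + c\<^sup>2 * form t \<rho> \<rho> + 2 * a * b * form t \<mu> \<nu>
     + 2 * b * c * form t \<nu> \<rho> + 2 * a * c * form t \<mu> \<rho>"
    by (intro tendsto_intros formN_tendsto assms)
  show "\<exists>N. \<forall>n\<ge>N. a\<^sup>2 * formN t n \<mu> \<mu> + b\<^sup>2 * formN t n \<nu> \<nu> + c\<^sup>2 * formN t n \<rho> \<rho> + 2 * a * b * formN t n \<mu> \<nu>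
     + 2 * b * c * formN t n \<nu> \<rho> + 2 * a * c * formN t n \<mu> \<rho> \<le> (a * mass \<mu> + b * mass \<nu> + c * mass \<rho>)\<^sup>2"
    unfolding formN_expand
    by (auto intro!: sum_nonneg mult_nonneg_nonneg binom_coeff_nonneg t simp: words_def)
qed

lemma form_le_mass: "0 < t \<Longrightarrow> t \<le> 1 \<Longrightarrow> posf \<mu> \<Longrightarrow> form t \<mu> \<mu> \<le> (mass \<mu>)\<^sup>2"
  using form_psd[of t \<mu> \<mu> \<mu> 1 0 0] by simp

text \<open>For equal masses, the squared seminorm of the difference: minus the form of the signed
  functional \<open>\<mu> - \<nu>\<close>, which has mass zero.\<close>

definition gap where
  "gap t \<mu> \<nu> = 2 * form t \<mu> \<nu> - form t \<mu> \<mu> - form t \<nu> \<nu>"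

text \<open>Cauchy-Schwarz for the positive semidefinite form "product of masses minus
  \<open>form\<close>", applied to \<open>\<rho>\<close> and to the difference of
  \<open>\<mu>\<close> and \<open>\<nu>\<close>, which has mass zero.\<close>

lemma form_diff_square:
  assumes t: "0 < t" "t \<le> 1" and p: "posf \<mu>" "posf \<nu>" "posf \<rho>" and m: "mass \<mu> = mass \<nu>"
  shows "(form t \<mu> \<rho> - form t \<nu> \<rho>)\<^sup>2 \<le> gap t \<mu> \<nu> * ((mass \<rho>)\<^sup>2 - form t \<rho> \<rho>)"
proof -
  have "a\<^sup>2 * gap t \<mu> \<nu> + c\<^sup>2 * ((mass \<rho>)\<^sup>2 - form t \<rho> \<rho>) + 2 * a * c * (form t \<nu> \<rho> - form t \<mu> \<rho>) \<ge> 0" for a c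
    using form_psd[OF t p, of a "- a" c] by (simp add: m gap_def power2_eq_square algebra_simps)
  from quadratic_form_discriminant[OF this] show ?thesis
    by (simp add: power2_commute)
qed

lemma gap_nonneg:
  assumes "0 < t" "t \<le> 1" "posf \<mu>" "posf \<nu>" "mass \<mu> = mass \<nu>"
  shows "0 \<le> gap t \<mu> \<nu>"
  using form_psd[OF assms(1-4,4), of 1 "-1" 0] assms(5) by (simp add: gap_def)

lemma gap_zero_form_eq:
  assumes "0 < t" "t \<le> 1" "posf \<mu>" "posf \<nu>" "mass \<mu> = mass \<nu>" "gap t \<mu> \<nu> = 0" "posf \<rho>"
  shows "form t \<mu> \<rho> = form t \<nu> \<rho>"
  using form_diff_square[OF assms(1-4,7,5)] assms(6) by simp

lemma Bd_form_section: "0 < t \<Longrightarrow> t \<le> 1 \<Longrightarrow> posf \<nu> \<Longrightarrow> (\<lambda>x. \<nu> (\<lambda>y. lorentz n x y powr t)) \<in> Bd"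
  by (rule Bd_section[of \<nu> "\<lambda>x y. lorentz n x y powr t" 2]) (assumption, rule kernel_bound)

lemma form_comb_left: "form t (comb a \<mu> b \<nu>) \<rho> = a * form t \<mu> \<rho> + b * form t \<nu> \<rho>"
  and form_scale_left: "form t (scale a \<mu>) \<rho> = a * form t \<mu> \<rho>"
  by (simp_all add: form_def comb_def scale_def)

lemma form_comb_right:
  assumes "0 < t" "t \<le> 1" "posf \<mu>" "posf \<nu>" "posf \<rho>"
  shows "form t \<rho> (comb a \<mu> b \<nu>) = a * form t \<rho> \<mu> + b * form t \<rho> \<nu>"
  using assms by (simp add: form_def comb_def posf_add[OF assms(5)] posf_cmult[OF assms(5)] Bd_form_section Bd_cmult)

lemma form_scale_right:
  assumes "0 < t" "t \<le> 1" "posf \<mu>" "posf \<rho>"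
  shows "form t \<rho> (scale a \<mu>) = a * form t \<rho> \<mu>"
  using assms by (simp add: form_def scale_def posf_cmult[OF assms(4)] Bd_form_section)

lemma form_dir_right: "form t \<mu> (dir \<xi>) = \<mu> (\<lambda>x. lorentz n x \<xi> powr t)"
  and form_dir_left: "form t (dir \<xi>) \<mu> = \<mu> (\<lambda>y. lorentz n \<xi> y powr t)"
  and form_dir_dir: "form t (dir \<xi>) (dir \<eta>) = lorentz n \<xi> \<eta> powr t"
  by (simp_all add: form_def dir_def)

lemma form_nonneg:
  assumes "0 < t" "t \<le> 1" "posf \<mu>" "posf \<nu>"
  shows "0 \<le> form t \<mu> \<nu>"
  unfolding form_def
  by (rule posf_nonneg[OF assms(3) Bd_form_section[OF assms(1,2,4)]])
    (rule posf_nonneg[OF assms(4)], use assms in \<open>auto simp: Bd_kernel'\<close>)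

lemma form_bound:
  assumes "0 < t" "t \<le> 1" "posf \<mu>" "posf \<nu>"
  shows "form t \<mu> \<nu> \<le> 2 * mass \<mu> * mass \<nu>"
proof -
  have "\<bar>form t \<mu> \<nu>\<bar> \<le> 2 * mass \<mu> * mass \<nu>"
    unfolding form_def by (rule double_bound[OF assms(3,4) kernel_bound]) (use assms in auto)
  then show ?thesis
    by simp
qed

text \<open>Coordinates of a functional modulo the radical of the form: the first moments, and for \<open>t < 1\<close>, where
  all coefficients of the binomial series are positive, all other moments as well. For \<open>t = 1\<close> the higher
  moments are in the radical, and the image is exactly the hyperboloid.\<close>

definition iota :: "real \<Rightarrow> (((nat \<Rightarrow> real) \<Rightarrow> real) \<Rightarrow> real) \<Rightarrow> nat \<Rightarrow> real" where
  "iota t \<mu> j = (if j \<le> n then \<mu> (\<lambda>x. x j) else if t = 1 then 0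
     else let w = from_nat (j - Suc n) in if set w \<subseteq> {1..n} then \<mu> (mon w) else 0)"

lemma iota_0: "posf \<mu> \<Longrightarrow> iota t \<mu> 0 = mass \<mu>"
  by (simp add: iota_def mass_coord)

lemma lorentz_iota:
  assumes "posf \<mu>"
  shows "lorentz n (iota t \<mu>) y = \<mu> (\<lambda>x. lorentz n x y)"
proof -
  have "\<mu> (\<lambda>x. lorentz n x y) = \<mu> (\<lambda>x. y 0 * x 0) - \<mu> (\<lambda>x. \<Sum>i=1..n. y i * x i)"
    unfolding lorentz_def mult.commute[of _ "y _"]
    by (intro posf_diff[OF assms] Bd_cmult Bd_sum Bd_coord)
  also have "\<dots> = y 0 * \<mu> (\<lambda>x. x 0) - (\<Sum>i=1..n. y i * \<mu> (\<lambda>x. x i))"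
    by (simp add: posf_sum[OF assms] posf_cmult[OF assms] Bd_cmult Bd_coord)
  also have "\<dots> = lorentz n (iota t \<mu>) y"
    by (simp add: lorentz_def iota_def mult_ac)
  finally show ?thesis ..
qed

lemma form_1:
  assumes "posf \<mu>" "posf \<nu>"
  shows "form 1 \<mu> \<nu> = lorentz n (iota t \<mu>) (iota t \<nu>)"
proof -
  have "form 1 \<mu> \<nu> = \<mu> (\<lambda>x. \<nu> (\<lambda>y. lorentz n x y))"
    unfolding form_def by (rule double_cong[OF assms kernel_bound]) (auto simp: lorentz_S_nonneg)
  also have "\<dots> = \<mu> (\<lambda>x. lorentz n x (iota t \<nu>))"
    using lorentz_iota[OF assms(2)] by (simp add: lorentz_commute)
  finally show ?thesis
    using lorentz_iota[OF assms(1)] by simp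
qed

lemma iota_eq_mon:
  assumes "iota t \<mu> = iota t \<nu>" "t \<noteq> 1" "set w \<subseteq> {1..n}"
  shows "\<mu> (mon w) = \<nu> (mon w)"
  using fun_cong[OF assms(1), of "Suc n + to_nat w"] assms(2,3) by (simp add: iota_def)

lemma iota_eq_form:
  assumes t: "0 < t" "t \<le> 1" and p: "posf \<mu>" "posf \<nu>" "posf \<rho>" and eq: "iota t \<mu> = iota t \<nu>"
  shows "form t \<mu> \<rho> = form t \<nu> \<rho>"
proof (cases "t = 1")
  case True
  then show ?thesis
    using form_1[of _ _ t] p eq by simp
next
  case False
  have "mass \<mu> = mass \<nu>"
    using fun_cong[OF eq, of 0] p by (simp add: iota_0)
  then have "formN t N \<mu> \<rho> = formN t N \<nu> \<rho>" for N
    unfolding formN_def by (auto simp: words_def iota_eq_mon[OF eq False] intro!: sum.cong)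
  then show ?thesis
    using formN_tendsto[OF t p(1,3)] formN_tendsto[OF t p(2,3)] LIMSEQ_unique by auto
qed

lemma mass_pos: 
  assumes t: "0 < t" "t \<le> 1" and p: "posf \<mu>" "0 < form t \<mu> \<mu>"
  shows "0 < mass \<mu>"
  using form_le_mass[OF t p(1)] p(2) mass_nonneg[OF p(1)] by (cases "mass \<mu> = 0") auto

text \<open>Equality case of the reversed Cauchy-Schwarz inequality: the difference has norm zero.
  In the truncations this norm is a sum of squared moment differences with nonnegative weights, so
  each difference with positive weight vanishes.\<close>

lemma form_eq_iota:
  assumes t: "0 < t" "t \<le> 1" and p: "posf \<mu>" "posf \<nu>"
    and 1: "form t \<mu> \<mu> = 1" "form t \<nu> \<nu> = 1" "form t \<mu> \<nu> = 1"
  shows "iota t \<mu> = iota t \<nu>"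
proof -
  have \<nu>: "mass \<nu> > 0"
    using mass_pos[OF t p(2)] 1 by simp
  \<comment> \<open>With this \<open>s\<close> the combination \<open>\<mu> + (s - 1) \<nu>\<close>
    has mass zero, so its form is at most zero, while it evaluates to the square of
    \<open>s\<close>.\<close>
  define s where "s = (mass \<nu> - mass \<mu>) / mass \<nu>"
  have "1 * mass \<mu> + (s - 1) * mass \<nu> + 0 * mass \<nu> = 0"
    using \<nu> by (simp add: s_def field_simps)
  then have "1 + (s - 1)\<^sup>2 + 2 * (s - 1) \<le> 0"
    using form_psd[OF t p p(2), of 1 "s - 1" 0] by (simp add: 1)
  then have "s\<^sup>2 \<le> 0"
    by (simp add: power2_eq_square algebra_simps)
  then have meq: "mass \<mu> = mass \<nu>"
    using \<nu> by (simp add: s_def)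
  define Q where "Q N = (\<Sum>w\<in>words N. binom_coeff t (length w) * (\<mu> (mon w) - \<nu> (mon w))\<^sup>2)" for N
  have "(\<lambda>N. 1\<^sup>2 * formN t N \<mu> \<mu> + (-1)\<^sup>2 * formN t N \<nu> \<nu> + 0\<^sup>2 * formN t N \<nu> \<nu> + 2 * 1 * (-1) * formN t N \<mu> \<nu>
     + 2 * (-1) * 0 * formN t N \<nu> \<nu> + 2 * 1 * 0 * formN t N \<mu> \<nu>) \<longlonglongrightarrow>
     1\<^sup>2 * form t \<mu> \<mu> + (-1)\<^sup>2 * form t \<nu> \<nu> + 0\<^sup>2 * form t \<nu> \<nu> + 2 * 1 * (-1) * form t \<mu> \<nu>
     + 2 * (-1) * 0 * form t \<nu> \<nu> + 2 * 1 * 0 * form t \<mu> \<nu>"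
    by (intro tendsto_intros formN_tendsto t p)
  then have "(\<lambda>N. - Q N) \<longlonglongrightarrow> 0"
    unfolding formN_expand by (simp add: 1 meq Q_def)
  from tendsto_minus[OF this] have Q: "Q \<longlonglongrightarrow> 0"
    by simp
  have term_le: "binom_coeff t (length w) * (\<mu> (mon w) - \<nu> (mon w))\<^sup>2 \<le> 0" if w: "set w \<subseteq> {1..n}" "w \<noteq> []" for w
  proof (rule LIMSEQ_le_const[OF Q], intro exI allI impI)
    fix N assume "length w \<le> N"
    then have "w \<in> words N"
      using w by (cases w) (auto simp: words_def)
    then show "binom_coeff t (length w) * (\<mu> (mon w) - \<nu> (mon w))\<^sup>2 \<le> Q N"
      unfolding Q_def
      by (intro member_le_sum finite_words) (auto intro!: mult_nonneg_nonneg binom_coeff_nonneg t simp: words_def)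
  qed
  have mon_eq: "\<mu> (mon w) = \<nu> (mon w)" if w: "set w \<subseteq> {1..n}" "w \<noteq> []" and pos: "binom_coeff t (length w) > 0" for w
  proof -
    have "(\<mu> (mon w) - \<nu> (mon w))\<^sup>2 \<le> 0"
      using term_le[OF w] pos by (simp add: mult_le_0_iff)
    then show ?thesis
      by simp
  qed
  show ?thesis
  proof
    fix j
    consider "j = 0" | "1 \<le> j" "j \<le> n" | "j > n"
      by linarith
    then show "iota t \<mu> j = iota t \<nu> j"
    proof cases
      case 1
      then show ?thesis
        using p meq by (simp add: iota_0)
    next
      case 2
      have "mon [j] = (\<lambda>x. x j)"
        by (rule ext) simp
      then show ?thesis
        using mon_eq[of "[j]"] 2 t by (simp add: iota_def binom_coeff_1)
    next
      case 3
      have "\<mu> (mon w) = \<nu> (mon w)" if "set w \<subseteq> {1..n}" "t \<noteq> 1" for w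
      proof (cases w)
        case Nil
        have "mon [] = (\<lambda>x. 1)"
          by (rule ext) simp
        then show ?thesis
          using meq Nil by (simp add: mass_def)
      next
        case (Cons i u)
        then show ?thesis
          using that t by (intro mon_eq binom_coeff_pos) auto
      qed
      then show ?thesis
        using 3 by (simp add: iota_def Let_def)
    qed
  qed
qed

section \<open>The model spaces\<close>

definition H :: "real \<Rightarrow> (((nat \<Rightarrow> real) \<Rightarrow> real) \<Rightarrow> real) set" where
  "H t = {\<mu>. posf \<mu> \<and> form t \<mu> \<mu> = 1}"

definition X :: "real \<Rightarrow> (nat \<Rightarrow> real) set" where
  "X t = iota t ` H t"

text \<open>Functionals with the same coordinates may differ, so a choice has to be made; by
  \<open>ker_iota\<close> the kernel does not depend on it.\<close>

definition rep :: "real \<Rightarrow> (nat \<Rightarrow> real) \<Rightarrow> ((nat \<Rightarrow> real) \<Rightarrow> real) \<Rightarrow> real" where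
  "rep t x = (SOME \<mu>. \<mu> \<in> H t \<and> iota t \<mu> = x)"

definition ker :: "real \<Rightarrow> (nat \<Rightarrow> real) \<Rightarrow> (nat \<Rightarrow> real) \<Rightarrow> real" where
  "ker t x y = form t (rep t x) (rep t y)"

lemma rep: assumes "x \<in> X t" shows "rep t x \<in> H t" "iota t (rep t x) = x"
  using someI_ex[of "\<lambda>\<mu>. \<mu> \<in> H t \<and> iota t \<mu> = x"] assms unfolding X_def rep_def by blast+

lemma H_posf: "\<mu> \<in> H t \<Longrightarrow> posf \<mu>" and H_form: "\<mu> \<in> H t \<Longrightarrow> form t \<mu> \<mu> = 1"
  by (simp_all add: H_def)

lemma iota_in_X: "\<mu> \<in> H t \<Longrightarrow> iota t \<mu> \<in> X t"
  by (simp add: X_def)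

lemma XE: assumes "x \<in> X t" obtains \<mu> where "\<mu> \<in> H t" "x = iota t \<mu>"
  using assms unfolding X_def by blast

text \<open>The form of a point of \<^term>\<open>X t\<close> with an arbitrary positive functional, in particular with a
  Dirac functional, that is, a point at infinity.\<close>

definition kerf :: "real \<Rightarrow> (nat \<Rightarrow> real) \<Rightarrow> (((nat \<Rightarrow> real) \<Rightarrow> real) \<Rightarrow> real) \<Rightarrow> real" where
  "kerf t x \<rho> = form t (rep t x) \<rho>"

end

locale light_sphere_param = light_sphere +
  fixes t :: real
  assumes t0: "0 < t" and t1: "t \<le> 1"
begin

lemma kerf_iota:
  assumes "\<mu> \<in> H t" "posf \<rho>"
  shows "kerf t (iota t \<mu>) \<rho> = form t \<mu> \<rho>"
  unfolding kerf_def
  by (rule iota_eq_form[OF t0 t1]) (simp_all add: assms H_posf[OF assms(1)] rep[OF iota_in_X[OF assms(1)]] H_posf[OF rep(1)[OF iota_in_X[OF assms(1)]]])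

lemma ker_kerf: "ker t x y = kerf t x (rep t y)"
  by (simp add: ker_def kerf_def)

lemma ker_iota:
  assumes "\<mu> \<in> H t" "\<nu> \<in> H t"
  shows "ker t (iota t \<mu>) (iota t \<nu>) = form t \<mu> \<nu>"
proof -
  have r: "rep t (iota t \<nu>) \<in> H t"
    by (rule rep(1)[OF iota_in_X[OF assms(2)]])
  have "ker t (iota t \<mu>) (iota t \<nu>) = form t \<mu> (rep t (iota t \<nu>))"
    unfolding ker_kerf by (rule kerf_iota[OF assms(1) H_posf[OF r]])
  also have "\<dots> = form t (rep t (iota t \<nu>)) \<mu>"
    by (rule form_commute[OF t0 t1]) (use assms r H_posf in auto)
  also have "\<dots> = form t \<nu> \<mu>"
    using kerf_iota[OF assms(2) H_posf[OF assms(1)]] by (simp add: kerf_def)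
  also have "\<dots> = form t \<mu> \<nu>"
    by (rule form_commute[OF t0 t1]) (use assms H_posf in auto)
  finally show ?thesis .
qed

text \<open>The combination of \<open>\<mu>\<close> and \<open>\<nu>\<close> with weights
  \<open>mass \<nu>\<close> and \<open>- mass \<mu>\<close> has mass zero, hence nonpositive form;
  the inequality of arithmetic and geometric means for the two masses does the rest.\<close>

lemma form_ge_1:
  assumes "\<mu> \<in> H t" "\<nu> \<in> H t"
  shows "1 \<le> form t \<mu> \<nu>"
proof -
  note p = H_posf[OF assms(1)] H_posf[OF assms(2)] and f = H_form[OF assms(1)] H_form[OF assms(2)]
  define A where "A = form t \<mu> \<nu>"
  have l: "0 < mass \<mu>" "0 < mass \<nu>"
    using mass_pos[OF t0 t1 p(1)] mass_pos[OF t0 t1 p(2)] f by auto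
  have "(mass \<nu>)\<^sup>2 + (mass \<mu>)\<^sup>2 \<le> 2 * (mass \<mu> * mass \<nu>) * A"
    using form_psd[OF t0 t1 p p(2), of "mass \<nu>" "- mass \<mu>" 0] by (simp add: f A_def mult_ac)
  moreover have "2 * (mass \<mu> * mass \<nu>) \<le> (mass \<nu>)\<^sup>2 + (mass \<mu>)\<^sup>2"
    using sum_squares_bound[of "mass \<mu>" "mass \<nu>"] by simp
  ultimately have "2 * (mass \<mu> * mass \<nu>) * 1 \<le> 2 * (mass \<mu> * mass \<nu>) * A"
    by simp
  then show ?thesis
    using l unfolding A_def[symmetric] by (subst (asm) mult_le_cancel_left_pos) auto
qed

lemma comb_H:
  assumes "\<mu> \<in> H t" "\<nu> \<in> H t" "0 \<le> a" "0 \<le> b" "a\<^sup>2 + b\<^sup>2 + 2 * a * b * form t \<mu> \<nu> = 1"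
  shows "comb a \<mu> b \<nu> \<in> H t"
proof -
  note p = H_posf[OF assms(1)] H_posf[OF assms(2)]
  have "form t (comb a \<mu> b \<nu>) (comb a \<mu> b \<nu>) = a\<^sup>2 + b\<^sup>2 + 2 * a * b * form t \<mu> \<nu>"
    using assms p form_commute[OF t0 t1 p]
    by (simp add: form_comb_left form_comb_right[OF t0 t1] H_form power2_eq_square algebra_simps)
  then show ?thesis
    using assms p by (simp add: H_def posf_comb)
qed

sublocale hyp_kernel "X t" "ker t"
proof
  fix x y assume "x \<in> X t" "y \<in> X t"
  then obtain \<mu> \<nu> where \<mu>: "\<mu> \<in> H t" "x = iota t \<mu>" and \<nu>: "\<nu> \<in> H t" "y = iota t \<nu>"
    by (auto elim!: XE)
  note p = H_posf[OF \<mu>(1)] H_posf[OF \<nu>(1)]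
  have xy: "ker t x y = form t \<mu> \<nu>" "ker t y x = form t \<nu> \<mu>" "ker t x x = 1"
    using \<mu> \<nu> ker_iota H_form by auto
  show "ker t x y = ker t y x"
    unfolding xy by (rule form_commute[OF t0 t1 p])
  show "ker t x x = 1"
    by (rule xy)
  show "1 \<le> ker t x y"
    unfolding xy by (rule form_ge_1[OF \<mu>(1) \<nu>(1)])
  show "x = y" if "ker t x y = 1"
    unfolding \<mu> \<nu> by (rule form_eq_iota[OF t0 t1 p]) (use that \<mu> \<nu> xy H_form in auto)
  show "(ker t x z - ker t x y * ker t y z)\<^sup>2 \<le> ((ker t x y)\<^sup>2 - 1) * ((ker t y z)\<^sup>2 - 1)" if "z \<in> X t" for z
  proof -
    obtain \<rho> where \<rho>: "\<rho> \<in> H t" "z = iota t \<rho>"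
      using \<open>z \<in> X t\<close> by (auto elim!: XE)
    have xz: "ker t x z = form t \<mu> \<rho>" "ker t y z = form t \<nu> \<rho>"
      using \<mu> \<nu> \<rho> ker_iota by auto
    show ?thesis
      unfolding xy xz
      by (rule lorentzian_gram_bound[where lx = "mass \<mu>" and ly = "mass \<nu>" and lz = "mass \<rho>"])
        (use form_psd[OF t0 t1 p H_posf[OF \<rho>(1)]] H_form[OF \<mu>(1)] H_form[OF \<nu>(1)] H_form[OF \<rho>(1)] in simp)
  qed
  fix a b :: real assume ab: "0 \<le> a" "0 \<le> b" "a\<^sup>2 + b\<^sup>2 + 2 * a * b * ker t x y = 1"
  have "comb a \<mu> b \<nu> \<in> H t"
    using ab xy \<mu> \<nu> by (intro comb_H) auto
  moreover have "ker t (iota t (comb a \<mu> b \<nu>)) w = a * ker t x w + b * ker t y w" if "w \<in> X t" for w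
  proof -
    obtain \<rho> where \<rho>: "\<rho> \<in> H t" "w = iota t \<rho>"
      using \<open>w \<in> X t\<close> by (auto elim!: XE)
    show ?thesis
      using \<mu> \<nu> \<rho> ker_iota calculation by (simp add: form_comb_left)
  qed
  ultimately show "\<exists>z\<in>X t. \<forall>w\<in>X t. ker t z w = a * ker t x w + b * ker t y w"
    by (intro bexI[of _ "iota t (comb a \<mu> b \<nu>)"]) (auto intro: iota_in_X)
qed

lemma kerf_comb: "posf \<mu> \<Longrightarrow> posf \<nu> \<Longrightarrow> x \<in> X t \<Longrightarrow> kerf t x (comb a \<mu> b \<nu>) = a * kerf t x \<mu> + b * kerf t x \<nu>"
  unfolding kerf_def using form_comb_right[OF t0 t1 _ _ H_posf[OF rep(1)]] by simp

text \<open>Radial projection to the unit level of the form. It places one and the same mean in the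
  spaces of different exponents.\<close>

definition pt :: "(((nat \<Rightarrow> real) \<Rightarrow> real) \<Rightarrow> real) \<Rightarrow> nat \<Rightarrow> real" where
  "pt \<mu> = iota t (scale (1 / sqrt (form t \<mu> \<mu>)) \<mu>)"

lemma scale_in_H: "posf \<mu> \<Longrightarrow> 0 < form t \<mu> \<mu> \<Longrightarrow> scale (1 / sqrt (form t \<mu> \<mu>)) \<mu> \<in> H t"
  by (simp add: H_def posf_scale form_scale_left form_scale_right[OF t0 t1] real_sqrt_mult_self flip: real_sqrt_mult)

lemma pt_in_X: "posf \<mu> \<Longrightarrow> 0 < form t \<mu> \<mu> \<Longrightarrow> pt \<mu> \<in> X t"
  unfolding pt_def by (intro iota_in_X scale_in_H)

lemma kerf_pt: "posf \<mu> \<Longrightarrow> 0 < form t \<mu> \<mu> \<Longrightarrow> posf \<rho> \<Longrightarrow> kerf t (pt \<mu>) \<rho> = form t \<mu> \<rho> / sqrt (form t \<mu> \<mu>)"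
  unfolding pt_def by (simp add: kerf_iota scale_in_H form_scale_left)

lemma ker_pt:
  "posf \<mu> \<Longrightarrow> 0 < form t \<mu> \<mu> \<Longrightarrow> posf \<nu> \<Longrightarrow> 0 < form t \<nu> \<nu> \<Longrightarrow>
   ker t (pt \<mu>) (pt \<nu>) = form t \<mu> \<nu> / (sqrt (form t \<mu> \<mu>) * sqrt (form t \<nu> \<nu>))"
  unfolding pt_def by (simp add: ker_iota scale_in_H form_scale_left form_scale_right[OF t0 t1])

lemma ker_iota_kerf: "x \<in> X t \<Longrightarrow> \<mu> \<in> H t \<Longrightarrow> ker t x (iota t \<mu>) = kerf t x \<mu>"
  by (metis ker_iota kerf_def rep)

lemma pt_iota: "\<mu> \<in> H t \<Longrightarrow> pt \<mu> = iota t \<mu>"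
  by (simp add: pt_def H_form scale_def)

lemma X_0: "\<mu> \<in> H t \<Longrightarrow> iota t \<mu> 0 = mass \<mu>"
  by (simp add: iota_0 H_posf)

end

context light_sphere
begin

text \<open>For \<open>s\<close> equal to 1 or -1, the light vector over a coordinate direction or
  its opposite; index 0 holds the time coordinate.\<close>

definition unit :: "nat \<Rightarrow> real \<Rightarrow> nat \<Rightarrow> real" where
  "unit i s = (\<lambda>j. if j = 0 then 1 else if j = i then s else 0)"

lemma unit_in_S: "i \<in> {1..n} \<Longrightarrow> s = 1 \<or> s = -1 \<Longrightarrow> unit i s \<in> S"
  unfolding S_def lorentz_def unit_def
  by (auto simp: if_distrib[of "\<lambda>x. x * _"] sum.delta cong: if_cong)

lemma lorentz_unit:
  assumes "i \<in> {1..n}" "j \<in> {1..n}"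
  shows "lorentz n (unit i s) (unit j r) = 1 - (if i = j then s * r else 0)"
proof -
  have "(\<Sum>l=1..n. unit i s l * unit j r l) = (\<Sum>l=1..n. if l = i then (if i = j then s * r else 0) else 0)"
    by (intro sum.cong) (auto simp: unit_def)
  then show ?thesis
    using assms by (simp add: lorentz_def unit_def)
qed

interpretation P1: light_sphere_param n 1
  by unfold_locales auto

lemma iota_1_in_hyperboloid:
  assumes "\<mu> \<in> H 1"
  shows "iota 1 \<mu> \<in> hyperboloid n"
proof -
  have "posf \<mu>" "form 1 \<mu> \<mu> = 1"
    using assms by (auto simp: H_def)
  then show ?thesis
    using form_1[of \<mu> \<mu> 1] mass_pos[of 1 \<mu>] iota_0[of \<mu> 1] by (auto simp: hyperboloid_def iota_def)
qed

text \<open>A point of the hyperboloid is a nonnegative combination of the two opposite light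
  vectors over the direction of its space part; for \<open>r = 0\<close> that direction is
  arbitrary.\<close>

lemma hyperboloid_in_X_1:
  assumes y: "y \<in> hyperboloid n"
  shows "y \<in> X 1"
proof -
  define r where "r = sqrt (\<Sum>i=1..n. y i * y i)"
  have y1: "lorentz n y y = 1" "y 0 > 0" "\<And>i. i > n \<Longrightarrow> y i = 0"
    using y by (auto simp: hyperboloid_def)
  have r2: "r * r = (\<Sum>i=1..n. y i * y i)"
    by (simp add: r_def sum_nonneg)
  then have "r * r = y 0 * y 0 - 1"
    using y1 by (simp add: lorentz_def)
  then have "r\<^sup>2 \<le> (y 0)\<^sup>2"
    by (simp add: power2_eq_square)
  then have r: "r \<le> y 0" "0 \<le> r"
    using y1 by (auto simp: r_def sum_nonneg intro: power2_le_imp_le)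
  obtain u where u: "(\<Sum>i=1..n. u i * u i) = 1" "\<And>i. i \<in> {1..n} \<Longrightarrow> y i = r * u i"
  proof (cases "r = 0")
    case True
    then have "(\<Sum>i=1..n. y i * y i) = 0"
      using r2 by simp
    then have "\<forall>i\<in>{1..n}. y i * y i = 0"
      by (subst (asm) sum_nonneg_eq_0_iff) auto
    moreover have "(\<Sum>i=1..n. (if i = 1 then 1 else 0) * (if i = 1 then 1 else (0 :: real))) = 1"
      using n2 by (simp add: if_distrib[of "\<lambda>x. x * _"] cong: if_cong)
    ultimately show ?thesis
      using True by (intro that[of "\<lambda>i. if i = 1 then 1 else 0"]) auto
  next
    case False
    have "(\<Sum>i=1..n. (y i / r) * (y i / r)) = (\<Sum>i=1..n. y i * y i) / (r * r)"
      by (simp add: sum_divide_distrib)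
    then show ?thesis
      using r2 False by (intro that[of "\<lambda>i. y i / r"]) auto
  qed
  define \<xi> where "\<xi> s i = (if i = 0 then 1 else if i \<le> n then s * u i else 0)" for s :: real and i
  have \<xi>: "\<xi> s \<in> S" if "s = 1 \<or> s = -1" for s
  proof -
    have "(\<Sum>i=1..n. \<xi> s i * \<xi> s i) = (\<Sum>i=1..n. u i * u i)"
      using that by (intro sum.cong) (auto simp: \<xi>_def)
    then show ?thesis
      using u(1) by (simp add: S_def lorentz_def) (simp add: \<xi>_def)
  qed
  define \<mu> where "\<mu> = comb ((y 0 + r) / 2) (dir (\<xi> 1)) ((y 0 - r) / 2) (dir (\<xi> (-1)))"
  have p: "posf \<mu>"
    unfolding \<mu>_def using r \<xi> by (intro posf_comb posf_dir) auto
  have i: "iota 1 \<mu> = y"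
  proof
    fix j
    show "iota 1 \<mu> j = y j"
      using y1(3)[of j] u(2)[of j]
      by (cases "j = 0"; cases "j \<le> n") (auto simp: iota_def \<mu>_def comb_def dir_def \<xi>_def field_simps)
  qed
  have "\<mu> \<in> H 1"
    using p form_1[OF p p, of 1] i y1 by (simp add: H_def)
  then show ?thesis
    using i by (auto simp: X_def)
qed

lemma X_1: "X 1 = hyperboloid n"
  using iota_1_in_hyperboloid hyperboloid_in_X_1 by (auto simp: X_def)

lemma ker_1: "x \<in> X 1 \<Longrightarrow> y \<in> X 1 \<Longrightarrow> ker 1 x y = lorentz n x y"
  by (metis ker_def form_1 H_posf rep)

definition Cspace :: "real \<Rightarrow> (nat \<Rightarrow> real) metric" where
  "Cspace t = kernel_space (X t) (ker t)"

lemma Cspace_1: "Cspace 1 = hyperbolic_space n"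
proof -
  have "(\<lambda>x y. if x \<in> X 1 \<and> y \<in> X 1 then arcosh (ker 1 x y) else 0)
    = (\<lambda>x y. if x \<in> X 1 \<and> y \<in> X 1 then arcosh (lorentz n x y) else 0)"
    by (intro ext) (auto simp: ker_1)
  then show ?thesis
    unfolding Cspace_def kernel_space_hyperboloid kernel_space_def X_1[symmetric] by simp
qed

end

section \<open>Jensen's inequality, null means and compactness\<close>

lemma powr_le_tangent:
  fixes x c t :: real
  assumes "0 \<le> x" "0 < c" "0 < t" "t \<le> 1"
  shows "x powr t \<le> c powr t + t * c powr (t - 1) * (x - c)"
proof (cases "x = 0")
  case True
  have 1: "t * c powr (t - 1) * (x - c) = - (t * c powr t)"
    using assms True by (simp add: powr_diff)
  have "t * c powr t \<le> c powr t"
    using assms by (simp add: mult_left_le_one_le)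
  then show ?thesis
    unfolding 1 using True by simp
next
  case False
  have "(x / c) powr t * 1 powr (1 - t) \<le> t * (x / c) + (1 - t) * 1"
    using assms False by (intro Youngs_inequality_0) auto
  then have "(x / c) powr t \<le> 1 + t * (x - c) / c"
    using assms by (simp add: field_simps)
  then have "(x / c) powr t * c powr t \<le> (1 + t * (x - c) / c) * c powr t"
    by (rule mult_right_mono) simp
  moreover have "(x / c) powr t * c powr t = x powr t"
    using assms by (simp add: powr_divide)
  moreover have "(1 + t * (x - c) / c) * c powr t = c powr t + t * c powr (t - 1) * (x - c)"
    using assms by (simp add: powr_diff field_simps)
  ultimately show ?thesis
    by simp
qed

text \<open>On [0, 2] the concave power lies above the chord through its endpoints. This compares
  the form of exponent \<open>t\<close> with that of exponent 1, which only depends on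
  barycentres.\<close>

lemma powr_ge_linear:
  fixes s t :: real
  assumes "0 \<le> s" "s \<le> 2" "0 < t" "t \<le> 1"
  shows "2 powr (t - 1) * s \<le> s powr t"
proof (cases "s = 0")
  case False
  then have "2 powr (t - 1) \<le> s powr (t - 1)"
    using assms by (intro powr_mono2') auto
  then have "2 powr (t - 1) * s \<le> s powr (t - 1) * s"
    using assms by (intro mult_right_mono) auto
  also have "\<dots> = s powr t"
    using False assms by (simp add: powr_diff)
  finally show ?thesis .
qed simp

context light_sphere
begin

text \<open>Integrate the tangent of the power at the mean value. If the mean value is 0 there may
  be no tangent, and tangents at small positive points take over.\<close>

lemma posf_Jensen:
  assumes m: "posf m" "mass m = 1" and \<phi>: "\<phi> \<in> Bd" "\<And>x. x \<in> S \<Longrightarrow> 0 \<le> \<phi> x" and t: "0 < t" "t \<le> 1"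
  shows "m (\<lambda>x. \<phi> x powr t) \<le> m \<phi> powr t"
proof -
  have tangent: "m (\<lambda>x. \<phi> x powr t) \<le> c powr t + t * c powr (t - 1) * (m \<phi> - c)" if c: "0 < c" for c
  proof -
    have "m (\<lambda>x. \<phi> x powr t) \<le> m (\<lambda>x. (c powr t - t * c powr (t - 1) * c) + (t * c powr (t - 1)) * \<phi> x)"
    proof (rule posf_mono[OF m(1)])
      show "(\<lambda>x. \<phi> x powr t) \<in> Bd"
        using \<phi> t by (intro Bd_powr) auto
      show "(\<lambda>x. (c powr t - t * c powr (t - 1) * c) + (t * c powr (t - 1)) * \<phi> x) \<in> Bd"
        by (intro Bd_add Bd_const Bd_cmult \<phi>)
      show "\<phi> x powr t \<le> (c powr t - t * c powr (t - 1) * c) + (t * c powr (t - 1)) * \<phi> x" if "x \<in> S" for x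
        using powr_le_tangent[OF \<phi>(2)[OF that] c t] by (simp add: algebra_simps)
    qed
    also have "\<dots> = (c powr t - t * c powr (t - 1) * c) + (t * c powr (t - 1)) * m \<phi>"
      using posf_add[OF m(1) Bd_const Bd_cmult[OF \<phi>(1)]] posf_cmult[OF m(1) \<phi>(1)] posf_const[OF m(1)] m(2)
      by simp
    finally show ?thesis
      by (simp add: algebra_simps)
  qed
  have 0: "0 \<le> m \<phi>"
    by (rule posf_nonneg[OF m(1) \<phi>])
  show ?thesis
  proof (cases "m \<phi> = 0")
    case False
    then show ?thesis
      using tangent[of "m \<phi>"] 0 by simp
  next
    case True
    have "m (\<lambda>x. \<phi> x powr t) \<le> 0"
    proof (rule ccontr)
      define v where "v = m (\<lambda>x. \<phi> x powr t)"
      assume "\<not> m (\<lambda>x. \<phi> x powr t) \<le> 0"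
      then have v: "v > 0"
        by (simp add: v_def)
      \<comment> \<open>The tangent at this point has height \<open>v / 2\<close> there and is lower
        still at 0.\<close>
      define c where "c = (v / 2) powr (1 / t)"
      have c: "c > 0" "c powr t = v / 2"
        using v t by (auto simp: c_def powr_powr)
      have "v \<le> c powr t + t * c powr (t - 1) * (m \<phi> - c)"
        using tangent[OF c(1)] by (simp add: v_def)
      also have "\<dots> \<le> v / 2"
        using c t True by (simp add: mult_nonneg_nonneg)
      finally show False
        using v by simp
    qed
    then show ?thesis
      using True by simp
  qed
qed

lemma double_mono:
  assumes "posf \<mu>" "posf \<nu>" "\<And>x y. x \<in> S \<Longrightarrow> y \<in> S \<Longrightarrow> \<bar>f x y\<bar> \<le> C" "\<And>x y. x \<in> S \<Longrightarrow> y \<in> S \<Longrightarrow> \<bar>g x y\<bar> \<le> D"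
    and "\<And>x y. x \<in> S \<Longrightarrow> y \<in> S \<Longrightarrow> f x y \<le> g x y"
  shows "\<mu> (\<lambda>x. \<nu> (f x)) \<le> \<mu> (\<lambda>x. \<nu> (g x))"
proof (rule posf_mono[OF assms(1) Bd_section[OF assms(2,3)] Bd_section[OF assms(2,4)]])
  show "\<nu> (f x) \<le> \<nu> (g x)" if "x \<in> S" for x
    using assms(3-5)[OF that] by (intro posf_mono[OF assms(2)]) (auto intro: BdI)
qed

lemma form_ge_form_1:
  assumes "posf \<mu>" "posf \<nu>" "0 < t" "t \<le> 1"
  shows "2 powr (t - 1) * form 1 \<mu> \<nu> \<le> form t \<mu> \<nu>"
proof -
  have "form 1 \<mu> (scale (2 powr (t - 1)) \<nu>) \<le> form t \<mu> \<nu>"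
    unfolding form_def scale_def
  proof -
    have "\<mu> (\<lambda>x. \<nu> (\<lambda>y. 2 powr (t - 1) * lorentz n x y powr 1)) \<le> \<mu> (\<lambda>x. \<nu> (\<lambda>y. lorentz n x y powr t))"
    proof (rule double_mono[OF assms(1,2)])
      show "\<bar>2 powr (t - 1) * lorentz n x y powr 1\<bar> \<le> 2 powr (t - 1) * 2" if "x \<in> S" "y \<in> S" for x y
        unfolding abs_mult using kernel_bound[OF that, of 1] by (intro mult_mono) auto
      show "\<bar>lorentz n x y powr t\<bar> \<le> 2" if "x \<in> S" "y \<in> S" for x y
        by (rule kernel_bound[OF that assms(3,4)])
      show "2 powr (t - 1) * lorentz n x y powr 1 \<le> lorentz n x y powr t" if "x \<in> S" "y \<in> S" for x y
        using powr_ge_linear[OF lorentz_S_nonneg[OF that] lorentz_S_le_2[OF that] assms(3,4)]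
          lorentz_S_nonneg[OF that] by simp
    qed
    moreover have "\<mu> (\<lambda>x. \<nu> (\<lambda>y. 2 powr (t - 1) * lorentz n x y powr 1)) = \<mu> (\<lambda>x. 2 powr (t - 1) * \<nu> (\<lambda>y. lorentz n x y powr 1))"
    proof (rule posf_cong[OF assms(1)])
      show "(\<lambda>x. \<nu> (\<lambda>y. 2 powr (t - 1) * lorentz n x y powr 1)) \<in> Bd"
      proof (rule Bd_section[OF assms(2)])
        show "\<bar>2 powr (t - 1) * lorentz n x y powr 1\<bar> \<le> 2 powr (t - 1) * 2" if "x \<in> S" "y \<in> S" for x y
          unfolding abs_mult using kernel_bound[OF that, of 1] by (intro mult_mono) auto
      qed
      show "\<nu> (\<lambda>y. 2 powr (t - 1) * lorentz n x y powr 1) = 2 powr (t - 1) * \<nu> (\<lambda>y. lorentz n x y powr 1)" if "x \<in> S" for x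
        by (rule posf_cmult[OF assms(2) Bd_kernel'[OF that]]) simp
    qed
    ultimately show "\<mu> (\<lambda>x. 2 powr (t - 1) * \<nu> (\<lambda>y. lorentz n x y powr 1)) \<le> \<mu> (\<lambda>x. \<nu> (\<lambda>y. lorentz n x y powr t))"
      by simp
  qed
  then show ?thesis
    using form_scale_right[of 1 \<nu> \<mu>] assms by simp
qed

text \<open>A mean that is null for exponent \<open>t\<close> is null for exponent 1, which says
  that its barycentre \<open>b\<close> lies on the sphere. By Jensen its product with the Dirac
  functional at \<open>b\<close> is 0, so the two have \<open>gap\<close> zero and cannot be told
  apart by the form. This identifies limits at infinity with points of \<open>S\<close>.\<close>

lemma form_light:
  assumes m: "posf m" "mass m = 1" and t: "0 < t" "t \<le> 1" and 0: "form t m m = 0"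
  shows "\<exists>\<sigma>\<in>S. \<forall>\<rho>. posf \<rho> \<longrightarrow> form t m \<rho> = form t (dir \<sigma>) \<rho>"
proof -
  have "2 powr (t - 1) * form 1 m m \<le> 0"
    using form_ge_form_1[OF m(1,1) t] 0 by simp
  then have "form 1 m m \<le> 0"
    by (simp add: mult_le_0_iff)
  then have f1: "form 1 m m = 0"
    using form_nonneg[of 1 m m] m by simp
  define b where "b = iota 1 m"
  have lb: "lorentz n b b = 0"
    using f1 form_1[OF m(1,1), of 1] by (simp add: b_def)
  have bS: "b \<in> S"
    using lb iota_0[OF m(1), of 1] m(2) by (simp add: S_def) (simp add: b_def iota_def)
  have "form t m (dir b) \<le> m (\<lambda>x. lorentz n x b) powr t"
    unfolding form_dir_right
    by (rule posf_Jensen[OF m Bd_lorentz _ t]) (simp add: lorentz_S_nonneg bS)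
  also have "\<dots> = 0"
    using lorentz_iota[OF m(1), of 1 b] lb by (simp add: b_def)
  finally have "form t m (dir b) = 0"
    using form_nonneg[OF t m(1) posf_dir[OF bS]] by simp
  then have "gap t m (dir b) = 0"
    using 0 t by (simp add: gap_def form_dir_dir lorentz_S_self[OF bS])
  then show ?thesis
    using gap_zero_form_eq[OF t m(1) posf_dir[OF bS]] m(2) bS by (auto simp: mass_dir)
qed

text \<open>Weak-* compactness of the set of means, in a form that does not mention the topology.\<close>

lemma means_cluster:
  fixes f :: "nat \<Rightarrow> ((nat \<Rightarrow> real) \<Rightarrow> real) \<Rightarrow> real"
  assumes f: "\<And>i. posf (f i)" "\<And>i. mass (f i) = 1"
  shows "\<exists>z. posf z \<and> mass z = 1 \<and>
    (\<forall>F \<epsilon>. finite F \<longrightarrow> F \<subseteq> Bd \<longrightarrow> 0 < \<epsilon> \<longrightarrow> (\<exists>\<^sub>F i in sequentially. \<forall>\<phi>\<in>F. \<bar>f i \<phi> - z \<phi>\<bar> < \<epsilon>))"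
proof -
  \<comment> \<open>Values off \<open>Bd\<close> are unconstrained; setting them to 0 places every
    \<open>g i\<close> in a product of compact intervals.\<close>
  define g where "g i \<phi> = (if \<phi> \<in> Bd then f i \<phi> else 0)" for i \<phi>
  have "\<exists>C. \<forall>\<phi>. \<forall>i. \<bar>g i \<phi>\<bar> \<le> C \<phi>"
  proof -
    have "\<exists>C. \<forall>i. \<bar>g i \<phi>\<bar> \<le> C" for \<phi>
    proof (cases "\<phi> \<in> Bd")
      case True
      then obtain C where "\<And>x. x \<in> S \<Longrightarrow> \<bar>\<phi> x\<bar> \<le> C"
        by (auto simp: Bd_def)
      then have "\<bar>f i \<phi>\<bar> \<le> C * mass (f i)" for i
        by (rule posf_bound[OF f(1)])
      then show ?thesis
        using True f(2) by (auto simp: g_def)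
    qed (auto simp: g_def)
    then show ?thesis
      by metis
  qed
  then obtain C where C: "\<And>\<phi> i. \<bar>g i \<phi>\<bar> \<le> C \<phi>"
    by blast
  define Z where "Z = (\<Pi>\<^sub>E \<phi>\<in>UNIV. {- C \<phi>..C \<phi>})"
  have "compactin (product_topology (\<lambda>\<phi>. euclidean) UNIV) Z"
    unfolding Z_def compactin_PiE by simp
  then have Z: "compact Z"
    by (simp add: euclidean_product_topology)
  have gZ: "g i \<in> Z" for i
    using C abs_le_D1[of "g i _"] abs_le_D2[of "g i _"] by (auto simp: Z_def) (metis minus_le_iff)
  have "filtermap g sequentially \<noteq> bot" "\<forall>\<^sub>F x in filtermap g sequentially. x \<in> Z"
    using gZ by (auto simp: filtermap_bot_iff eventually_filtermap)
  \<comment> \<open>Only a cluster point is at hand: the product has uncountably many factors, and a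
    convergent subsequence need not exist.\<close>
  then obtain z where z: "inf (nhds z) (filtermap g sequentially) \<noteq> bot"
    using Z unfolding compact_filter by blast
  have freq: "\<exists>\<^sub>F i in sequentially. \<forall>\<phi>\<in>F. \<bar>f i \<phi> - z \<phi>\<bar> < \<epsilon>"
    if F: "finite F" "F \<subseteq> Bd" and \<epsilon>: "0 < \<epsilon>" for F \<epsilon>
  proof -
    define U where "U = (\<Inter>\<phi>\<in>F. {m :: ((nat \<Rightarrow> real) \<Rightarrow> real) \<Rightarrow> real. \<bar>m \<phi> - z \<phi>\<bar> < \<epsilon>})"
    have "open U"
      unfolding U_def using F(1)
      by (intro open_INT ballI open_Collect_less continuous_intros continuous_on_product_coordinates) auto
    moreover have "z \<in> U"
      using \<epsilon> by (simp add: U_def)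
    ultimately have U: "\<forall>\<^sub>F m in nhds z. m \<in> U"
      by (auto simp: eventually_nhds)
    have "\<exists>\<^sub>F i in sequentially. g i \<in> U"
    proof (rule ccontr)
      assume "\<not> (\<exists>\<^sub>F i in sequentially. g i \<in> U)"
      then have "\<forall>\<^sub>F m in filtermap g sequentially. m \<notin> U"
        by (simp add: not_frequently eventually_filtermap)
      then have "\<forall>\<^sub>F m in inf (nhds z) (filtermap g sequentially). False"
        unfolding eventually_inf using U by blast
      then show False
        using z by (simp add: eventually_False)
    qed
    then show ?thesis
    proof (rule frequently_elim1, intro ballI)
      fix i \<phi> assume "g i \<in> U" and \<phi>: "\<phi> \<in> F"
      then have "\<bar>g i \<phi> - z \<phi>\<bar> < \<epsilon>"
        by (simp add: U_def)
      moreover have "g i \<phi> = f i \<phi>"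
        using F(2) \<phi> by (auto simp: g_def)
      ultimately show "\<bar>f i \<phi> - z \<phi>\<bar> < \<epsilon>"
        by simp
    qed
  qed
  have ex: "\<exists>i. \<forall>\<phi>\<in>F. \<bar>f i \<phi> - z \<phi>\<bar> < \<epsilon>" if "finite F" "F \<subseteq> Bd" "0 < \<epsilon>" for F \<epsilon>
    using frequently_ex[OF freq[OF that]] .
  have "posf z"
    unfolding posf_def
  proof (intro conjI ballI allI impI)
    fix \<phi> \<psi> assume \<phi>: "\<phi> \<in> Bd" and \<psi>: "\<psi> \<in> Bd"
    show "z (\<lambda>x. \<phi> x + \<psi> x) = z \<phi> + z \<psi>"
    proof (rule ccontr)
      assume ne: "z (\<lambda>x. \<phi> x + \<psi> x) \<noteq> z \<phi> + z \<psi>"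
      define \<epsilon> where "\<epsilon> = \<bar>z (\<lambda>x. \<phi> x + \<psi> x) - (z \<phi> + z \<psi>)\<bar> / 3"
      have "\<epsilon> > 0" and 3: "\<bar>z (\<lambda>x. \<phi> x + \<psi> x) - (z \<phi> + z \<psi>)\<bar> = 3 * \<epsilon>"
        using ne by (simp_all add: \<epsilon>_def)
      then obtain i where "\<bar>f i \<phi> - z \<phi>\<bar> < \<epsilon>" "\<bar>f i \<psi> - z \<psi>\<bar> < \<epsilon>" "\<bar>f i (\<lambda>x. \<phi> x + \<psi> x) - z (\<lambda>x. \<phi> x + \<psi> x)\<bar> < \<epsilon>"
        using ex[of "{\<phi>, \<psi>, \<lambda>x. \<phi> x + \<psi> x}" \<epsilon>] \<phi> \<psi> Bd_add by auto
      then show False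
        using posf_add[OF f(1) \<phi> \<psi>, of i] 3 by linarith
    qed
  next
    fix c \<phi> assume \<phi>: "\<phi> \<in> Bd"
    show "z (\<lambda>x. c * \<phi> x) = c * z \<phi>"
    proof (rule ccontr)
      assume ne: "z (\<lambda>x. c * \<phi> x) \<noteq> c * z \<phi>"
      define \<epsilon> where "\<epsilon> = \<bar>z (\<lambda>x. c * \<phi> x) - c * z \<phi>\<bar> / (1 + \<bar>c\<bar>)"
      have \<epsilon>: "\<epsilon> > 0"
        using ne by (simp add: \<epsilon>_def)
      then obtain i where i: "\<bar>f i \<phi> - z \<phi>\<bar> < \<epsilon>" "\<bar>f i (\<lambda>x. c * \<phi> x) - z (\<lambda>x. c * \<phi> x)\<bar> < \<epsilon>"
        using ex[of "{\<phi>, \<lambda>x. c * \<phi> x}" \<epsilon>] \<phi> Bd_cmult by auto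
      have "\<bar>c * f i \<phi> - c * z \<phi>\<bar> \<le> \<bar>c\<bar> * \<epsilon>"
        using i(1) unfolding right_diff_distrib[symmetric] abs_mult by (intro mult_left_mono) auto
      then have "\<bar>z (\<lambda>x. c * \<phi> x) - c * z \<phi>\<bar> < \<epsilon> + \<bar>c\<bar> * \<epsilon>"
        using i(2) posf_cmult[OF f(1) \<phi>, of i c] by linarith
      also have "\<dots> = (1 + \<bar>c\<bar>) * \<epsilon>"
        by (simp add: algebra_simps)
      also have "\<dots> = \<bar>z (\<lambda>x. c * \<phi> x) - c * z \<phi>\<bar>"
        unfolding \<epsilon>_def times_divide_eq_right
        by (rule nonzero_mult_div_cancel_left) (use abs_ge_zero[of c] in linarith)
      finally show False
        by simp
    qed
  next
    fix \<phi> assume \<phi>: "\<phi> \<in> Bd" and nn: "\<forall>x\<in>S. 0 \<le> \<phi> x"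
    show "0 \<le> z \<phi>"
    proof (rule ccontr)
      assume "\<not> 0 \<le> z \<phi>"
      then obtain i where "\<bar>f i \<phi> - z \<phi>\<bar> < - z \<phi>"
        using ex[of "{\<phi>}" "- z \<phi>"] \<phi> by auto
      then show False
        using posf_nonneg[OF f(1) \<phi>, of i] nn by auto
    qed
  qed
  moreover have "mass z = 1"
  proof (rule ccontr)
    assume "mass z \<noteq> 1"
    then obtain i where "\<bar>f i (\<lambda>_. 1) - mass z\<bar> < \<bar>1 - mass z\<bar>"
      using ex[of "{\<lambda>_. 1}" "\<bar>1 - mass z\<bar>"] by (auto simp: mass_def)
    then show False
      using f(2)[of i] by (simp add: mass_def)
  qed
  ultimately show ?thesis
    using freq by blast
qed

text \<open>Up to any given error, \<open>gap\<close> is controlled by finitely many moments. A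
  weak-* cluster point therefore makes the real sequence \<open>gap t (f i) z\<close> frequently
  small, and a subsequence tending to 0 can be selected.\<close>

lemma means_gap_subsequence:
  fixes f :: "nat \<Rightarrow> ((nat \<Rightarrow> real) \<Rightarrow> real) \<Rightarrow> real"
  assumes f: "\<And>i. posf (f i)" "\<And>i. mass (f i) = 1" and t: "0 < t" "t \<le> 1"
  shows "\<exists>z r. posf z \<and> mass z = 1 \<and> strict_mono r \<and> (\<lambda>i. gap t (f (r i)) z) \<longlonglongrightarrow> 0"
proof -
  obtain z where z: "posf z" "mass z = 1" and
    freq: "\<And>F \<epsilon>. finite F \<Longrightarrow> F \<subseteq> Bd \<Longrightarrow> 0 < \<epsilon> \<Longrightarrow> \<exists>\<^sub>F i in sequentially. \<forall>\<phi>\<in>F. \<bar>f i \<phi> - z \<phi>\<bar> < \<epsilon>"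
    using means_cluster[of f] f by blast
  obtain e where e: "e \<longlonglongrightarrow> 0" and
    ea: "\<And>N \<mu> \<nu>. posf \<mu> \<Longrightarrow> posf \<nu> \<Longrightarrow> \<bar>form t \<mu> \<nu> - formN t N \<mu> \<nu>\<bar> \<le> e N * mass \<mu> * mass \<nu>"
    using form_approx[OF t] by blast
  have gf: "\<exists>\<^sub>F i in sequentially. gap t (f i) z < \<epsilon>" if \<epsilon>: "0 < \<epsilon>" for \<epsilon>
  proof -
    \<comment> \<open>The truncation errors enter \<open>gap\<close> with total weight four and cost
      \<open>\<epsilon> / 2\<close>; the moments will cost another
      \<open>\<epsilon> / 4\<close>.\<close>
    have "\<forall>\<^sub>F N in sequentially. e N < \<epsilon> / 8"
      using e \<epsilon> by (intro order_tendstoD) auto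
    then obtain N where N: "e N < \<epsilon> / 8"
      by (auto simp: eventually_sequentially)
    define c where "c = (\<Sum>w\<in>words N. binom_coeff t (length w))"
    have cn: "0 \<le> binom_coeff t (length w)" if "w \<in> words N" for w
      using that t by (intro binom_coeff_nonneg) (auto simp: words_def)
    have c0: "0 \<le> c"
      unfolding c_def by (intro sum_nonneg cn)
    define \<delta> where "\<delta> = min 1 (\<epsilon> / (4 * (c + 1)))"
    have \<delta>: "0 < \<delta>" "\<delta> \<le> 1" "\<delta> \<le> \<epsilon> / (4 * (c + 1))"
      using \<epsilon> c0 by (auto simp: \<delta>_def)
    have "\<exists>\<^sub>F i in sequentially. \<forall>\<phi>\<in>mon ` words N. \<bar>f i \<phi> - z \<phi>\<bar> < \<delta>"
      using \<delta>(1) by (intro freq) (auto simp: finite_words Bd_mon)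
    then show ?thesis
    proof (rule frequently_elim1)
      fix i assume i: "\<forall>\<phi>\<in>mon ` words N. \<bar>f i \<phi> - z \<phi>\<bar> < \<delta>"
      have "(\<Sum>w\<in>words N. binom_coeff t (length w) * (f i (mon w) - z (mon w))\<^sup>2)
         \<le> (\<Sum>w\<in>words N. binom_coeff t (length w) * \<delta>)"
      proof (intro sum_mono mult_left_mono cn)
        fix w assume w: "w \<in> words N"
        have "(f i (mon w) - z (mon w))\<^sup>2 \<le> \<delta>\<^sup>2"
          using i w by (intro power2_le_iff_abs_le[THEN iffD2]) (auto intro: less_imp_le \<delta>(1))
        also have "\<dots> \<le> \<delta>"
          using \<delta> by (simp add: power2_eq_square mult_left_le)
        finally show "(f i (mon w) - z (mon w))\<^sup>2 \<le> \<delta>" .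
      qed
      also have "\<dots> = c * \<delta>"
        by (simp add: c_def sum_distrib_right)
      also have "\<dots> \<le> c * (\<epsilon> / (4 * (c + 1)))"
        using c0 \<delta>(3) by (intro mult_left_mono) auto
      also have "\<dots> \<le> \<epsilon> / 4"
        using c0 \<epsilon> by (simp add: field_simps)
      finally have Q: "(\<Sum>w\<in>words N. binom_coeff t (length w) * (f i (mon w) - z (mon w))\<^sup>2) \<le> \<epsilon> / 4" .
      have "2 * formN t N (f i) z - formN t N (f i) (f i) - formN t N z z
        = (\<Sum>w\<in>words N. binom_coeff t (length w) * (f i (mon w) - z (mon w))\<^sup>2)"
        using formN_expand[of 1 t N "f i" "-1" z 0 z] z f by simp
      with Q have "2 * formN t N (f i) z - formN t N (f i) (f i) - formN t N z z \<le> \<epsilon> / 4"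
        by simp
      moreover have "\<bar>form t (f i) z - formN t N (f i) z\<bar> \<le> e N" "\<bar>form t (f i) (f i) - formN t N (f i) (f i)\<bar> \<le> e N"
        "\<bar>form t z z - formN t N z z\<bar> \<le> e N"
        using ea[OF f(1) z(1), of i N] ea[OF f(1) f(1), of i i N] ea[OF z(1) z(1), of N] f z by auto
      ultimately show "gap t (f i) z < \<epsilon>"
        using N \<epsilon> unfolding gap_def by linarith
    qed
  qed
  have "\<forall>k m. \<exists>i. m < i \<and> gap t (f i) z < 1 / real (Suc k)"
  proof (intro allI)
    fix k m
    show "\<exists>i>m. gap t (f i) z < 1 / real (Suc k)"
    using gf[of "1 / real (Suc k)"] unfolding frequently_sequentially by (metis Suc_le_lessD zero_less_Suc
        of_nat_0_less_iff zero_less_divide_1_iff)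
  qed
  then obtain h where h: "\<And>m k. h k m > m" "\<And>m k. gap t (f (h k m)) z < 1 / real (Suc k)"
    by metis
  define r where "r = rec_nat (h 0 0) (\<lambda>k m. h (Suc k) m)"
  have r: "r (Suc k) = h (Suc k) (r k)" for k
    by (simp add: r_def)
  have "strict_mono r"
    unfolding strict_mono_Suc_iff r using h(1) by simp
  moreover have small: "gap t (f (r k)) z < 1 / real (Suc k)" for k
  proof (cases k)
    case 0
    then show ?thesis
      using h(2)[of 0 0] by (simp add: r_def)
  next
    case (Suc j)
    then show ?thesis
      using h(2)[of "Suc j" "r j"] r[of j] by simp
  qed
  have "(\<lambda>k. gap t (f (r k)) z) \<longlonglongrightarrow> 0"
  proof (rule tendsto_sandwich[OF always_eventually always_eventually tendsto_const])
    show "(\<lambda>k. 1 / real (Suc k)) \<longlonglongrightarrow> 0"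
      using LIMSEQ_inverse_real_of_nat by (simp add: inverse_eq_divide)
    show "\<forall>k. 0 \<le> gap t (f (r k)) z"
      using f z t by (auto intro: gap_nonneg)
    show "\<forall>k. gap t (f (r k)) z \<le> 1 / real (Suc k)"
      using small less_imp_le by blast
  qed
  ultimately show ?thesis
    using z by blast
qed

lemma gap_tendsto_form:
  fixes f :: "nat \<Rightarrow> ((nat \<Rightarrow> real) \<Rightarrow> real) \<Rightarrow> real"
  assumes t: "0 < t" "t \<le> 1" and f: "\<And>i. posf (f i)" "\<And>i. mass (f i) = 1" and z: "posf z" "mass z = 1"
    and g: "(\<lambda>i. gap t (f i) z) \<longlonglongrightarrow> 0" and \<rho>: "posf \<rho>"
  shows "(\<lambda>i. form t (f i) \<rho>) \<longlonglongrightarrow> form t z \<rho>"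
proof -
  have "(\<lambda>i. gap t (f i) z * ((mass \<rho>)\<^sup>2 - form t \<rho> \<rho>)) \<longlonglongrightarrow> 0 * ((mass \<rho>)\<^sup>2 - form t \<rho> \<rho>)"
    by (intro tendsto_intros g)
  then have "(\<lambda>i. (form t (f i) \<rho> - form t z \<rho>)\<^sup>2) \<longlonglongrightarrow> 0"
    using form_diff_square[OF t f(1) z(1) \<rho>] f(2) z(2)
    by (intro Lim_null_comparison[of "\<lambda>i. (form t (f i) \<rho> - form t z \<rho>)\<^sup>2"]) auto
  then have "(\<lambda>i. sqrt ((form t (f i) \<rho> - form t z \<rho>)\<^sup>2)) \<longlonglongrightarrow> sqrt 0"
    by (rule tendsto_real_sqrt)
  then have "(\<lambda>i. form t (f i) \<rho> - form t z \<rho>) \<longlonglongrightarrow> 0"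
    by (simp add: tendsto_rabs_zero_iff)
  then show ?thesis
    by (simp add: LIM_zero_iff)
qed

text \<open>Masses converge along a subsequence by Bolzano-Weierstrass and the normalized means
  converge in \<open>gap\<close>. Convergence in \<open>gap\<close>, and not just against fixed
  functionals, is what makes the form converge on the diagonal as well.\<close>

lemma cone_compact:
  fixes f :: "nat \<Rightarrow> ((nat \<Rightarrow> real) \<Rightarrow> real) \<Rightarrow> real"
  assumes t: "0 < t" "t \<le> 1" and f: "\<And>i. posf (f i)" "\<And>i. mass (f i) \<le> M"
  shows "\<exists>z r. posf z \<and> strict_mono r \<and> (\<lambda>i. mass (f (r i))) \<longlonglongrightarrow> mass z \<and>
    (\<forall>\<rho>. posf \<rho> \<longrightarrow> (\<lambda>i. form t (f (r i)) \<rho>) \<longlonglongrightarrow> form t z \<rho>) \<and>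
    (\<lambda>i. form t (f (r i)) (f (r i))) \<longlonglongrightarrow> form t z z"
proof -
  have e: "unit 1 1 \<in> S"
    by (rule unit_in_S) (use n2 in auto)
  \<comment> \<open>A functional of mass zero has no mean; any Dirac functional serves, since its
    weight is 0.\<close>
  define m where "m i = (if mass (f i) = 0 then dir (unit 1 1) else scale (1 / mass (f i)) (f i))" for i
  have m: "posf (m i)" "mass (m i) = 1" for i
    using f(1)[of i] mass_nonneg[OF f(1)[of i]] e by (auto simp: m_def posf_dir posf_scale mass_dir mass_scale)
  have fm: "form t (f i) \<rho> = mass (f i) * form t (m i) \<rho>" if "posf \<rho>" for i \<rho>
  proof (cases "mass (f i) = 0")
    case True
    then have "form t (f i) \<rho> \<le> 0"
      using form_bound[OF t f(1)[of i] that] by simp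
    then show ?thesis
      using form_nonneg[OF t f(1)[of i] that] True by simp
  next
    case False
    then show ?thesis
      by (simp add: m_def form_scale_left)
  qed
  have ff: "form t (f i) (f i) = mass (f i) * mass (f i) * form t (m i) (m i)" for i
    using fm[OF f(1)[of i], of i] fm[OF m(1)[of i], of i] form_commute[OF t m(1) f(1), of i i] by simp
  have "bounded (range (\<lambda>i. mass (f i)))"
    using f mass_nonneg[OF f(1)] by (intro boundedI[of _ M]) auto
  then obtain a r1 where r1: "strict_mono r1" "((\<lambda>i. mass (f i)) \<circ> r1) \<longlonglongrightarrow> a"
    using bounded_imp_convergent_subsequence by blast
  obtain z r2 where z: "posf z" "mass z = 1" and r2: "strict_mono r2" and
    g: "(\<lambda>i. gap t (m (r1 (r2 i))) z) \<longlonglongrightarrow> 0"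
    using means_gap_subsequence[of "\<lambda>i. m (r1 i)", OF m t] by blast
  have a: "(\<lambda>i. mass (f (r1 (r2 i)))) \<longlonglongrightarrow> a"
    using LIMSEQ_subseq_LIMSEQ[OF r1(2) r2] by (simp add: o_def)
  then have a0: "0 \<le> a"
    by (rule LIMSEQ_le_const) (use mass_nonneg[OF f(1)] in auto)
  have 1: "(\<lambda>i. form t (m (r1 (r2 i))) \<rho>) \<longlonglongrightarrow> form t z \<rho>" if "posf \<rho>" for \<rho>
    by (rule gap_tendsto_form[OF t m z g that])
  have "(\<lambda>i. 2 * form t (m (r1 (r2 i))) z - form t z z - gap t (m (r1 (r2 i))) z) \<longlonglongrightarrow> 2 * form t z z - form t z z - 0"
    by (intro tendsto_intros 1 z g)
  then have 2: "(\<lambda>i. form t (m (r1 (r2 i))) (m (r1 (r2 i)))) \<longlonglongrightarrow> form t z z"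
    by (simp add: gap_def)
  define y where "y = scale a z"
  have y: "posf y" "mass y = a"
    using z a0 by (auto simp: y_def posf_scale mass_scale)
  have y1: "form t y \<rho> = a * form t z \<rho>" for \<rho>
    by (simp add: y_def form_scale_left)
  have y2: "form t y y = a * a * form t z z"
    by (simp add: y_def form_scale_left form_scale_right[OF t z(1) z(1)])
  show ?thesis
  proof (intro exI conjI allI impI)
    show "posf y" by (rule y)
    show "strict_mono (r1 \<circ> r2)"
      using r1(1) r2 by (rule strict_mono_o)
    show "(\<lambda>i. mass (f ((r1 \<circ> r2) i))) \<longlonglongrightarrow> mass y"
      using a y(2) by simp
    show "(\<lambda>i. form t (f ((r1 \<circ> r2) i)) \<rho>) \<longlonglongrightarrow> form t y \<rho>" if "posf \<rho>" for \<rho>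
      unfolding fm[OF that] y1 using tendsto_mult[OF a 1[OF that]] by simp
    show "(\<lambda>i. form t (f ((r1 \<circ> r2) i)) (f ((r1 \<circ> r2) i))) \<longlonglongrightarrow> form t y y"
      unfolding ff y2 using tendsto_mult[OF tendsto_mult[OF a a] 2] by simp
  qed
qed

text \<open>Two opposite Dirac functionals with equal weights. The same mean serves all exponents,
  so that the comparison map between two spaces can preserve base points exactly.\<close>

definition base :: "((nat \<Rightarrow> real) \<Rightarrow> real) \<Rightarrow> real" where
  "base = comb (1/2) (dir (unit 1 1)) (1/2) (dir (unit 1 (-1)))"

lemma unit_1_S: "unit 1 1 \<in> S" "unit 1 (-1) \<in> S"
  using n2 by (auto intro!: unit_in_S)

lemma posf_base: "posf base"
  unfolding base_def by (intro posf_comb posf_dir unit_1_S) auto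

lemma mass_base: "mass base = 1"
  by (simp add: base_def mass_comb mass_dir)

lemma form_base_base: "0 < t \<Longrightarrow> form t base base = 2 powr t / 2"
  using n2 by (simp add: base_def form_def comb_def dir_def lorentz_unit)

text \<open>The products of \<open>x\<close> with the two opposite points are \<open>1 - x 1\<close>
  and \<open>1 + x 1\<close>, one of which is at least 1; it enters with weight 1/2.\<close>

lemma form_base:
  assumes m: "posf m" and t: "0 < t" "t \<le> 1"
  shows "mass m / 2 \<le> form t m base"
proof -
  have "m (\<lambda>x. 1/2) \<le> m (\<lambda>x. 1/2 * lorentz n x (unit 1 1) powr t + 1/2 * lorentz n x (unit 1 (-1)) powr t)"
  proof (rule posf_mono[OF m])
    show "(\<lambda>x. 1/2 * lorentz n x (unit 1 1) powr t + 1/2 * lorentz n x (unit 1 (-1)) powr t) \<in> Bd"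
      using t by (intro Bd_add Bd_cmult Bd_kernel unit_1_S) auto
    fix x assume x: "x \<in> S"
    have "(\<Sum>i=1..n. x i * unit 1 s i) = s * x 1" for s
    proof -
      have "(\<Sum>i=1..n. x i * unit 1 s i) = (\<Sum>i=1..n. if i = 1 then s * x 1 else 0)"
        by (intro sum.cong) (auto simp: unit_def)
      then show ?thesis
        using n2 by simp
    qed
    then have "lorentz n x (unit 1 s) = 1 - s * x 1" for s
      using x by (simp add: lorentz_def S_def) (simp add: unit_def)
    then have l: "lorentz n x (unit 1 1) = 1 - x 1" "lorentz n x (unit 1 (-1)) = 1 + x 1"
      by simp_all
    show "1/2 \<le> 1/2 * lorentz n x (unit 1 1) powr t + 1/2 * lorentz n x (unit 1 (-1)) powr t"
    proof (cases "0 \<le> x 1")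
      case True
      then have "1 \<le> (1 + x 1) powr t"
        using t by (intro ge_one_powr_ge_zero) auto
      then show ?thesis
        unfolding l by (simp add: add_increasing)
    next
      case False
      then have "1 \<le> (1 - x 1) powr t"
        using t by (intro ge_one_powr_ge_zero) auto
      then show ?thesis
        unfolding l by (simp add: add_increasing2)
    qed
  qed auto
  also have "\<dots> = form t m base"
    by (simp add: form_def base_def comb_def dir_def)
  finally show ?thesis
    using posf_const[OF m, of "1/2"] by simp
qed

end

section \<open>Masses, distances and properness\<close>

context light_sphere_param
begin

lemma form_base_bounds: "0 < form t base base" "form t base base \<le> 1"
proof -
  have "2 powr t \<le> 2 powr 1"
    using t1 by (intro powr_mono) auto
  then show "0 < form t base base" "form t base base \<le> 1"
    using t0 by (auto simp: form_base_base)
qed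

definition basept where "basept = pt base"

lemma basept_in_X: "basept \<in> X t"
  unfolding basept_def by (intro pt_in_X posf_base form_base_bounds)

text \<open>Converts distance from the base point into a bound on the mass, which brings bounded
  sets within reach of \<open>cone_compact\<close>. Normalizing \<open>base\<close> goes in the
  right direction because its form is at most 1.\<close>

lemma mass_le_ker:
  assumes x: "x \<in> X t"
  shows "x 0 \<le> 2 * ker t x basept"
proof -
  note r = rep[OF x] and p = H_posf[OF rep(1)[OF x]]
  have "x 0 = mass (rep t x)"
    using X_0[OF r(1)] r(2) by simp
  also have "\<dots> \<le> 2 * form t (rep t x) base"
    using form_base[OF p t0 t1] by simp
  also have "\<dots> \<le> 2 * (form t (rep t x) base / sqrt (form t base base))"
  proof -
    have "form t (rep t x) base * sqrt (form t base base) \<le> form t (rep t x) base"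
      using form_nonneg[OF t0 t1 p posf_base] form_base_bounds by (intro mult_left_le) auto
    then show ?thesis
      using form_base_bounds by (simp add: field_simps)
  qed
  also have "\<dots> = 2 * ker t x basept"
    unfolding basept_def pt_def
    using ker_iota_kerf[OF x scale_in_H[OF posf_base form_base_bounds(1)]]
    by (simp add: kerf_def form_scale_right[OF t0 t1 posf_base p])
  finally show ?thesis .
qed

lemma ker_triangle:
  assumes "x \<in> X t" "y \<in> X t" "z \<in> X t"
  shows "ker t x z \<le> 2 * ker t x y * ker t y z"
proof -
  have d: "mdist K x z \<le> mdist K x y + mdist K y z"
    by (rule mdist_triangle) (use assms in auto)
  have "ker t x z = cosh (mdist K x z)"
    using assms by (simp add: cosh_mdist)
  also have "\<dots> \<le> cosh (mdist K x y + mdist K y z)"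
    using d by (subst cosh_real_nonneg_le_iff) auto
  also have "\<dots> \<le> 2 * cosh (mdist K x y) * cosh (mdist K y z)"
  proof -
    have "sinh (mdist K x y) * sinh (mdist K y z) \<le> cosh (mdist K x y) * cosh (mdist K y z)"
      by (intro mult_mono) (auto simp: sinh_le_cosh_real)
    then show ?thesis
      by (simp add: cosh_add)
  qed
  also have "\<dots> = 2 * ker t x y * ker t y z"
    using assms by (simp add: cosh_mdist)
  finally show ?thesis .
qed

lemma mass_le_ker':
  assumes x: "x \<in> X t" and y: "y \<in> X t"
  shows "x 0 \<le> 4 * ker t y basept * ker t x y"
proof -
  have "2 * ker t x basept \<le> 2 * (2 * ker t x y * ker t y basept)"
    using ker_triangle[OF x y basept_in_X] by simp
  then show ?thesis
    using mass_le_ker[OF x] by (simp add: mult_ac)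
qed

lemma limitin_kernelI:
  assumes l: "l \<in> X t" and s: "\<And>i. s i \<in> X t" and lim: "(\<lambda>i. ker t (s i) l) \<longlonglongrightarrow> 1"
  shows "limitin mtopology s l sequentially"
proof -
  have "(\<lambda>i. arcosh (ker t (s i) l)) \<longlonglongrightarrow> arcosh 1"
    by (rule tendsto_arcosh_strong[OF lim]) (simp_all add: ge1 l s)
  then show ?thesis
    unfolding limitin_metric_dist_null using l s by simp
qed

text \<open>The limit functional still has form 1, because the form converges on the diagonal; so
  the limit is a point of the space and not an ideal one.\<close>

lemma bounded_mass_compact:
  assumes x: "\<And>i. x i \<in> X t" and M: "\<And>i. x i 0 \<le> M"
  shows "\<exists>l\<in>X t. \<exists>r. strict_mono (r :: nat \<Rightarrow> nat) \<and> (\<lambda>i. ker t (x (r i)) l) \<longlonglongrightarrow> 1 \<and> (\<lambda>i. x (r i) 0) \<longlonglongrightarrow> l 0"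
proof -
  define \<mu> where "\<mu> i = rep t (x i)" for i
  have \<mu>: "\<mu> i \<in> H t" "x i = iota t (\<mu> i)" "posf (\<mu> i)" for i
    using rep[OF x[of i]] H_posf by (auto simp: \<mu>_def)
  have m0: "mass (\<mu> i) = x i 0" for i
    using X_0[OF \<mu>(1)] \<mu>(2) by simp
  obtain z r where z: "posf z" and r: "strict_mono (r :: nat \<Rightarrow> nat)" and
    zm: "(\<lambda>i. mass (\<mu> (r i))) \<longlonglongrightarrow> mass z" and
    z1: "\<And>\<rho>. posf \<rho> \<Longrightarrow> (\<lambda>i. form t (\<mu> (r i)) \<rho>) \<longlonglongrightarrow> form t z \<rho>" and
    z2: "(\<lambda>i. form t (\<mu> (r i)) (\<mu> (r i))) \<longlonglongrightarrow> form t z z"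
    using cone_compact[OF t0 t1, of \<mu> M] \<mu>(3) M m0 by auto
  have "(\<lambda>i. 1) \<longlonglongrightarrow> form t z z"
    using z2 H_form[OF \<mu>(1)] by simp
  then have zz: "form t z z = 1"
    using LIMSEQ_unique tendsto_const by metis
  then have zH: "z \<in> H t"
    using z by (simp add: H_def)
  show ?thesis
  proof (intro bexI exI conjI)
    show "strict_mono r" by (rule r)
    show "iota t z \<in> X t" by (rule iota_in_X[OF zH])
    show "(\<lambda>i. ker t (x (r i)) (iota t z)) \<longlonglongrightarrow> 1"
      using z1[OF z] by (simp add: \<mu>(2) ker_iota[OF \<mu>(1) zH] zz)
    show "(\<lambda>i. x (r i) 0) \<longlonglongrightarrow> iota t z 0"
      using zm by (simp add: m0 X_0[OF zH])
  qed
qed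

lemma bounded_mass_imp_compact:
  assumes A: "closedin mtopology A" and M: "\<And>x. x \<in> A \<Longrightarrow> x 0 \<le> M"
  shows "compactin mtopology A"
  unfolding compactin_sequentially
proof (intro conjI allI impI)
  show AX: "A \<subseteq> X t"
    using closedin_subset[OF A] by simp
  fix s :: "nat \<Rightarrow> nat \<Rightarrow> real" assume s: "range s \<subseteq> A"
  then have sX: "s i \<in> X t" and sA: "s i \<in> A" for i
    using AX by auto
  obtain l r where l: "l \<in> X t" "strict_mono (r :: nat \<Rightarrow> nat)" "(\<lambda>i. ker t (s (r i)) l) \<longlonglongrightarrow> 1"
    using bounded_mass_compact[of s M] sX sA M by blast
  have lim: "limitin mtopology (s \<circ> r) l sequentially"
    unfolding o_def by (rule limitin_kernelI[OF l(1) sX l(3)])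
  moreover have "range (s \<circ> r) \<subseteq> A"
    using sA by auto
  ultimately have "l \<in> A"
    using A unfolding metric_closedin_iff_sequentially_closed by blast
  then show "\<exists>l r. l \<in> A \<and> strict_mono r \<and> limitin mtopology (s \<circ> r) l sequentially"
    using l lim by blast
qed

lemma ker_le_of_mdist:
  assumes "x \<in> X t" "y \<in> X t" "mdist K x y \<le> r"
  shows "ker t x y \<le> cosh r"
proof -
  have "cosh (mdist K x y) \<le> cosh r"
    using assms(3) order_trans[OF mdist_nonneg assms(3)] by (subst cosh_real_nonneg_le_iff) auto
  then show ?thesis
    by (simp add: cosh_mdist assms(1,2))
qed

lemma proper_space_K: "proper_space K"
  unfolding proper_space_def mtopology_kernel_space
proof (intro ballI allI)
  fix x r assume "x \<in> mspace K"
  then have x: "x \<in> X t"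
    by simp
  show "compactin mtopology (mcball_of K x r)"
  proof (rule bounded_mass_imp_compact)
    show "closedin mtopology (mcball_of K x r)"
      unfolding kernel_space_def mcball_of by simp
    show "y 0 \<le> 4 * ker t x basept * cosh r" if "y \<in> mcball_of K x r" for y
    proof -
      have y: "y \<in> X t" "mdist K x y \<le> r"
        using that by auto
      have "y 0 \<le> 4 * ker t x basept * ker t y x"
        by (rule mass_le_ker'[OF y(1) x])
      also have "\<dots> \<le> 4 * ker t x basept * cosh r"
        using ker_le_of_mdist[OF x y] sym[OF x y(1)] ge1[OF x basept_in_X] by (intro mult_left_mono) auto
      finally show ?thesis .
    qed
  qed
qed

end

section \<open>The action of the hyperbolic isometry group\<close>

abbreviation hyp_isometries :: "nat \<Rightarrow> ((nat \<Rightarrow> real) \<Rightarrow> nat \<Rightarrow> real) monoid" where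
  "hyp_isometries n \<equiv> isometry_group (hyperbolic_space n)"

context hyp_kernel
begin

lemma isometry_groupD:
  assumes "g \<in> carrier (isometry_group K)"
  shows "g \<in> Bij X" "\<And>x. x \<in> X \<Longrightarrow> g x \<in> X" "\<And>x y. x \<in> X \<Longrightarrow> y \<in> X \<Longrightarrow> B (g x) (g y) = B x y"
    "\<And>x. x \<in> X \<Longrightarrow> \<exists>y\<in>X. g y = x"
proof -
  show g: "g \<in> Bij X"
    using assms by (simp add: isometry_group_def)
  then have b: "bij_betw g X X"
    by (simp add: Bij_def)
  then show gX: "g x \<in> X" if "x \<in> X" for x
    using that by (auto simp: bij_betw_def)
  show "B (g x) (g y) = B x y" if "x \<in> X" "y \<in> X" for x y
    using assms that by (simp add: isometry_group_def flip: cosh_mdist[OF that] cosh_mdist[OF gX gX, OF that])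
  show "\<exists>y\<in>X. g y = x" if "x \<in> X" for x
  proof -
    have "x \<in> g ` X"
      using b that by (simp add: bij_betw_def)
    then show ?thesis
      by blast
  qed
qed

lemma isometry_groupI:
  assumes "g \<in> Bij X" "\<And>x y. x \<in> X \<Longrightarrow> y \<in> X \<Longrightarrow> B (g x) (g y) = B x y"
  shows "g \<in> carrier (isometry_group K)"
proof -
  have "g x \<in> X" if "x \<in> X" for x
    using assms(1) that by (auto simp: Bij_def bij_betw_def)
  then show ?thesis
    using assms by (simp add: isometry_group_def mdist_kernel_space)
qed

lemma isometry_group_mult: "f \<in> carrier (isometry_group K) \<Longrightarrow> g \<in> carrier (isometry_group K) \<Longrightarrow>
    f \<otimes>\<^bsub>isometry_group K\<^esub> g = compose X f g"
  using isometry_groupD(1)[of f] isometry_groupD(1)[of g] by (simp add: isometry_group_def BijGroup_def)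

lemma isometry_group_one: "\<one>\<^bsub>isometry_group K\<^esub> = (\<lambda>x\<in>X. x)"
  by (simp add: isometry_group_def BijGroup_def)

end

section \<open>Linear extensions of isometries and conformal boundary maps\<close>

context light_sphere
begin

abbreviation "G \<equiv> hyp_isometries n"

lemmas G_D = hyperboloid.isometry_groupD[of _ n, folded kernel_space_hyperboloid]
lemmas G_I = hyperboloid.isometry_groupI[of _ n, folded kernel_space_hyperboloid]
lemmas G_mult = hyperboloid.isometry_group_mult[of _ n, folded kernel_space_hyperboloid]
lemmas G_one = hyperboloid.isometry_group_one[of n, folded kernel_space_hyperboloid]

lemma group_G: "group G"
  by (rule group_isometry_group)

definition origin :: "nat \<Rightarrow> real" where
  "origin = (\<lambda>i. if i = 0 then 1 else 0)"

text \<open>Together with \<open>origin\<close> these points form a basis of Lorentz space inside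
  the hyperboloid, so that a linear map can be read off from the values of an isometry.\<close>

definition axis :: "nat \<Rightarrow> nat \<Rightarrow> real" where
  "axis i = (\<lambda>j. if j = 0 then sqrt 2 else if j = i then 1 else 0)"

lemma lorentz_origin: "lorentz n x origin = x 0" "lorentz n origin x = x 0"
  by (simp_all add: lorentz_def origin_def)

lemma lorentz_axis:
  assumes "i \<in> {1..n}"
  shows "lorentz n x (axis i) = sqrt 2 * x 0 - x i" "lorentz n (axis i) x = sqrt 2 * x 0 - x i"
proof -
  have "(\<Sum>j=1..n. x j * axis i j) = (\<Sum>j=1..n. if j = i then x i else 0)"
    by (intro sum.cong) (auto simp: axis_def)
  then show "lorentz n x (axis i) = sqrt 2 * x 0 - x i"
    using assms by (simp add: lorentz_def axis_def mult.commute)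
  then show "lorentz n (axis i) x = sqrt 2 * x 0 - x i"
    by (simp add: lorentz_commute)
qed

lemma origin_in_hyperboloid: "origin \<in> hyperboloid n"
  by (simp add: hyperboloid_def lorentz_origin) (simp add: origin_def)

lemma axis_in_hyperboloid: "i \<in> {1..n} \<Longrightarrow> axis i \<in> hyperboloid n"
  by (simp add: hyperboloid_def lorentz_axis) (simp add: axis_def)

lemma lorentz_unique:
  assumes "\<And>v. v \<in> hyperboloid n \<Longrightarrow> lorentz n x v = lorentz n y v" "\<And>i. i > n \<Longrightarrow> x i = y i"
  shows "x = y"
proof
  fix i
  have 0: "x 0 = y 0"
    using assms(1)[OF origin_in_hyperboloid] by (simp add: lorentz_origin)
  show "x i = y i"
  proof (cases "i \<in> {1..n}")
    case True
    then show ?thesis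
      using assms(1)[OF axis_in_hyperboloid[OF True]] 0 by (simp add: lorentz_axis[OF True])
  next
    case False
    then show ?thesis
      using 0 assms(2)[of i] by (cases "i = 0") auto
  qed
qed

text \<open>The linear extension of \<open>g\<close>: the coordinates of \<open>x\<close> in the
  basis of \<open>origin\<close> and the points \<open>axis i\<close>, put on the images of the
  basis.\<close>

definition lift :: "((nat \<Rightarrow> real) \<Rightarrow> nat \<Rightarrow> real) \<Rightarrow> (nat \<Rightarrow> real) \<Rightarrow> nat \<Rightarrow> real" where
  "lift g x = (\<lambda>j. (x 0 - sqrt 2 * (\<Sum>i=1..n. x i)) * g origin j + (\<Sum>i=1..n. x i * g (axis i) j))"

lemma lorentz_lift:
  "lorentz n (lift g x) y = (x 0 - sqrt 2 * (\<Sum>i=1..n. x i)) * lorentz n (g origin) y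
     + (\<Sum>i=1..n. x i * lorentz n (g (axis i)) y)"
proof -
  define a where "a = x 0 - sqrt 2 * (\<Sum>i=1..n. x i)"
  have L: "lift g x j = a * g origin j + (\<Sum>i=1..n. x i * g (axis i) j)" for j
    by (simp only: lift_def a_def)
  have "(\<Sum>j=1..n. lift g x j * y j) = a * (\<Sum>j=1..n. g origin j * y j) + (\<Sum>i=1..n. x i * (\<Sum>j=1..n. g (axis i) j * y j))"
  proof -
    have "(\<Sum>j=1..n. lift g x j * y j) = (\<Sum>j=1..n. a * (g origin j * y j)) + (\<Sum>j=1..n. \<Sum>i=1..n. x i * (g (axis i) j * y j))"
      unfolding sum.distrib[symmetric]
      by (intro sum.cong refl) (simp add: L distrib_right sum_distrib_right mult.assoc)
    also have "(\<Sum>j=1..n. \<Sum>i=1..n. x i * (g (axis i) j * y j)) = (\<Sum>i=1..n. \<Sum>j=1..n. x i * (g (axis i) j * y j))"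
      by (rule sum.swap)
    finally show ?thesis
      by (simp add: sum_distrib_left)
  qed
  moreover have "lift g x 0 * y 0 = a * (g origin 0 * y 0) + (\<Sum>i=1..n. x i * (g (axis i) 0 * y 0))"
    by (simp add: L distrib_right sum_distrib_right mult.assoc)
  ultimately show ?thesis
    unfolding a_def[symmetric] lorentz_def
    by (simp add: right_diff_distrib sum_subtractf)
qed

lemma lorentz_expand:
  "lorentz n x y = (x 0 - sqrt 2 * (\<Sum>i=1..n. x i)) * lorentz n origin y + (\<Sum>i=1..n. x i * lorentz n (axis i) y)"
proof -
  have "(\<Sum>i=1..n. x i * lorentz n (axis i) y) = (\<Sum>i=1..n. x i * (sqrt 2 * y 0) - x i * y i)"
    by (intro sum.cong refl) (simp add: lorentz_axis right_diff_distrib)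
  also have "\<dots> = (\<Sum>i=1..n. x i) * (sqrt 2 * y 0) - (\<Sum>i=1..n. x i * y i)"
    by (simp only: sum_subtractf sum_distrib_right)
  finally have "(\<Sum>i=1..n. x i * lorentz n (axis i) y) = (\<Sum>i=1..n. x i) * (sqrt 2 * y 0) - (\<Sum>i=1..n. x i * y i)" .
  then show ?thesis
    unfolding lorentz_origin lorentz_def[of n x y] by (simp only:) (simp add: algebra_simps)
qed

lemma lorentz_lift_image:
  assumes g: "g \<in> carrier G" and v: "v \<in> hyperboloid n"
  shows "lorentz n (lift g x) (g v) = lorentz n x v"
  unfolding lorentz_lift lorentz_expand[of x v]
  by (simp add: G_D(3)[OF g] origin_in_hyperboloid axis_in_hyperboloid v)

lemma lorentz_lift_lift:
  assumes g: "g \<in> carrier G"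
  shows "lorentz n (lift g x) (lift g y) = lorentz n x y"
proof -
  have 1: "lorentz n (g v) (lift g x) = lorentz n v x" if "v \<in> hyperboloid n" for v x
    using lorentz_lift_image[OF g that] by (simp add: lorentz_commute)
  show ?thesis
    unfolding lorentz_lift lorentz_expand[of x y] by (simp add: 1 origin_in_hyperboloid axis_in_hyperboloid)
qed

lemma lift_support:
  assumes g: "g \<in> carrier G" and j: "j > n"
  shows "lift g x j = 0"
proof -
  have "g v j = 0" if "v \<in> hyperboloid n" for v
    using G_D(2)[OF g that] j by (simp add: hyperboloid_def)
  then show ?thesis
    by (simp add: lift_def origin_in_hyperboloid axis_in_hyperboloid)
qed

text \<open>The points \<open>g v\<close> exhaust the hyperboloid, which separates vectors. Boundary
  maps obtained in other ways are recognized as lifts through this criterion.\<close>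

lemma lift_unique:
  assumes g: "g \<in> carrier G" and x: "\<And>v. v \<in> hyperboloid n \<Longrightarrow> lorentz n y (g v) = lorentz n x v"
    and supp: "\<And>j. j > n \<Longrightarrow> y j = 0"
  shows "y = lift g x"
proof (rule lorentz_unique)
  fix w assume "w \<in> hyperboloid n"
  then obtain v where "v \<in> hyperboloid n" "g v = w"
    using G_D(4)[OF g] by blast
  then show "lorentz n y w = lorentz n (lift g x) w"
    using x lorentz_lift_image[OF g] by metis
qed (use supp lift_support[OF g] in auto)

definition sg :: "((nat \<Rightarrow> real) \<Rightarrow> nat \<Rightarrow> real) \<Rightarrow> (nat \<Rightarrow> real) \<Rightarrow> nat \<Rightarrow> real" where
  "sg a \<xi> = (\<lambda>i. a \<xi> i / a \<xi> 0)"

text \<open>A boundary map together with its conformal factor: \<open>a \<xi>\<close> is the light vector whose time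
  coordinate is the factor and whose ray is the image of \<open>\<xi>\<close>.\<close>

definition conf :: "((nat \<Rightarrow> real) \<Rightarrow> nat \<Rightarrow> real) \<Rightarrow> bool" where
  "conf a \<longleftrightarrow> (\<forall>\<xi>\<in>S. 0 < a \<xi> 0 \<and> sg a \<xi> \<in> S) \<and> (\<forall>\<xi>\<in>S. \<forall>\<eta>\<in>S. lorentz n (a \<xi>) (a \<eta>) = lorentz n \<xi> \<eta>) \<and>
     (\<exists>M. \<forall>\<xi>\<in>S. a \<xi> 0 \<le> M)"

lemma conf_pos: "conf a \<Longrightarrow> \<xi> \<in> S \<Longrightarrow> 0 < a \<xi> 0"
  and conf_sg: "conf a \<Longrightarrow> \<xi> \<in> S \<Longrightarrow> sg a \<xi> \<in> S"
  and conf_lorentz: "conf a \<Longrightarrow> \<xi> \<in> S \<Longrightarrow> \<eta> \<in> S \<Longrightarrow> lorentz n (a \<xi>) (a \<eta>) = lorentz n \<xi> \<eta>"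
  by (auto simp: conf_def)

lemma lorentz_scale_left: "lorentz n (\<lambda>i. x i / c) y = lorentz n x y / c"
  by (simp add: lorentz_def diff_divide_distrib sum_divide_distrib)

lemma lorentz_scale_right: "lorentz n y (\<lambda>i. x i / c) = lorentz n y x / c"
  by (simp add: lorentz_def diff_divide_distrib sum_divide_distrib)

lemma lorentz_sg: "conf a \<Longrightarrow> \<xi> \<in> S \<Longrightarrow> \<eta> \<in> S \<Longrightarrow>
    lorentz n \<xi> \<eta> = a \<xi> 0 * a \<eta> 0 * lorentz n (sg a \<xi>) (sg a \<eta>)"
  using conf_pos[of a \<xi>] conf_pos[of a \<eta>] conf_lorentz[of a \<xi> \<eta>]
  by (simp add: sg_def lorentz_scale_left lorentz_scale_right)

text \<open>Weak forms of the bounds \<open>exp (- d)\<close> and \<open>exp d\<close>, with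
  \<open>d\<close> the distance of \<open>y\<close> from the origin and
  \<open>y 0 = cosh d\<close>.\<close>

lemma lorentz_S_pos:
  assumes x: "x \<in> S" and y: "y \<in> hyperboloid n"
  shows "0 < lorentz n x y" "lorentz n x y \<le> 2 * y 0" "1 / (2 * y 0) \<le> lorentz n x y"
proof -
  define q where "q = (\<Sum>i=1..n. x i * y i)"
  have y1: "y 0 > 0" "(\<Sum>i=1..n. (y i)\<^sup>2) = (y 0)\<^sup>2 - 1"
    using y by (auto simp: hyperboloid_def lorentz_def power2_eq_square)
  have "(\<Sum>i=1..n. (x i)\<^sup>2) = 1"
    using dot_self[OF x] by (simp add: dot_def power2_eq_square)
  then have q: "q\<^sup>2 \<le> (y 0)\<^sup>2 - 1"
    using Cauchy_Schwarz_ineq_sum[of x y "{1..n}"] y1 by (simp add: q_def)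
  then have "q\<^sup>2 < (y 0)\<^sup>2"
    by simp
  then have qy: "\<bar>q\<bar> < y 0"
    using y1(1) by (metis abs_of_pos power2_less_imp_less power2_abs less_imp_le)
  have l: "lorentz n x y = y 0 - q"
    using x by (simp add: lorentz_def S_def q_def)
  show "0 < lorentz n x y" "lorentz n x y \<le> 2 * y 0"
    using qy by (auto simp: l)
  have "1 \<le> (y 0 - q) * (y 0 + q)"
    using q by (simp add: algebra_simps power2_eq_square)
  also have "\<dots> \<le> (y 0 - q) * (2 * y 0)"
    using qy by (intro mult_left_mono) auto
  finally show "1 / (2 * y 0) \<le> lorentz n x y"
    using y1(1) by (simp add: l field_simps)
qed

text \<open>As a function of a light direction this is the conformal factor of \<open>g\<close>, an
  exponentiated Busemann function at the preimage of the origin.\<close>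

lemma lift_0_eq:
  assumes g: "g \<in> carrier G" and y: "y \<in> hyperboloid n" "g y = origin"
  shows "lift g x 0 = lorentz n x y"
  using lorentz_lift_image[OF g y(1), of x] y(2) by (simp add: lorentz_origin)

lemma conf_lift:
  assumes g: "g \<in> carrier G"
  shows "conf (lift g)"
proof -
  obtain y where y: "y \<in> hyperboloid n" "g y = origin"
    using G_D(4)[OF g origin_in_hyperboloid] by blast
  note l0 = lift_0_eq[OF g y]
  have pos: "0 < lift g \<xi> 0" if "\<xi> \<in> S" for \<xi>
    unfolding l0 using lorentz_S_pos(1)[OF that y(1)] .
  have "sg (lift g) \<xi> \<in> S" if "\<xi> \<in> S" for \<xi>
  proof -
    have "lorentz n (sg (lift g) \<xi>) (sg (lift g) \<xi>) = 0"
      using that by (simp add: sg_def lorentz_scale_left lorentz_scale_right lorentz_lift_lift[OF g] lorentz_S_self)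
    then show ?thesis
      using pos[OF that] lift_support[OF g] by (simp add: S_def) (simp add: sg_def)
  qed
  moreover have "lift g \<xi> 0 \<le> 2 * y 0" if "\<xi> \<in> S" for \<xi>
    unfolding l0 by (rule lorentz_S_pos(2)[OF that y(1)])
  ultimately show ?thesis
    unfolding conf_def using pos lorentz_lift_lift[OF g] by blast
qed

text \<open>Composition of boundary maps; the multiplication by \<open>b \<xi> 0\<close> is the
  chain rule for conformal factors.\<close>

definition cmp where
  "cmp a b \<xi> = (\<lambda>i. b \<xi> 0 * a (sg b \<xi>) i :: real)" for a :: "(nat \<Rightarrow> real) \<Rightarrow> nat \<Rightarrow> real"

lemma sg_cmp: "0 < b \<xi> 0 \<Longrightarrow> sg (cmp a b) \<xi> = sg a (sg b \<xi>)"
  by (simp add: sg_def cmp_def)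

lemma lorentz_scale: "lorentz n (\<lambda>i. c * x i) (\<lambda>i. d * y i) = c * d * lorentz n x y"
proof -
  have "(\<Sum>i=1..n. (c * x i) * (d * y i)) = c * d * (\<Sum>i=1..n. x i * y i)"
    unfolding sum_distrib_left by (intro sum.cong refl) (simp add: mult_ac)
  then show ?thesis
    by (simp add: lorentz_def right_diff_distrib mult_ac)
qed

lemma conf_cmp:
  assumes a: "conf a" and b: "conf b"
  shows "conf (cmp a b)"
proof -
  obtain M N where M: "\<forall>\<xi>\<in>S. a \<xi> 0 \<le> M" and N: "\<forall>\<xi>\<in>S. b \<xi> 0 \<le> N"
    using a b unfolding conf_def by blast
  have "cmp a b \<xi> 0 \<le> N * M" if "\<xi> \<in> S" for \<xi>
    unfolding cmp_def using M N that conf_pos[OF a conf_sg[OF b that]] conf_pos[OF b that] conf_sg[OF b that]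
    by (intro mult_mono) (auto intro: order_trans less_imp_le)
  moreover have "lorentz n (cmp a b \<xi>) (cmp a b \<eta>) = lorentz n \<xi> \<eta>" if "\<xi> \<in> S" "\<eta> \<in> S" for \<xi> \<eta>
    unfolding cmp_def lorentz_scale lorentz_sg[OF b that] conf_lorentz[OF a conf_sg[OF b that(1)] conf_sg[OF b that(2)]]
    by simp
  moreover have "0 < cmp a b \<xi> 0" if "\<xi> \<in> S" for \<xi>
    unfolding cmp_def using conf_pos[OF a conf_sg[OF b that]] conf_pos[OF b that] by simp
  moreover have "sg (cmp a b) \<xi> \<in> S" if "\<xi> \<in> S" for \<xi>
    using sg_cmp[of b \<xi> a, OF conf_pos[OF b that]] conf_sg[OF a conf_sg[OF b that]] by simp
  ultimately show ?thesis
    unfolding conf_def by blast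
qed

lemma lift_mult:
  assumes g: "g \<in> carrier G" and h: "h \<in> carrier G" and \<xi>: "\<xi> \<in> S"
  shows "cmp (lift g) (lift h) \<xi> = lift (g \<otimes>\<^bsub>G\<^esub> h) \<xi>"
proof (rule lift_unique)
  show "g \<otimes>\<^bsub>G\<^esub> h \<in> carrier G"
    using group_G g h by (simp add: group.is_monoid monoid.m_closed)
  show "cmp (lift g) (lift h) \<xi> j = 0" if "j > n" for j
    by (simp add: cmp_def lift_support[OF g that])
  fix v assume v: "v \<in> hyperboloid n"
  have "lorentz n (cmp (lift g) (lift h) \<xi>) (g (h v)) = lift h \<xi> 0 * lorentz n (lift g (sg (lift h) \<xi>)) (g (h v))"
    using lorentz_scale[of "lift h \<xi> 0" "lift g (sg (lift h) \<xi>)" 1] by (simp add: cmp_def)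
  also have "\<dots> = lift h \<xi> 0 * lorentz n (sg (lift h) \<xi>) (h v)"
    by (simp add: lorentz_lift_image[OF g] G_D(2)[OF h] v)
  also have "\<dots> = lorentz n (lift h \<xi>) (h v)"
    using conf_pos[OF conf_lift[OF h] \<xi>] by (simp add: sg_def lorentz_scale_left)
  also have "\<dots> = lorentz n \<xi> v"
    by (rule lorentz_lift_image[OF h v])
  finally show "lorentz n (cmp (lift g) (lift h) \<xi>) ((g \<otimes>\<^bsub>G\<^esub> h) v) = lorentz n \<xi> v"
    using v by (simp add: G_mult[OF g h] compose_eq)
qed

lemma lift_one:
  assumes \<xi>: "\<xi> \<in> S"
  shows "lift \<one>\<^bsub>G\<^esub> \<xi> = \<xi>"
proof (rule lift_unique[symmetric])
  show "\<one>\<^bsub>G\<^esub> \<in> carrier G"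
    using group_G by (simp add: group.is_monoid)
qed (use \<xi> in \<open>auto simp: G_one S_def\<close>)

definition push :: "real \<Rightarrow> ((nat \<Rightarrow> real) \<Rightarrow> nat \<Rightarrow> real) \<Rightarrow> (((nat \<Rightarrow> real) \<Rightarrow> real) \<Rightarrow> real) \<Rightarrow> ((nat \<Rightarrow> real) \<Rightarrow> real) \<Rightarrow> real" where
  "push t a \<mu> = (\<lambda>\<phi>. \<mu> (\<lambda>\<xi>. a \<xi> 0 powr t * \<phi> (sg a \<xi>)))"

lemma Bd_push:
  assumes a: "conf a" and t: "0 \<le> t" and \<phi>: "\<phi> \<in> Bd"
  shows "(\<lambda>\<xi>. a \<xi> 0 powr t * \<phi> (sg a \<xi>)) \<in> Bd"
proof (rule Bd_mult)
  obtain M where M: "\<forall>\<xi>\<in>S. a \<xi> 0 \<le> M"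
    using a unfolding conf_def by blast
  then have "\<bar>a \<xi> 0\<bar> \<le> M" if "\<xi> \<in> S" for \<xi>
    using conf_pos[OF a that] that by auto
  then have "(\<lambda>\<xi>. a \<xi> 0) \<in> Bd"
    by (rule BdI)
  then show "(\<lambda>\<xi>. a \<xi> 0 powr t) \<in> Bd"
    using conf_pos[OF a] t by (intro Bd_powr) (auto intro: less_imp_le)
  obtain C where "\<forall>x\<in>S. \<bar>\<phi> x\<bar> \<le> C"
    using \<phi> by (auto simp: Bd_def)
  then show "(\<lambda>\<xi>. \<phi> (sg a \<xi>)) \<in> Bd"
    using conf_sg[OF a] by (intro BdI[of _ C]) auto
qed

lemma posf_push:
  assumes a: "conf a" and t: "0 \<le> t" and \<mu>: "posf \<mu>"
  shows "posf (push t a \<mu>)"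
  unfolding posf_def push_def
proof (intro conjI ballI allI impI)
  fix \<phi> \<psi> assume "\<phi> \<in> Bd" "\<psi> \<in> Bd"
  then show "\<mu> (\<lambda>\<xi>. a \<xi> 0 powr t * (\<phi> (sg a \<xi>) + \<psi> (sg a \<xi>))) =
      \<mu> (\<lambda>\<xi>. a \<xi> 0 powr t * \<phi> (sg a \<xi>)) + \<mu> (\<lambda>\<xi>. a \<xi> 0 powr t * \<psi> (sg a \<xi>))"
    using posf_add[OF \<mu> Bd_push[OF a t] Bd_push[OF a t]] by (simp add: distrib_left)
next
  fix c \<phi> assume "\<phi> \<in> Bd"
  then show "\<mu> (\<lambda>\<xi>. a \<xi> 0 powr t * (c * \<phi> (sg a \<xi>))) = c * \<mu> (\<lambda>\<xi>. a \<xi> 0 powr t * \<phi> (sg a \<xi>))"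
    using posf_cmult[OF \<mu> Bd_push[OF a t], of \<phi> c] by (simp add: mult_ac)
next
  fix \<phi> assume "\<phi> \<in> Bd" and "\<forall>x\<in>S. 0 \<le> \<phi> x"
  then show "0 \<le> \<mu> (\<lambda>\<xi>. a \<xi> 0 powr t * \<phi> (sg a \<xi>))"
    using conf_sg[OF a] by (intro posf_nonneg[OF \<mu> Bd_push[OF a t]]) auto
qed

lemma form_push_left: "form t (push t a \<mu>) \<nu> = \<mu> (\<lambda>\<xi>. a \<xi> 0 powr t * form t (dir (sg a \<xi>)) \<nu>)"
  by (simp add: form_def push_def dir_def)

text \<open>Raise \<open>lorentz_sg\<close> to the power \<open>t\<close>: the two conformal factors
  it produces are exactly the weights in the two push-forwards.\<close>

lemma form_push_push:
  assumes a: "conf a" and t: "0 < t" "t \<le> 1" and \<mu>: "posf \<mu>" and \<nu>: "posf \<nu>"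
  shows "form t (push t a \<mu>) (push t a \<nu>) = form t \<mu> \<nu>"
proof -
  have 1: "a \<xi> 0 powr t * form t (dir (sg a \<xi>)) (push t a \<nu>) = \<nu> (\<lambda>\<eta>. lorentz n \<xi> \<eta> powr t)" if \<xi>: "\<xi> \<in> S" for \<xi>
  proof -
    have "a \<xi> 0 powr t * form t (dir (sg a \<xi>)) (push t a \<nu>)
      = \<nu> (\<lambda>\<eta>. a \<xi> 0 powr t * (a \<eta> 0 powr t * lorentz n (sg a \<xi>) (sg a \<eta>) powr t))"
      unfolding form_dir_left push_def
      by (rule posf_cmult[OF \<nu>, symmetric]) (intro Bd_push[OF a] Bd_kernel' conf_sg[OF a] \<xi>, use t in auto)
    also have "\<dots> = \<nu> (\<lambda>\<eta>. lorentz n \<xi> \<eta> powr t)"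
    proof (rule posf_cong[OF \<nu>, symmetric])
      show "(\<lambda>\<eta>. lorentz n \<xi> \<eta> powr t) \<in> Bd"
        using \<xi> t by (intro Bd_kernel') auto
      show "lorentz n \<xi> \<eta> powr t = a \<xi> 0 powr t * (a \<eta> 0 powr t * lorentz n (sg a \<xi>) (sg a \<eta>) powr t)" if \<eta>: "\<eta> \<in> S" for \<eta>
        unfolding lorentz_sg[OF a \<xi> \<eta>]
        using conf_pos[OF a \<xi>] conf_pos[OF a \<eta>] lorentz_S_nonneg[OF conf_sg[OF a \<xi>] conf_sg[OF a \<eta>]]
        by (simp add: powr_mult)
    qed
    finally show ?thesis .
  qed
  show ?thesis
    unfolding form_push_left form_def[of t \<mu> \<nu>]
    by (rule posf_cong[OF \<mu>, symmetric]) (simp_all add: 1 Bd_form_section t \<nu>)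
qed

lemma form_push_dir:
  assumes a: "conf a" and t: "0 < t" "t \<le> 1" and \<mu>: "posf \<mu>" and \<xi>: "\<xi> \<in> S"
  shows "a \<xi> 0 powr t * form t (push t a \<mu>) (dir (sg a \<xi>)) = form t \<mu> (dir \<xi>)"
proof -
  have "posf (push t a \<mu>)"
    using posf_push[OF a _ \<mu>] t by simp
  have "scale (a \<xi> 0 powr t) (dir (sg a \<xi>)) = push t a (dir \<xi>)"
    by (simp add: scale_def dir_def push_def)
  then have "a \<xi> 0 powr t * form t (push t a \<mu>) (dir (sg a \<xi>)) = form t (push t a \<mu>) (push t a (dir \<xi>))"
    using form_scale_right[OF t posf_dir[OF conf_sg[OF a \<xi>]] \<open>posf (push t a \<mu>)\<close>] by metis
  also have "\<dots> = form t \<mu> (dir \<xi>)"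
    by (rule form_push_push[OF a t \<mu> posf_dir[OF \<xi>]])
  finally show ?thesis .
qed

lemma push_cong:
  assumes "conf a" "0 \<le> t" "posf \<mu>" "\<And>\<xi>. \<xi> \<in> S \<Longrightarrow> a \<xi> = b \<xi>" "\<phi> \<in> Bd"
  shows "push t a \<mu> \<phi> = push t b \<mu> \<phi>"
  unfolding push_def by (rule posf_cong[OF assms(3) Bd_push[OF assms(1,2,5)]]) (simp add: assms(4) sg_def)

lemma iota_cong: "(\<And>\<phi>. \<phi> \<in> Bd \<Longrightarrow> \<mu> \<phi> = \<nu> \<phi>) \<Longrightarrow> iota t \<mu> = iota t \<nu>"
  by (rule ext) (auto simp: iota_def Let_def Bd_coord Bd_mon)

text \<open>Defined for every conformal boundary map and not just for lifts: the boundary map of an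
  isometry of \<open>X t\<close> is only recognized as a lift after it has been made to act on the
  hyperboloid.\<close>

definition trans :: "real \<Rightarrow> ((nat \<Rightarrow> real) \<Rightarrow> nat \<Rightarrow> real) \<Rightarrow> (nat \<Rightarrow> real) \<Rightarrow> nat \<Rightarrow> real" where
  "trans t a = (\<lambda>x\<in>X t. iota t (push t a (rep t x)))"

definition act :: "real \<Rightarrow> ((nat \<Rightarrow> real) \<Rightarrow> nat \<Rightarrow> real) \<Rightarrow> (nat \<Rightarrow> real) \<Rightarrow> nat \<Rightarrow> real" where
  "act t g = trans t (lift g)"

end

context light_sphere_param
begin

lemma push_H: "conf a \<Longrightarrow> \<mu> \<in> H t \<Longrightarrow> push t a \<mu> \<in> H t"
  using t0 t1 by (simp add: H_def posf_push form_push_push)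

lemma trans_in_X: "conf a \<Longrightarrow> x \<in> X t \<Longrightarrow> trans t a x \<in> X t"
  unfolding trans_def by (simp add: iota_in_X push_H rep)

lemma trans_iota:
  assumes a: "conf a" and \<mu>: "\<mu> \<in> H t"
  shows "trans t a (iota t \<mu>) = iota t (push t a \<mu>)"
proof -
  note x = iota_in_X[OF \<mu>]
  note r = rep[OF x]
  have "form t (rep t (iota t \<mu>)) \<mu> = 1"
    using kerf_iota[OF \<mu> H_posf[OF \<mu>]] H_form[OF \<mu>] by (simp add: kerf_def)
  then show ?thesis
    unfolding trans_def using x
    by (simp, intro form_eq_iota[OF t0 t1])
      (simp_all add: H_posf[OF push_H[OF a r(1)]] H_posf[OF push_H[OF a \<mu>]] H_form[OF push_H[OF a r(1)]]
        H_form[OF push_H[OF a \<mu>]] form_push_push[OF a t0 t1 H_posf[OF r(1)] H_posf[OF \<mu>]])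
qed

lemma ker_trans:
  assumes a: "conf a" and x: "x \<in> X t" and y: "y \<in> X t"
  shows "ker t (trans t a x) (trans t a y) = ker t x y"
proof -
  obtain \<mu> \<nu> where \<mu>: "\<mu> \<in> H t" "x = iota t \<mu>" and \<nu>: "\<nu> \<in> H t" "y = iota t \<nu>"
    using x y by (auto elim!: XE)
  show ?thesis
    unfolding \<mu> \<nu> trans_iota[OF a \<mu>(1)] trans_iota[OF a \<nu>(1)] ker_iota[OF push_H[OF a \<mu>(1)] push_H[OF a \<nu>(1)]]
      ker_iota[OF \<mu>(1) \<nu>(1)] by (rule form_push_push[OF a t0 t1 H_posf[OF \<mu>(1)] H_posf[OF \<nu>(1)]])
qed

lemma kerf_trans:
  assumes a: "conf a" and x: "x \<in> X t" and \<xi>: "\<xi> \<in> S"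
  shows "a \<xi> 0 powr t * kerf t (trans t a x) (dir (sg a \<xi>)) = kerf t x (dir \<xi>)"
proof -
  obtain \<mu> where \<mu>: "\<mu> \<in> H t" "x = iota t \<mu>"
    using x by (auto elim!: XE)
  show ?thesis
    unfolding \<mu> trans_iota[OF a \<mu>(1)] kerf_iota[OF push_H[OF a \<mu>(1)] posf_dir[OF conf_sg[OF a \<xi>]]]
      kerf_iota[OF \<mu>(1) posf_dir[OF \<xi>]] by (rule form_push_dir[OF a t0 t1 H_posf[OF \<mu>(1)] \<xi>])
qed

text \<open>Points are determined by their products with ideal points: integrating the hypothesis
  against a representative of \<open>x\<close> shows that \<open>trans t a x\<close> and
  \<open>y\<close> have product 1. Composition, identity and the case \<open>t = 1\<close> all
  follow from this.\<close>

lemma trans_unique: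
  assumes a: "conf a" and x: "x \<in> X t" and y: "y \<in> X t"
    and bd: "\<And>\<xi>. \<xi> \<in> S \<Longrightarrow> a \<xi> 0 powr t * kerf t y (dir (sg a \<xi>)) = kerf t x (dir \<xi>)"
  shows "y = trans t a x"
proof -
  define \<mu> \<nu> where "\<mu> = rep t x" and "\<nu> = rep t y"
  have \<mu>: "\<mu> \<in> H t" "x = iota t \<mu>" and \<nu>: "\<nu> \<in> H t" "y = iota t \<nu>"
    using rep[OF x] rep[OF y] by (auto simp: \<mu>_def \<nu>_def)
  note p = H_posf[OF \<mu>(1)] H_posf[OF \<nu>(1)]
  have "ker t (trans t a x) y = form t (push t a \<mu>) \<nu>"
    using \<mu> \<nu> by (simp add: trans_iota[OF a] ker_iota push_H[OF a])
  also have "\<dots> = \<mu> (\<lambda>\<xi>. a \<xi> 0 powr t * form t (dir (sg a \<xi>)) \<nu>)"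
    by (rule form_push_left)
  also have "\<dots> = \<mu> (\<lambda>\<xi>. form t (dir \<xi>) \<mu>)"
  proof (rule posf_cong[OF p(1), symmetric])
    show "(\<lambda>\<xi>. form t (dir \<xi>) \<mu>) \<in> Bd"
      unfolding form_dir_left by (rule Bd_form_section[OF t0 t1 p(1)])
    show "form t (dir \<xi>) \<mu> = a \<xi> 0 powr t * form t (dir (sg a \<xi>)) \<nu>" if \<xi>: "\<xi> \<in> S" for \<xi>
      using bd[OF \<xi>] form_commute[OF t0 t1 p(1) posf_dir[OF \<xi>]]
        form_commute[OF t0 t1 p(2) posf_dir[OF conf_sg[OF a \<xi>]]]
      by (simp add: kerf_def \<mu>_def[symmetric] \<nu>_def[symmetric])
  qed
  also have "\<dots> = form t \<mu> \<mu>"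
    by (simp add: form_def dir_def)
  also have "\<dots> = 1"
    by (rule H_form[OF \<mu>(1)])
  finally show ?thesis
    using eq[OF trans_in_X[OF a x] y] by simp
qed

end

section \<open>Transitivity on the hyperboloid and continuity of the action\<close>

lemma powr_subadditive:
  fixes a b t :: real
  assumes "0 \<le> a" "0 \<le> b" "0 < t" "t \<le> 1"
  shows "(a + b) powr t \<le> a powr t + b powr t"
proof (cases "a + b = 0")
  case False
  then have s: "a + b > 0"
    using assms by simp
  have le: "x \<le> x powr t" if "0 \<le> x" "x \<le> 1" for x :: real
    using that powr_mono'[of t 1 x] assms by simp
  have "1 = a / (a + b) + b / (a + b)"
    using s by (simp flip: add_divide_distrib)
  also have "\<dots> \<le> (a / (a + b)) powr t + (b / (a + b)) powr t"
    using assms s by (intro add_mono le) auto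
  also have "\<dots> = (a powr t + b powr t) / (a + b) powr t"
    using assms s by (simp add: powr_divide add_divide_distrib)
  finally show ?thesis
    using s by (simp add: field_simps)
qed simp

text \<open>Hoelder continuity holds up to 0, that is, on the diagonal of the sphere, where a
  Lipschitz bound for the kernel fails when \<open>t < 1\<close>.\<close>

lemma powr_diff_le:
  fixes a b t :: real
  assumes "0 \<le> a" "0 \<le> b" "0 < t" "t \<le> 1"
  shows "\<bar>a powr t - b powr t\<bar> \<le> \<bar>a - b\<bar> powr t"
proof -
  have "x powr t - y powr t \<le> \<bar>x - y\<bar> powr t" if "0 \<le> y" "0 \<le> x" for x y :: real
  proof (cases "y \<le> x")
    case True
    then show ?thesis
      using powr_subadditive[of "x - y" y t] that assms by simp
  next
    case False
    then have "x powr t \<le> y powr t"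
      using that assms by (intro powr_mono2) auto
    then show ?thesis
      using powr_ge_zero[of "\<bar>x - y\<bar>" t] by linarith
  qed
  from this[of b a] this[of a b] assms show ?thesis
    by (simp add: abs_minus_commute abs_le_iff)
qed

context light_sphere
begin

abbreviation "T \<equiv> isometry_topology (hyperbolic_space n)"

lemma topspace_T: "topspace T = carrier G"
  by (rule topspace_isometry_topology)

lemma eval_continuous:
  assumes "v \<in> hyperboloid n"
  shows "continuous_map T (mtopology_of (hyperbolic_space n)) (\<lambda>g. g v)"
  unfolding isometry_topology_def
  by (rule continuous_map_from_subtopology, rule continuous_map_product_projection) (use assms in simp)

lemma lorentz_cosh: "x \<in> hyperboloid n \<Longrightarrow> y \<in> hyperboloid n \<Longrightarrow>
    lorentz n x y = cosh (mdist (hyperbolic_space n) x y)"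
  using hyperboloid.cosh_mdist[of x n y] by (simp add: kernel_space_hyperboloid)

lemma lorentz_eval_continuous:
  assumes v: "v \<in> hyperboloid n" and w: "w \<in> hyperboloid n"
  shows "continuous_map T euclideanreal (\<lambda>g. lorentz n (g v) w)"
proof -
  have "continuous_map T euclideanreal (\<lambda>g. mdist (hyperbolic_space n) (g v) w)"
    by (rule continuous_map_mdist[OF eval_continuous[OF v]]) (use w in simp)
  then have "continuous_map T euclideanreal (cosh \<circ> (\<lambda>g. mdist (hyperbolic_space n) (g v) w))"
    by (rule continuous_map_compose) (auto intro!: continuous_intros)
  then show ?thesis
    by (rule continuous_map_eq) (simp add: topspace_T lorentz_cosh G_D(2) v w)
qed

definition frame :: "(nat \<Rightarrow> real) set" where
  "frame = insert origin (axis ` {1..n})"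

lemma frame_subset: "frame \<subseteq> hyperboloid n"
  by (auto simp: frame_def origin_in_hyperboloid axis_in_hyperboloid)

text \<open>In the basis of the frame, a light vector of time coordinate 1 has a coefficient of size
  at most \<open>1 + 2 * n\<close> at \<open>origin\<close> and \<open>n\<close> coefficients of
  size at most 1.\<close>

lemma frame_combination_bound:
  assumes x: "x \<in> S" and p: "\<bar>p\<bar> \<le> \<delta>" and q: "\<And>i. i \<in> {1..n} \<Longrightarrow> \<bar>q i\<bar> \<le> \<delta>"
  shows "\<bar>(x 0 - sqrt 2 * (\<Sum>i=1..n. x i)) * p + (\<Sum>i=1..n. x i * q i)\<bar> \<le> (1 + 3 * real n) * \<delta>"
proof -
  have \<delta>: "0 \<le> \<delta>"
    using p by simp
  have "\<bar>\<Sum>i=1..n. x i\<bar> \<le> (\<Sum>i=1..n. 1)"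
    by (rule order_trans[OF sum_abs sum_mono]) (rule coord_bound[OF x])
  then have s: "\<bar>\<Sum>i=1..n. x i\<bar> \<le> real n"
    by simp
  have "sqrt 2 \<le> sqrt 4"
    by (rule real_sqrt_le_mono) simp
  then have "\<bar>sqrt 2 * (\<Sum>i=1..n. x i)\<bar> \<le> 2 * real n"
    unfolding abs_mult using s by (intro mult_mono) auto
  then have "\<bar>x 0 - sqrt 2 * (\<Sum>i=1..n. x i)\<bar> \<le> 1 + 2 * real n"
    using x by (simp add: S_def)
  then have 1: "\<bar>(x 0 - sqrt 2 * (\<Sum>i=1..n. x i)) * p\<bar> \<le> (1 + 2 * real n) * \<delta>"
    unfolding abs_mult using p by (intro mult_mono) auto
  have "\<bar>\<Sum>i=1..n. x i * q i\<bar> \<le> (\<Sum>i=1..n. 1 * \<delta>)"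
  proof (rule order_trans[OF sum_abs sum_mono])
    fix i assume "i \<in> {1..n}"
    then show "\<bar>x i * q i\<bar> \<le> 1 * \<delta>"
      unfolding abs_mult using coord_bound[OF x, of i] q \<delta> by (intro mult_mono) auto
  qed
  then have 2: "\<bar>\<Sum>i=1..n. x i * q i\<bar> \<le> real n * \<delta>"
    by simp
  show ?thesis
    using 1 2 abs_triangle_ineq[of "(x 0 - sqrt 2 * (\<Sum>i=1..n. x i)) * p" "\<Sum>i=1..n. x i * q i"]
    by (simp add: algebra_simps)
qed

text \<open>The topology of the group is that of pointwise convergence, and testing at the finitely
  many points of the frame already gives uniform control over the whole sphere. The frame bound is
  applied once in each argument, hence the squared constant.\<close>

lemma lift_close:
  assumes g0: "g0 \<in> carrier G"
    and close: "\<And>v w. v \<in> frame \<Longrightarrow> w \<in> frame \<Longrightarrow> \<bar>lorentz n (g v) (g0 w) - lorentz n v w\<bar> \<le> \<delta>"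
    and \<xi>: "\<xi> \<in> S" and \<eta>: "\<eta> \<in> S"
  shows "\<bar>lorentz n (lift g \<xi>) (lift g0 \<eta>) - lorentz n \<xi> \<eta>\<bar> \<le> (1 + 3 * real n) * ((1 + 3 * real n) * \<delta>)"
proof -
  have fr: "origin \<in> frame" "i \<in> {1..n} \<Longrightarrow> axis i \<in> frame" for i
    by (auto simp: frame_def)
  have 1: "\<bar>lorentz n (g v) (lift g0 \<eta>) - lorentz n v \<eta>\<bar> \<le> (1 + 3 * real n) * \<delta>" if v: "v \<in> frame" for v
  proof -
    have "lorentz n (g v) (lift g0 \<eta>) - lorentz n v \<eta>
      = (\<eta> 0 - sqrt 2 * (\<Sum>i=1..n. \<eta> i)) * (lorentz n (g v) (g0 origin) - lorentz n v origin)
        + (\<Sum>i=1..n. \<eta> i * (lorentz n (g v) (g0 (axis i)) - lorentz n v (axis i)))"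
      unfolding lorentz_commute[of n "g v"] lorentz_commute[of n v] lorentz_lift lorentz_expand[of \<eta> v]
      by (simp add: right_diff_distrib sum_subtractf)
    then show ?thesis
      using frame_combination_bound[OF \<eta> close[OF v fr(1)], of "\<lambda>i. lorentz n (g v) (g0 (axis i)) - lorentz n v (axis i)"]
        close[OF v fr(2)] by simp
  qed
  have "lorentz n (lift g \<xi>) (lift g0 \<eta>) - lorentz n \<xi> \<eta>
      = (\<xi> 0 - sqrt 2 * (\<Sum>i=1..n. \<xi> i)) * (lorentz n (g origin) (lift g0 \<eta>) - lorentz n origin \<eta>)
        + (\<Sum>i=1..n. \<xi> i * (lorentz n (g (axis i)) (lift g0 \<eta>) - lorentz n (axis i) \<eta>))"
    unfolding lorentz_lift[of g \<xi>] lorentz_expand[of \<xi> \<eta>] by (simp add: right_diff_distrib sum_subtractf)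
  then show ?thesis
    using frame_combination_bound[OF \<xi> 1[OF fr(1)], of "\<lambda>i. lorentz n (g (axis i)) (lift g0 \<eta>) - lorentz n (axis i) \<eta>"]
      1[OF fr(2)] by simp
qed

lemma frame_nbhd:
  assumes g0: "g0 \<in> carrier G" and \<delta>: "0 < \<delta>"
  shows "\<exists>U. openin T U \<and> g0 \<in> U \<and> (\<forall>g\<in>U. \<forall>v\<in>frame. \<forall>w\<in>frame. \<bar>lorentz n (g v) (g0 w) - lorentz n v w\<bar> \<le> \<delta>)"
proof -
  define P where "P v w = {g \<in> topspace T. lorentz n (g v) (g0 w) \<in> ball (lorentz n v w) \<delta>}" for v w
  have fin: "finite frame"
    by (simp add: frame_def)
  have "openin T (P v w)" if "v \<in> frame" "w \<in> frame" for v w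
    unfolding P_def
    by (rule openin_continuous_map_preimage[OF lorentz_eval_continuous])
      (use that frame_subset G_D(2)[OF g0] in auto)
  then have op: "openin T (\<Inter>v\<in>frame. \<Inter>w\<in>frame. P v w)"
    using fin by (intro openin_INT2) (auto simp: frame_def)
  have mem: "g0 \<in> P v w" if "v \<in> frame" "w \<in> frame" for v w
    using g0 \<delta> G_D(3)[OF g0 subsetD[OF frame_subset that(1)] subsetD[OF frame_subset that(2)]]
    by (simp add: P_def topspace_T)
  have "\<bar>lorentz n (g v) (g0 w) - lorentz n v w\<bar> \<le> \<delta>" if "g \<in> P v w" for g v w
    using that by (auto simp: P_def dist_real_def)
  then have "\<forall>g\<in>(\<Inter>v\<in>frame. \<Inter>w\<in>frame. P v w). \<forall>v\<in>frame. \<forall>w\<in>frame. \<bar>lorentz n (g v) (g0 w) - lorentz n v w\<bar> \<le> \<delta>"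
    by simp
  moreover have "g0 \<in> (\<Inter>v\<in>frame. \<Inter>w\<in>frame. P v w)"
    using mem by simp
  ultimately show ?thesis
    using op by (intro exI conjI)
qed

lemma form_push2:
  assumes a: "conf a" and b: "conf b" and t: "0 < t" "t \<le> 1" and \<mu>: "posf \<mu>" and \<nu>: "posf \<nu>"
  shows "form t (push t a \<mu>) (push t b \<nu>) = \<mu> (\<lambda>\<xi>. \<nu> (\<lambda>\<eta>. lorentz n (a \<xi>) (b \<eta>) powr t))"
proof -
  have l: "lorentz n (a \<xi>) (b \<eta>) = a \<xi> 0 * b \<eta> 0 * lorentz n (sg a \<xi>) (sg b \<eta>)" if "\<xi> \<in> S" "\<eta> \<in> S" for \<xi> \<eta>
    using conf_pos[OF a that(1)] conf_pos[OF b that(2)]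
    by (simp add: sg_def lorentz_scale_left lorentz_scale_right)
  have 1: "a \<xi> 0 powr t * form t (dir (sg a \<xi>)) (push t b \<nu>) = \<nu> (\<lambda>\<eta>. lorentz n (a \<xi>) (b \<eta>) powr t)" if \<xi>: "\<xi> \<in> S" for \<xi>
  proof -
    have Bd1: "(\<lambda>\<eta>. b \<eta> 0 powr t * lorentz n (sg a \<xi>) (sg b \<eta>) powr t) \<in> Bd"
      by (intro Bd_push[OF b] Bd_kernel' conf_sg[OF a] \<xi>) (use t in auto)
    have "a \<xi> 0 powr t * form t (dir (sg a \<xi>)) (push t b \<nu>)
      = \<nu> (\<lambda>\<eta>. a \<xi> 0 powr t * (b \<eta> 0 powr t * lorentz n (sg a \<xi>) (sg b \<eta>) powr t))"
      unfolding form_dir_left push_def by (rule posf_cmult[OF \<nu> Bd1, symmetric])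
    also have "\<dots> = \<nu> (\<lambda>\<eta>. lorentz n (a \<xi>) (b \<eta>) powr t)"
    proof (rule posf_cong[OF \<nu> Bd_cmult[OF Bd1]])
      show "a \<xi> 0 powr t * (b \<eta> 0 powr t * lorentz n (sg a \<xi>) (sg b \<eta>) powr t) = lorentz n (a \<xi>) (b \<eta>) powr t" if \<eta>: "\<eta> \<in> S" for \<eta>
        unfolding l[OF \<xi> \<eta>]
        using conf_pos[OF a \<xi>] conf_pos[OF b \<eta>] lorentz_S_nonneg[OF conf_sg[OF a \<xi>] conf_sg[OF b \<eta>]]
        by (simp add: powr_mult)
    qed
    finally show ?thesis .
  qed
  have posb: "posf (push t b \<nu>)"
    using posf_push[OF b _ \<nu>] t by simp
  have "(\<lambda>\<xi>. a \<xi> 0 powr t * form t (dir (sg a \<xi>)) (push t b \<nu>)) \<in> Bd"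
    using Bd_push[OF a _ Bd_form_section[OF t posb]] t by (simp add: form_dir_left)
  then show ?thesis
    unfolding form_push_left by (rule posf_cong[OF \<mu>]) (rule 1)
qed

lemma lorentz_conf_nonneg:
  assumes a: "conf a" and b: "conf b" and "\<xi> \<in> S" "\<eta> \<in> S"
  shows "0 \<le> lorentz n (a \<xi>) (b \<eta>)"
proof -
  have "lorentz n (a \<xi>) (b \<eta>) = a \<xi> 0 * b \<eta> 0 * lorentz n (sg a \<xi>) (sg b \<eta>)"
    using conf_pos[OF a assms(3)] conf_pos[OF b assms(4)]
    by (simp add: sg_def lorentz_scale_left lorentz_scale_right)
  then show ?thesis
    using conf_pos[OF a assms(3)] conf_pos[OF b assms(4)]
      lorentz_S_nonneg[OF conf_sg[OF a assms(3)] conf_sg[OF b assms(4)]] by simp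
qed

lemma future_hyperboloid:
  assumes v: "lorentz n v v = 1" "\<And>i. i > n \<Longrightarrow> v i = 0" and y: "y \<in> hyperboloid n" "0 < lorentz n v y"
  shows "v \<in> hyperboloid n"
proof (rule ccontr)
  assume nv: "v \<notin> hyperboloid n"
  have "v 0 * v 0 = 1 + (\<Sum>i=1..n. v i * v i)"
    using v(1) by (simp add: lorentz_def)
  moreover have "0 \<le> (\<Sum>i=1..n. v i * v i)"
    by (simp add: sum_nonneg)
  ultimately have "v 0 \<noteq> 0"
    by auto
  then have "v 0 < 0"
    using nv v by (auto simp: hyperboloid_def)
  define w where "w = (\<lambda>i. (-1) * v i)"
  have "lorentz n w w = 1"
    using lorentz_scale[of "-1" v "-1" v] v(1) by (simp add: w_def)
  then have "w \<in> hyperboloid n"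
    using v(2) \<open>v 0 < 0\<close> by (simp add: hyperboloid_def) (simp add: w_def)
  then have "1 \<le> lorentz n w y"
    using y(1) by (rule lorentz_ge_1)
  moreover have "lorentz n w y = - lorentz n v y"
    using lorentz_scale[of "-1" v 1 y] by (simp add: w_def)
  ultimately show False
    using y(2) by simp
qed

text \<open>The Lorentz reflection in the hyperplane orthogonal to \<open>x - y\<close> exchanges
  \<open>x\<close> and \<open>y\<close>.\<close>

lemma transitive:
  assumes x: "x \<in> hyperboloid n" and y: "y \<in> hyperboloid n"
  shows "\<exists>g\<in>carrier G. g x = y"
proof (cases "x = y")
  case True
  moreover have "\<one>\<^bsub>G\<^esub> \<in> carrier G"
    by (rule monoid.one_closed[OF group.is_monoid[OF group_G]])
  moreover have "\<one>\<^bsub>G\<^esub> x = x"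
    using x by (simp add: G_one)
  ultimately show ?thesis
    by blast
next
  case False
  define A where "A = lorentz n x y"
  have A: "1 < A"
    using hyperboloid.ge1[OF x y] hyperboloid.eq[OF x y] False by (force simp: A_def less_le)
  define u where "u = (\<lambda>i. x i + (-1) * y i)"
  have x1: "lorentz n x x = 1" "\<And>i. i > n \<Longrightarrow> x i = 0" and y1: "lorentz n y y = 1" "\<And>i. i > n \<Longrightarrow> y i = 0"
    using x y by (auto simp: hyperboloid_def)
  have ux: "lorentz n u x = 1 - A" and uy: "lorentz n u y = A - 1"
    using x1 y1 unfolding u_def lorentz_comb_left by (simp_all add: A_def lorentz_commute[of n y x])
  define k where "k = A - 1"
  have k: "0 < k"
    using A by (simp add: k_def)
  have uu: "lorentz n u u = - 2 * k"
  proof -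
    have "lorentz n u u = lorentz n u x + (-1) * lorentz n u y"
      by (subst (2) u_def) (rule lorentz_comb_right)
    then show ?thesis
      by (simp add: ux uy k_def)
  qed
  \<comment> \<open>The usual reflection formula, with \<open>lorentz n u u = - 2 * k\<close>
    inserted.\<close>
  define R where "R z = (\<lambda>i. z i + (lorentz n z u / k) * u i)" for z
  have R_app: "R z i = z i + (lorentz n z u / k) * u i" for z i
    by (simp only: R_def)
  have RR: "lorentz n (R z) (R w) = lorentz n z w" for z w
    unfolding R_def lorentz_comb_left lorentz_comb_right uu lorentz_commute[of n u w]
    using k by (simp add: field_simps)
  have Ru: "lorentz n (R z) u = - lorentz n z u" for z
    unfolding R_def lorentz_comb_left uu using k by (simp add: field_simps)
  have inv: "R (R z) = z" for z
    by (rule ext) (simp add: R_app[of "R z"] Ru R_app[of z])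
  have Rx: "R x = y"
  proof
    fix i
    have "lorentz n x u / k = -1"
      using k ux by (simp add: lorentz_commute[of n x u] k_def divide_simps)
    then show "R x i = y i"
      by (simp add: R_app) (simp add: u_def)
  qed
  have RH: "R z \<in> hyperboloid n" if z: "z \<in> hyperboloid n" for z
  proof (rule future_hyperboloid[OF _ _ y])
    show "lorentz n (R z) (R z) = 1"
      unfolding RR using z by (simp add: hyperboloid_def)
    show "R z i = 0" if "i > n" for i
      using that z x1 y1 by (simp add: R_app hyperboloid_def) (simp add: u_def)
    have "lorentz n (R z) y = lorentz n z x"
      using RR[of z x] by (simp add: Rx)
    then show "0 < lorentz n (R z) y"
      using lorentz_ge_1[OF z x] by simp
  qed
  have "restrict R (hyperboloid n) \<in> carrier G"
  proof (rule G_I)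
    have "bij_betw R (hyperboloid n) (hyperboloid n)"
      by (rule bij_betw_byWitness[where f' = R]) (auto simp: inv RH)
    then show "restrict R (hyperboloid n) \<in> Bij (hyperboloid n)"
      by (simp add: Bij_def)
  qed (simp add: RR)
  then show ?thesis
    using x Rx by (intro bexI[of _ "restrict R (hyperboloid n)"]) auto
qed

lemma trans_cong:
  assumes a: "conf a" and t: "0 \<le> t" and ab: "\<And>\<xi>. \<xi> \<in> S \<Longrightarrow> a \<xi> = b \<xi>"
  shows "trans t a = trans t b"
proof -
  have "iota t (push t a (rep t x)) = iota t (push t b (rep t x))" if "x \<in> X t" for x
    by (rule iota_cong, rule push_cong[OF a t H_posf[OF rep(1)[OF that]] ab])
  then show ?thesis
    unfolding trans_def by (intro ext) (simp add: restrict_def)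
qed

lemma iota_dir: "\<xi> \<in> S \<Longrightarrow> iota 1 (dir \<xi>) = \<xi>"
  by (rule ext) (auto simp: iota_def dir_def S_def)

lemma kerf_1: "x \<in> X 1 \<Longrightarrow> \<xi> \<in> S \<Longrightarrow> kerf 1 x (dir \<xi>) = lorentz n x \<xi>"
  unfolding kerf_def
  by (subst form_1[OF H_posf[OF rep(1)] posf_dir, where t = 1]) (simp_all add: rep iota_dir)

lemma act_1:
  assumes g: "g \<in> carrier G"
  shows "act 1 g = g"
proof
  fix x
  interpret P: light_sphere_param n 1
    by unfold_locales auto
  show "act 1 g x = g x"
  proof (cases "x \<in> hyperboloid n")
    case True
    have "g x = trans 1 (lift g) x"
    proof (rule P.trans_unique[OF conf_lift[OF g]])
      show "x \<in> X 1" "g x \<in> X 1"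
        using True G_D(2)[OF g] by (auto simp: X_1)
      fix \<xi> assume \<xi>: "\<xi> \<in> S"
      show "lift g \<xi> 0 powr 1 * kerf 1 (g x) (dir (sg (lift g) \<xi>)) = kerf 1 x (dir \<xi>)"
        using True G_D(2)[OF g True] \<xi> conf_sg[OF conf_lift[OF g] \<xi>] conf_pos[OF conf_lift[OF g] \<xi>]
          lorentz_lift_image[OF g True, of \<xi>]
        by (simp add: kerf_1 X_1) (simp add: sg_def lorentz_scale_right lorentz_commute)
    qed
    then show ?thesis
      by (simp add: act_def)
  next
    case False
    then show ?thesis
      using G_D(1)[OF g] by (simp add: act_def trans_def X_1 Bij_def extensional_def)
  qed
qed

end

context light_sphere_param
begin

lemma trans_cmp:
  assumes a: "conf a" and b: "conf b" and x: "x \<in> X t"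
  shows "trans t a (trans t b x) = trans t (cmp a b) x"
proof (rule trans_unique[OF conf_cmp[OF a b] x])
  show "trans t a (trans t b x) \<in> X t"
    by (intro trans_in_X a b x)
  fix \<xi> assume \<xi>: "\<xi> \<in> S"
  have "cmp a b \<xi> 0 powr t = b \<xi> 0 powr t * a (sg b \<xi>) 0 powr t"
    using conf_pos[OF b \<xi>] conf_pos[OF a conf_sg[OF b \<xi>]] by (simp add: cmp_def powr_mult)
  then show "cmp a b \<xi> 0 powr t * kerf t (trans t a (trans t b x)) (dir (sg (cmp a b) \<xi>)) = kerf t x (dir \<xi>)"
    using kerf_trans[OF a trans_in_X[OF b x] conf_sg[OF b \<xi>]] kerf_trans[OF b x \<xi>]
      sg_cmp[of b \<xi> a, OF conf_pos[OF b \<xi>]] by (simp add: mult.assoc)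
qed

lemma trans_id:
  assumes a: "conf a" and id: "\<And>\<xi>. \<xi> \<in> S \<Longrightarrow> a \<xi> = \<xi>" and x: "x \<in> X t"
  shows "trans t a x = x"
proof (rule trans_unique[OF a x x, symmetric])
  fix \<xi> assume \<xi>: "\<xi> \<in> S"
  then have "\<xi> 0 = 1"
    by (simp add: S_def)
  then show "a \<xi> 0 powr t * kerf t x (dir (sg a \<xi>)) = kerf t x (dir \<xi>)"
    by (simp add: sg_def id \<xi>)
qed

lemma act_in_X: "g \<in> carrier G \<Longrightarrow> x \<in> X t \<Longrightarrow> act t g x \<in> X t"
  by (simp add: act_def trans_in_X conf_lift)

lemma ker_act: "g \<in> carrier G \<Longrightarrow> x \<in> X t \<Longrightarrow> y \<in> X t \<Longrightarrow> ker t (act t g x) (act t g y) = ker t x y"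
  by (simp add: act_def ker_trans conf_lift)

lemma act_mult:
  assumes g: "g \<in> carrier G" and h: "h \<in> carrier G" and x: "x \<in> X t"
  shows "act t (g \<otimes>\<^bsub>G\<^esub> h) x = act t g (act t h x)"
proof -
  have "act t g (act t h x) = trans t (cmp (lift g) (lift h)) x"
    unfolding act_def by (rule trans_cmp[OF conf_lift[OF g] conf_lift[OF h] x])
  also have "trans t (cmp (lift g) (lift h)) = trans t (lift (g \<otimes>\<^bsub>G\<^esub> h))"
    using t0 by (intro trans_cong conf_cmp conf_lift g h lift_mult) auto
  finally show ?thesis
    by (simp add: act_def)
qed

lemma act_one: "x \<in> X t \<Longrightarrow> act t \<one>\<^bsub>G\<^esub> x = x"
  unfolding act_def using group_G
  by (intro trans_id conf_lift lift_one) (auto simp: group.is_monoid monoid.one_closed)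

lemma act_inv:
  assumes g: "g \<in> carrier G" and x: "x \<in> X t"
  shows "act t (inv\<^bsub>G\<^esub> g) (act t g x) = x" "act t g (act t (inv\<^bsub>G\<^esub> g) x) = x"
  using act_mult[OF group.inv_closed[OF group_G g] g x] act_mult[OF g group.inv_closed[OF group_G g] x]
  by (simp_all add: group.l_inv[OF group_G g] group.r_inv[OF group_G g] act_one x)

lemma act_isometry:
  assumes g: "g \<in> carrier G"
  shows "act t g \<in> carrier (isometry_group K)"
proof (rule isometry_groupI)
  have "bij_betw (act t g) (X t) (X t)"
    by (rule bij_betw_byWitness[where f' = "act t (inv\<^bsub>G\<^esub> g)"])
      (auto simp: act_inv[OF g] intro!: act_in_X g group.inv_closed[OF group_G])
  then show "act t g \<in> Bij (X t)"
    by (simp add: Bij_def act_def trans_def)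
qed (rule ker_act[OF g])

lemma act_hom: "act t \<in> hom G (isometry_group K)"
proof (rule homI)
  show "act t g \<in> carrier (isometry_group K)" if "g \<in> carrier G" for g
    by (rule act_isometry[OF that])
  show "act t (g \<otimes>\<^bsub>G\<^esub> h) = act t g \<otimes>\<^bsub>isometry_group K\<^esub> act t h" if g: "g \<in> carrier G" and h: "h \<in> carrier G" for g h
  proof -
    have "act t (g \<otimes>\<^bsub>G\<^esub> h) x = compose (X t) (act t g) (act t h) x" for x
      using act_mult[OF g h, of x] by (cases "x \<in> X t") (auto simp: compose_def act_def trans_def)
    then show ?thesis
      unfolding isometry_group_mult[OF act_isometry[OF g] act_isometry[OF h]] by blast
  qed
qed

lemma act_group_action: "group_action G (X t) (act t)"
proof -
  have "act t \<in> hom G (BijGroup (X t))"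
  proof (rule homI)
    show "act t g \<in> carrier (BijGroup (X t))" if "g \<in> carrier G" for g
      using isometry_groupD(1)[OF act_isometry[OF that]] by (simp add: BijGroup_def)
    show "act t (g \<otimes>\<^bsub>G\<^esub> h) = act t g \<otimes>\<^bsub>BijGroup (X t)\<^esub> act t h" if "g \<in> carrier G" "h \<in> carrier G" for g h
      using hom_mult[OF act_hom that] by (simp add: isometry_group_def)
  qed
  then show ?thesis
    by (simp add: group_action_def group_hom_def group_hom_axioms_def group_G group_BijGroup)
qed

lemma orbit_continuous:
  assumes g0: "g0 \<in> carrier G" and x: "x \<in> X t" and \<epsilon>: "0 < \<epsilon>"
  shows "\<exists>U. openin T U \<and> g0 \<in> U \<and> (\<forall>g\<in>U. mdist K (act t g x) (act t g0 x) < \<epsilon>)"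
proof -
  define \<mu> where "\<mu> = rep t x"
  have \<mu>: "\<mu> \<in> H t" "x = iota t \<mu>" "posf \<mu>"
    using rep[OF x] H_posf by (auto simp: \<mu>_def)
  have m: "0 < mass \<mu>"
    using mass_pos[OF t0 t1 \<mu>(3)] H_form[OF \<mu>(1)] by simp
  define c where "c = (cosh \<epsilon> - 1) / 2"
  have c: "0 < c"
    using \<epsilon> cosh_real_nonneg_less_iff[of 0 \<epsilon>] by (simp add: c_def)
  \<comment> \<open>A kernel error of \<open>D powr t\<close> changes the form by at most
    \<open>c\<close>, and \<open>1 + c < cosh \<epsilon>\<close>.\<close>
  define D where "D = (c / (mass \<mu> * mass \<mu>)) powr (1 / t)"
  have D: "0 < D" "D powr t * (mass \<mu> * mass \<mu>) = c"
    using c m t0 by (auto simp: D_def powr_powr)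
  define N where "N = 1 + 3 * real n"
  have N: "N > 0"
    by (simp add: N_def)
  \<comment> \<open>Undoes the two factors \<open>N\<close> lost in
    \<open>lift_close\<close>.\<close>
  define \<delta> where "\<delta> = D / (N * N)"
  have \<delta>: "0 < \<delta>" "N * (N * \<delta>) = D"
    using D N by (auto simp: \<delta>_def)
  obtain U where U: "openin T U" "g0 \<in> U"
    and close: "\<And>g v w. g \<in> U \<Longrightarrow> v \<in> frame \<Longrightarrow> w \<in> frame \<Longrightarrow> \<bar>lorentz n (g v) (g0 w) - lorentz n v w\<bar> \<le> \<delta>"
    using frame_nbhd[OF g0 \<delta>(1)] by blast
  have "mdist K (act t g x) (act t g0 x) < \<epsilon>" if gU: "g \<in> U" for g
  proof -
    have g: "g \<in> carrier G"
      using openin_subset[OF U(1)] gU by (auto simp: topspace_T)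
    note cg = conf_lift[OF g] and cg0 = conf_lift[OF g0]
    have le: "\<bar>lorentz n (lift g \<xi>) (lift g0 \<eta>) powr t - lorentz n \<xi> \<eta> powr t\<bar> \<le> D powr t" if "\<xi> \<in> S" "\<eta> \<in> S" for \<xi> \<eta>
    proof -
      have "\<bar>lorentz n (lift g \<xi>) (lift g0 \<eta>) powr t - lorentz n \<xi> \<eta> powr t\<bar>
         \<le> \<bar>lorentz n (lift g \<xi>) (lift g0 \<eta>) - lorentz n \<xi> \<eta>\<bar> powr t"
        by (rule powr_diff_le[OF lorentz_conf_nonneg[OF cg cg0 that] lorentz_S_nonneg[OF that] t0 t1])
      also have "\<dots> \<le> D powr t"
        using lift_close[OF g0 close[OF gU] that] t0 by (intro powr_mono2) (auto simp: N_def[symmetric] \<delta>)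
      finally show ?thesis .
    qed
    have "\<bar>lorentz n (lift g \<xi>) (lift g0 \<eta>) powr t\<bar> \<le> 2 + D powr t" if "\<xi> \<in> S" "\<eta> \<in> S" for \<xi> \<eta>
      using le[OF that] kernel_bound[OF that t0 t1] by linarith
    then have "\<bar>form t (push t (lift g) \<mu>) (push t (lift g0) \<mu>) - form t \<mu> \<mu>\<bar> \<le> D powr t * mass \<mu> * mass \<mu>"
      unfolding form_push2[OF cg cg0 t0 t1 \<mu>(3) \<mu>(3)] form_def[of t \<mu> \<mu>]
      by (rule double_bound_diff[OF \<mu>(3) \<mu>(3) _ kernel_bound[OF _ _ t0 t1] le])
    then have "form t (push t (lift g) \<mu>) (push t (lift g0) \<mu>) \<le> 1 + c"
      using H_form[OF \<mu>(1)] D(2) by (simp add: mult.assoc)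
    also have "\<dots> < cosh \<epsilon>"
      using c by (simp add: c_def field_simps)
    finally have "ker t (act t g x) (act t g0 x) < cosh \<epsilon>"
      unfolding act_def \<mu>(2) trans_iota[OF cg \<mu>(1)] trans_iota[OF cg0 \<mu>(1)]
        ker_iota[OF push_H[OF cg \<mu>(1)] push_H[OF cg0 \<mu>(1)]] .
    then have "cosh (mdist K (act t g x) (act t g0 x)) < cosh \<epsilon>"
      by (simp add: cosh_mdist act_in_X g g0 x)
    then show ?thesis
      using \<epsilon> by (subst (asm) cosh_real_nonneg_less_iff) auto
  qed
  then show ?thesis
    using U by blast
qed

lemma act_mdist: "g \<in> carrier G \<Longrightarrow> x \<in> X t \<Longrightarrow> y \<in> X t \<Longrightarrow> mdist K (act t g x) (act t g y) = mdist K x y"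
  by (simp add: mdist_kernel_space act_in_X ker_act)

text \<open>Orbit maps are continuous and the group acts by isometries, which together give joint
  continuity: half of \<open>\<epsilon>\<close> is spent on moving \<open>g\<close>, half on moving
  the point.\<close>

lemma act_continuous: "continuous_isometric_action G T K (act t)"
  unfolding continuous_isometric_action_def mspace_kernel_space
proof (intro conjI ballI)
  show "group_action G (X t) (act t)"
    by (rule act_group_action)
  show "mdist K (act t g x) (act t g y) = mdist K x y" if "g \<in> carrier G" "x \<in> X t" "y \<in> X t" for g x y
    by (rule act_mdist[OF that])
  show "continuous_map (prod_topology T (mtopology_of K)) (mtopology_of K) (\<lambda>(g, x). act t g x)"
    unfolding mtopology_kernel_space continuous_map_to_metric
  proof (intro ballI allI impI)
    fix p \<epsilon> assume p: "p \<in> topspace (prod_topology T mtopology)" and \<epsilon>: "(0::real) < \<epsilon>"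
    obtain g0 x0 where gx: "p = (g0, x0)" "g0 \<in> carrier G" "x0 \<in> X t"
      using p by (auto simp: topspace_T)
    obtain U where U: "openin T U" "g0 \<in> U" "\<And>g. g \<in> U \<Longrightarrow> mdist K (act t g x0) (act t g0 x0) < \<epsilon> / 2"
      using orbit_continuous[OF gx(2,3), of "\<epsilon> / 2"] \<epsilon> by auto
    have mb: "y \<in> mball x r \<longleftrightarrow> x \<in> X t \<and> y \<in> X t \<and> mdist K x y < r" for x y r
      by (auto simp: in_mball mdist_kernel_space)
    show "\<exists>W. openin (prod_topology T mtopology) W \<and> p \<in> W \<and>
      (\<forall>y\<in>W. (case y of (g, x) \<Rightarrow> act t g x) \<in> mball (case p of (g, x) \<Rightarrow> act t g x) \<epsilon>)"
    proof (intro exI conjI ballI)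
      show "openin (prod_topology T mtopology) (U \<times> mball x0 (\<epsilon> / 2))"
        using U(1) by (auto simp: openin_prod_Times_iff)
      show "p \<in> U \<times> mball x0 (\<epsilon> / 2)"
        using gx U \<epsilon> by (simp add: mb mdist_kernel_space self)
      fix y assume "y \<in> U \<times> mball x0 (\<epsilon> / 2)"
      then obtain g x where y: "y = (g, x)" "g \<in> U" "x \<in> X t" "mdist K x0 x < \<epsilon> / 2"
        by (auto simp: mb mdist_kernel_space)
      have g: "g \<in> carrier G"
        using openin_subset[OF U(1)] y by (auto simp: topspace_T)
      have "mdist K (act t g0 x0) (act t g x) \<le> mdist K (act t g0 x0) (act t g x0) + mdist K (act t g x0) (act t g x)"
        by (rule mdist_triangle) (auto intro: act_in_X gx g y)
      also have "\<dots> < \<epsilon>"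
        using U(3)[OF y(2)] y(4) act_mdist[OF g gx(3) y(3)] by (simp add: mdist_commute)
      finally show "(case y of (g, x) \<Rightarrow> act t g x) \<in> mball (case p of (g, x) \<Rightarrow> act t g x) \<epsilon>"
        using gx y g by (simp add: mb act_in_X mdist_kernel_space)
    qed
  qed
qed

end

section \<open>Cocompactness and minimality\<close>

text \<open>A normalized nonnegative combination of two points lies on the segment between them: the
  weight \<open>b\<close> fixes the parameter, and the normalization then leaves a single
  nonnegative value for the other weight.\<close>

lemma (in hyp_kernel) geodesically_convex_combination:
  assumes A: "geodesically_convex K A" "A \<subseteq> X" and x: "x \<in> A" and y: "y \<in> A" and ab: "0 \<le> a" "0 \<le> b"
    and z: "z \<in> X" "\<And>w. w \<in> X \<Longrightarrow> B z w = a * B x w + b * B y w"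
  shows "z \<in> A"
proof -
  have xX: "x \<in> X" and yX: "y \<in> X"
    using x y A by auto
  obtain c where c: "geodesic_path K x y c"
    using geodesic_path_exists[OF xX yX] by blast
  define L where "L = mdist K x y"
  have cA: "c s \<in> A" if "s \<in> {0..L}" for s
    using A(1) x y c that unfolding geodesically_convex_def L_def by blast
  have zz: "1 = a * (a + b * B x y) + b * (a * B x y + b)"
    using z(2)[OF z(1)] z(2)[OF xX] z(2)[OF yX] sym[OF z(1) xX] sym[OF z(1) yX]
    by (simp add: self z xX yX sym[OF yX xX])
  show ?thesis
  proof (cases "L = 0")
    case True
    then have "x = y"
      using cosh_mdist[OF xX yX] eq[OF xX yX] by (simp add: L_def)
    then have "(a + b)\<^sup>2 = 1"
      using zz by (simp add: self yX power2_eq_square algebra_simps)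
    then have "a + b = 1"
      using ab by (simp add: power2_eq_1_iff)
    then have "B z w = B x w" if "w \<in> X" for w
      using z(2)[OF that] \<open>x = y\<close> by (simp flip: distrib_right)
    then have "z = x"
      using z(1) xX by (intro kernel_eqI)
    then show ?thesis
      using x by simp
  next
    case False
    then have L: "0 < L"
      by (simp add: L_def less_le)
    then have sL: "0 < sinh L"
      by simp
    have Bxy: "B x y = cosh L"
      by (simp add: L_def cosh_mdist xX yX)
    have "0 \<le> a * b * B x y" "0 \<le> a * a"
      using ab ge1[OF xX yX] by auto
    moreover have "b * b = 1 - a * a - 2 * (a * b * B x y)"
      using zz by (simp add: algebra_simps)
    ultimately have "b\<^sup>2 \<le> 1\<^sup>2"
      unfolding power2_eq_square by linarith
    then have b1: "b \<le> 1"
      by (rule power2_le_imp_le) simp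
    \<comment> \<open>Solves \<open>geo_coeff L (L - s) = b\<close>.\<close>
    define s where "s = arsinh (b * sinh L)"
    have s: "sinh s = b * sinh L"
      by (simp add: s_def)
    have "sinh 0 \<le> sinh s" "sinh s \<le> sinh L"
      using ab b1 sL s by (auto simp: mult_le_cancel_right1)
    then have s0: "s \<in> {0..L}"
      by (simp add: sinh_real_le_iff)
    have csX: "c s \<in> X"
      using cA[OF s0] A by auto
    define a' where "a' = geo_coeff L s"
    have a': "0 \<le> a'"
      unfolding a'_def using s0 by (intro geo_coeff_nonneg) auto
    have "geo_coeff L (L - s) = b"
      using L s sL by (simp add: geo_coeff_def)
    then have cs: "B (c s) w = a' * B x w + b * B y w" if "w \<in> X" for w
      using geodesic_path_kernel[OF c xX yX s0[unfolded L_def] that] L by (simp add: L_def[symmetric] a'_def)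
    have "1 = a' * (a' + b * B x y) + b * (a' * B x y + b)"
      using cs[OF csX] cs[OF xX] cs[OF yX] sym[OF csX xX] sym[OF csX yX]
      by (simp add: self csX xX yX sym[OF yX xX])
    with zz have "(a - a') * (a + a' + 2 * b * cosh L) = 0"
      by (simp add: Bxy algebra_simps)
    then have "a = a'"
    proof (elim disjE[OF iffD1[OF mult_eq_0_iff]])
      assume *: "a + a' + 2 * b * cosh L = 0"
      have "0 \<le> 2 * b * cosh L"
        using ab by simp
      then show "a = a'"
        using * ab a' by linarith
    qed simp
    then have "B z w = B (c s) w" if "w \<in> X" for w
      using z(2)[OF that] cs[OF that] by simp
    then have "z = c s"
      using z(1) csX by (intro kernel_eqI)
    then show ?thesis
      using cA[OF s0] by simp
  qed
qed

section \<open>Orbits of small mass and cocompactness\<close>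

context light_sphere_param
begin

lemma X_ge_1:
  assumes x: "x \<in> X t"
  shows "1 \<le> x 0"
proof -
  note r = rep[OF x] and p = H_posf[OF rep(1)[OF x]]
  have "1\<^sup>2 \<le> (mass (rep t x))\<^sup>2"
    using form_le_mass[OF t0 t1 p] H_form[OF r(1)] by simp
  then have "1 \<le> mass (rep t x)"
    using mass_nonneg[OF p] by (rule power2_le_imp_le)
  then show ?thesis
    using X_0[OF r(1)] r(2) by simp
qed

lemma mass_rep: "x \<in> X t \<Longrightarrow> mass (rep t x) = x 0"
  using X_0[OF rep(1)] rep(2) by metis

lemma kerf_basept: "x \<in> X t \<Longrightarrow> ker t x basept = form t (rep t x) base / sqrt (form t base base)"
  unfolding basept_def pt_def
  using ker_iota_kerf[OF _ scale_in_H[OF posf_base form_base_bounds(1)]]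
  by (simp add: kerf_def form_scale_right[OF t0 t1 posf_base H_posf[OF rep(1)]])

lemma ker_le_mass:
  assumes x: "x \<in> X t"
  shows "ker t x basept \<le> 4 * x 0"
proof -
  have "2 powr 0 \<le> 2 powr t"
    using t0 by (intro powr_mono) auto
  then have "sqrt ((1/2)\<^sup>2) \<le> sqrt (form t base base)"
    unfolding form_base_base[OF t0] by (intro real_sqrt_le_mono) (simp add: power2_eq_square)
  then have s: "1/2 \<le> sqrt (form t base base)"
    by simp
  have "form t (rep t x) base \<le> 2 * x 0"
    using form_bound[OF t0 t1 H_posf[OF rep(1)[OF x]] posf_base] by (simp add: mass_rep[OF x] mass_base)
  also have "\<dots> \<le> 4 * x 0 * sqrt (form t base base)"
    using mult_left_mono[OF s, of "4 * x 0"] X_ge_1[OF x] by simp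
  finally show ?thesis
    unfolding kerf_basept[OF x] using form_base_bounds by (simp add: field_simps)
qed

lemma act_0:
  assumes x: "x \<in> X t" and g: "g \<in> carrier G"
  shows "act t g x 0 = rep t x (\<lambda>\<xi>. lift g \<xi> 0 powr t)"
  using X_0[OF push_H[OF conf_lift[OF g] rep(1)[OF x]]] x by (simp add: act_def trans_def mass_def push_def)

text \<open>The infimum of the mass over an orbit need not be known to be attained; a multiplicative
  margin is all that the barycentre argument uses.\<close>

lemma near_minimum:
  assumes x: "x \<in> X t" and s: "1 < s"
  shows "\<exists>g\<in>carrier G. \<forall>h\<in>carrier G. act t g x 0 < s * act t h (act t g x) 0"
proof -
  define I where "I = Inf ((\<lambda>g. act t g x 0) ` carrier G)"
  have one: "\<one>\<^bsub>G\<^esub> \<in> carrier G"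
    by (rule monoid.one_closed[OF group.is_monoid[OF group_G]])
  have ge: "1 \<le> act t g x 0" if "g \<in> carrier G" for g
    by (rule X_ge_1[OF act_in_X[OF that x]])
  have bdd: "bdd_below ((\<lambda>g. act t g x 0) ` carrier G)"
    by (rule bdd_belowI2[of _ 1]) (rule ge)
  have "1 \<le> I"
    unfolding I_def using one ge by (intro cInf_greatest) auto
  then have "I < s * I"
    using s by simp
  then obtain g where g: "g \<in> carrier G" "act t g x 0 < s * I"
    unfolding I_def using cInf_lessD[of "(\<lambda>g. act t g x 0) ` carrier G"] one by blast
  have "I \<le> act t h (act t g x) 0" if h: "h \<in> carrier G" for h
  proof -
    have "h \<otimes>\<^bsub>G\<^esub> g \<in> carrier G"
      by (rule monoid.m_closed[OF group.is_monoid[OF group_G] h g(1)])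
    then have "I \<le> act t (h \<otimes>\<^bsub>G\<^esub> g) x 0"
      unfolding I_def by (intro cInf_lower bdd imageI)
    then show ?thesis
      by (simp add: act_mult[OF h g(1) x])
  qed
  then have "act t g x 0 < s * act t h (act t g x) 0" if "h \<in> carrier G" for h
    using g(2) that s by (meson less_le_trans less_trans mult_left_mono not_le order.strict_implies_order zero_less_one)
  then show ?thesis
    using g(1) by blast
qed

text \<open>If the mass cannot be decreased much, the barycentre stays away from the sphere: otherwise a
  hyperbolic translation towards the barycentre would decrease the mass, by Jensen's inequality.\<close>

lemma balanced_mass_bound:
  assumes y: "y \<in> X t" and bal: "\<And>h. h \<in> carrier G \<Longrightarrow> y 0 < (5/3) powr t * act t h y 0"
  shows "y 0 \<le> 4"
proof -
  note p = H_posf[OF rep(1)[OF y]]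
  have y0: "1 \<le> y 0"
    by (rule X_ge_1[OF y])
  define m where "m = scale (1 / y 0) (rep t y)"
  have m: "posf m" "mass m = 1"
    using y0 p by (auto simp: m_def posf_scale mass_scale mass_rep[OF y])
  have repm: "rep t y \<phi> = y 0 * m \<phi>" for \<phi>
    using y0 by (simp add: m_def scale_def)
  have fm: "form t m m = 1 / (y 0)\<^sup>2"
    using H_form[OF rep(1)[OF y]]
    by (simp add: m_def form_scale_left form_scale_right[OF t0 t1 p p] power2_eq_square)
  define b where "b = iota 1 m"
  define Q where "Q = (\<Sum>i=1..n. b i * b i)"
  have b0: "b 0 = 1" "\<And>i. i > n \<Longrightarrow> b i = 0"
    using iota_0[OF m(1), of 1] m(2) by (auto simp: b_def iota_def)
  have f1: "form 1 m m = 1 - Q"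
    using form_1[OF m(1) m(1), of 1] b0 by (simp add: b_def[symmetric] lorentz_def Q_def)
  have "Q \<le> 81 / 100"
  proof (rule ccontr)
    assume "\<not> Q \<le> 81 / 100"
    then have Q: "81 / 100 < Q"
      by simp
    define r where "r = sqrt Q"
    have "sqrt ((9/10)\<^sup>2) < r"
      unfolding r_def using Q by (intro real_sqrt_less_mono) (simp add: power2_eq_square)
    then have r: "9/10 < r" "r * r = Q"
      using Q by (auto simp: r_def)
    \<comment> \<open>A step of length \<open>ln 2\<close> towards the barycentre, with hyperbolic
      cosine 5/4 and sine 3/4. As \<open>r\<close> exceeds 9/10, the mean factor
      \<open>5/4 - 3/4 * r\<close> is below 23/40, hence below 3/5, the inverse of the
      margin.\<close>
    define z where "z = (\<lambda>i. if i = 0 then 5/4 else 3/4 * (b i / r))"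
    have "(\<Sum>i=1..n. z i * z i) = (\<Sum>i=1..n. 9/16 / Q * (b i * b i))"
      unfolding r(2)[symmetric] by (intro sum.cong) (auto simp: z_def)
    also have "\<dots> = 9/16"
      unfolding sum_distrib_left[symmetric] Q_def[symmetric] using Q by simp
    finally have "lorentz n z z = 1"
      by (simp add: lorentz_def) (simp add: z_def)
    then have z: "z \<in> hyperboloid n"
      using b0 by (simp add: hyperboloid_def) (simp add: z_def)
    obtain h where h: "h \<in> carrier G" "h z = origin"
      using transitive[OF z origin_in_hyperboloid] by blast
    have "(\<Sum>i=1..n. b i * z i) = (\<Sum>i=1..n. 3/4 / r * (b i * b i))"
      by (intro sum.cong) (auto simp: z_def)
    also have "\<dots> = 3/4 * r"
      unfolding sum_distrib_left[symmetric] Q_def[symmetric] using r by (simp add: field_simps)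
    finally have lbz: "lorentz n b z = 5/4 - 3/4 * r"
      by (simp add: lorentz_def b0) (simp add: z_def)
    have mz: "m (\<lambda>\<xi>. lorentz n \<xi> z) = lorentz n b z"
      using lorentz_iota[OF m(1), of 1 z] by (simp add: b_def)
    have nn: "0 \<le> lorentz n \<xi> z" if "\<xi> \<in> S" for \<xi>
      using lorentz_S_pos(1)[OF that z] by simp
    have "act t h y 0 = y 0 * m (\<lambda>\<xi>. lorentz n \<xi> z powr t)"
      unfolding act_0[OF y h(1)] lift_0_eq[OF h(1) z h(2)] repm ..
    also have "\<dots> \<le> y 0 * (m (\<lambda>\<xi>. lorentz n \<xi> z) powr t)"
      using y0 by (intro mult_left_mono posf_Jensen m Bd_lorentz nn t0 t1) auto
    also have "\<dots> \<le> y 0 * (3/5) powr t"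
      using y0 r(1) t0 posf_nonneg[OF m(1) Bd_lorentz nn]
      by (intro mult_left_mono powr_mono2) (auto simp: mz lbz)
    finally have "(5/3) powr t * act t h y 0 \<le> (5/3) powr t * (y 0 * (3/5) powr t)"
      by (intro mult_left_mono) auto
    also have "\<dots> = y 0 * ((5/3 * (3/5)) powr t)"
      by (subst powr_mult) auto
    finally show False
      using bal[OF h(1)] by simp
  qed
  then have "19 / 100 \<le> form 1 m m"
    by (simp add: f1)
  moreover have "2 powr (-1) \<le> 2 powr (t - 1)"
    using t0 by (intro powr_mono) auto
  then have "1 / 2 \<le> 2 powr (t - 1)"
    by (simp add: powr_minus)
  ultimately have "1 / 2 * (19 / 100) \<le> 2 powr (t - 1) * form 1 m m"
    by (intro mult_mono) auto
  also have "\<dots> \<le> form t m m"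
    by (rule form_ge_form_1[OF m(1) m(1) t0 t1])
  finally have "19 / 200 * (y 0)\<^sup>2 \<le> 1"
    using y0 by (simp add: fm field_simps)
  then have "(y 0)\<^sup>2 \<le> 4\<^sup>2"
    by simp
  then show ?thesis
    by (rule power2_le_imp_le) simp
qed

lemma act_cocompact: "cocompact_action G K (act t)"
  unfolding cocompact_action_def
proof (intro exI conjI)
  \<comment> \<open>Every orbit has a point of mass at most 4, and \<open>ker_le_mass\<close>
    contributes another factor 4.\<close>
  show "compactin (mtopology_of K) (mcball_of K basept (arcosh 16))"
    using proper_space_K basept_in_X by (simp add: proper_space_def)
  show "(\<Union>g\<in>carrier G. act t g ` mcball_of K basept (arcosh 16)) = mspace K"
  proof (intro subset_antisym subsetI)
    fix x assume "x \<in> (\<Union>g\<in>carrier G. act t g ` mcball_of K basept (arcosh 16))"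
    then show "x \<in> mspace K"
      by (auto intro: act_in_X)
  next
    fix x assume "x \<in> mspace K"
    then have x: "x \<in> X t"
      by simp
    have "(5/3) powr 0 < (5/3::real) powr t"
      using t0 by (intro powr_less_mono) auto
    then obtain g where g: "g \<in> carrier G" "\<And>h. h \<in> carrier G \<Longrightarrow> act t g x 0 < (5/3) powr t * act t h (act t g x) 0"
      using near_minimum[OF x, of "(5/3) powr t"] by auto
    have y: "act t g x \<in> X t"
      by (rule act_in_X[OF g(1) x])
    have "act t g x 0 \<le> 4"
      by (rule balanced_mass_bound[OF y g(2)])
    then have "ker t (act t g x) basept \<le> 16"
      using ker_le_mass[OF y] by simp
    then have "mdist K basept (act t g x) \<le> arcosh 16"
      using mdist_le_iff[OF basept_in_X y, of "arcosh 16"] sym[OF y basept_in_X] by simp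
    then have "act t g x \<in> mcball_of K basept (arcosh 16)"
      using y basept_in_X by simp
    moreover have "act t (inv\<^bsub>G\<^esub> g) (act t g x) = x"
      by (rule act_inv(1)[OF g(1) x])
    ultimately show "x \<in> (\<Union>g\<in>carrier G. act t g ` mcball_of K basept (arcosh 16))"
      using group.inv_closed[OF group_G g(1)] by (intro UN_I[of "inv\<^bsub>G\<^esub> g"] image_eqI[of _ _ "act t g x"]) auto
  qed
qed

section \<open>Minimality\<close>

lemma pt_scale: "0 < c \<Longrightarrow> posf \<mu> \<Longrightarrow> 0 < form t \<mu> \<mu> \<Longrightarrow> pt (scale c \<mu>) = pt \<mu>"
proof -
  assume c: "0 < c" and \<mu>: "posf \<mu>" "0 < form t \<mu> \<mu>"
  have "sqrt (form t (scale c \<mu>) (scale c \<mu>)) = c * sqrt (form t \<mu> \<mu>)"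
    using c by (simp add: form_scale_left form_scale_right[OF t0 t1 \<mu>(1,1)] real_sqrt_mult)
  then have "scale (1 / sqrt (form t (scale c \<mu>) (scale c \<mu>))) (scale c \<mu>) = scale (1 / sqrt (form t \<mu> \<mu>)) \<mu>"
    using c by (simp add: scale_def)
  then show ?thesis
    by (simp add: pt_def)
qed

definition mean :: "(nat \<Rightarrow> real) \<Rightarrow> ((nat \<Rightarrow> real) \<Rightarrow> real) \<Rightarrow> real" where
  "mean x = scale (1 / x 0) (rep t x)"

lemma mean:
  assumes x: "x \<in> X t"
  shows "posf (mean x)" "mass (mean x) = 1" "form t (mean x) (mean x) = 1 / (x 0)\<^sup>2" "pt (mean x) = x"
    "form t (mean x) \<rho> = kerf t x \<rho> / x 0"
proof -
  note p = H_posf[OF rep(1)[OF x]] and f = H_form[OF rep(1)[OF x]]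
  have x0: "0 < x 0"
    using X_ge_1[OF x] by simp
  show "posf (mean x)" "mass (mean x) = 1"
    using x0 p by (auto simp: mean_def posf_scale mass_scale mass_rep[OF x])
  show "form t (mean x) (mean x) = 1 / (x 0)\<^sup>2"
    using f by (simp add: mean_def form_scale_left form_scale_right[OF t0 t1 p p] power2_eq_square)
  show "pt (mean x) = x"
    unfolding mean_def using x0 p f pt_scale[of "1 / x 0" "rep t x"] pt_iota[OF rep(1)[OF x]] rep(2)[OF x] by simp
  show "form t (mean x) \<rho> = kerf t x \<rho> / x 0"
    by (simp add: mean_def form_scale_left kerf_def)
qed

text \<open>The coefficient of \<open>s\<close> is the first variation of \<open>gap\<close> as
  \<open>a\<close> moves towards \<open>b\<close>; near minimality of \<open>a\<close> bounds it
  from below.\<close>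

lemma gap_comb:
  assumes p: "posf a" "posf b" "posf \<nu>" and s: "0 \<le> s" "s \<le> 1"
  shows "gap t (comb (1 - s) a s b) \<nu> = gap t a \<nu>
    + 2 * s * (form t \<nu> b - form t \<nu> a - form t a b + form t a a) + s\<^sup>2 * gap t a b"
proof -
  have "form t (comb (1 - s) a s b) (comb (1 - s) a s b)
     = (1 - s)\<^sup>2 * form t a a + 2 * s * (1 - s) * form t a b + s\<^sup>2 * form t b b"
    using s p form_commute[OF t0 t1 p(1,2)]
    by (simp add: form_comb_left form_comb_right[OF t0 t1] power2_eq_square algebra_simps)
  moreover have "form t (comb (1 - s) a s b) \<nu> = (1 - s) * form t \<nu> a + s * form t \<nu> b"
    using form_commute[OF t0 t1 p(1,3)] form_commute[OF t0 t1 p(2,3)] by (simp add: form_comb_left)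
  ultimately show ?thesis
    using form_commute[OF t0 t1 p(1,3)] by (simp add: gap_def power2_eq_square algebra_simps)
qed

text \<open>The element \<open>a\<close> below is an almost nearest point of the set to \<open>\<nu>\<close>. Its first-order condition against
  Dirac functionals, integrated against \<open>\<nu>\<close>, bounds the distance from \<open>a\<close> to \<open>\<nu>\<close>.\<close>

lemma act_minimal: "minimal_action G K (act t)"
  unfolding minimal_action_def
proof (rule notI, elim exE conjE)
  fix A assume "A \<noteq> {}" and psub: "A \<subset> mspace K" and cl: "closedin (mtopology_of K) A"
    and conv: "geodesically_convex K A" and inv: "\<forall>g\<in>carrier G. act t g ` A \<subseteq> A"
  have AX: "A \<subseteq> X t"
    using psub by auto
  obtain x where x: "x \<in> A" "x \<in> X t"
    using \<open>A \<noteq> {}\<close> AX by blast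
  \<comment> \<open>The nearest-point argument is linear in means, so \<open>A\<close> is replaced
    by the means projecting into it; geodesic convexity of \<open>A\<close> becomes affine convexity
    of \<open>W\<close>.\<close>
  define W where "W = {m. posf m \<and> mass m = 1 \<and> 0 < form t m m \<and> pt m \<in> A}"
  have Wm: "mean b \<in> W" if "b \<in> A" for b
    using mean[of b] X_ge_1[of b] that AX by (auto simp: W_def)
  have near_dirac: "\<exists>m\<in>W. form t m (dir \<xi>) \<le> \<epsilon>" if \<xi>: "\<xi> \<in> S" and \<epsilon>: "0 < \<epsilon>" for \<xi> \<epsilon>
  proof -
    have x0: "0 < x 0"
      using X_ge_1[OF x(2)] by simp
    \<comment> \<open>Translating towards \<open>\<xi>\<close> multiplies the product with an ideal
      point by \<open>s powr t\<close>; this choice brings the a priori bound \<open>2 * x 0\<close>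
      below \<open>\<epsilon>\<close>.\<close>
    define s where "s = min 1 ((\<epsilon> / (2 * x 0)) powr (1 / t))"
    have s: "0 < s" "s \<le> 1" "s powr t \<le> \<epsilon> / (2 * x 0)"
    proof -
      show "0 < s" "s \<le> 1"
        using \<epsilon> x0 by (auto simp: s_def)
      have "s powr t \<le> ((\<epsilon> / (2 * x 0)) powr (1 / t)) powr t"
        using \<epsilon> x0 t0 by (intro powr_mono2) (auto simp: s_def)
      also have "\<dots> = \<epsilon> / (2 * x 0)"
        using \<epsilon> x0 t0 by (simp add: powr_powr)
      finally show "s powr t \<le> \<epsilon> / (2 * x 0)" .
    qed
    \<comment> \<open>The point at distance \<open>- ln s\<close> from the origin on the ray towards
      \<open>\<xi>\<close>; its product with \<open>\<xi>\<close> is \<open>s\<close>.\<close>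
    define y where "y = (\<lambda>i. if i = 0 then (1 / s + s) / 2 else (1 / s - s) / 2 * \<xi> i)"
    have sum1: "(\<Sum>i=1..n. \<xi> i * \<xi> i) = 1"
      using dot_self[OF \<xi>] by (simp add: dot_def)
    have "(\<Sum>i=1..n. y i * y i) = (\<Sum>i=1..n. ((1 / s - s) / 2)\<^sup>2 * (\<xi> i * \<xi> i))"
      by (intro sum.cong) (auto simp: y_def power2_eq_square)
    also have "\<dots> = ((1 / s - s) / 2)\<^sup>2"
      unfolding sum_distrib_left[symmetric] sum1 by simp
    finally have "lorentz n y y = ((1 / s + s) / 2)\<^sup>2 - ((1 / s - s) / 2)\<^sup>2"
      by (simp add: lorentz_def) (simp add: y_def power2_eq_square)
    also have "\<dots> = 1"
      using s by (simp add: power2_eq_square field_simps)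
    finally have y: "y \<in> hyperboloid n"
      using s \<xi> by (simp add: hyperboloid_def) (auto simp: y_def S_def add_pos_pos)
    have "(\<Sum>i=1..n. \<xi> i * y i) = (\<Sum>i=1..n. (1 / s - s) / 2 * (\<xi> i * \<xi> i))"
      by (intro sum.cong) (auto simp: y_def)
    also have "\<dots> = (1 / s - s) / 2"
      unfolding sum_distrib_left[symmetric] sum1 by simp
    finally have ly: "lorentz n \<xi> y = s"
      using \<xi> by (simp add: lorentz_def S_def) (simp add: y_def field_simps)
    obtain g' where g': "g' \<in> carrier G" "g' y = origin"
      using transitive[OF y origin_in_hyperboloid] by blast
    define g where "g = inv\<^bsub>G\<^esub> g'"
    have g: "g \<in> carrier G"
      unfolding g_def by (rule group.inv_closed[OF group_G g'(1)])
    define b where "b = act t g x"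
    have b: "b \<in> A" "b \<in> X t"
      using inv g x AX by (auto simp: b_def)
    have "act t g' b = x"
      unfolding b_def g_def by (rule act_inv(2)[OF g'(1) x(2)])
    then have "s powr t * kerf t x (dir (sg (lift g') \<xi>)) = kerf t b (dir \<xi>)"
      using kerf_trans[OF conf_lift[OF g'(1)] b(2) \<xi>] lift_0_eq[OF g'(1) y g'(2), of \<xi>] ly by (simp add: act_def)
    moreover have "kerf t x (dir (sg (lift g') \<xi>)) \<le> 2 * x 0"
      using form_bound[OF t0 t1 H_posf[OF rep(1)[OF x(2)]] posf_dir[OF conf_sg[OF conf_lift[OF g'(1)] \<xi>]]]
      by (simp add: kerf_def mass_rep[OF x(2)] mass_dir)
    ultimately have "kerf t b (dir \<xi>) \<le> s powr t * (2 * x 0)"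
      by (metis mult_left_mono powr_ge_zero)
    also have "\<dots> \<le> \<epsilon> / (2 * x 0) * (2 * x 0)"
      using s(3) x0 by (intro mult_right_mono) auto
    also have "\<dots> = \<epsilon>"
      using x0 by simp
    finally have kb: "kerf t b (dir \<xi>) \<le> \<epsilon>" .
    have "form t (mean b) (dir \<xi>) = kerf t b (dir \<xi>) / b 0"
      by (rule mean(5)[OF b(2)])
    also have "\<dots> \<le> \<epsilon> / b 0"
      using kb X_ge_1[OF b(2)] by (intro divide_right_mono) auto
    also have "\<dots> \<le> \<epsilon>"
      using X_ge_1[OF b(2)] \<epsilon> by (simp add: field_simps)
    finally show ?thesis
      using Wm[OF b(1)] by blast
  qed
  have W_comb: "comb (1 - s) a s b \<in> W" if a: "a \<in> W" and b: "b \<in> W" and s: "0 \<le> s" "s \<le> 1" for a b s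
  proof -
    have ap: "posf a" "mass a = 1" "0 < form t a a" "pt a \<in> A" and bp: "posf b" "mass b = 1" "0 < form t b b" "pt b \<in> A"
      using a b by (auto simp: W_def)
    define c where "c = comb (1 - s) a s b"
    have c: "posf c" "mass c = 1"
      using s ap bp by (auto simp: c_def posf_comb mass_comb)
    have "form t c c = (1 - s)\<^sup>2 * form t a a + 2 * s * (1 - s) * form t a b + s\<^sup>2 * form t b b"
      using s ap bp form_commute[OF t0 t1 ap(1) bp(1)]
      by (simp add: c_def form_comb_left form_comb_right[OF t0 t1] posf_comb power2_eq_square algebra_simps)
    moreover have "0 \<le> 2 * s * (1 - s) * form t a b"
      using s form_nonneg[OF t0 t1 ap(1) bp(1)] by simp
    moreover have "0 < (1 - s)\<^sup>2 * form t a a + s\<^sup>2 * form t b b"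
      using ap bp by (cases "s = 0") (auto intro!: add_nonneg_pos)
    ultimately have fc: "0 < form t c c"
      by linarith
    define \<alpha> where "\<alpha> = (1 - s) * sqrt (form t a a) / sqrt (form t c c)"
    define \<beta> where "\<beta> = s * sqrt (form t b b) / sqrt (form t c c)"
    have "pt c \<in> A"
    proof (rule geodesically_convex_combination[OF conv AX ap(4) bp(4), of \<alpha> \<beta>])
      show "0 \<le> \<alpha>" "0 \<le> \<beta>"
        using s ap bp fc by (auto simp: \<alpha>_def \<beta>_def)
      show "pt c \<in> X t"
        by (rule pt_in_X[OF c(1) fc])
      show "ker t (pt c) w = \<alpha> * ker t (pt a) w + \<beta> * ker t (pt b) w" if w: "w \<in> X t" for w
        unfolding ker_kerf
        using kerf_pt[OF c(1) fc H_posf[OF rep(1)[OF w]]] kerf_pt[OF ap(1,3) H_posf[OF rep(1)[OF w]]]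
          kerf_pt[OF bp(1,3) H_posf[OF rep(1)[OF w]]] ap bp fc
        by (simp add: \<alpha>_def \<beta>_def c_def form_comb_left add_divide_distrib)
    qed
    then show ?thesis
      using c fc by (simp add: W_def c_def)
  qed
  have "x \<in> A" if x: "x \<in> X t" for x
  proof -
    define \<nu> where "\<nu> = mean x"
    have \<nu>: "posf \<nu>" "mass \<nu> = 1" "0 < form t \<nu> \<nu>" "pt \<nu> = x"
      using mean[OF x] X_ge_1[OF x] by (auto simp: \<nu>_def)
    define d2 where "d2 = Inf ((\<lambda>a. gap t a \<nu>) ` W)"
    have Wne: "W \<noteq> {}"
      using Wm \<open>A \<noteq> {}\<close> by blast
    have "bdd_below ((\<lambda>a. gap t a \<nu>) ` W)"
      using \<nu> by (intro bdd_belowI2[of _ 0]) (auto simp: W_def intro: gap_nonneg[OF t0 t1])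
    then have d2: "d2 \<le> gap t a \<nu>" if "a \<in> W" for a
      unfolding d2_def using that by (intro cInf_lower imageI)
    have approx: "\<exists>a\<in>W. gap t a \<nu> \<le> 4 * \<epsilon>" if \<epsilon>: "0 < \<epsilon>" "\<epsilon> \<le> 1" for \<epsilon>
    proof -
      obtain a where a: "a \<in> W" "gap t a \<nu> < d2 + \<epsilon>\<^sup>2"
        using cInf_lessD[of "(\<lambda>a. gap t a \<nu>) ` W" "d2 + \<epsilon>\<^sup>2"] Wne \<epsilon> unfolding d2_def by auto
      have ap: "posf a" "mass a = 1"
        using a by (auto simp: W_def)
      \<comment> \<open>First variation with step \<open>\<epsilon>\<close>: the slack in the
        infimum costs its square once, the quadratic term four times.\<close>
      have nb: "- (form t \<nu> b - form t \<nu> a - form t a b + form t a a) \<le> 5 / 2 * \<epsilon>" if b: "b \<in> W" for b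
      proof -
        have bp: "posf b" "mass b = 1"
          using b by (auto simp: W_def)
        have "gap t a b \<le> 4"
          using form_bound[OF t0 t1 ap(1) bp(1)] form_nonneg[OF t0 t1 ap(1) ap(1)] form_nonneg[OF t0 t1 bp(1) bp(1)]
          by (simp add: gap_def ap bp)
        then have "\<epsilon>\<^sup>2 * gap t a b \<le> \<epsilon>\<^sup>2 * 4"
          by (intro mult_left_mono) auto
        moreover have "d2 \<le> gap t (comb (1 - \<epsilon>) a \<epsilon> b) \<nu>"
          using W_comb[OF a(1) b] \<epsilon> by (intro d2) auto
        ultimately have "0 \<le> \<epsilon>\<^sup>2 + 2 * \<epsilon> * (form t \<nu> b - form t \<nu> a - form t a b + form t a a) + \<epsilon>\<^sup>2 * 4"
          using a(2) gap_comb[OF ap(1) bp(1) \<nu>(1) less_imp_le[OF \<epsilon>(1)] \<epsilon>(2)] by linarith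
        then have "0 \<le> \<epsilon> * (5 * \<epsilon> + 2 * (form t \<nu> b - form t \<nu> a - form t a b + form t a a))"
          by (simp add: power2_eq_square algebra_simps)
        then have "0 \<le> 5 * \<epsilon> + 2 * (form t \<nu> b - form t \<nu> a - form t a b + form t a a)"
          using \<epsilon>(1) by (simp add: zero_le_mult_iff)
        then show ?thesis
          by (simp add: field_simps)
      qed
      \<comment> \<open>Replacing \<open>b\<close> by the Dirac functional costs
        \<open>\<epsilon> / 2\<close> in each of two products, so 5/2 grows to 7/2, rounded up to
        4.\<close>
      have n\<xi>: "form t \<nu> a - form t a a \<le> 4 * \<epsilon> + form t (dir \<xi>) \<nu> - form t (dir \<xi>) a" if \<xi>: "\<xi> \<in> S" for \<xi>
      proof -
        note d = posf_dir[OF \<xi>]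
        obtain b where b: "b \<in> W" "form t b (dir \<xi>) \<le> (\<epsilon> / 2)\<^sup>2 / 2"
          using near_dirac[OF \<xi>, of "(\<epsilon> / 2)\<^sup>2 / 2"] \<epsilon> by auto
        have bp: "posf b" "mass b = 1" "0 < form t b b"
          using b by (auto simp: W_def)
        have g: "gap t b (dir \<xi>) \<le> (\<epsilon> / 2)\<^sup>2"
          using b(2) bp(3) t0 by (simp add: gap_def form_dir_dir lorentz_S_self[OF \<xi>])
        have near: "\<bar>form t b \<rho> - form t (dir \<xi>) \<rho>\<bar> \<le> \<epsilon> / 2" if \<rho>: "posf \<rho>" "mass \<rho> = 1" for \<rho>
        proof -
          have g0: "0 \<le> gap t b (dir \<xi>)"
            using bp by (intro gap_nonneg[OF t0 t1 _ d]) (auto simp: mass_dir)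
          have "(form t b \<rho> - form t (dir \<xi>) \<rho>)\<^sup>2 \<le> gap t b (dir \<xi>) * ((mass \<rho>)\<^sup>2 - form t \<rho> \<rho>)"
            by (rule form_diff_square[OF t0 t1 bp(1) d \<rho>(1)]) (simp add: bp mass_dir)
          also have "\<dots> \<le> gap t b (dir \<xi>) * 1"
            using form_nonneg[OF t0 t1 \<rho>(1,1)] g0 by (intro mult_left_mono) (auto simp: \<rho>)
          finally have "(form t b \<rho> - form t (dir \<xi>) \<rho>)\<^sup>2 \<le> (\<epsilon> / 2)\<^sup>2"
            using g by simp
          then show ?thesis
            using \<epsilon> by (subst (asm) abs_le_square_iff[symmetric]) auto
        qed
        show ?thesis
          using nb[OF b(1)] near[OF \<nu>(1,2)] near[OF ap] form_commute[OF t0 t1 \<nu>(1) bp(1)]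
            form_commute[OF t0 t1 ap(1) bp(1)] \<epsilon> by linarith
      qed
      have sec: "(\<lambda>\<xi>. form t (dir \<xi>) \<rho>) \<in> Bd" if "posf \<rho>" for \<rho>
        unfolding form_dir_left by (rule Bd_form_section[OF t0 t1 that])
      \<comment> \<open>Integrated against \<open>\<nu>\<close>, the Dirac terms become
        \<open>form t \<nu> \<nu>\<close> and \<open>form t \<nu> a\<close>, and the condition turns
        into a bound on \<open>gap t a \<nu>\<close>.\<close>
      have "\<nu> (\<lambda>\<xi>. form t \<nu> a - form t a a) \<le> \<nu> (\<lambda>\<xi>. 4 * \<epsilon> + form t (dir \<xi>) \<nu> - form t (dir \<xi>) a)"
        by (rule posf_mono[OF \<nu>(1) Bd_const Bd_diff[OF Bd_add[OF Bd_const sec[OF \<nu>(1)]] sec[OF ap(1)]]]) (rule n\<xi>)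
      also have "\<dots> = 4 * \<epsilon> + form t \<nu> \<nu> - form t \<nu> a"
        using posf_diff[OF \<nu>(1) Bd_add[OF Bd_const sec[OF \<nu>(1)]] sec[OF ap(1)], of "4 * \<epsilon>"]
          posf_add[OF \<nu>(1) Bd_const sec[OF \<nu>(1)], of "4 * \<epsilon>"] posf_const[OF \<nu>(1), of "4 * \<epsilon>"] \<nu>(2)
        by (simp add: form_def dir_def)
      finally have "gap t a \<nu> \<le> 4 * \<epsilon>"
        using form_commute[OF t0 t1 \<nu>(1) ap(1)] posf_const[OF \<nu>(1)] \<nu>(2) by (simp add: gap_def)
      then show ?thesis
        using a(1) by blast
    qed
    have "\<exists>a\<in>W. gap t a \<nu> \<le> 4 * (1 / real (Suc i))" for i
      by (rule approx) auto
    then obtain a where a: "\<And>i. a i \<in> W" "\<And>i. gap t (a i) \<nu> \<le> 4 * (1 / real (Suc i))"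
      by metis
    have ap: "posf (a i)" "mass (a i) = 1" "0 < form t (a i) (a i)" "pt (a i) \<in> A" for i
      using a(1)[of i] by (auto simp: W_def)
    have g0: "(\<lambda>i. gap t (a i) \<nu>) \<longlonglongrightarrow> 0"
    proof (rule tendsto_sandwich[OF always_eventually always_eventually tendsto_const])
      show "\<forall>i. 0 \<le> gap t (a i) \<nu>"
        using ap \<nu> by (auto intro: gap_nonneg[OF t0 t1])
      show "\<forall>i. gap t (a i) \<nu> \<le> 4 * (1 / real (Suc i))"
        using a by blast
      have "(\<lambda>i. 4 * (1 / real (Suc i))) \<longlonglongrightarrow> 4 * 0"
        using LIMSEQ_inverse_real_of_nat by (intro tendsto_intros) (simp add: inverse_eq_divide)
      then show "(\<lambda>i. 4 * (1 / real (Suc i))) \<longlonglongrightarrow> 0"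
        by simp
    qed
    have l1: "(\<lambda>i. form t (a i) \<nu>) \<longlonglongrightarrow> form t \<nu> \<nu>"
      by (rule gap_tendsto_form[OF t0 t1 ap(1,2) \<nu>(1,2) g0 \<nu>(1)])
    have "(\<lambda>i. 2 * form t (a i) \<nu> - form t \<nu> \<nu> - gap t (a i) \<nu>) \<longlonglongrightarrow> 2 * form t \<nu> \<nu> - form t \<nu> \<nu> - 0"
      by (intro tendsto_intros l1 g0)
    then have l2: "(\<lambda>i. form t (a i) (a i)) \<longlonglongrightarrow> form t \<nu> \<nu>"
      by (simp add: gap_def)
    have "(\<lambda>i. form t (a i) \<nu> / (sqrt (form t (a i) (a i)) * sqrt (form t \<nu> \<nu>)))
       \<longlonglongrightarrow> form t \<nu> \<nu> / (sqrt (form t \<nu> \<nu>) * sqrt (form t \<nu> \<nu>))"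
      using \<nu>(3) by (intro tendsto_intros l1 l2) auto
    then have "(\<lambda>i. ker t (pt (a i)) x) \<longlonglongrightarrow> 1"
      using \<nu> ap by (simp add: ker_pt flip: \<nu>(4))
    then have "limitin mtopology (\<lambda>i. pt (a i)) x sequentially"
      using ap(4) AX by (intro limitin_kernelI x) auto
    moreover have "range (\<lambda>i. pt (a i)) \<subseteq> A"
      using ap(4) by auto
    ultimately show "x \<in> A"
      using cl unfolding mtopology_kernel_space metric_closedin_iff_sequentially_closed by blast
  qed
  then show False
    using psub by auto
qed

end

section \<open>Boundary maps of similarities\<close>

lemma exp_arcosh: "1 \<le> (A::real) \<Longrightarrow> exp (arcosh A) = A + sqrt (A\<^sup>2 - 1)"
proof -
  assume A: "1 \<le> A"
  then have "0 \<le> A\<^sup>2 - 1"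
    by simp
  then have "0 < A + sqrt (A\<^sup>2 - 1)"
    using A by (intro add_pos_nonneg) auto
  then show ?thesis
    using A by (simp add: arcosh_real_def)
qed

text \<open>For large \<open>A\<close> both \<open>2 * A\<close> and \<open>exp (arcosh A)\<close>
  agree to leading order, so multiplying distances by \<open>\<mu>\<close> raises
  \<open>2 * A\<close> to the power \<open>\<mu>\<close> at infinity. The factors 2 in the boundary
  relations originate here.\<close>

lemma cosh_arcosh_asymptotic:
  fixes c A :: "nat \<Rightarrow> real"
  assumes c: "\<And>i. 0 < c i" "c \<longlonglongrightarrow> 0" and A: "\<And>i. 1 \<le> A i" and lim: "(\<lambda>i. c i * A i) \<longlonglongrightarrow> \<alpha>"
    and \<alpha>: "0 < \<alpha>" and \<mu>: "0 < \<mu>"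
  shows "(\<lambda>i. c i powr \<mu> * (2 * cosh (\<mu> * arcosh (A i)))) \<longlonglongrightarrow> (2 * \<alpha>) powr \<mu>"
proof -
  have "(\<lambda>i. c i * A i + sqrt ((c i * A i)\<^sup>2 - (c i)\<^sup>2)) \<longlonglongrightarrow> \<alpha> + sqrt (\<alpha>\<^sup>2 - 0\<^sup>2)"
    by (intro tendsto_intros lim c)
  then have "(\<lambda>i. c i * A i + sqrt ((c i * A i)\<^sup>2 - (c i)\<^sup>2)) \<longlonglongrightarrow> 2 * \<alpha>"
    using \<alpha> by simp
  moreover have "c i * A i + sqrt ((c i * A i)\<^sup>2 - (c i)\<^sup>2) = c i * exp (arcosh (A i))" for i
  proof -
    have "(c i * A i)\<^sup>2 - (c i)\<^sup>2 = (c i)\<^sup>2 * ((A i)\<^sup>2 - 1)"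
      by (simp add: power2_eq_square algebra_simps)
    then show ?thesis
      using c(1)[of i] by (simp add: exp_arcosh[OF A] real_sqrt_mult distrib_left)
  qed
  ultimately have e: "(\<lambda>i. c i * exp (arcosh (A i))) \<longlonglongrightarrow> 2 * \<alpha>"
    by simp
  have 1: "(\<lambda>i. (c i * exp (arcosh (A i))) powr \<mu>) \<longlonglongrightarrow> (2 * \<alpha>) powr \<mu>"
    using \<alpha> by (intro tendsto_intros e) auto
  have "(\<lambda>i. c i powr (2 * \<mu>)) \<longlonglongrightarrow> 0 powr (2 * \<mu>)"
    using c \<mu> by (intro tendsto_powr' tendsto_const) (auto intro!: always_eventually less_imp_le)
  then have "(\<lambda>i. c i powr (2 * \<mu>) / (c i * exp (arcosh (A i))) powr \<mu>) \<longlonglongrightarrow> 0 powr (2 * \<mu>) / (2 * \<alpha>) powr \<mu>"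
    using \<alpha> by (intro tendsto_divide 1) auto
  then have 2: "(\<lambda>i. c i powr (2 * \<mu>) / (c i * exp (arcosh (A i))) powr \<mu>) \<longlonglongrightarrow> 0"
    by simp
  have "c i powr \<mu> * (2 * cosh (\<mu> * arcosh (A i)))
     = (c i * exp (arcosh (A i))) powr \<mu> + c i powr (2 * \<mu>) / (c i * exp (arcosh (A i))) powr \<mu>" for i
  proof -
    have p: "exp (arcosh (A i)) powr \<mu> = exp (\<mu> * arcosh (A i))"
      by (simp add: powr_def)
    have "c i powr (2 * \<mu>) = c i powr \<mu> * c i powr \<mu>"
      by (simp flip: powr_add)
    then show ?thesis
      using c(1)[of i] by (simp add: powr_mult p cosh_def exp_minus field_simps)
  qed
  then show ?thesis
    using tendsto_add[OF 1 2] by simp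
qed

section \<open>Cross-ratios and products with ideal points\<close>

context light_sphere
begin

text \<open>On \<open>S\<close> the Lorentz product is half the squared chordal distance, so this is
  Ptolemy's inequality with the roots cleared: the roots of the three products satisfy the triangle
  inequality. It is Cauchy-Schwarz for the components of \<open>s2\<close> and \<open>s4\<close>
  orthogonal to the plane of \<open>s1\<close> and \<open>s3\<close>.\<close>

lemma S_Ptolemy:
  assumes s: "s1 \<in> S" "s2 \<in> S" "s3 \<in> S" "s4 \<in> S" and 13: "0 < lorentz n s1 s3"
  shows "(lorentz n s1 s3 * lorentz n s2 s4 - lorentz n s1 s2 * lorentz n s3 s4 - lorentz n s1 s4 * lorentz n s2 s3)\<^sup>2
    \<le> 4 * (lorentz n s1 s2 * lorentz n s3 s4) * (lorentz n s1 s4 * lorentz n s2 s3)"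
proof -
  define q where "q = lorentz n s1 s3"
  \<comment> \<open>A unit timelike vector in that plane, which makes the orthogonal complement
    negative semidefinite; \<open>w\<close> below is the projection to the complement.\<close>
  define y where "y = (\<lambda>i. (0 + (1 / sqrt (2 * q)) * s1 i) + (1 / sqrt (2 * q)) * s3 i)"
  define w where "w x = (\<lambda>i. (x i + (- lorentz n x s3 / q) * s1 i) + (- lorentz n x s1 / q) * s3 i)" for x
  have q: "0 < q"
    using 13 by (simp add: q_def)
  have z: "lorentz n (\<lambda>i. 0) x = 0" for x
    by (simp add: lorentz_def)
  have l: "lorentz n s1 s1 = 0" "lorentz n s3 s3 = 0" "lorentz n s1 s3 = q" "lorentz n s3 s1 = q"
    using s by (auto simp: lorentz_S_self q_def lorentz_commute[of n s3 s1])
  have y1: "lorentz n y x = (lorentz n s1 x + lorentz n s3 x) / sqrt (2 * q)" for x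
    unfolding y_def lorentz_comb_left z by (simp add: add_divide_distrib)
  have "lorentz n s1 y = q / sqrt (2 * q)" "lorentz n s3 y = q / sqrt (2 * q)"
    using y1[of s1] y1[of s3] by (simp_all add: l lorentz_commute[of n s1 y] lorentz_commute[of n s3 y])
  then have "lorentz n y y = 2 * q / (sqrt (2 * q) * sqrt (2 * q))"
    using y1[of y] by simp
  then have "lorentz n y y = 1"
    using q by simp
  have w1: "lorentz n (w x) v = lorentz n x v - lorentz n x s3 / q * lorentz n s1 v - lorentz n x s1 / q * lorentz n s3 v" for x v
    unfolding w_def lorentz_comb_left by simp
  have w13: "lorentz n (w x) s1 = 0" "lorentz n (w x) s3 = 0" for x
    using q by (simp_all add: w1 l)
  have wy: "lorentz n (w x) y = 0" for x
    unfolding lorentz_commute[of n _ y] y1 by (simp add: lorentz_commute[of n _ "w x"] w13)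
  have ww: "lorentz n (w x) (w v) = lorentz n x v - (lorentz n x s3 * lorentz n s1 v + lorentz n x s1 * lorentz n s3 v) / q" for x v
  proof -
    have "lorentz n (w x) (w v) = lorentz n (w v) (w x)"
      by (rule lorentz_commute)
    also have "\<dots> = lorentz n v (w x)"
      using w13[of x] by (simp add: w1[of v "w x"] lorentz_commute[of n s1 "w x"] lorentz_commute[of n s3 "w x"])
    also have "\<dots> = lorentz n (w x) v"
      by (rule lorentz_commute)
    finally show ?thesis
      unfolding w1 by (simp add: diff_divide_distrib add_divide_distrib)
  qed
  have "(lorentz n (w s2) (w s4))\<^sup>2 \<le> lorentz n (w s2) (w s2) * lorentz n (w s4) (w s4)"
    by (rule lorentz_orth_Cauchy_Schwarz[OF \<open>lorentz n y y = 1\<close> wy wy])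
  then have "(lorentz n (w s2) (w s4))\<^sup>2 * (q * q) \<le> lorentz n (w s2) (w s2) * lorentz n (w s4) (w s4) * (q * q)"
    using q by (intro mult_right_mono) auto
  moreover have "(lorentz n (w s2) (w s4))\<^sup>2 * (q * q) = (q * lorentz n s2 s4 - lorentz n s1 s2 * lorentz n s3 s4 - lorentz n s1 s4 * lorentz n s2 s3)\<^sup>2"
    using q by (simp add: ww power2_eq_square field_simps lorentz_commute[of n s2 s1])
  moreover have "lorentz n (w s2) (w s2) * lorentz n (w s4) (w s4) * (q * q)
     = 4 * (lorentz n s1 s2 * lorentz n s3 s4) * (lorentz n s1 s4 * lorentz n s2 s3)"
    using q s by (simp add: ww lorentz_S_self lorentz_commute[of n s2 s1] lorentz_commute[of n s4 s1]
      lorentz_commute[of n s3 s2] lorentz_commute[of n s4 s3] field_simps)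
  ultimately show ?thesis
    by (simp add: q_def)
qed

lemma other_point:
  assumes "\<xi> \<in> S"
  shows "\<exists>\<eta>\<in>S. \<eta> \<noteq> \<xi>"
proof -
  have "unit 1 1 \<noteq> unit 1 (-1)"
    by (auto simp: unit_def fun_eq_iff intro!: exI[of _ 1])
  then show ?thesis
    using unit_1_S by metis
qed

end

context light_sphere_param
begin

text \<open>If the product were 0, subtracting the multiple of the null functional \<open>z\<close>
  that cancels the mass would leave form 1 at mass zero.\<close>

lemma form_H_light_pos:
  assumes \<mu>: "\<mu> \<in> H t" and z: "posf z" "form t z z = 0" "0 < mass z"
  shows "0 < form t \<mu> z"
proof (rule ccontr)
  assume "\<not> 0 < form t \<mu> z"
  then have "form t \<mu> z = 0"
    using form_nonneg[OF t0 t1 H_posf[OF \<mu>] z(1)] by simp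
  then show False
    using form_psd[OF t0 t1 H_posf[OF \<mu>] z(1,1), of 1 "- mass \<mu> / mass z" 0] z H_form[OF \<mu>] by simp
qed

lemma kerf_dir_pos: "x \<in> X t \<Longrightarrow> \<xi> \<in> S \<Longrightarrow> 0 < kerf t x (dir \<xi>)"
  unfolding kerf_def using t0
  by (intro form_H_light_pos rep posf_dir) (auto simp: form_dir_dir lorentz_S_self mass_dir)

text \<open>A sequence of Dirac functionals with products tending to 0 would have a null limit of
  mass 1 with product 0. The uniform bound serves to bound conformal factors.\<close>

lemma kerf_dir_lower:
  assumes x: "x \<in> X t"
  shows "\<exists>c>0. \<forall>\<xi>\<in>S. c \<le> kerf t x (dir \<xi>)"
proof (rule ccontr)
  assume "\<not> ?thesis"
  then have "\<exists>\<xi>\<in>S. kerf t x (dir \<xi>) < 1 / real (Suc i)" for i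
    by (metis not_le of_nat_0_less_iff zero_less_Suc zero_less_divide_1_iff)
  then obtain \<xi> where \<xi>: "\<And>i. \<xi> i \<in> S" "\<And>i. kerf t x (dir (\<xi> i)) < 1 / real (Suc i)"
    by metis
  note r = rep(1)[OF x]
  obtain z r where z: "posf z" "strict_mono (r :: nat \<Rightarrow> nat)" "(\<lambda>i. mass (dir (\<xi> (r i)))) \<longlonglongrightarrow> mass z"
    and f: "\<And>\<rho>. posf \<rho> \<Longrightarrow> (\<lambda>i. form t (dir (\<xi> (r i))) \<rho>) \<longlonglongrightarrow> form t z \<rho>"
    and ff: "(\<lambda>i. form t (dir (\<xi> (r i))) (dir (\<xi> (r i)))) \<longlonglongrightarrow> form t z z"
    using cone_compact[OF t0 t1, of "\<lambda>i. dir (\<xi> i)" 1] \<xi>(1) by (auto simp: posf_dir mass_dir)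
  have "(\<lambda>i::nat. 1) \<longlonglongrightarrow> mass z"
    using z(3) by (simp add: mass_dir)
  from LIMSEQ_unique[OF tendsto_const this] have mz: "mass z = 1"
    by simp
  have "(\<lambda>i::nat. 0) \<longlonglongrightarrow> form t z z"
    using ff t0 \<xi>(1) by (simp add: form_dir_dir lorentz_S_self)
  from LIMSEQ_unique[OF tendsto_const this] have zz: "form t z z = 0"
    by simp
  have "form t z (rep t x) \<le> 0"
  proof (rule LIMSEQ_le[OF f[OF H_posf[OF rep(1)[OF x]]]])
    show "(\<lambda>i. 1 / real (Suc i)) \<longlonglongrightarrow> 0"
      using LIMSEQ_inverse_real_of_nat by (simp add: inverse_eq_divide)
    have "form t (dir (\<xi> (r i))) (rep t x) \<le> 1 / real (Suc i)" for i
    proof -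
      have "form t (dir (\<xi> (r i))) (rep t x) = kerf t x (dir (\<xi> (r i)))"
        unfolding kerf_def by (rule form_commute[OF t0 t1 posf_dir[OF \<xi>(1)] H_posf[OF rep(1)[OF x]]])
      also have "\<dots> \<le> 1 / real (Suc (r i))"
        using \<xi>(2) less_imp_le by blast
      also have "\<dots> \<le> 1 / real (Suc i)"
        using seq_suble[OF z(2), of i] by (intro divide_left_mono) auto
      finally show ?thesis .
    qed
    then show "\<exists>N. \<forall>i\<ge>N. form t (dir (\<xi> (r i))) (rep t x) \<le> 1 / real (Suc i)"
      by blast
  qed
  moreover have "0 < form t (rep t x) z"
    by (rule form_H_light_pos[OF rep(1)[OF x] z(1) zz]) (simp add: mz)
  ultimately show False
    using form_commute[OF t0 t1 z(1) H_posf[OF rep(1)[OF x]]] by simp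
qed

text \<open>The unit-speed geodesic running from \<open>\<eta>\<close> at minus infinity to
  \<open>\<xi>\<close> at plus infinity; the root normalizes the form to 1.\<close>

definition line where
  "line \<xi> \<eta> s = comb (exp s / sqrt (2 * lorentz n \<xi> \<eta> powr t)) (dir \<xi>) (exp (- s) / sqrt (2 * lorentz n \<xi> \<eta> powr t)) (dir \<eta>)"

lemma line_in_H:
  assumes "\<xi> \<in> S" "\<eta> \<in> S" "\<eta> \<noteq> \<xi>"
  shows "line \<xi> \<eta> s \<in> H t" "0 < lorentz n \<xi> \<eta>"
proof -
  show l: "0 < lorentz n \<xi> \<eta>"
    using lorentz_S_nonneg[OF assms(1,2)] lorentz_S_eq_0[OF assms(1,2)] assms(3) by fastforce
  have "exp s * exp (- s) = 1"
    by (simp flip: exp_add)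
  then show "line \<xi> \<eta> s \<in> H t"
    using assms l t0 by (simp add: H_def line_def posf_comb posf_dir form_comb_left form_comb_right[OF t0 t1]
        form_dir_dir lorentz_S_self lorentz_commute[of n \<eta> \<xi>] field_simps)
qed

lemma kerf_line:
  assumes "\<xi> \<in> S" "\<eta> \<in> S" "\<eta> \<noteq> \<xi>" "posf \<rho>"
  shows "kerf t (iota t (line \<xi> \<eta> s)) \<rho> = exp s / sqrt (2 * lorentz n \<xi> \<eta> powr t) * form t (dir \<xi>) \<rho>
     + exp (- s) / sqrt (2 * lorentz n \<xi> \<eta> powr t) * form t (dir \<eta>) \<rho>"
  unfolding kerf_iota[OF line_in_H(1)[OF assms(1-3)] assms(4)] by (simp add: line_def form_comb_left)

text \<open>Test along a line ending at \<open>\<zeta>\<close>. The product of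
  \<open>\<zeta>\<close> with itself is 0, so one side only contains \<open>exp (- s)\<close>;
  comparing two parameters removes the \<open>exp s\<close> term of the other side, which is the
  product of \<open>\<zeta>\<close> and \<open>\<xi>\<close>.\<close>

lemma dirac_unique:
  assumes \<xi>: "\<xi> \<in> S" and \<zeta>: "\<zeta> \<in> S" and eq: "\<And>v. v \<in> X t \<Longrightarrow> c * kerf t v (dir \<zeta>) = kerf t v (dir \<xi>)"
  shows "\<zeta> = \<xi>" "c = 1"
proof -
  obtain \<eta> where \<eta>: "\<eta> \<in> S" "\<eta> \<noteq> \<zeta>"
    using other_point[OF \<zeta>] by blast
  define k where "k = sqrt (2 * lorentz n \<zeta> \<eta> powr t)"
  have k: "0 < k"
    using line_in_H(2)[OF \<zeta> \<eta>] by (simp add: k_def)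
  have "c * exp (- s) * lorentz n \<eta> \<zeta> powr t = exp s * lorentz n \<zeta> \<xi> powr t + exp (- s) * lorentz n \<eta> \<xi> powr t" for s
    using eq[OF iota_in_X[OF line_in_H(1)[OF \<zeta> \<eta>, of s]]] t0 k
    unfolding kerf_line[OF \<zeta> \<eta> posf_dir[OF \<zeta>]] kerf_line[OF \<zeta> \<eta> posf_dir[OF \<xi>]] k_def[symmetric]
    by (simp add: form_dir_dir lorentz_S_self[OF \<zeta>] field_simps)
  from this[of 0] this[of "ln 2"]
  have "lorentz n \<zeta> \<xi> powr t = 0"
    by (simp add: exp_minus field_simps)
  then show *: "\<zeta> = \<xi>"
    using lorentz_S_eq_0[OF \<zeta> \<xi>] by simp
  have v: "iota t (line \<zeta> \<eta> 0) \<in> X t"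
    by (rule iota_in_X[OF line_in_H(1)[OF \<zeta> \<eta>]])
  show "c = 1"
    using eq[OF v] kerf_dir_pos[OF v \<xi>] * by simp
qed

end

section \<open>Ideal points and scaling factors of similarities\<close>

locale similarity = P: light_sphere_param n t + Q: light_sphere_param n t'
  for n :: nat and t t' :: real +
  fixes \<mu> :: real and h :: "(nat \<Rightarrow> real) \<Rightarrow> nat \<Rightarrow> real"
  assumes \<mu>: "0 < \<mu>" and h_in: "x \<in> P.X t \<Longrightarrow> h x \<in> P.X t'"
    and h_dist: "x \<in> P.X t \<Longrightarrow> y \<in> P.X t \<Longrightarrow> arcosh (P.ker t' (h x) (h y)) = \<mu> * arcosh (P.ker t x y)"
begin

lemma ker_h: "x \<in> P.X t \<Longrightarrow> y \<in> P.X t \<Longrightarrow> P.ker t' (h x) (h y) = cosh (\<mu> * arcosh (P.ker t x y))"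
  by (simp flip: h_dist add: Q.ge1 h_in)

text \<open>Follow a line to \<open>\<xi>\<close>. The images, rescaled by
  \<open>c i powr \<mu>\<close>, keep bounded mass and subconverge to a nonzero null functional,
  which is a Dirac functional up to the factor \<open>\<kappa>\<close>. The approximating sequence
  stays in the statement because a second passage to the limit relates pairs of ideal
  points.\<close>

lemma ideal_point:
  assumes \<xi>: "\<xi> \<in> P.S"
  shows "\<exists>\<sigma>\<in>P.S. \<exists>\<kappa>>0. (\<forall>v\<in>P.X t. \<kappa> * (2 * P.kerf t' (h v) (P.dir \<sigma>)) = (2 * P.kerf t v (P.dir \<xi>)) powr \<mu>) \<and>
    (\<exists>x c. (\<forall>i. x i \<in> P.X t \<and> 0 < c i) \<and>
       (\<forall>\<rho>. P.posf \<rho> \<longrightarrow> (\<lambda>i::nat. c i * P.kerf t (x i) \<rho>) \<longlonglongrightarrow> P.form t (P.dir \<xi>) \<rho>) \<and>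
       (\<forall>\<rho>. P.posf \<rho> \<longrightarrow> (\<lambda>i. c i powr \<mu> * P.kerf t' (h (x i)) \<rho>) \<longlonglongrightarrow> \<kappa> * P.form t' (P.dir \<sigma>) \<rho>))"
proof -
  obtain \<eta> where \<eta>: "\<eta> \<in> P.S" "\<eta> \<noteq> \<xi>"
    using P.other_point[OF \<xi>] by blast
  define k where "k = sqrt (2 * lorentz n \<xi> \<eta> powr t)"
  have k: "0 < k"
    using P.line_in_H(2)[OF \<xi> \<eta>] by (simp add: k_def)
  define x where "x i = P.iota t (P.line \<xi> \<eta> (real i))" for i
  define c where "c i = k * exp (- real i)" for i
  have xX: "x i \<in> P.X t" for i
    unfolding x_def by (rule P.iota_in_X[OF P.line_in_H(1)[OF \<xi> \<eta>]])
  have c0: "0 < c i" for i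
    using k by (simp add: c_def)
  have e0: "(\<lambda>i. exp (- real i)) \<longlonglongrightarrow> 0"
    by (rule filterlim_compose[OF exp_at_bot]) (rule filterlim_compose[OF filterlim_uminus_at_bot_at_top filterlim_real_sequentially])
  then have cl: "c \<longlonglongrightarrow> 0"
    unfolding c_def using tendsto_mult[OF tendsto_const[of k] e0] by simp
  have cx: "c i * P.kerf t (x i) \<rho> = P.form t (P.dir \<xi>) \<rho> + exp (- real i) * exp (- real i) * P.form t (P.dir \<eta>) \<rho>" if "P.posf \<rho>" for i \<rho>
  proof -
    have "exp (- real i) * exp (real i) = 1"
      by (simp flip: exp_add)
    then show ?thesis
      unfolding x_def P.kerf_line[OF \<xi> \<eta> that] k_def[symmetric] c_def using k by (simp add: field_simps)
  qed
  have lim1: "(\<lambda>i. c i * P.kerf t (x i) \<rho>) \<longlonglongrightarrow> P.form t (P.dir \<xi>) \<rho>" if "P.posf \<rho>" for \<rho>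
  proof -
    have "(\<lambda>i. P.form t (P.dir \<xi>) \<rho> + exp (- real i) * exp (- real i) * P.form t (P.dir \<eta>) \<rho>)
        \<longlonglongrightarrow> P.form t (P.dir \<xi>) \<rho> + 0 * 0 * P.form t (P.dir \<eta>) \<rho>"
      by (intro tendsto_intros e0)
    then show ?thesis
      unfolding cx[OF that] by simp
  qed
  have lim2: "(\<lambda>i. c i powr \<mu> * (2 * P.ker t' (h (x i)) (h v))) \<longlonglongrightarrow> (2 * P.kerf t v (P.dir \<xi>)) powr \<mu>" if v: "v \<in> P.X t" for v
  proof -
    have pv: "P.posf (P.rep t v)"
      by (rule P.H_posf[OF P.rep(1)[OF v]])
    have "(\<lambda>i. c i * P.ker t (x i) v) \<longlonglongrightarrow> P.kerf t v (P.dir \<xi>)"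
      using lim1[OF pv] P.form_commute[OF P.t0 P.t1 P.posf_dir[OF \<xi>] pv] by (simp add: P.ker_kerf P.kerf_def)
    then have "(\<lambda>i. c i powr \<mu> * (2 * cosh (\<mu> * arcosh (P.ker t (x i) v)))) \<longlonglongrightarrow> (2 * P.kerf t v (P.dir \<xi>)) powr \<mu>"
      by (intro cosh_arcosh_asymptotic c0 cl P.kerf_dir_pos v \<xi> \<mu> P.ge1 xX)
    then show ?thesis
      by (simp add: ker_h xX v)
  qed
  define y where "y i = P.scale (2 * c i powr \<mu>) (P.rep t' (h (x i)))" for i
  have hr: "P.rep t' (h (x i)) \<in> P.H t'" "P.posf (P.rep t' (h (x i)))" for i
    using P.rep(1)[OF h_in[OF xX]] P.H_posf by auto
  have y: "P.posf (y i)" for i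
    unfolding y_def by (intro P.posf_scale hr) simp
  have fy: "P.form t' (y i) \<rho> = 2 * c i powr \<mu> * P.kerf t' (h (x i)) \<rho>" for i \<rho>
    by (simp add: y_def P.form_scale_left P.kerf_def)
  have fyv: "P.form t' (y i) (P.rep t' (h v)) = c i powr \<mu> * (2 * P.ker t' (h (x i)) (h v))" for i v
    by (simp add: fy P.ker_def P.kerf_def)
  obtain M where M: "\<And>i. P.mass (y i) \<le> M"
  proof -
    \<comment> \<open>Mass is controlled by the product with one fixed point, here the image of
      \<open>x 0\<close>, and these rescaled products converge.\<close>
    define w where "w = h (x 0)"
    have w: "w \<in> P.X t'"
      by (simp add: w_def h_in xX)
    obtain B where B: "\<And>i. \<bar>c i powr \<mu> * (2 * P.ker t' (h (x i)) w)\<bar> \<le> B"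
      using convergent_imp_Bseq[OF convergentI[OF lim2[OF xX[of 0]]]] unfolding Bseq_def w_def real_norm_def by blast
    have "P.mass (y i) \<le> 4 * P.ker t' w Q.basept * B" for i
    proof -
      have "P.mass (y i) = 2 * c i powr \<mu> * h (x i) 0"
        by (simp add: y_def P.mass_scale Q.mass_rep h_in xX)
      also have "\<dots> \<le> 2 * c i powr \<mu> * (4 * P.ker t' w Q.basept * P.ker t' (h (x i)) w)"
        by (intro mult_left_mono Q.mass_le_ker' h_in xX w) simp
      also have "\<dots> = 4 * P.ker t' w Q.basept * (c i powr \<mu> * (2 * P.ker t' (h (x i)) w))"
        by simp
      also have "\<dots> \<le> 4 * P.ker t' w Q.basept * B"
        using B[of i] Q.ge1[OF w Q.basept_in_X] by (intro mult_left_mono) auto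
      finally show ?thesis .
    qed
    then show ?thesis
      by (rule that)
  qed
  obtain z r where z: "P.posf z" and r: "strict_mono (r :: nat \<Rightarrow> nat)"
    and fz: "\<And>\<rho>. P.posf \<rho> \<Longrightarrow> (\<lambda>i. P.form t' (y (r i)) \<rho>) \<longlonglongrightarrow> P.form t' z \<rho>"
    and ffz: "(\<lambda>i. P.form t' (y (r i)) (y (r i))) \<longlonglongrightarrow> P.form t' z z"
    using P.cone_compact[OF Q.t0 Q.t1, of y M, OF y M] by blast
  have zv: "P.form t' z (P.rep t' (h v)) = (2 * P.kerf t v (P.dir \<xi>)) powr \<mu>" if v: "v \<in> P.X t" for v
  proof -
    have "(\<lambda>i. P.form t' (y (r i)) (P.rep t' (h v))) \<longlonglongrightarrow> (2 * P.kerf t v (P.dir \<xi>)) powr \<mu>"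
      unfolding fyv using LIMSEQ_subseq_LIMSEQ[OF lim2[OF v] r] by (simp add: o_def)
    then show ?thesis
      using fz[OF P.H_posf[OF P.rep(1)[OF h_in[OF v]]]] LIMSEQ_unique by blast
  qed
  have "P.form t' (y i) (y i) = 4 * (c i powr \<mu> * c i powr \<mu>)" for i
    using P.H_form[OF hr(1)[of i]]
    by (simp add: y_def P.form_scale_left P.form_scale_right[OF Q.t0 Q.t1 hr(2) hr(2)])
  moreover have cp: "(\<lambda>i. c i powr \<mu>) \<longlonglongrightarrow> 0 powr \<mu>"
    using c0 cl \<mu> by (intro tendsto_powr' tendsto_const) (auto intro!: always_eventually less_imp_le)
  have "(\<lambda>i. 4 * (c i powr \<mu> * c i powr \<mu>)) \<longlonglongrightarrow> 4 * (0 powr \<mu> * 0 powr \<mu>)"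
    by (rule tendsto_mult[OF tendsto_const tendsto_mult[OF cp cp]])
  ultimately have "(\<lambda>i. P.form t' (y i) (y i)) \<longlonglongrightarrow> 0"
    by simp
  then have "(\<lambda>i. P.form t' (y (r i)) (y (r i))) \<longlonglongrightarrow> 0"
    using LIMSEQ_subseq_LIMSEQ[OF _ r] by (fastforce simp: o_def)
  then have zz: "P.form t' z z = 0"
    using ffz LIMSEQ_unique by blast
  have mz: "0 < P.mass z"
  proof (rule ccontr)
    assume "\<not> 0 < P.mass z"
    then have "P.mass z = 0"
      using P.mass_nonneg[OF z] by simp
    then have "P.form t' z (P.rep t' (h (x 0))) \<le> 0"
      using P.form_bound[OF Q.t0 Q.t1 z hr(2)[of 0]] by simp
    then have "(2 * P.kerf t (x 0) (P.dir \<xi>)) powr \<mu> \<le> 0"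
      by (simp only: zv[OF xX])
    moreover have "0 < (2 * P.kerf t (x 0) (P.dir \<xi>)) powr \<mu>"
      using P.kerf_dir_pos[OF xX \<xi>, of 0] by simp
    ultimately show False
      by simp
  qed
  define m where "m = P.scale (1 / P.mass z) z"
  have m: "P.posf m" "P.mass m = 1" "P.form t' m m = 0"
    using z mz zz by (auto simp: m_def P.posf_scale P.mass_scale P.form_scale_left P.form_scale_right[OF Q.t0 Q.t1 z z])
  obtain \<sigma> where \<sigma>: "\<sigma> \<in> P.S" "\<And>\<rho>. P.posf \<rho> \<Longrightarrow> P.form t' m \<rho> = P.form t' (P.dir \<sigma>) \<rho>"
    using P.form_light[OF m(1,2) Q.t0 Q.t1 m(3)] by blast
  define \<kappa> where "\<kappa> = P.mass z / 2"
  have fz\<sigma>: "P.form t' z \<rho> = 2 * \<kappa> * P.form t' (P.dir \<sigma>) \<rho>" if "P.posf \<rho>" for \<rho>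
    using \<sigma>(2)[OF that] mz by (simp add: m_def P.form_scale_left \<kappa>_def field_simps)
  show ?thesis
  proof (intro bexI[of _ \<sigma>] exI[of _ \<kappa>] conjI ballI exI[of _ "x \<circ> r"] exI[of _ "c \<circ> r"] allI impI)
    show "0 < \<kappa>"
      using mz by (simp add: \<kappa>_def)
    show "\<sigma> \<in> P.S"
      by (rule \<sigma>)
    show "\<kappa> * (2 * P.kerf t' (h v) (P.dir \<sigma>)) = (2 * P.kerf t v (P.dir \<xi>)) powr \<mu>" if v: "v \<in> P.X t" for v
    proof -
      have p: "P.posf (P.rep t' (h v))"
        by (rule P.H_posf[OF P.rep(1)[OF h_in[OF v]]])
      show ?thesis
        using zv[OF v] fz\<sigma>[OF p] P.form_commute[OF Q.t0 Q.t1 P.posf_dir[OF \<sigma>(1)] p] by (simp add: P.kerf_def)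
    qed
    show "(x \<circ> r) i \<in> P.X t" "0 < (c \<circ> r) i" for i
      by (simp_all add: xX c0)
    show "(\<lambda>i. (c \<circ> r) i * P.kerf t ((x \<circ> r) i) \<rho>) \<longlonglongrightarrow> P.form t (P.dir \<xi>) \<rho>" if "P.posf \<rho>" for \<rho>
      using LIMSEQ_subseq_LIMSEQ[OF lim1[OF that] r] by (simp add: o_def)
    show "(\<lambda>i. (c \<circ> r) i powr \<mu> * P.kerf t' (h ((x \<circ> r) i)) \<rho>) \<longlonglongrightarrow> \<kappa> * P.form t' (P.dir \<sigma>) \<rho>" if "P.posf \<rho>" for \<rho>
      using tendsto_divide[OF fz[OF that] tendsto_const[of 2]] by (simp add: fy fz\<sigma>[OF that])
  qed
qed

text \<open>Evaluate the relation for \<open>\<eta>\<close> along the sequence approximating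
  \<open>\<xi>\<close>: both sides converge, and the limit is the relation between two ideal
  points.\<close>

lemma boundary_map:
  obtains \<sigma> \<kappa> where "\<And>\<xi>. \<xi> \<in> P.S \<Longrightarrow> \<sigma> \<xi> \<in> P.S" "\<And>\<xi>. \<xi> \<in> P.S \<Longrightarrow> 0 < (\<kappa> \<xi> :: real)"
    "\<And>\<xi> v. \<xi> \<in> P.S \<Longrightarrow> v \<in> P.X t \<Longrightarrow> \<kappa> \<xi> * (2 * P.kerf t' (h v) (P.dir (\<sigma> \<xi>))) = (2 * P.kerf t v (P.dir \<xi>)) powr \<mu>"
    "\<And>\<xi> \<eta>. \<xi> \<in> P.S \<Longrightarrow> \<eta> \<in> P.S \<Longrightarrow>
      \<kappa> \<xi> * \<kappa> \<eta> * (2 * lorentz n (\<sigma> \<xi>) (\<sigma> \<eta>) powr t') = (2 * lorentz n \<xi> \<eta> powr t) powr \<mu>"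
proof -
  define R where "R \<xi> \<sigma> \<kappa> \<longleftrightarrow> (\<exists>x c. (\<forall>i. x i \<in> P.X t \<and> 0 < c i) \<and>
       (\<forall>\<rho>. P.posf \<rho> \<longrightarrow> (\<lambda>i::nat. c i * P.kerf t (x i) \<rho>) \<longlonglongrightarrow> P.form t (P.dir \<xi>) \<rho>) \<and>
       (\<forall>\<rho>. P.posf \<rho> \<longrightarrow> (\<lambda>i. c i powr \<mu> * P.kerf t' (h (x i)) \<rho>) \<longlonglongrightarrow> \<kappa> * P.form t' (P.dir \<sigma>) \<rho>))" for \<xi> \<sigma> and \<kappa> :: real
  define R' where "R' \<xi> \<sigma> \<kappa> \<longleftrightarrow> (\<forall>v\<in>P.X t. \<kappa> * (2 * P.kerf t' (h v) (P.dir \<sigma>)) = (2 * P.kerf t v (P.dir \<xi>)) powr \<mu>)"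
    for \<xi> \<sigma> and \<kappa> :: real
  have "\<exists>\<sigma>\<in>P.S. \<exists>\<kappa>>0. R' \<xi> \<sigma> \<kappa> \<and> R \<xi> \<sigma> \<kappa>" if "\<xi> \<in> P.S" for \<xi>
    unfolding R_def R'_def by (rule ideal_point[OF that])
  then obtain \<sigma> \<kappa> where \<sigma>: "\<And>\<xi>. \<xi> \<in> P.S \<Longrightarrow> \<sigma> \<xi> \<in> P.S" and \<kappa>: "\<And>\<xi>. \<xi> \<in> P.S \<Longrightarrow> 0 < (\<kappa> \<xi> :: real)"
    and R': "\<And>\<xi>. \<xi> \<in> P.S \<Longrightarrow> R' \<xi> (\<sigma> \<xi>) (\<kappa> \<xi>)" and R: "\<And>\<xi>. \<xi> \<in> P.S \<Longrightarrow> R \<xi> (\<sigma> \<xi>) (\<kappa> \<xi>)"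
    by metis
  have 1: "\<kappa> \<xi> * (2 * P.kerf t' (h v) (P.dir (\<sigma> \<xi>))) = (2 * P.kerf t v (P.dir \<xi>)) powr \<mu>" if "\<xi> \<in> P.S" "v \<in> P.X t" for \<xi> v
    using R'[OF that(1)] that(2) by (simp add: R'_def)
  have "\<kappa> \<xi> * \<kappa> \<eta> * (2 * lorentz n (\<sigma> \<xi>) (\<sigma> \<eta>) powr t') = (2 * lorentz n \<xi> \<eta> powr t) powr \<mu>"
    if \<xi>: "\<xi> \<in> P.S" and \<eta>: "\<eta> \<in> P.S" for \<xi> \<eta>
  proof -
    obtain x c where x: "\<And>i. x i \<in> P.X t" and c: "\<And>i. 0 < c i"
      and l1: "\<And>\<rho>. P.posf \<rho> \<Longrightarrow> (\<lambda>i::nat. c i * P.kerf t (x i) \<rho>) \<longlonglongrightarrow> P.form t (P.dir \<xi>) \<rho>"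
      and l2: "\<And>\<rho>. P.posf \<rho> \<Longrightarrow> (\<lambda>i. c i powr \<mu> * P.kerf t' (h (x i)) \<rho>) \<longlonglongrightarrow> \<kappa> \<xi> * P.form t' (P.dir (\<sigma> \<xi>)) \<rho>"
      using R[OF \<xi>] unfolding R_def by blast
    have "(\<lambda>i. 2 * \<kappa> \<eta> * (c i powr \<mu> * P.kerf t' (h (x i)) (P.dir (\<sigma> \<eta>)))) \<longlonglongrightarrow> 2 * \<kappa> \<eta> * (\<kappa> \<xi> * P.form t' (P.dir (\<sigma> \<xi>)) (P.dir (\<sigma> \<eta>)))"
      by (intro tendsto_intros l2 P.posf_dir \<sigma> \<eta>)
    moreover have "2 * \<kappa> \<eta> * (c i powr \<mu> * P.kerf t' (h (x i)) (P.dir (\<sigma> \<eta>))) = (2 * (c i * P.kerf t (x i) (P.dir \<eta>))) powr \<mu>" for i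
    proof -
      have "2 * \<kappa> \<eta> * (c i powr \<mu> * P.kerf t' (h (x i)) (P.dir (\<sigma> \<eta>))) = c i powr \<mu> * (2 * P.kerf t (x i) (P.dir \<eta>)) powr \<mu>"
        using 1[OF \<eta> x[of i]] by (simp add: mult_ac)
      also have "\<dots> = (c i * (2 * P.kerf t (x i) (P.dir \<eta>))) powr \<mu>"
        using c[of i] P.kerf_dir_pos[OF x[of i] \<eta>] by (simp add: powr_mult)
      finally show ?thesis
        by (simp add: mult_ac)
    qed
    moreover have "(\<lambda>i. (2 * (c i * P.kerf t (x i) (P.dir \<eta>))) powr \<mu>) \<longlonglongrightarrow> (2 * P.form t (P.dir \<xi>) (P.dir \<eta>)) powr \<mu>"
    proof (rule tendsto_powr')
      show "(\<lambda>i. 2 * (c i * P.kerf t (x i) (P.dir \<eta>))) \<longlonglongrightarrow> 2 * P.form t (P.dir \<xi>) (P.dir \<eta>)"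
        by (intro tendsto_intros l1 P.posf_dir \<eta>)
      have "0 \<le> 2 * (c i * P.kerf t (x i) (P.dir \<eta>))" for i
        using c[of i] P.kerf_dir_pos[OF x[of i] \<eta>] by simp
      then show "2 * P.form t (P.dir \<xi>) (P.dir \<eta>) \<noteq> 0 \<or> 0 < \<mu> \<and> (\<forall>\<^sub>F i in sequentially. 0 \<le> 2 * (c i * P.kerf t (x i) (P.dir \<eta>)))"
        using \<mu> by simp
    qed simp
    ultimately have "2 * \<kappa> \<eta> * (\<kappa> \<xi> * P.form t' (P.dir (\<sigma> \<xi>)) (P.dir (\<sigma> \<eta>))) = (2 * P.form t (P.dir \<xi>) (P.dir \<eta>)) powr \<mu>"
      using LIMSEQ_unique by simp
    then show ?thesis
      by (simp add: P.form_dir_dir mult_ac)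
  qed
  then show ?thesis
    using that[of \<sigma> \<kappa>] \<sigma> \<kappa> 1 by blast
qed

text \<open>A square has the largest cross-ratio that Ptolemy's inequality allows.\<close>

lemma ratio_le: "\<mu> * t \<le> t'"
proof -
  obtain \<sigma> \<kappa> where \<sigma>: "\<And>\<xi>. \<xi> \<in> P.S \<Longrightarrow> \<sigma> \<xi> \<in> P.S" and \<kappa>: "\<And>\<xi>. \<xi> \<in> P.S \<Longrightarrow> 0 < (\<kappa> \<xi> :: real)"
    and b: "\<And>\<xi> \<eta>. \<xi> \<in> P.S \<Longrightarrow> \<eta> \<in> P.S \<Longrightarrow>
      \<kappa> \<xi> * \<kappa> \<eta> * (2 * lorentz n (\<sigma> \<xi>) (\<sigma> \<eta>) powr t') = (2 * lorentz n \<xi> \<eta> powr t) powr \<mu>"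
    by (rule boundary_map) blast
  \<comment> \<open>The vertices of a square in the plane of the first two coordinates: the product
    is 1 along sides and 2 along diagonals.\<close>
  define e where "e = (\<lambda>i::nat. if i = 1 then P.unit 1 1 else if i = 2 then P.unit 2 1 else if i = 3 then P.unit 1 (-1) else P.unit 2 (-1))"
  have eS: "e i \<in> P.S" for i
    using P.n2 by (auto simp: e_def intro!: P.unit_in_S)
  define q where "q i j = lorentz n (\<sigma> (e i)) (\<sigma> (e j))" for i j
  define k where "k i = \<kappa> (e i)" for i
  have k: "0 < k i" for i
    by (simp add: k_def \<kappa> eS)
  have q0: "0 \<le> q i j" for i j
    unfolding q_def by (rule P.lorentz_S_nonneg[OF \<sigma>[OF eS] \<sigma>[OF eS]])
  have kq: "k i * k j * (2 * q i j powr t') = (2 * lorentz n (e i) (e j) powr t) powr \<mu>" for i j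
    unfolding k_def q_def by (rule b[OF eS eS])
  have l: "lorentz n (e 1) (e 3) = 2" "lorentz n (e 2) (e 4) = 2" "lorentz n (e 1) (e 2) = 1" "lorentz n (e 3) (e 4) = 1"
    "lorentz n (e 1) (e 4) = 1" "lorentz n (e 2) (e 3) = 1"
    using P.n2 by (simp_all add: e_def P.lorentz_unit)
  define s where "s = 2 powr \<mu>"
  define u where "u = (2 * 2 powr t) powr \<mu>"
  \<comment> \<open>Each way of pairing up the four vertices uses every conformal factor once, so
    all three products carry the same constant.\<close>
  define \<Lambda> where "\<Lambda> = 4 * (k 1 * k 2 * k 3 * k 4)"
  have \<Lambda>: "0 < \<Lambda>"
    using k by (simp add: \<Lambda>_def)
  have pair: "\<Lambda> * (q i j * q a b) powr t' = x * y"
    if "k i * k j * (2 * q i j powr t') = x" "k a * k b * (2 * q a b powr t') = y" "k i * k j * (k a * k b) = k 1 * k 2 * k 3 * k 4" for i j a b x y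
  proof -
    have "x * y = (k i * k j * (k a * k b)) * 4 * (q i j powr t' * q a b powr t')"
      unfolding that(1)[symmetric] that(2)[symmetric] by simp
    then show ?thesis
      using q0 by (simp add: that(3) \<Lambda>_def powr_mult)
  qed
  have c: "\<Lambda> * (q 1 3 * q 2 4) powr t' = u * u"
    by (rule pair) (use kq[of 1 3, unfolded l] kq[of 2 4, unfolded l] in \<open>simp_all add: u_def\<close>)
  have a: "\<Lambda> * (q 1 2 * q 3 4) powr t' = s * s"
    by (rule pair) (use kq[of 1 2, unfolded l] kq[of 3 4, unfolded l] in \<open>simp_all add: s_def\<close>)
  have d: "\<Lambda> * (q 1 4 * q 2 3) powr t' = s * s"
    by (rule pair) (use kq[of 1 4, unfolded l] kq[of 2 3, unfolded l] in \<open>simp_all add: s_def\<close>)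
  have s0: "0 < s" "0 < u"
    by (auto simp: s_def u_def)
  define A where "A = q 1 2 * q 3 4"
  have A: "0 < A"
  proof -
    have "A \<noteq> 0"
      using a s0 by (auto simp: A_def)
    then show ?thesis
      using q0 by (simp add: A_def less_le)
  qed
  have D: "q 1 4 * q 2 3 = A"
  proof -
    have "\<Lambda> * (q 1 4 * q 2 3) powr t' = \<Lambda> * A powr t'"
      using a d by (simp add: A_def)
    then have "(q 1 4 * q 2 3) powr t' = A powr t'"
      using \<Lambda> by simp
    then have "((q 1 4 * q 2 3) powr t') powr (1 / t') = (A powr t') powr (1 / t')"
      by simp
    then show ?thesis
      using q0 A Q.t0 by (simp add: powr_powr)
  qed
  have C: "q 1 3 * q 2 4 = 4 powr (\<mu> * t / t') * A"
  proof -
    have "u * u = 4 powr (\<mu> * t) * (s * s)"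
    proof -
      have "u = 2 powr (t * \<mu>) * s"
        by (simp add: u_def s_def powr_mult powr_powr)
      moreover have "(4::real) powr (\<mu> * t) = 2 powr (t * \<mu>) * 2 powr (t * \<mu>)"
        using powr_mult[of 2 2 "\<mu> * t"] by (simp add: mult.commute)
      ultimately show ?thesis
        by simp
    qed
    then have "\<Lambda> * (q 1 3 * q 2 4) powr t' = \<Lambda> * (4 powr (\<mu> * t) * A powr t')"
      using a c by (simp add: A_def mult_ac)
    then have "(q 1 3 * q 2 4) powr t' = 4 powr (\<mu> * t) * A powr t'"
      using \<Lambda> by simp
    then have "((q 1 3 * q 2 4) powr t') powr (1 / t') = (4 powr (\<mu> * t) * A powr t') powr (1 / t')"
      by simp
    also have "\<dots> = 4 powr (\<mu> * t / t') * A"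
      using A Q.t0 by (simp add: powr_mult powr_powr)
    finally show ?thesis
      using q0 Q.t0 by (simp add: powr_powr)
  qed
  have "0 < q 1 3"
    using C A q0[of 1 3] by (cases "q 1 3 = 0") auto
  \<comment> \<open>Both products of opposite sides equal \<open>A\<close>, so Ptolemy bounds the
    product of the diagonals by \<open>4 * A\<close>, while \<open>C\<close> gives its
    value.\<close>
  then have "(q 1 3 * q 2 4 - q 1 2 * q 3 4 - q 1 4 * q 2 3)\<^sup>2 \<le> 4 * (q 1 2 * q 3 4) * (q 1 4 * q 2 3)"
    unfolding q_def by (intro P.S_Ptolemy \<sigma> eS)
  then have "(q 1 3 * q 2 4 - 2 * A)\<^sup>2 \<le> (2 * A)\<^sup>2"
    unfolding D A_def[symmetric] by (simp add: power2_eq_square algebra_simps)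
  then have "q 1 3 * q 2 4 - 2 * A \<le> 2 * A"
    by (rule power2_le_imp_le) (use A in simp)
  then have "4 powr (\<mu> * t / t') * A \<le> 4 powr 1 * A"
    unfolding C by simp
  then have "4 powr (\<mu> * t / t') \<le> 4 powr 1"
    using A by (simp only: mult_le_cancel_right_pos)
  then have "\<mu> * t / t' \<le> 1"
    by (subst (asm) powr_le_cancel_iff) auto
  then show ?thesis
    using Q.t0 by (simp add: field_simps)
qed

text \<open>The midpoint of the geodesic line between two antipodal ideal points, seen from a third one,
  detects the scaling factor.\<close>

lemma factor_eq_1: "\<mu> = 1"
proof -
  obtain \<sigma> \<kappa> where \<sigma>: "\<And>\<xi>. \<xi> \<in> P.S \<Longrightarrow> \<sigma> \<xi> \<in> P.S" and \<kappa>: "\<And>\<xi>. \<xi> \<in> P.S \<Longrightarrow> 0 < (\<kappa> \<xi> :: real)"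
    and a: "\<And>\<xi> v. \<xi> \<in> P.S \<Longrightarrow> v \<in> P.X t \<Longrightarrow> \<kappa> \<xi> * (2 * P.kerf t' (h v) (P.dir (\<sigma> \<xi>))) = (2 * P.kerf t v (P.dir \<xi>)) powr \<mu>"
    and b: "\<And>\<xi> \<eta>. \<xi> \<in> P.S \<Longrightarrow> \<eta> \<in> P.S \<Longrightarrow>
      \<kappa> \<xi> * \<kappa> \<eta> * (2 * lorentz n (\<sigma> \<xi>) (\<sigma> \<eta>) powr t') = (2 * lorentz n \<xi> \<eta> powr t) powr \<mu>"
    by (rule boundary_map) blast
  define e1 e2 e3 where "e1 = P.unit 1 1" and "e2 = P.unit 2 1" and "e3 = P.unit 1 (-1)"
  have eS: "e1 \<in> P.S" "e2 \<in> P.S" "e3 \<in> P.S"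
    using P.n2 by (auto simp: e1_def e2_def e3_def intro!: P.unit_in_S)
  note \<sigma>S = \<sigma>[OF eS(1)] \<sigma>[OF eS(2)] \<sigma>[OF eS(3)]
  note k = \<kappa>[OF eS(1)] \<kappa>[OF eS(2)] \<kappa>[OF eS(3)]
  have l: "lorentz n e1 e3 = 2" "lorentz n e3 e1 = 2" "lorentz n e1 e2 = 1" "lorentz n e3 e2 = 1" "lorentz n e1 e1 = 0" "lorentz n e3 e3 = 0"
    using P.n2 by (simp_all add: e1_def e2_def e3_def P.lorentz_unit)
  \<comment> \<open>Normalizes the midpoint of the line between \<open>e1\<close> and
    \<open>e3\<close>.\<close>
  define c where "c = 1 / sqrt (2 * 2 powr t)"
  have c: "0 < c" "2 * c * c * 2 powr t = 1"
    by (simp_all add: c_def)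
  define \<nu> where "\<nu> = P.comb c (P.dir e1) c (P.dir e3)"
  have \<nu>H: "\<nu> \<in> P.H t"
    using c P.t0 by (simp add: P.H_def \<nu>_def P.posf_comb P.posf_dir eS P.form_comb_left P.form_comb_right[OF P.t0 P.t1]
        P.form_dir_dir l mult_ac)
  define v where "v = P.iota t \<nu>"
  have v: "v \<in> P.X t"
    unfolding v_def by (rule P.iota_in_X[OF \<nu>H])
  have kv: "P.kerf t v (P.dir e1) = c * 2 powr t" "P.kerf t v (P.dir e3) = c * 2 powr t" "P.kerf t v (P.dir e2) = 2 * c"
    unfolding v_def P.kerf_iota[OF \<nu>H P.posf_dir[OF eS(1)]] P.kerf_iota[OF \<nu>H P.posf_dir[OF eS(2)]]
      P.kerf_iota[OF \<nu>H P.posf_dir[OF eS(3)]]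
    using P.t0 by (simp_all add: \<nu>_def P.form_comb_left P.form_dir_dir l)
  have hv: "h v \<in> P.X t'"
    by (rule h_in[OF v])
  define \<alpha> \<beta> where "\<alpha> = \<kappa> e1 * c powr \<mu>" and "\<beta> = \<kappa> e3 * c powr \<mu>"
  have ab: "0 \<le> \<alpha>" "0 \<le> \<beta>"
    using k by (auto simp: \<alpha>_def \<beta>_def)
  define Q13 where "Q13 = lorentz n (\<sigma> e1) (\<sigma> e3) powr t'"
  have one: "(c * c * 2 * 2 powr t) powr \<mu> = 1"
    using c by (simp add: mult_ac)
  have "2 * \<alpha> * \<beta> * Q13 = c powr \<mu> * c powr \<mu> * (\<kappa> e1 * \<kappa> e3 * (2 * Q13))"
    by (simp add: \<alpha>_def \<beta>_def)
  also have "\<dots> = c powr \<mu> * c powr \<mu> * (2 * 2 powr t) powr \<mu>"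
    using b[OF eS(1,3)] by (simp add: Q13_def l)
  also have "\<dots> = 1"
    using c(1) by (simp flip: one add: powr_mult)
  finally have ab1: "2 * \<alpha> * \<beta> * Q13 = 1" .
  \<comment> \<open>The candidate for the image of the midpoint: a point on the line between the
    image ideal points. Its product with \<open>h v\<close> will be 1, so it is
    \<open>h v\<close>.\<close>
  define \<zeta> where "\<zeta> = P.comb \<alpha> (P.dir (\<sigma> e1)) \<beta> (P.dir (\<sigma> e3))"
  have \<zeta>H: "\<zeta> \<in> P.H t'"
    using ab ab1 Q.t0 by (simp add: P.H_def \<zeta>_def P.posf_comb P.posf_dir \<sigma>S P.form_comb_left P.form_comb_right[OF Q.t0 Q.t1]
        P.form_dir_dir P.lorentz_S_self Q13_def lorentz_commute[of n "\<sigma> e3" "\<sigma> e1"] algebra_simps)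
  have half: "2 * (\<kappa> \<xi> * c powr \<mu> * P.kerf t' (h v) (P.dir (\<sigma> \<xi>))) = 1" if "\<xi> \<in> P.S" "P.kerf t v (P.dir \<xi>) = c * 2 powr t" for \<xi>
  proof -
    have "2 * (\<kappa> \<xi> * c powr \<mu> * P.kerf t' (h v) (P.dir (\<sigma> \<xi>))) = c powr \<mu> * (2 * (c * 2 powr t)) powr \<mu>"
      using a[OF that(1) v] that(2) by (simp add: mult_ac)
    also have "\<dots> = 1"
      using c(1) by (simp flip: one add: powr_mult)
    finally show ?thesis .
  qed
  have "P.ker t' (h v) (P.iota t' \<zeta>) = P.kerf t' (h v) \<zeta>"
    by (rule Q.ker_iota_kerf[OF hv \<zeta>H])
  also have "\<dots> = \<alpha> * P.kerf t' (h v) (P.dir (\<sigma> e1)) + \<beta> * P.kerf t' (h v) (P.dir (\<sigma> e3))"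
    unfolding \<zeta>_def by (rule Q.kerf_comb[OF P.posf_dir P.posf_dir hv]) (rule \<sigma>S)+
  also have "\<dots> = 1"
    using half[OF eS(1) kv(1)] half[OF eS(3) kv(2)] by (simp add: \<alpha>_def \<beta>_def)
  finally have "h v = P.iota t' \<zeta>"
    using Q.eq[OF hv P.iota_in_X[OF \<zeta>H]] by blast
  then have "P.kerf t' (h v) (P.dir (\<sigma> e2)) = \<alpha> * lorentz n (\<sigma> e1) (\<sigma> e2) powr t' + \<beta> * lorentz n (\<sigma> e3) (\<sigma> e2) powr t'"
    using Q.kerf_iota[OF \<zeta>H P.posf_dir[OF \<sigma>S(2)]] by (simp add: \<zeta>_def P.form_comb_left P.form_dir_dir)
  then have "\<kappa> e2 * (2 * P.kerf t' (h v) (P.dir (\<sigma> e2)))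
    = c powr \<mu> * (\<kappa> e1 * \<kappa> e2 * (2 * lorentz n (\<sigma> e1) (\<sigma> e2) powr t')) + c powr \<mu> * (\<kappa> e3 * \<kappa> e2 * (2 * lorentz n (\<sigma> e3) (\<sigma> e2) powr t'))"
    by (simp add: \<alpha>_def \<beta>_def algebra_simps)
  also have "\<dots> = 2 * (c powr \<mu> * 2 powr \<mu>)"
    unfolding b[OF eS(1,2)] b[OF eS(3,2)] l by simp
  \<comment> \<open>From \<open>e2\<close> the midpoint is seen as a sum of two equal terms. Before
    the map the sum is inside the power, after it outside, and the two agree only for
    \<open>2 powr \<mu> = 2\<close>.\<close>
  finally have "(4 * c) powr \<mu> = 2 * (c powr \<mu> * 2 powr \<mu>)"
    using a[OF eS(2) v] kv(3) by simp
  moreover have "(4 * c) powr \<mu> = 2 powr \<mu> * 2 powr \<mu> * c powr \<mu>"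
    using c(1) powr_mult[of 2 2 \<mu>] by (simp add: powr_mult)
  ultimately have "2 powr \<mu> * (2 powr \<mu> * c powr \<mu>) = 2 * (2 powr \<mu> * c powr \<mu>)"
    by (simp add: mult_ac)
  then have "2 powr \<mu> = (2::real) powr 1"
    using c(1) by simp
  then show ?thesis
    by (simp only: powr_inj)
qed

end

section \<open>The action is an isomorphism onto the isometry group\<close>

context light_sphere_param
begin

lemma trans_fixes_imp:
  assumes b: "conf b" and fixed: "\<And>v. v \<in> X t \<Longrightarrow> trans t b v = v" and \<xi>: "\<xi> \<in> S"
  shows "b \<xi> = \<xi>"
proof -
  have "b \<xi> 0 powr t * kerf t v (dir (sg b \<xi>)) = kerf t v (dir \<xi>)" if "v \<in> X t" for v
    using kerf_trans[OF b that \<xi>] fixed[OF that] by simp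
  from dirac_unique[OF \<xi> conf_sg[OF b \<xi>] this]
  have 1: "sg b \<xi> = \<xi>" "b \<xi> 0 powr t = 1"
    by auto
  have pos: "0 < b \<xi> 0"
    by (rule conf_pos[OF b \<xi>])
  then have "t * ln (b \<xi> 0) = 0"
    using 1(2) by (metis ln_one ln_powr)
  then have "b \<xi> 0 = 1"
    using t0 pos by simp
  then show ?thesis
    using 1(1) by (simp add: sg_def)
qed

text \<open>An isometry is a similarity of factor 1. Since \<open>conf\<close> records factors for
  exponent 1, the factor \<open>\<kappa>\<close> enters with power \<open>1 / t\<close>. It is
  bounded because the products of the image of the base point with ideal points stay away from
  0.\<close>

lemma isometry_boundary:
  assumes \<phi>: "\<phi> \<in> carrier (isometry_group K)"
  shows "\<exists>a. conf a \<and> (\<forall>x\<in>X t. \<phi> x = trans t a x)"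
proof -
  note D = isometry_groupD[OF \<phi>]
  interpret I: similarity n t t 1 \<phi>
    by unfold_locales (auto simp: D)
  obtain \<sigma> \<kappa> where \<sigma>: "\<And>\<xi>. \<xi> \<in> S \<Longrightarrow> \<sigma> \<xi> \<in> S" and \<kappa>: "\<And>\<xi>. \<xi> \<in> S \<Longrightarrow> 0 < (\<kappa> \<xi> :: real)"
    and 1: "\<And>\<xi> v. \<xi> \<in> S \<Longrightarrow> v \<in> X t \<Longrightarrow> \<kappa> \<xi> * (2 * kerf t (\<phi> v) (dir (\<sigma> \<xi>))) = (2 * kerf t v (dir \<xi>)) powr 1"
    and 2: "\<And>\<xi> \<eta>. \<xi> \<in> S \<Longrightarrow> \<eta> \<in> S \<Longrightarrow>
      \<kappa> \<xi> * \<kappa> \<eta> * (2 * lorentz n (\<sigma> \<xi>) (\<sigma> \<eta>) powr t) = (2 * lorentz n \<xi> \<eta> powr t) powr 1"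
    by (rule I.boundary_map) blast
  have k1: "\<kappa> \<xi> * kerf t (\<phi> v) (dir (\<sigma> \<xi>)) = kerf t v (dir \<xi>)" if "\<xi> \<in> S" "v \<in> X t" for \<xi> v
    using 1[OF that] kerf_dir_pos[OF that(2,1)] by simp
  have k2: "\<kappa> \<xi> * \<kappa> \<eta> * lorentz n (\<sigma> \<xi>) (\<sigma> \<eta>) powr t = lorentz n \<xi> \<eta> powr t" if "\<xi> \<in> S" "\<eta> \<in> S" for \<xi> \<eta>
    using 2[OF that] by simp
  define a where "a \<xi> = (\<lambda>i. \<kappa> \<xi> powr (1 / t) * \<sigma> \<xi> i)" for \<xi>
  have a0: "a \<xi> 0 = \<kappa> \<xi> powr (1 / t)" if "\<xi> \<in> S" for \<xi>
    using \<sigma>[OF that] by (simp add: a_def S_def)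
  have at: "a \<xi> 0 powr t = \<kappa> \<xi>" if "\<xi> \<in> S" for \<xi>
    using \<kappa>[OF that] t0 by (simp add: a0[OF that] powr_powr)
  have sga: "sg a \<xi> = \<sigma> \<xi>" if "\<xi> \<in> S" for \<xi>
    unfolding sg_def a0[OF that] using \<kappa>[OF that] by (simp add: a_def)
  have "conf a"
    unfolding conf_def
  proof (intro conjI ballI)
    show "0 < a \<xi> 0" "sg a \<xi> \<in> S" if "\<xi> \<in> S" for \<xi>
      using \<kappa>[OF that] \<sigma>[OF that] that by (simp_all add: a0 sga)
    show "lorentz n (a \<xi>) (a \<eta>) = lorentz n \<xi> \<eta>" if \<xi>: "\<xi> \<in> S" and \<eta>: "\<eta> \<in> S" for \<xi> \<eta>
    proof -
      have la: "lorentz n (a \<xi>) (a \<eta>) = \<kappa> \<xi> powr (1 / t) * \<kappa> \<eta> powr (1 / t) * lorentz n (\<sigma> \<xi>) (\<sigma> \<eta>)"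
        unfolding a_def by (rule lorentz_scale)
      have nn: "0 \<le> lorentz n (\<sigma> \<xi>) (\<sigma> \<eta>)" "0 \<le> lorentz n \<xi> \<eta>"
        by (rule lorentz_S_nonneg[OF \<sigma>[OF \<xi>] \<sigma>[OF \<eta>]], rule lorentz_S_nonneg[OF \<xi> \<eta>])
      have "(lorentz n \<xi> \<eta> powr t) powr (1 / t) = (\<kappa> \<xi> * \<kappa> \<eta> * lorentz n (\<sigma> \<xi>) (\<sigma> \<eta>) powr t) powr (1 / t)"
        by (simp add: k2[OF \<xi> \<eta>])
      also have "\<dots> = \<kappa> \<xi> powr (1 / t) * \<kappa> \<eta> powr (1 / t) * (lorentz n (\<sigma> \<xi>) (\<sigma> \<eta>) powr t) powr (1 / t)"
        using \<kappa>[OF \<xi>] \<kappa>[OF \<eta>] by (simp add: powr_mult)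
      finally show ?thesis
        using nn t0 by (simp add: la powr_powr)
    qed
    obtain c where c: "0 < c" "\<And>\<xi>. \<xi> \<in> S \<Longrightarrow> c \<le> kerf t (\<phi> basept) (dir \<xi>)"
      using kerf_dir_lower[OF D(2)[OF basept_in_X]] by blast
    have "\<kappa> \<xi> \<le> 2 * basept 0 / c" if \<xi>: "\<xi> \<in> S" for \<xi>
    proof -
      have "\<kappa> \<xi> * c \<le> \<kappa> \<xi> * kerf t (\<phi> basept) (dir (\<sigma> \<xi>))"
        using \<kappa>[OF \<xi>] c(2)[OF \<sigma>[OF \<xi>]] by (intro mult_left_mono) auto
      also have "\<dots> = kerf t basept (dir \<xi>)"
        by (rule k1[OF \<xi> basept_in_X])
      also have "\<dots> \<le> 2 * basept 0"
        using form_bound[OF t0 t1 H_posf[OF rep(1)[OF basept_in_X]] posf_dir[OF \<xi>]]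
        by (simp add: kerf_def mass_rep[OF basept_in_X] mass_dir)
      finally show ?thesis
        using c(1) by (simp add: field_simps)
    qed
    then have "a \<xi> 0 \<le> (2 * basept 0 / c) powr (1 / t)" if "\<xi> \<in> S" for \<xi>
      unfolding a0[OF that] using \<kappa>[OF that] that t0 by (intro powr_mono2) auto
    then show "\<exists>M. \<forall>\<xi>\<in>S. a \<xi> 0 \<le> M"
      by blast
  qed
  moreover have "\<phi> x = trans t a x" if x: "x \<in> X t" for x
    using k1 by (intro trans_unique[OF \<open>conf a\<close> x D(2)[OF x]]) (simp add: at sga x)
  ultimately show ?thesis
    by blast
qed

text \<open>The boundary map of \<open>\<phi>\<close> makes no reference to the exponent, so it also
  acts on \<open>X 1\<close>, the hyperboloid, and yields an element \<open>g\<close> of the group.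
  Its lift is the given boundary map, hence \<open>g\<close> acts on \<open>X t\<close> as
  \<open>\<phi>\<close>. The boundary map of the inverse shows that \<open>g\<close> is
  bijective.\<close>

lemma act_surj:
  assumes \<phi>: "\<phi> \<in> carrier (isometry_group K)"
  shows "\<exists>g\<in>carrier G. act t g = \<phi>"
proof -
  interpret P1: light_sphere_param n 1
    by unfold_locales auto
  note group = group_isometry_group[of K]
  define \<psi> where "\<psi> = inv\<^bsub>isometry_group K\<^esub> \<phi>"
  have \<psi>: "\<psi> \<in> carrier (isometry_group K)"
    unfolding \<psi>_def by (rule group.inv_closed[OF group \<phi>])
  have inv1: "\<psi> (\<phi> x) = x" "\<phi> (\<psi> x) = x" if x: "x \<in> X t" for x
  proof -
    have "\<psi> \<otimes>\<^bsub>isometry_group K\<^esub> \<phi> = \<one>\<^bsub>isometry_group K\<^esub>" "\<phi> \<otimes>\<^bsub>isometry_group K\<^esub> \<psi> = \<one>\<^bsub>isometry_group K\<^esub>"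
      unfolding \<psi>_def by (rule group.l_inv[OF group \<phi>], rule group.r_inv[OF group \<phi>])
    then have "compose (X t) \<psi> \<phi> = (\<lambda>x\<in>X t. x)" "compose (X t) \<phi> \<psi> = (\<lambda>x\<in>X t. x)"
      by (simp_all add: isometry_group_mult \<phi> \<psi> isometry_group_one)
    then show "\<psi> (\<phi> x) = x" "\<phi> (\<psi> x) = x"
      using x by (metis compose_eq restrict_apply')+
  qed
  obtain a where a: "conf a" "\<And>x. x \<in> X t \<Longrightarrow> \<phi> x = trans t a x"
    using isometry_boundary[OF \<phi>] by blast
  obtain b where b: "conf b" "\<And>x. x \<in> X t \<Longrightarrow> \<psi> x = trans t b x"
    using isometry_boundary[OF \<psi>] by blast
  have ba: "cmp b a \<xi> = \<xi>" if "\<xi> \<in> S" for \<xi>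
  proof (rule trans_fixes_imp[OF conf_cmp[OF b(1) a(1)] _ that])
    show "trans t (cmp b a) v = v" if "v \<in> X t" for v
      using trans_cmp[OF b(1) a(1) that] a(2)[OF that] b(2)[OF trans_in_X[OF a(1) that]] inv1[OF that] by simp
  qed
  have ab: "cmp a b \<xi> = \<xi>" if "\<xi> \<in> S" for \<xi>
  proof (rule trans_fixes_imp[OF conf_cmp[OF a(1) b(1)] _ that])
    show "trans t (cmp a b) v = v" if "v \<in> X t" for v
      using trans_cmp[OF a(1) b(1) that] b(2)[OF that] a(2)[OF trans_in_X[OF b(1) that]] inv1[OF that] by simp
  qed
  define g where "g = trans 1 a"
  have gX: "g y \<in> hyperboloid n" if "y \<in> hyperboloid n" for y
    using P1.trans_in_X[OF a(1)] that by (simp add: g_def X_1)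
  have "bij_betw g (hyperboloid n) (hyperboloid n)"
  proof (rule bij_betw_byWitness[where f' = "trans 1 b"])
    show "\<forall>y\<in>hyperboloid n. trans 1 b (g y) = y"
      unfolding g_def X_1[symmetric]
      using P1.trans_cmp[OF b(1) a(1)] P1.trans_id[OF conf_cmp[OF b(1) a(1)] ba] by simp
    show "\<forall>y\<in>hyperboloid n. g (trans 1 b y) = y"
      unfolding g_def X_1[symmetric]
      using P1.trans_cmp[OF a(1) b(1)] P1.trans_id[OF conf_cmp[OF a(1) b(1)] ab] by simp
    show "g ` hyperboloid n \<subseteq> hyperboloid n"
      using gX by blast
    show "trans 1 b ` hyperboloid n \<subseteq> hyperboloid n"
      using P1.trans_in_X[OF b(1)] by (auto simp: X_1)
  qed
  moreover have "g \<in> extensional (hyperboloid n)"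
    by (simp add: g_def trans_def X_1)
  ultimately have gB: "g \<in> Bij (hyperboloid n)"
    by (simp add: Bij_def)
  have g: "g \<in> carrier G"
  proof (rule G_I[OF gB])
    show "lorentz n (g x) (g y) = lorentz n x y" if "x \<in> hyperboloid n" "y \<in> hyperboloid n" for x y
      using P1.ker_trans[OF a(1), of x y] that gX by (simp add: g_def[symmetric] X_1 ker_1)
  qed
  have lift: "a \<xi> = lift g \<xi>" if \<xi>: "\<xi> \<in> S" for \<xi>
  proof (rule lift_unique[OF g])
    have pos: "0 < a \<xi> 0" and sS: "sg a \<xi> \<in> S"
      using conf_pos[OF a(1) \<xi>] conf_sg[OF a(1) \<xi>] .
    fix v assume v: "v \<in> hyperboloid n"
    then have "a \<xi> 0 powr 1 * kerf 1 (g v) (dir (sg a \<xi>)) = kerf 1 v (dir \<xi>)"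
      unfolding g_def by (intro P1.kerf_trans[OF a(1) _ \<xi>]) (simp add: X_1)
    then have "a \<xi> 0 * lorentz n (g v) (sg a \<xi>) = lorentz n v \<xi>"
      using v gX[OF v] pos by (simp add: kerf_1 X_1 \<xi> sS)
    then show "lorentz n (a \<xi>) (g v) = lorentz n \<xi> v"
      using pos by (simp add: sg_def lorentz_scale_right lorentz_commute)
  next
    fix j assume "j > n"
    then have "sg a \<xi> j = 0"
      using conf_sg[OF a(1) \<xi>] by (simp add: S_def)
    then show "a \<xi> j = 0"
      using conf_pos[OF a(1) \<xi>] by (simp add: sg_def)
  qed
  have "act t g = trans t a"
    unfolding act_def using t0 lift by (intro trans_cong conf_lift g) auto
  also have "\<dots> = \<phi>"
  proof
    fix x
    show "trans t a x = \<phi> x"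
      using a(2)[of x] isometry_groupD(1)[OF \<phi>] by (cases "x \<in> X t") (auto simp: trans_def Bij_def extensional_def)
  qed
  finally show ?thesis
    using g by blast
qed

text \<open>Ideal points are separated by their products, so the action on \<open>X t\<close>
  determines the lift on the sphere; the lift in turn determines the action at exponent 1, which is
  \<open>g\<close> itself.\<close>

lemma act_inj: "inj_on (act t) (carrier G)"
proof (rule inj_onI)
  fix g g' assume g: "g \<in> carrier G" and g': "g' \<in> carrier G" and eq: "act t g = act t g'"
  note c = conf_lift[OF g] and c' = conf_lift[OF g']
  have lift: "lift g \<xi> = lift g' \<xi>" if \<xi>: "\<xi> \<in> S" for \<xi>
  proof -
    define k where "k = lift g \<xi> 0 powr t / lift g' \<xi> 0 powr t"
    have pos: "0 < lift g \<xi> 0" "0 < lift g' \<xi> 0"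
      by (rule conf_pos[OF c \<xi>], rule conf_pos[OF c' \<xi>])
    have "k * kerf t w (dir (sg (lift g) \<xi>)) = kerf t w (dir (sg (lift g') \<xi>))" if w: "w \<in> X t" for w
    proof -
      define v where "v = act t (inv\<^bsub>G\<^esub> g) w"
      have v: "v \<in> X t" "act t g v = w"
        using act_in_X[OF group.inv_closed[OF group_G g] w] act_inv(2)[OF g w] by (auto simp: v_def)
      have "lift g \<xi> 0 powr t * kerf t w (dir (sg (lift g) \<xi>)) = lift g' \<xi> 0 powr t * kerf t w (dir (sg (lift g') \<xi>))"
        using kerf_trans[OF c v(1) \<xi>] kerf_trans[OF c' v(1) \<xi>] v(2) eq by (simp add: act_def)
      then show ?thesis
        using pos by (simp add: k_def field_simps)
    qed
    from dirac_unique[OF conf_sg[OF c' \<xi>] conf_sg[OF c \<xi>] this]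
    have s: "sg (lift g) \<xi> = sg (lift g') \<xi>" and "k = 1"
      by auto
    then have "(lift g \<xi> 0 powr t) powr (1 / t) = (lift g' \<xi> 0 powr t) powr (1 / t)"
      using pos by (simp add: k_def)
    then have 0: "lift g \<xi> 0 = lift g' \<xi> 0"
      using pos t0 by (simp add: powr_powr)
    show ?thesis
    proof
      fix i
      have "sg (lift g) \<xi> i = sg (lift g') \<xi> i"
        by (simp add: s)
      then show "lift g \<xi> i = lift g' \<xi> i"
        using pos 0 by (simp add: sg_def)
    qed
  qed
  have "act 1 g = act 1 g'"
    unfolding act_def by (rule trans_cong[OF c _ lift]) simp
  then show "g = g'"
    by (simp add: act_1 g g')
qed

lemma act_iso: "act t \<in> iso G (isometry_group K)"
proof -
  have "act t ` carrier G = carrier (isometry_group K)"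
    using act_surj act_isometry by blast
  then show ?thesis
    using act_hom act_inj by (simp add: iso_def bij_betw_def)
qed

end

section \<open>Strong continuity\<close>

text \<open>Uniform continuity on a compact box. Exponents below \<open>t / 2\<close> are cut off
  because at \<open>s = 0\<close> the power is not continuous in the limit of exponent 0.\<close>

lemma powr_exponent_close:
  fixes t \<eta> :: real
  assumes t: "0 < t" "t \<le> 1" and \<eta>: "0 < \<eta>"
  shows "\<exists>\<delta>>0. \<forall>u\<in>{0<..1}. \<bar>u - t\<bar> < \<delta> \<longrightarrow> (\<forall>s\<in>{0..2}. \<bar>s powr t - s powr u\<bar> \<le> \<eta>)"
proof -
  define A where "A = {t / 2..1} \<times> {0..2::real}"
  have "continuous_on A (\<lambda>p. snd p powr fst p)"
    unfolding A_def using t by (intro continuous_on_powr' continuous_intros) auto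
  moreover have "compact A"
    unfolding A_def by (intro compact_Times compact_Icc)
  ultimately have "uniformly_continuous_on A (\<lambda>p. snd p powr fst p)"
    by (rule compact_uniformly_continuous)
  then obtain d where d: "0 < d" "\<And>p q. p \<in> A \<Longrightarrow> q \<in> A \<Longrightarrow> dist q p < d \<Longrightarrow> dist (snd q powr fst q) (snd p powr fst p) < \<eta>"
    using \<eta> unfolding uniformly_continuous_on_def by blast
  have "\<bar>s powr t - s powr u\<bar> \<le> \<eta>" if u: "u \<in> {0<..1}" "\<bar>u - t\<bar> < min d (t / 2)" and s: "s \<in> {0..2}" for u s
  proof -
    have "(t, s) \<in> A" "(u, s) \<in> A"
      using u s t by (auto simp: A_def abs_if split: if_splits)
    moreover have "dist (t, s) (u, s) < d"
      using u by (simp add: dist_Pair_Pair dist_real_def abs_minus_commute)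
    ultimately show ?thesis
      using d(2)[of "(u, s)" "(t, s)"] by (simp add: dist_real_def)
  qed
  then show ?thesis
    using d(1) t by (intro exI[of _ "min d (t / 2)"]) auto
qed

lemma powr_near_one:
  fixes J \<theta> :: real
  assumes J: "1 \<le> J" and \<theta>: "0 < \<theta>"
  shows "\<exists>\<delta>>0. \<forall>z. \<bar>z\<bar> < \<delta> \<longrightarrow> (\<forall>s\<in>{1 / J..J}. \<bar>s powr z - 1\<bar> \<le> \<theta>)"
proof -
  have "isCont exp (0::real)"
    by simp
  then obtain d where d: "0 < d" "\<And>x::real. dist x 0 < d \<Longrightarrow> dist (exp x) (exp 0) < \<theta>"
    unfolding continuous_at_eps_delta using \<theta> by blast
  have lnJ: "0 \<le> ln J"
    using J by simp
  have "\<bar>s powr z - 1\<bar> \<le> \<theta>" if z: "\<bar>z\<bar> < d / (ln J + 1)" and s: "s \<in> {1 / J..J}" for z s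
  proof -
    have s0: "0 < s"
      using s J by (auto intro: less_le_trans[of 0 "1 / J"])
    have "ln s \<le> ln J" "ln (1 / J) \<le> ln s"
      using s s0 J by auto
    then have "\<bar>ln s\<bar> \<le> ln J"
      using J by (simp add: ln_div)
    then have "\<bar>z\<bar> * \<bar>ln s\<bar> \<le> \<bar>z\<bar> * (ln J + 1)"
      by (intro mult_left_mono) auto
    also have "\<dots> < d"
      using z lnJ by (simp add: pos_less_divide_eq)
    finally have "dist (z * ln s) 0 < d"
      by (simp add: abs_mult)
    then show ?thesis
      using d(2)[of "z * ln s"] s0 by (simp add: dist_real_def powr_def)
  qed
  then show ?thesis
    using d(1) lnJ by (intro exI[of _ "d / (ln J + 1)"]) auto
qed

text \<open>The distance of two projected functionals in terms of the three form values. The maximum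
  with 1 makes it continuous also at triples that no functionals realize, so that uniform continuity
  on a whole box applies.\<close>

definition kernel_dist :: "real \<Rightarrow> real \<Rightarrow> real \<Rightarrow> real" where
  "kernel_dist a b e = arcosh (max 1 (a / (sqrt b * sqrt e)))"

lemma kernel_dist_uniform:
  assumes c: "0 < c" and \<epsilon>: "0 < \<epsilon>"
  shows "\<exists>\<eta>>0. \<forall>a b e a' b' e'. a \<in> {0..4} \<and> b \<in> {c..4} \<and> e \<in> {c..4} \<and> a' \<in> {0..4} \<and> b' \<in> {c..4} \<and> e' \<in> {c..4} \<and>
    \<bar>a - a'\<bar> \<le> \<eta> \<and> \<bar>b - b'\<bar> \<le> \<eta> \<and> \<bar>e - e'\<bar> \<le> \<eta> \<longrightarrow> \<bar>kernel_dist a b e - kernel_dist a' b' e'\<bar> < \<epsilon>"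
proof -
  define A where "A = {0..4::real} \<times> {c..4::real} \<times> {c..4::real}"
  define F where "F p = kernel_dist (fst p) (fst (snd p)) (snd (snd p))" for p
  have "continuous_on A F"
    unfolding F_def kernel_dist_def A_def
    by (rule continuous_on_compose2[OF continuous_on_arcosh[OF subset_refl]]) (use c in \<open>auto intro!: continuous_intros\<close>)
  moreover have "compact A"
    unfolding A_def by (intro compact_Times compact_Icc)
  ultimately have "uniformly_continuous_on A F"
    by (rule compact_uniformly_continuous)
  then obtain d where d: "0 < d" "\<And>p q. p \<in> A \<Longrightarrow> q \<in> A \<Longrightarrow> dist q p < d \<Longrightarrow> dist (F q) (F p) < \<epsilon>"
    using \<epsilon> unfolding uniformly_continuous_on_def by blast
  have "\<bar>kernel_dist a b e - kernel_dist a' b' e'\<bar> < \<epsilon>"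
    if m: "a \<in> {0..4}" "b \<in> {c..4}" "e \<in> {c..4}" "a' \<in> {0..4}" "b' \<in> {c..4}" "e' \<in> {c..4}"
      and \<eta>: "\<bar>a - a'\<bar> \<le> d / 4" "\<bar>b - b'\<bar> \<le> d / 4" "\<bar>e - e'\<bar> \<le> d / 4" for a b e a' b' e'
  proof -
    have "dist (a, b, e) (a', b', e') \<le> dist a a' + dist (b, e) (b', e')"
      unfolding dist_Pair_Pair[of a] by (rule order_trans[OF sqrt_sum_squares_le_sum]) auto
    also have "dist (b, e) (b', e') \<le> dist b b' + dist e e'"
      unfolding dist_Pair_Pair by (rule order_trans[OF sqrt_sum_squares_le_sum]) auto
    finally have "dist (a, b, e) (a', b', e') < d"
      using \<eta> d(1) by (simp add: dist_real_def)
    then show ?thesis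
      using d(2)[of "(a', b', e')" "(a, b, e)"] m by (simp add: A_def F_def dist_real_def)
  qed
  then show ?thesis
    using d(1) by (intro exI[of _ "d / 4"]) auto
qed

section \<open>Comparing different exponents\<close>

context light_sphere
begin

lemma form_le_form_1_powr:
  assumes m: "posf m" "mass m = 1" and t: "0 < t" "t \<le> 1"
  shows "form t m m \<le> form 1 m m powr t"
proof -
  define \<phi> where "\<phi> x = m (\<lambda>y. lorentz n x y powr 1)" for x
  have \<phi>B: "\<phi> \<in> Bd"
    unfolding \<phi>_def by (rule Bd_form_section[OF _ _ m(1)]) auto
  have \<phi>0: "0 \<le> \<phi> x" if "x \<in> S" for x
    unfolding \<phi>_def by (rule posf_nonneg[OF m(1) Bd_kernel'[OF that]]) auto
  have "form t m m \<le> m (\<lambda>x. \<phi> x powr t)"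
    unfolding form_def
  proof (rule posf_mono[OF m(1) Bd_form_section[OF t m(1)] Bd_powr[OF \<phi>B \<phi>0 less_imp_le[OF t(1)]]])
    fix x assume x: "x \<in> S"
    have "m (\<lambda>y. lorentz n x y powr t) = m (\<lambda>y. (lorentz n x y powr 1) powr t)"
      by (rule posf_cong[OF m(1) Bd_kernel'[OF x]]) (use t lorentz_S_nonneg[OF x] in auto)
    also have "\<dots> \<le> \<phi> x powr t"
      unfolding \<phi>_def by (rule posf_Jensen[OF m Bd_kernel'[OF x] _ t]) auto
    finally show "m (\<lambda>y. lorentz n x y powr t) \<le> \<phi> x powr t" .
  qed
  also have "\<dots> \<le> m \<phi> powr t"
    by (rule posf_Jensen[OF m \<phi>B \<phi>0 t])
  also have "m \<phi> = form 1 m m"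
    unfolding form_def \<phi>_def ..
  finally show ?thesis .
qed

text \<open>Through the form of exponent 1: Jensen applied twice bounds the other forms above by its
  power, and the chord estimate bounds them below. So a mean that projects to a point of one space
  projects to a point of every other.\<close>

lemma form_pos_transfer:
  assumes m: "posf m" "mass m = 1" and t: "0 < t" "t \<le> 1" and u: "0 < u" "u \<le> 1" and pos: "0 < form u m m"
  shows "0 < form t m m"
proof -
  have "form 1 m m \<noteq> 0"
    using form_le_form_1_powr[OF m u] pos by auto
  then have "0 < form 1 m m"
    using form_nonneg[of 1 m m] m by simp
  then have "0 < 2 powr (t - 1) * form 1 m m"
    by simp
  also have "\<dots> \<le> form t m m"
    by (rule form_ge_form_1[OF m(1,1) t])
  finally show ?thesis .
qed

lemma form_cong_Bd:
  assumes "posf \<mu>" "posf \<nu>" "posf \<rho>" "\<And>\<phi>. \<phi> \<in> Bd \<Longrightarrow> \<mu> \<phi> = \<nu> \<phi>" "0 < t" "t \<le> 1"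
  shows "form t \<mu> \<rho> = form t \<nu> \<rho>" "form t \<rho> \<mu> = form t \<rho> \<nu>"
proof -
  show "form t \<mu> \<rho> = form t \<nu> \<rho>"
    unfolding form_def by (rule assms(4)) (rule Bd_form_section[OF assms(5,6,3)])
  then show "form t \<rho> \<mu> = form t \<rho> \<nu>"
    using form_commute[OF assms(5,6)] assms(1-3) by simp
qed

text \<open>The factor lies between \<open>1 / (2 * y 0)\<close> and \<open>2 * y 0\<close>, where
  \<open>y\<close> is the preimage of the origin, and a compact set displaces the origin by a
  bounded distance.\<close>

lemma conformal_factor_bounds:
  assumes M: "compactin T M"
  shows "\<exists>J\<ge>1. \<forall>g\<in>M. \<forall>\<xi>\<in>S. lift g \<xi> 0 \<in> {1 / J..J}"
proof -
  interpret P1: light_sphere_param n 1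
    by unfold_locales auto
  have MG: "M \<subseteq> carrier G"
    using compactin_subset_topspace[OF M] by (simp add: topspace_T)
  have o: "origin \<in> mspace P1.K"
    unfolding P1.mspace_kernel_space unfolding X_1 by (rule origin_in_hyperboloid)
  obtain B where B: "0 \<le> B" "\<And>g. g \<in> M \<Longrightarrow> mdist P1.K (act 1 g origin) origin \<le> B"
    using bounded_displacement[OF P1.act_continuous o M] by blast
  define J where "J = 2 * cosh B"
  have J: "1 \<le> J"
    using cosh_real_ge_1[of B] by (simp add: J_def)
  have "lift g \<xi> 0 \<in> {1 / J..J}" if g: "g \<in> M" and \<xi>: "\<xi> \<in> S" for g \<xi>
  proof -
    have gG: "g \<in> carrier G"
      using g MG by auto
    obtain y where y: "y \<in> hyperboloid n" "g y = origin"
      using G_D(4)[OF gG origin_in_hyperboloid] by blast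
    have go: "g origin \<in> hyperboloid n"
      by (rule G_D(2)[OF gG origin_in_hyperboloid])
    have "y 0 = lorentz n (g y) (g origin)"
      using G_D(3)[OF gG y(1) origin_in_hyperboloid] by (simp add: lorentz_origin)
    also have "\<dots> = lorentz n (g origin) origin"
      by (simp add: y(2) lorentz_commute)
    also have "\<dots> = ker 1 (act 1 g origin) origin"
      by (simp add: act_1[OF gG] ker_1 X_1 go origin_in_hyperboloid)
    also have "\<dots> \<le> cosh B"
      using B(2)[OF g] by (intro P1.ker_le_of_mdist) (simp_all add: act_1[OF gG] X_1 go origin_in_hyperboloid)
    finally have y0: "2 * y 0 \<le> J"
      by (simp add: J_def)
    have pos: "0 < y 0"
      using y by (simp add: hyperboloid_def)
    have "1 / J \<le> 1 / (2 * y 0)"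
      using y0 pos by (intro divide_left_mono) auto
    then show ?thesis
      using lorentz_S_pos(2,3)[OF \<xi> y(1)] y0 by (simp add: lift_0_eq[OF gG y])
  qed
  then show ?thesis
    using J by blast
qed

end

context light_sphere_param
begin

lemma trans_pt:
  assumes a: "conf a" and m: "posf m" "0 < form t m m"
  shows "trans t a (pt m) = pt (push t a m)"
proof -
  have "push t a (scale c m) = scale c (push t a m)" for c
    by (simp add: push_def scale_def)
  then show ?thesis
    unfolding pt_def trans_iota[OF a scale_in_H[OF m]] by (simp add: form_push_push[OF a t0 t1 m(1) m(1)])
qed

lemma pt_0: "posf m \<Longrightarrow> mass m = 1 \<Longrightarrow> 0 < form t m m \<Longrightarrow> form t m m = 1 / (pt m 0)\<^sup>2"
  unfolding pt_def using X_0[OF scale_in_H, of m] by (simp add: mass_scale power_divide)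

lemma mdist_pt:
  assumes "posf m" "0 < form t m m" "posf m'" "0 < form t m' m'"
  shows "mdist K (pt m) (pt m') = kernel_dist (form t m m') (form t m m) (form t m' m')"
  using assms ge1[OF pt_in_X pt_in_X, OF assms]
  by (simp add: mdist_kernel_space pt_in_X ker_pt kernel_dist_def max_def)

lemma pt_cong:
  assumes "posf \<mu>" "posf \<nu>" "\<And>\<phi>. \<phi> \<in> Bd \<Longrightarrow> \<mu> \<phi> = \<nu> \<phi>"
  shows "pt \<mu> = pt \<nu>"
proof -
  have "form t \<mu> \<mu> = form t \<nu> \<nu>"
    using form_cong_Bd(1)[OF assms(1,2,1,3) t0 t1] form_cong_Bd(2)[OF assms(1,2,2,3) t0 t1] by simp
  then show ?thesis
    unfolding pt_def by (intro iota_cong) (simp add: scale_def assms(3))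
qed

text \<open>The exception at the base point makes the comparison map send base point to base point
  exactly; the representative chosen there by \<open>rep\<close> might be a mean other than
  \<open>base\<close>.\<close>

definition chosen_mean where
  "chosen_mean x = (if x = basept then base else mean x)"

lemma chosen_mean:
  assumes "x \<in> X t"
  shows "posf (chosen_mean x)" "mass (chosen_mean x) = 1" "pt (chosen_mean x) = x" "0 < form t (chosen_mean x) (chosen_mean x)"
    "form t (chosen_mean x) (chosen_mean x) = 1 / (x 0)\<^sup>2"
proof -
  show 1: "posf (chosen_mean x)" "mass (chosen_mean x) = 1" "pt (chosen_mean x) = x"
    using mean[OF assms] by (auto simp: chosen_mean_def posf_base mass_base basept_def)
  show 2: "0 < form t (chosen_mean x) (chosen_mean x)"
    using mean(3)[OF assms] X_ge_1[OF assms] form_base_bounds by (simp add: chosen_mean_def)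
  show "form t (chosen_mean x) (chosen_mean x) = 1 / (x 0)\<^sup>2"
    using pt_0[OF 1(1,2) 2] by (simp add: 1(3))
qed

lemma ball_mass: "x \<in> mcball_of K basept R \<Longrightarrow> x 0 \<le> 2 * cosh R"
proof -
  assume "x \<in> mcball_of K basept R"
  then have x: "x \<in> X t" "mdist K basept x \<le> R"
    by auto
  have "ker t basept x \<le> cosh R"
    by (rule ker_le_of_mdist[OF basept_in_X x])
  then show ?thesis
    using mass_le_ker[OF x(1)] sym[OF x(1) basept_in_X] by simp
qed

lemma act_mass:
  assumes x: "x \<in> X t" and g: "g \<in> carrier G" and J: "1 \<le> J" "\<And>\<xi>. \<xi> \<in> S \<Longrightarrow> lift g \<xi> 0 \<le> J"
  shows "act t g x 0 \<le> J * x 0"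
proof -
  have b: "\<bar>lift g \<xi> 0 powr t\<bar> \<le> J" if \<xi>: "\<xi> \<in> S" for \<xi>
  proof -
    have "lift g \<xi> 0 powr t \<le> J powr t"
      using conf_pos[OF conf_lift[OF g] \<xi>] J(2)[OF \<xi>] t0 by (intro powr_mono2) auto
    also have "\<dots> \<le> J powr 1"
      using J t1 by (intro powr_mono) auto
    finally show ?thesis
      using J(1) by simp
  qed
  have "\<bar>rep t x (\<lambda>\<xi>. lift g \<xi> 0 powr t)\<bar> \<le> J * mass (rep t x)"
    by (rule posf_bound[OF H_posf[OF rep(1)[OF x]] b])
  then show ?thesis
    by (simp add: act_0[OF x g] mass_rep[OF x])
qed

end

section \<open>The comparison map between two exponents\<close>

locale two_params = P: light_sphere_param n t + Q: light_sphere_param n u for n :: nat and t u :: real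
begin

definition nearby :: "(nat \<Rightarrow> real) \<Rightarrow> nat \<Rightarrow> real" where
  "nearby x = P.pt (Q.chosen_mean x)"

lemma form_close:
  assumes cl: "\<And>s. s \<in> {0..2} \<Longrightarrow> \<bar>s powr t - s powr u\<bar> \<le> \<eta>" and m: "P.posf m" "P.mass m = 1" "P.posf m'" "P.mass m' = 1"
  shows "\<bar>P.form t m m' - P.form u m m'\<bar> \<le> \<eta>"
proof -
  have "\<bar>P.form t m m' - P.form u m m'\<bar> \<le> \<eta> * P.mass m * P.mass m'"
    unfolding P.form_def
    by (rule P.double_bound_diff[OF m(1,3) P.kernel_bound[OF _ _ P.t0 P.t1] P.kernel_bound[OF _ _ Q.t0 Q.t1]])
      (auto intro!: cl P.lorentz_S_nonneg P.lorentz_S_le_2)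
  then show ?thesis
    by (simp add: m)
qed

lemma form_range: "P.posf m \<Longrightarrow> P.mass m = 1 \<Longrightarrow> P.posf m' \<Longrightarrow> P.mass m' = 1 \<Longrightarrow> P.form t m m' \<in> {0..2}"
  using P.form_nonneg[OF P.t0 P.t1, of m m'] P.form_bound[OF P.t0 P.t1, of m m'] by simp

text \<open>Points in the ball and its translates under \<open>M\<close> have mass at most
  \<open>J * (2 * cosh R)\<close>, so their means have form at least \<open>2 * c\<close>. Changing
  the exponent costs at most \<open>\<eta>\<close>, which leaves the form above \<open>c\<close>,
  where distances depend uniformly continuously on form values.\<close>

lemma strong_nbhd_mem:
  assumes \<epsilon>1: "0 < \<epsilon>1" "2 * \<epsilon>1 < \<epsilon>" "\<epsilon>1 \<le> R" and M: "M \<subseteq> carrier P.G" "\<one>\<^bsub>P.G\<^esub> \<in> M"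
    and J: "1 \<le> J" "\<And>g \<xi>. g \<in> M \<Longrightarrow> \<xi> \<in> P.S \<Longrightarrow> P.lift g \<xi> 0 \<in> {1 / J..J}"
    and c: "c = 1 / (2 * (J * (2 * cosh R))\<^sup>2)"
    and unif: "\<And>a b e a' b' e'. a \<in> {0..4} \<Longrightarrow> b \<in> {c..4} \<Longrightarrow> e \<in> {c..4} \<Longrightarrow> a' \<in> {0..4} \<Longrightarrow> b' \<in> {c..4} \<Longrightarrow> e' \<in> {c..4} \<Longrightarrow>
      \<bar>a - a'\<bar> \<le> \<eta>0 \<Longrightarrow> \<bar>b - b'\<bar> \<le> \<eta>0 \<Longrightarrow> \<bar>e - e'\<bar> \<le> \<eta>0 \<Longrightarrow> \<bar>kernel_dist a b e - kernel_dist a' b' e'\<bar> < \<epsilon>1"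
    and \<eta>: "0 < \<eta>" "\<eta> \<le> \<eta>0" "\<eta> \<le> c / 2" "\<eta> \<le> 1"
    and cl: "\<And>s. s \<in> {0..2} \<Longrightarrow> \<bar>s powr t - s powr u\<bar> \<le> \<eta>"
    and fac: "\<And>s. s \<in> {1 / J..J} \<Longrightarrow> \<bar>s powr (u - t) - 1\<bar> \<le> \<eta> / 6"
  shows "(Q.K, Q.basept, P.act u) \<in> strong_nbhd P.G P.T R \<epsilon> M (P.K, P.basept, P.act t)"
proof -
  define C2 where "C2 = J * (2 * cosh R)"
  have chR: "1 \<le> cosh R"
    by (rule cosh_real_ge_1)
  have "1 * 1 \<le> J * (2 * cosh R)"
    using J(1) chR by (intro mult_mono) auto
  then have C2: "1 \<le> C2"
    by (simp add: C2_def)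
  have C1: "2 * cosh R \<le> C2"
    using J(1) chR mult_right_mono[of 1 J "2 * cosh R"] by (simp add: C2_def)
  have c2: "2 * c = 1 / C2\<^sup>2" and c0: "0 < c"
    using C2 by (auto simp: c C2_def[symmetric])
  have clow: "2 * c \<le> 1 / (s::real)\<^sup>2" if "1 \<le> s" "s \<le> C2" for s
    unfolding c2 using that by (intro divide_left_mono power_mono mult_pos_pos) auto
  have posu: "0 < P.form u m m" if "P.posf m" "P.mass m = 1" "0 < P.form t m m" for m
    by (rule P.form_pos_transfer[OF that(1,2) Q.t0 Q.t1 P.t0 P.t1 that(3)])
  have post: "0 < P.form t m m" if "P.posf m" "P.mass m = 1" "0 < P.form u m m" for m
    by (rule P.form_pos_transfer[OF that(1,2) P.t0 P.t1 Q.t0 Q.t1 that(3)])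
  have dist_close: "\<bar>mdist P.K (P.pt m) (P.pt m') - mdist Q.K (Q.pt m) (Q.pt m')\<bar> < \<epsilon>1"
    if m: "P.posf m" "P.mass m = 1" "P.posf m'" "P.mass m' = 1"
      and low: "2 * c \<le> P.form t m m \<or> 2 * c \<le> P.form u m m" "2 * c \<le> P.form t m' m' \<or> 2 * c \<le> P.form u m' m'" for m m'
  proof -
    note f = form_close[OF cl m] form_close[OF cl m(1,2) m(1,2)] form_close[OF cl m(3,4) m(3,4)]
    have lt: "c \<le> P.form t m m" "c \<le> P.form t m' m'" "c \<le> P.form u m m" "c \<le> P.form u m' m'"
      using low f(2,3) \<eta>(3) c0 by (auto simp: abs_le_iff)
    have rt: "P.form t m m' \<in> {0..2}" "P.form t m m \<in> {0..2}" "P.form t m' m' \<in> {0..2}"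
      using form_range m by auto
    have ru: "P.form u m m' \<in> {0..4}" "P.form u m m \<le> 4" "P.form u m' m' \<le> 4"
      using P.form_nonneg[OF Q.t0 Q.t1 m(1,3)] P.form_bound[OF Q.t0 Q.t1 m(1,3)] P.form_bound[OF Q.t0 Q.t1 m(1,1)]
        P.form_bound[OF Q.t0 Q.t1 m(3,3)] m by auto
    have "\<bar>kernel_dist (P.form t m m') (P.form t m m) (P.form t m' m') - kernel_dist (P.form u m m') (P.form u m m) (P.form u m' m')\<bar> < \<epsilon>1"
      using lt rt ru f \<eta>(2) by (intro unif) auto
    then show ?thesis
      using lt c0 m by (simp add: P.mdist_pt Q.mdist_pt)
  qed
  note cm = Q.chosen_mean
  have nearX: "nearby x \<in> P.X t" if "x \<in> P.X u" for x
    unfolding nearby_def using cm[OF that] by (intro P.pt_in_X post) auto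
  have cmlow: "2 * c \<le> P.form u (Q.chosen_mean x) (Q.chosen_mean x)" if "x \<in> P.X u" "x 0 \<le> C2" for x
    using clow[OF Q.X_ge_1[OF that(1)] that(2)] cm(5)[OF that(1)] by simp
  have near_dist: "\<bar>mdist P.K (nearby x) (nearby y) - mdist Q.K x y\<bar> < \<epsilon>1"
    if "x \<in> P.X u" "y \<in> P.X u" "x 0 \<le> C2" "y 0 \<le> C2" for x y
    using dist_close[OF cm(1,2)[OF that(1)] cm(1,2)[OF that(2)]] cmlow that cm(3)[OF that(1)] cm(3)[OF that(2)]
    by (simp add: nearby_def)
  have near_base: "nearby Q.basept = P.basept"
    by (simp add: nearby_def Q.chosen_mean_def P.basept_def)
  have base0: "Q.basept 0 \<le> C2"
    using Q.ball_mass[of Q.basept R] C1 \<epsilon>1 Q.basept_in_X by simp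
  have near_pt: "mdist P.K (nearby (Q.pt m)) (P.pt m) < \<epsilon>1"
    if m: "P.posf m" "P.mass m = 1" and fu: "0 < P.form u m m" and b: "Q.pt m 0 \<le> C2" for m
  proof -
    have x: "Q.pt m \<in> P.X u"
      by (rule Q.pt_in_X[OF m(1) fu])
    have "2 * c \<le> P.form u m m"
      using Q.pt_0[OF m fu] clow[OF Q.X_ge_1[OF x] b] by simp
    then have "\<bar>mdist P.K (nearby (Q.pt m)) (P.pt m) - mdist Q.K (Q.pt m) (Q.pt m)\<bar> < \<epsilon>1"
      using dist_close[OF cm(1,2)[OF x] m] cmlow[OF x b] cm(3)[OF x] by (simp add: nearby_def)
    then show ?thesis
      using x by simp
  qed
  show ?thesis
    unfolding mem_strong_nbhd
  proof (intro conjI)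
    show "(Q.K, Q.basept, P.act u) \<in> pointed_metric_G_spaces P.G P.T"
      using Q.geodesic_space_kernel Q.act_continuous Q.basept_in_X by (simp add: pointed_metric_G_spaces_def)
    show "\<exists>f\<in>mspace Q.K \<rightarrow> mspace P.K. f Q.basept = P.basept \<and>
       hausdorff_distance P.K (f ` mcball_of Q.K Q.basept R) (mcball_of P.K P.basept R) < ereal \<epsilon> \<and>
       (\<forall>x\<in>\<Union>g\<in>M. P.act u g ` mcball_of Q.K Q.basept R. \<forall>y\<in>\<Union>g\<in>M. P.act u g ` mcball_of Q.K Q.basept R.
           \<bar>mdist P.K (f x) (f y) - mdist Q.K x y\<bar> < \<epsilon>) \<and>
       (\<forall>x\<in>mcball_of Q.K Q.basept R. \<forall>g\<in>M. mdist P.K (P.act t g (f x)) (f (P.act u g x)) < \<epsilon>)"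
    proof (intro bexI[of _ nearby] conjI ballI)
      show "nearby \<in> mspace Q.K \<rightarrow> mspace P.K"
        using nearX by simp
      show "nearby Q.basept = P.basept"
        by (rule near_base)
      show "hausdorff_distance P.K (nearby ` mcball_of Q.K Q.basept R) (mcball_of P.K P.basept R) < ereal \<epsilon>"
        unfolding hausdorff_distance_less_iff
      proof (intro exI[of _ "2 * \<epsilon>1"] conjI ballI)
        show "0 \<le> 2 * \<epsilon>1" "2 * \<epsilon>1 < \<epsilon>"
          using \<epsilon>1 by auto
        fix a assume "a \<in> nearby ` mcball_of Q.K Q.basept R"
        then obtain x where xb: "x \<in> mcball_of Q.K Q.basept R" "a = nearby x"
          by blast
        then have x: "x \<in> P.X u" "mdist Q.K Q.basept x \<le> R" "x 0 \<le> C2"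
          using Q.ball_mass[OF xb(1)] C1 by auto
        have "mdist P.K P.basept a \<le> R + \<epsilon>1"
          using near_dist[OF Q.basept_in_X x(1) base0 x(3)] x(2) by (simp add: near_base xb(2) abs_less_iff)
        then obtain w where "w \<in> mcball_of P.K P.basept R" "mdist P.K w a \<le> \<epsilon>1"
          using geodesic_space_shrink[OF P.geodesic_space_kernel, of P.basept a R \<epsilon>1] P.basept_in_X nearX[OF x(1)] \<epsilon>1 xb(2)
          by auto
        then show "\<exists>b\<in>mcball_of P.K P.basept R. mdist P.K a b \<le> 2 * \<epsilon>1"
          using \<epsilon>1(1) by (intro bexI[of _ w]) (auto simp: mdist_commute)
      next
        fix b assume "b \<in> mcball_of P.K P.basept R"
        then have b: "b \<in> P.X t" "mdist P.K P.basept b \<le> R"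
          by auto
        \<comment> \<open>Moving \<open>b\<close> inwards first makes room for the error of
          \<open>dist_close\<close>, so that the preimage stays within radius
          \<open>R\<close>.\<close>
        then obtain w where w: "w \<in> mcball_of P.K P.basept (R - \<epsilon>1)" "mdist P.K w b \<le> \<epsilon>1"
          using geodesic_space_shrink[OF P.geodesic_space_kernel, of P.basept b "R - \<epsilon>1" \<epsilon>1] P.basept_in_X \<epsilon>1 by auto
        have wX: "w \<in> P.X t" "mdist P.K P.basept w \<le> R - \<epsilon>1"
          using w(1) by auto
        have wR: "w \<in> mcball_of P.K P.basept R"
          using w(1) \<epsilon>1 by auto
        define m where "m = P.chosen_mean w"
        have m: "P.posf m" "P.mass m = 1" "P.pt m = w" "0 < P.form t m m"
          using P.chosen_mean[OF wX(1)] by (auto simp: m_def)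
        have fu: "0 < P.form u m m"
          by (rule posu[OF m(1,2,4)])
        have "w 0 \<le> C2"
          using P.ball_mass[OF wR] C1 by simp
        then have lowm: "2 * c \<le> P.form t m m"
          using clow[OF P.X_ge_1[OF wX(1)]] P.chosen_mean(5)[OF wX(1)] by (simp add: m_def)
        have lowb: "2 * c \<le> P.form u P.base P.base"
        proof -
          have "P.form u P.base P.base = 1 / (Q.basept 0)\<^sup>2"
            unfolding Q.basept_def by (rule Q.pt_0[OF P.posf_base P.mass_base Q.form_base_bounds(1)])
          then show ?thesis
            using clow[OF Q.X_ge_1[OF Q.basept_in_X] base0] by simp
        qed
        have "\<bar>mdist P.K P.basept w - mdist Q.K Q.basept (Q.pt m)\<bar> < \<epsilon>1"
          using dist_close[OF P.posf_base P.mass_base m(1,2)] lowm lowb m(3) by (simp add: P.basept_def Q.basept_def)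
        then have xR: "Q.pt m \<in> mcball_of Q.K Q.basept R"
          using wX(2) Q.pt_in_X[OF m(1) fu] Q.basept_in_X by (simp add: abs_less_iff)
        have "mdist P.K (nearby (Q.pt m)) w < \<epsilon>1"
          using near_pt[OF m(1,2) fu] Q.ball_mass[OF xR] C1 m(3) by simp
        moreover have "mdist P.K (nearby (Q.pt m)) b \<le> mdist P.K (nearby (Q.pt m)) w + mdist P.K w b"
          using nearX[OF Q.pt_in_X[OF m(1) fu]] wX b by (intro mdist_triangle) auto
        ultimately have "mdist P.K (nearby (Q.pt m)) b \<le> 2 * \<epsilon>1"
          using w(2) by simp
        then show "\<exists>a\<in>nearby ` mcball_of Q.K Q.basept R. mdist P.K a b \<le> 2 * \<epsilon>1"
          using xR by blast
      qed
      have moved: "x \<in> P.X u \<and> x 0 \<le> C2" if mv: "x \<in> (\<Union>g\<in>M. P.act u g ` mcball_of Q.K Q.basept R)" for x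
      proof -
        obtain g y where g: "g \<in> M" "y \<in> mcball_of Q.K Q.basept R" "x = P.act u g y"
          using mv by blast
        have gG: "g \<in> carrier P.G" and yX: "y \<in> P.X u"
          using g M by auto
        have "x 0 \<le> J * y 0"
          using Q.act_mass[OF yX gG J(1)] J(2)[OF g(1)] g(3) by auto
        also have "\<dots> \<le> C2"
          using Q.ball_mass[OF g(2)] J(1) by (simp add: C2_def)
        finally show ?thesis
          using Q.act_in_X[OF gG yX] g(3) by simp
      qed
      show "\<bar>mdist P.K (nearby x) (nearby y) - mdist Q.K x y\<bar> < \<epsilon>"
        if "x \<in> (\<Union>g\<in>M. P.act u g ` mcball_of Q.K Q.basept R)" "y \<in> (\<Union>g\<in>M. P.act u g ` mcball_of Q.K Q.basept R)" for x y
        using near_dist[of x y] moved[OF that(1)] moved[OF that(2)] \<epsilon>1 by auto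
      show "mdist P.K (P.act t g (nearby x)) (nearby (P.act u g x)) < \<epsilon>"
        if xb: "x \<in> mcball_of Q.K Q.basept R" and g: "g \<in> M" for x g
      proof -
        have gG: "g \<in> carrier P.G" and x: "x \<in> P.X u"
          using xb g M by auto
        define a where "a = P.lift g"
        have a: "P.conf a"
          unfolding a_def by (rule P.conf_lift[OF gG])
        define m where "m = Q.chosen_mean x"
        have m: "P.posf m" "P.mass m = 1" "Q.pt m = x" "0 < P.form u m m"
          using cm[OF x] by (auto simp: m_def)
        have ft: "0 < P.form t m m"
          by (rule post[OF m(1,2,4)])
        have x2: "x 0 \<le> C2"
          using Q.ball_mass[OF xb] C1 by simp
        have lowt: "c + c / 2 \<le> P.form t m m"
          using cmlow[OF x x2] form_close[OF cl m(1,2,1,2)] \<eta>(3) by (simp add: m_def abs_le_iff)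
        \<comment> \<open>The two actions weight a push-forward by different powers of the same
          factor. Reweighting \<open>m\<close> by their quotient gives \<open>m'\<close> whose
          push-forward for \<open>t\<close> is that of \<open>m\<close> for \<open>u\<close>. Up to
          the error of \<open>near_pt\<close>, the failure of equivariance is thus the distance
          between the points of \<open>m\<close> and \<open>m'\<close>.\<close>
        define w where "w \<xi> = a \<xi> 0 powr (u - t)" for \<xi>
        have w: "\<bar>w \<xi> - 1\<bar> \<le> \<eta> / 6" if "\<xi> \<in> P.S" for \<xi>
          unfolding w_def a_def by (rule fac[OF J(2)[OF g that]])
        have w2: "\<bar>w \<xi>\<bar> \<le> 2" "0 \<le> w \<xi>" if "\<xi> \<in> P.S" for \<xi>
          using w[OF that] \<eta>(4) by linarith (simp add: w_def)
        have wB: "w \<in> P.Bd"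
          by (rule P.BdI[OF w2(1)])
        define m' where "m' = (\<lambda>\<phi>. m (\<lambda>\<xi>. w \<xi> * \<phi> \<xi>))"
        have m': "P.posf m'"
          unfolding P.posf_def m'_def
        proof (intro conjI ballI allI impI)
          fix \<phi> \<psi> assume "\<phi> \<in> P.Bd" "\<psi> \<in> P.Bd"
          then show "m (\<lambda>\<xi>. w \<xi> * (\<phi> \<xi> + \<psi> \<xi>)) = m (\<lambda>\<xi>. w \<xi> * \<phi> \<xi>) + m (\<lambda>\<xi>. w \<xi> * \<psi> \<xi>)"
            using P.posf_add[OF m(1) P.Bd_mult[OF wB] P.Bd_mult[OF wB]] by (simp add: distrib_left)
        next
          fix k \<phi> assume "\<phi> \<in> P.Bd"
          then show "m (\<lambda>\<xi>. w \<xi> * (k * \<phi> \<xi>)) = k * m (\<lambda>\<xi>. w \<xi> * \<phi> \<xi>)"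
            using P.posf_cmult[OF m(1) P.Bd_mult[OF wB], of \<phi> k] by (simp add: mult_ac)
        next
          fix \<phi> assume "\<phi> \<in> P.Bd" "\<forall>x\<in>P.S. 0 \<le> \<phi> x"
          then show "0 \<le> m (\<lambda>\<xi>. w \<xi> * \<phi> \<xi>)"
            using w2(2) by (intro P.posf_nonneg[OF m(1) P.Bd_mult[OF wB]]) auto
        qed
        have kb: "\<bar>lorentz n \<xi> \<zeta> powr t\<bar> \<le> 2" if "\<xi> \<in> P.S" "\<zeta> \<in> P.S" for \<xi> \<zeta>
          by (rule P.kernel_bound[OF that P.t0 P.t1])
        have f1: "\<bar>P.form t m m' - P.form t m m\<bar> \<le> \<eta>"
        proof -
          have "P.form t m m' = m (\<lambda>\<xi>. m (\<lambda>\<zeta>. w \<zeta> * lorentz n \<xi> \<zeta> powr t))"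
            by (simp add: P.form_def m'_def)
          moreover have "\<bar>m (\<lambda>\<xi>. m (\<lambda>\<zeta>. w \<zeta> * lorentz n \<xi> \<zeta> powr t)) - m (\<lambda>\<xi>. m (\<lambda>\<zeta>. lorentz n \<xi> \<zeta> powr t))\<bar> \<le> \<eta> * P.mass m * P.mass m"
          proof (rule P.double_bound_diff[OF m(1) m(1) _ kb])
            show "\<bar>w \<zeta> * lorentz n \<xi> \<zeta> powr t\<bar> \<le> 2 * 2" if "\<xi> \<in> P.S" "\<zeta> \<in> P.S" for \<xi> \<zeta>
              unfolding abs_mult using w2(1)[OF that(2)] kb[OF that] by (intro mult_mono) auto
            show "\<bar>w \<zeta> * lorentz n \<xi> \<zeta> powr t - lorentz n \<xi> \<zeta> powr t\<bar> \<le> \<eta>" if "\<xi> \<in> P.S" "\<zeta> \<in> P.S" for \<xi> \<zeta>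
            proof -
              have "\<bar>w \<zeta> * lorentz n \<xi> \<zeta> powr t - lorentz n \<xi> \<zeta> powr t\<bar> = \<bar>w \<zeta> - 1\<bar> * \<bar>lorentz n \<xi> \<zeta> powr t\<bar>"
                unfolding abs_mult[symmetric] by (simp add: algebra_simps)
              also have "\<dots> \<le> \<eta> / 6 * 2"
                using w[OF that(2)] kb[OF that] \<eta>(1) by (intro mult_mono) auto
              finally show ?thesis
                using \<eta>(1) by simp
            qed
          qed
          ultimately show ?thesis
            by (simp add: m(2) P.form_def)
        qed
        have f2: "\<bar>P.form t m' m' - P.form t m m\<bar> \<le> \<eta>"
        proof -
          have "P.form t m' m' = m (\<lambda>\<xi>. w \<xi> * m (\<lambda>\<zeta>. w \<zeta> * lorentz n \<xi> \<zeta> powr t))"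
            by (simp add: P.form_def m'_def)
          also have "\<dots> = m (\<lambda>\<xi>. m (\<lambda>\<zeta>. w \<xi> * (w \<zeta> * lorentz n \<xi> \<zeta> powr t)))"
          proof (rule P.posf_cong[OF m(1)])
            have "(\<lambda>\<xi>. m (\<lambda>\<zeta>. w \<zeta> * lorentz n \<xi> \<zeta> powr t)) \<in> P.Bd"
            proof (rule P.Bd_section[OF m(1)])
              show "\<bar>w \<zeta> * lorentz n \<xi> \<zeta> powr t\<bar> \<le> 2 * 2" if "\<xi> \<in> P.S" "\<zeta> \<in> P.S" for \<xi> \<zeta>
                unfolding abs_mult using w2(1)[OF that(2)] kb[OF that] by (intro mult_mono) auto
            qed
            then show "(\<lambda>\<xi>. w \<xi> * m (\<lambda>\<zeta>. w \<zeta> * lorentz n \<xi> \<zeta> powr t)) \<in> P.Bd"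
              by (rule P.Bd_mult[OF wB])
            show "w \<xi> * m (\<lambda>\<zeta>. w \<zeta> * lorentz n \<xi> \<zeta> powr t) = m (\<lambda>\<zeta>. w \<xi> * (w \<zeta> * lorentz n \<xi> \<zeta> powr t))" if "\<xi> \<in> P.S" for \<xi>
              by (rule P.posf_cmult[OF m(1), symmetric]) (intro P.Bd_mult wB P.Bd_kernel'[OF that], use P.t0 in simp)
          qed
          finally have 1: "P.form t m' m' = m (\<lambda>\<xi>. m (\<lambda>\<zeta>. w \<xi> * (w \<zeta> * lorentz n \<xi> \<zeta> powr t)))" .
          have "\<bar>m (\<lambda>\<xi>. m (\<lambda>\<zeta>. w \<xi> * (w \<zeta> * lorentz n \<xi> \<zeta> powr t))) - m (\<lambda>\<xi>. m (\<lambda>\<zeta>. lorentz n \<xi> \<zeta> powr t))\<bar> \<le> \<eta> * P.mass m * P.mass m"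
          proof (rule P.double_bound_diff[OF m(1) m(1) _ kb])
            show "\<bar>w \<xi> * (w \<zeta> * lorentz n \<xi> \<zeta> powr t)\<bar> \<le> 2 * (2 * 2)" if "\<xi> \<in> P.S" "\<zeta> \<in> P.S" for \<xi> \<zeta>
              unfolding abs_mult using w2(1)[OF that(1)] w2(1)[OF that(2)] kb[OF that] by (intro mult_mono) auto
            show "\<bar>w \<xi> * (w \<zeta> * lorentz n \<xi> \<zeta> powr t) - lorentz n \<xi> \<zeta> powr t\<bar> \<le> \<eta>" if "\<xi> \<in> P.S" "\<zeta> \<in> P.S" for \<xi> \<zeta>
            proof -
              have "w \<xi> * w \<zeta> - 1 = w \<xi> * (w \<zeta> - 1) + (w \<xi> - 1)"
                by (simp add: algebra_simps)
              then have "\<bar>w \<xi> * w \<zeta> - 1\<bar> \<le> \<bar>w \<xi>\<bar> * \<bar>w \<zeta> - 1\<bar> + \<bar>w \<xi> - 1\<bar>"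
                unfolding abs_mult[symmetric] by (metis abs_triangle_ineq)
              \<comment> \<open>Three times \<open>\<eta> / 6\<close>, to be doubled by the bound 2
                on the kernel: hence the 6.\<close>
              also have "\<dots> \<le> 2 * (\<eta> / 6) + \<eta> / 6"
                using w[OF that(1)] w[OF that(2)] w2(1)[OF that(1)] by (intro add_mono mult_mono) auto
              finally have 2: "\<bar>w \<xi> * w \<zeta> - 1\<bar> \<le> \<eta> / 2"
                by simp
              have "\<bar>w \<xi> * (w \<zeta> * lorentz n \<xi> \<zeta> powr t) - lorentz n \<xi> \<zeta> powr t\<bar> = \<bar>w \<xi> * w \<zeta> - 1\<bar> * \<bar>lorentz n \<xi> \<zeta> powr t\<bar>"
                unfolding abs_mult[symmetric] by (simp add: algebra_simps)
              also have "\<dots> \<le> \<eta> / 2 * 2"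
                using 2 kb[OF that] \<eta>(1) by (intro mult_mono) auto
              finally show ?thesis
                by simp
            qed
          qed
          then show ?thesis
            by (simp add: m(2) P.form_def[of t m m] 1)
        qed
        have ft': "c \<le> P.form t m' m'"
          using f2 lowt \<eta>(3) by (simp add: abs_le_iff)
        have r: "P.form t m m \<in> {0..2}"
          by (rule form_range[OF m(1,2,1,2)])
        have d1: "mdist P.K (P.pt m) (P.pt m') < \<epsilon>1"
        proof -
          have "\<bar>kernel_dist (P.form t m m') (P.form t m m) (P.form t m' m') - kernel_dist (P.form t m m) (P.form t m m) (P.form t m m)\<bar> < \<epsilon>1"
            using f1 f2 r lowt ft' c0 \<eta> P.form_nonneg[OF P.t0 P.t1 m(1) m'] by (intro unif) (auto simp: abs_le_iff)
          moreover have "kernel_dist (P.form t m m) (P.form t m m) (P.form t m m) = 0"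
            using ft by (simp add: kernel_dist_def)
          ultimately show ?thesis
            using P.mdist_pt[OF m(1) ft m'] ft' c0 by simp
        qed
        have pu: "P.posf (P.push u a m)"
          using P.posf_push[OF a _ m(1)] Q.t0 by simp
        have pm': "P.posf (P.push t a m')"
          using P.posf_push[OF a _ m'] P.t0 by simp
        have same: "P.push t a m' \<phi> = P.push u a m \<phi>" if "\<phi> \<in> P.Bd" for \<phi>
          unfolding P.push_def m'_def w_def
        proof (rule P.posf_cong[OF m(1)])
          show "(\<lambda>\<xi>. a \<xi> 0 powr (u - t) * (a \<xi> 0 powr t * \<phi> (P.sg a \<xi>))) \<in> P.Bd"
            using P.Bd_mult[OF wB P.Bd_push[OF a _ that, of t]] P.t0 by (simp add: w_def)
          show "a \<xi> 0 powr (u - t) * (a \<xi> 0 powr t * \<phi> (P.sg a \<xi>)) = a \<xi> 0 powr u * \<phi> (P.sg a \<xi>)" if "\<xi> \<in> P.S" for \<xi>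
            using P.conf_pos[OF a that] by (simp flip: mult.assoc powr_add)
        qed
        have e1: "P.act t g (nearby x) = P.trans t a (P.pt m)"
          by (simp add: P.act_def a_def nearby_def m_def)
        have e2: "P.trans t a (P.pt m') = P.pt (P.push u a m)"
          unfolding P.trans_pt[OF a m' less_le_trans[OF c0 ft']] by (rule P.pt_cong[OF pm' pu same])
        have fpu: "P.form u (P.push u a m) (P.push u a m) = P.form u m m"
          by (rule P.form_push_push[OF a Q.t0 Q.t1 m(1) m(1)])
        define k where "k = P.mass (P.push u a m)"
        have k: "0 < k"
          unfolding k_def by (rule P.mass_pos[OF Q.t0 Q.t1 pu]) (simp add: fpu m(4))
        \<comment> \<open>\<open>near_pt\<close> applies to means only, while the push-forward has
          mass \<open>k\<close>; scaling does not change its projections.\<close>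
        define m1 where "m1 = P.scale (1 / k) (P.push u a m)"
        have m1: "P.posf m1" "P.mass m1 = 1"
          using k pu by (auto simp: m1_def P.posf_scale P.mass_scale k_def[symmetric])
        have fm1: "0 < P.form u m1 m1"
          using k m(4) by (simp add: m1_def P.form_scale_left P.form_scale_right[OF Q.t0 Q.t1 pu pu] fpu)
        have e3: "P.act u g x = Q.pt m1"
        proof -
          have "P.act u g x = Q.pt (P.push u a m)"
            using Q.trans_pt[OF a m(1,4)] by (simp add: P.act_def a_def[symmetric] m(3))
          also have "\<dots> = Q.pt m1"
            unfolding m1_def using k pu fpu m(4) by (intro Q.pt_scale[symmetric]) auto
          finally show ?thesis .
        qed
        have e4: "P.pt (P.push u a m) = P.pt m1"
        proof -
          have "P.form t (P.push u a m) (P.push u a m) = P.form t (P.push t a m') (P.push t a m')"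
            using P.form_cong_Bd(1)[OF pm' pu pm' same P.t0 P.t1] P.form_cong_Bd(2)[OF pm' pu pu same P.t0 P.t1] by simp
          also have "\<dots> = P.form t m' m'"
            by (rule P.form_push_push[OF a P.t0 P.t1 m' m'])
          finally have "0 < P.form t (P.push u a m) (P.push u a m)"
            using ft' c0 by simp
          then show ?thesis
            unfolding m1_def using k pu by (intro P.pt_scale[symmetric]) auto
        qed
        have "P.act u g x \<in> (\<Union>g\<in>M. P.act u g ` mcball_of Q.K Q.basept R)"
          by (rule UN_I[OF g imageI[OF xb]])
        from moved[OF this] have b1: "Q.pt m1 0 \<le> C2"
          unfolding e3 by (rule conjunct2)
        have d2: "mdist P.K (nearby (P.act u g x)) (P.pt m1) < \<epsilon>1"
          unfolding e3 by (rule near_pt[OF m1 fm1 b1])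
        have X1: "P.pt m \<in> P.X t" "P.pt m' \<in> P.X t" "P.pt m1 \<in> P.X t" "nearby (P.act u g x) \<in> P.X t"
          using P.pt_in_X[OF m(1) ft] P.pt_in_X[OF m' less_le_trans[OF c0 ft']] P.pt_in_X[OF m1(1) post[OF m1 fm1]]
            nearX[OF Q.act_in_X[OF gG x]] by auto
        have "mdist P.K (P.act t g (nearby x)) (P.pt m1) = mdist P.K (P.pt m) (P.pt m')"
          unfolding e1 e4[symmetric] e2[symmetric]
          using X1 P.trans_in_X[OF a] by (simp add: P.mdist_kernel_space P.ker_trans[OF a])
        then have "mdist P.K (P.act t g (nearby x)) (P.pt m1) < \<epsilon>1"
          using d1 by simp
        moreover have "mdist P.K (P.act t g (nearby x)) (nearby (P.act u g x))
          \<le> mdist P.K (P.act t g (nearby x)) (P.pt m1) + mdist P.K (P.pt m1) (nearby (P.act u g x))"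
          using X1 P.trans_in_X[OF a] e1 by (intro mdist_triangle) auto
        ultimately show ?thesis
          using d2 \<epsilon>1 by (simp add: mdist_commute)
      qed
    qed
  qed
qed

end

section \<open>Continuity of the family and absence of similarities\<close>

context light_sphere
begin

definition basepoint :: "real \<Rightarrow> nat \<Rightarrow> real" where
  "basepoint t = light_sphere_param.basept n t"

lemma light_sphere_param: "0 < t \<Longrightarrow> t \<le> 1 \<Longrightarrow> light_sphere_param n t"
  by unfold_locales

lemma strong_nbhd_eventually:
  assumes t: "t \<in> {0<..1}" and R: "0 < R" and \<epsilon>: "0 < \<epsilon>" and M: "compactin T M" "\<one>\<^bsub>G\<^esub> \<in> M"
  shows "\<exists>\<delta>>0. \<forall>u\<in>{0<..1}. \<bar>u - t\<bar> < \<delta> \<longrightarrow>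
    (Cspace u, basepoint u, act u) \<in> strong_nbhd G T R \<epsilon> M (Cspace t, basepoint t, act t)"
proof -
  have t': "0 < t" "t \<le> 1"
    using t by auto
  have MG: "M \<subseteq> carrier G"
    using compactin_subset_topspace[OF M(1)] by (simp add: topspace_T)
  obtain J where J: "1 \<le> J" "\<And>g \<xi>. g \<in> M \<Longrightarrow> \<xi> \<in> S \<Longrightarrow> lift g \<xi> 0 \<in> {1 / J..J}"
    using conformal_factor_bounds[OF M(1)] by blast
  define \<epsilon>1 where "\<epsilon>1 = min (\<epsilon> / 3) R"
  have \<epsilon>1: "0 < \<epsilon>1" "2 * \<epsilon>1 < \<epsilon>" "\<epsilon>1 \<le> R"
    using R \<epsilon> by (auto simp: \<epsilon>1_def)
  define c where "c = 1 / (2 * (J * (2 * cosh R))\<^sup>2)"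
  have "0 < J * (2 * cosh R)"
    using J(1) by simp
  then have c: "0 < c"
    unfolding c_def by (metis zero_less_divide_1_iff zero_less_mult_iff zero_less_numeral zero_less_power)
  obtain \<eta>0 where \<eta>0: "0 < \<eta>0" "\<And>a b e a' b' e'. a \<in> {0..4} \<Longrightarrow> b \<in> {c..4} \<Longrightarrow> e \<in> {c..4} \<Longrightarrow> a' \<in> {0..4} \<Longrightarrow> b' \<in> {c..4} \<Longrightarrow> e' \<in> {c..4} \<Longrightarrow>
      \<bar>a - a'\<bar> \<le> \<eta>0 \<Longrightarrow> \<bar>b - b'\<bar> \<le> \<eta>0 \<Longrightarrow> \<bar>e - e'\<bar> \<le> \<eta>0 \<Longrightarrow> \<bar>kernel_dist a b e - kernel_dist a' b' e'\<bar> < \<epsilon>1"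
    using kernel_dist_uniform[OF c \<epsilon>1(1)] by blast
  define \<eta> where "\<eta> = min (min \<eta>0 (c / 2)) 1"
  have \<eta>: "0 < \<eta>" "\<eta> \<le> \<eta>0" "\<eta> \<le> c / 2" "\<eta> \<le> 1"
    using \<eta>0 c by (auto simp: \<eta>_def)
  obtain \<delta>1 where \<delta>1: "0 < \<delta>1" "\<And>u s. u \<in> {0<..1} \<Longrightarrow> \<bar>u - t\<bar> < \<delta>1 \<Longrightarrow> s \<in> {0..2} \<Longrightarrow> \<bar>s powr t - s powr u\<bar> \<le> \<eta>"
    using powr_exponent_close[OF t' \<eta>(1)] by blast
  obtain \<delta>2 where \<delta>2: "0 < \<delta>2" "\<And>z s. \<bar>z\<bar> < \<delta>2 \<Longrightarrow> s \<in> {1 / J..J} \<Longrightarrow> \<bar>s powr z - 1\<bar> \<le> \<eta> / 6"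
    using powr_near_one[OF J(1), of "\<eta> / 6"] \<eta>(1) by auto
  have "(Cspace u, basepoint u, act u) \<in> strong_nbhd G T R \<epsilon> M (Cspace t, basepoint t, act t)"
    if u: "u \<in> {0<..1}" "\<bar>u - t\<bar> < min \<delta>1 \<delta>2" for u
  proof -
    interpret two_params n t u
      using t' u n2 by unfold_locales auto
    show ?thesis
      unfolding Cspace_def basepoint_def
      by (rule strong_nbhd_mem[OF \<epsilon>1 MG M(2) J c_def \<eta>0(2) \<eta> \<delta>1(2) \<delta>2(2)]) (use u in auto)
  qed
  then show ?thesis
    using \<delta>1(1) \<delta>2(1) by (intro exI[of _ "min \<delta>1 \<delta>2"]) auto
qed

lemma strong_continuous:
  "continuous_map (top_of_set {0<..1}) (strong_topology G T) (\<lambda>t. (Cspace t, basepoint t, act t))"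
proof -
  have pm: "(Cspace t, basepoint t, act t) \<in> pointed_metric_G_spaces G T" if "t \<in> {0<..1}" for t
  proof -
    interpret light_sphere_param n t
      by (rule light_sphere_param) (use that in auto)
    show ?thesis
      using geodesic_space_kernel act_continuous basept_in_X
      by (simp add: pointed_metric_G_spaces_def Cspace_def basepoint_def)
  qed
  have one: "\<one>\<^bsub>G\<^esub> \<in> carrier G"
    by (rule monoid.one_closed[OF group.is_monoid[OF group_G]])
  show ?thesis
    unfolding continuous_map
  proof (intro conjI allI impI)
    show "(\<lambda>t. (Cspace t, basepoint t, act t)) ` topspace (top_of_set {0<..1}) \<subseteq> topspace (strong_topology G T)"
      unfolding topspace_strong_topology[OF topspace_T one] using pm by auto
    fix U :: "((nat \<Rightarrow> real), ((nat \<Rightarrow> real) \<Rightarrow> nat \<Rightarrow> real)) pointed_space set"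
    assume U: "openin (strong_topology G T) U"
    have "\<exists>\<delta>>0. \<forall>u\<in>{0<..1}. dist u t < \<delta> \<longrightarrow> u \<in> {t \<in> {0<..1}. (Cspace t, basepoint t, act t) \<in> U}"
      if t: "t \<in> {0<..1}" "(Cspace t, basepoint t, act t) \<in> U" for t
    proof -
      obtain R \<epsilon> M where par: "(R, \<epsilon>, M) \<in> strong_nbhd_params G T"
        and sub: "strong_nbhd G T R \<epsilon> M (Cspace t, basepoint t, act t) \<subseteq> U"
        using U t(2) unfolding openin_strong_topology[OF topspace_T] by blast
      then obtain \<delta> where \<delta>: "0 < \<delta>" "\<And>u. u \<in> {0<..1} \<Longrightarrow> \<bar>u - t\<bar> < \<delta> \<Longrightarrow>
          (Cspace u, basepoint u, act u) \<in> strong_nbhd G T R \<epsilon> M (Cspace t, basepoint t, act t)"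
        using strong_nbhd_eventually[OF t(1), of R \<epsilon> M] by (auto simp: strong_nbhd_params_def)
      then show ?thesis
        using sub by (intro exI[of _ \<delta>]) (auto simp: dist_real_def)
    qed
    then show "openin (top_of_set {0<..1}) {t \<in> topspace (top_of_set {0<..1}). (Cspace t, basepoint t, act t) \<in> U}"
      unfolding openin_euclidean_subtopology_iff by auto
  qed
qed

text \<open>Once the factor is known to be 1, the exponent inequality of \<open>ratio_le\<close>
  applies to \<open>h\<close> and to its inverse.\<close>

lemma not_similar:
  assumes t: "t \<in> {0<..1}" and t': "t' \<in> {0<..1}" and \<mu>: "0 < \<mu>"
    and h: "bij_betw h (mspace (Cspace t)) (mspace (Cspace t'))"
    and d: "\<forall>x\<in>mspace (Cspace t). \<forall>y\<in>mspace (Cspace t). mdist (Cspace t') (h x) (h y) = \<mu> * mdist (Cspace t) x y"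
  shows "t = t'"
proof -
  interpret P: light_sphere_param n t
    by (rule light_sphere_param) (use t in auto)
  interpret Q: light_sphere_param n t'
    by (rule light_sphere_param) (use t' in auto)
  have b: "bij_betw h (X t) (X t')"
    using h by (simp add: Cspace_def)
  have hX: "h x \<in> X t'" if "x \<in> X t" for x
    using b that by (auto simp: bij_betw_def)
  have dh: "arcosh (ker t' (h x) (h y)) = \<mu> * arcosh (ker t x y)" if "x \<in> X t" "y \<in> X t" for x y
    using d that hX by (simp add: Cspace_def P.mdist_kernel_space Q.mdist_kernel_space)
  define k where "k = inv_into (X t) h"
  have k: "k y \<in> X t" "h (k y) = y" if "y \<in> X t'" for y
    using b that by (auto simp: k_def bij_betw_def inv_into_into f_inv_into_f)
  interpret I: similarity n t t' \<mu> h
    by unfold_locales (use \<mu> hX dh in auto)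
  have \<mu>1: "\<mu> = 1"
    by (rule I.factor_eq_1)
  interpret I': similarity n t' t 1 k
  proof unfold_locales
    show "arcosh (ker t (k x) (k y)) = 1 * arcosh (ker t' x y)" if "x \<in> X t'" "y \<in> X t'" for x y
      using dh[OF k(1)[OF that(1)] k(1)[OF that(2)]] k(2) that \<mu>1 by simp
  qed (use k in auto)
  show ?thesis
    using I.ratio_le I'.ratio_le \<mu>1 by simp
qed

end

theorem theorem1:
  fixes n :: nat
  assumes "n \<ge> 2"
  shows "\<exists>(C :: real \<Rightarrow> (nat \<Rightarrow> real) metric) (p :: real \<Rightarrow> nat \<Rightarrow> real)
            (\<pi> :: real \<Rightarrow> ((nat \<Rightarrow> real) \<Rightarrow> nat \<Rightarrow> real) \<Rightarrow> (nat \<Rightarrow> real) \<Rightarrow> nat \<Rightarrow> real).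
    let G = isometry_group (hyperbolic_space n); T = isometry_topology (hyperbolic_space n) in
      (\<forall>t\<in>{0<..1}.
         proper_space (C t) \<and> CAT_minus_one (C t) \<and>
         continuous_isometric_action G T (C t) (\<pi> t) \<and>
         cocompact_action G (C t) (\<pi> t) \<and> minimal_action G (C t) (\<pi> t)) \<and>
      C 1 = hyperbolic_space n \<and> (\<forall>g\<in>carrier G. \<pi> 1 g = g) \<and>
      (\<forall>t\<in>{0<..1}. p t \<in> mspace (C t)) \<and>
      continuous_map (top_of_set {0<..1}) (strong_topology G T) (\<lambda>t. (C t, p t, \<pi> t)) \<and>
      (\<forall>t\<in>{0<..1}. \<forall>t'\<in>{0<..1}. t \<noteq> t' \<longrightarrow>
         (\<forall>\<mu>>0. \<not> (\<exists>h. bij_betw h (mspace (C t)) (mspace (C t')) \<and>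
            (\<forall>x\<in>mspace (C t). \<forall>y\<in>mspace (C t).
               mdist (C t') (h x) (h y) = \<mu> * mdist (C t) x y)))) \<and>
      (\<forall>t\<in>{0<..1}. \<pi> t \<in> iso G (isometry_group (C t)))"
proof -
  interpret light_sphere n
    using assms by unfold_locales
  have param: "light_sphere_param n t" if "t \<in> {0<..1}" for t
    using that by (intro light_sphere_param) auto
  show ?thesis
    unfolding Let_def
  proof (intro exI[of _ Cspace] exI[of _ basepoint] exI[of _ act] conjI ballI allI impI notI)
    fix t :: real assume t: "t \<in> {0<..1}"
    interpret light_sphere_param n t
      by (rule param[OF t])
    show "proper_space (Cspace t)" "CAT_minus_one (Cspace t)"
      unfolding Cspace_def by (rule proper_space_K CAT_minus_one_kernel)+
    show "continuous_isometric_action G T (Cspace t) (act t)" "cocompact_action G (Cspace t) (act t)"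
      "minimal_action G (Cspace t) (act t)" "act t \<in> iso G (isometry_group (Cspace t))"
      unfolding Cspace_def by (rule act_continuous act_cocompact act_minimal act_iso)+
    show "basepoint t \<in> mspace (Cspace t)"
      using basept_in_X by (simp add: Cspace_def basepoint_def)
  next
    show "Cspace 1 = hyperbolic_space n"
      by (rule Cspace_1)
    show "act 1 g = g" if "g \<in> carrier G" for g
      by (rule act_1[OF that])
    show "continuous_map (top_of_set {0<..1}) (strong_topology G T) (\<lambda>t. (Cspace t, basepoint t, act t))"
      by (rule strong_continuous)
  next
    fix t t' \<mu> :: real
    assume "t \<in> {0<..1}" "t' \<in> {0<..1}" "t \<noteq> t'" "0 < \<mu>"
      and "\<exists>h. bij_betw h (mspace (Cspace t)) (mspace (Cspace t')) \<and>
        (\<forall>x\<in>mspace (Cspace t). \<forall>y\<in>mspace (Cspace t). mdist (Cspace t') (h x) (h y) = \<mu> * mdist (Cspace t) x y)"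
    then show False
      using not_similar by blast
  qed
qed

end
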